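(* Let $n,r\in\mathbb{Z}_{\geq 1}$ and let $\mathbb{K}$ be an algebraically closed field of characteristic $p\geq 0$ such that $p$ does not divide $r$. Let $\mu\models n$ be an $r$-composition of $n$. Then the linear map $\Phi_{\mu}: E_{\mu}\widehat{Y}_{r,n}\to \mathrm{Mat}_{m_{\mu}}(\widehat{H}^{\mu})$ determined by $$\Phi_{\mu}(E_{\chi}x^{\alpha}f_{w})=\bm{1}_{\chi, w^{-1}(\chi)}\,\bar{x}^{\pi_{\chi}^{-1}(\alpha)}\,\overline{\pi_{\chi}^{-1}w\pi_{w^{-1}(\chi)}}\qquad (\mathrm{Comp}(\chi)=\mu,\ \alpha\in \mathbb{Z}_{\geq 0}^{n},\ w\in \mathfrak{S}_{n})$$ is an isomorphism of algebras, with inverse the linear map $\Psi_{\mu}: \mathrm{Mat}_{m_{\mu}}(\widehat{H}^{\mu})\to E_{\mu}\widehat{Y}_{r,n}$ determined by $$\Psi_{\mu}(\bm{1}_{\chi, \chi'}\,\bar{x}^{\alpha}\bar{w})=E_{\chi}x^{\pi_{\chi}(\alpha)}f_{\pi_{\chi}w\pi_{\chi'}^{-1}}\qquad (\mathrm{Comp}(\chi)=\mathrm{Comp}(\chi')=\mu,\ \alpha\in \mathbb{Z}_{\geq 0}^{n},\ w\in \mathfrak{S}^{\mu}).$$ Accordingly, $\Phi_{r,n}:=\bigoplus_{\mu\in\mathcal{C}_{r,n}}\Phi_{\mu}$ is an algebra isomorphism from the degenerate affine Yokonuma-Hecke algebra $\widehat{Y}_{r,n}$ onto $\bigoplus_{\mu\in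 \mathcal{C}_{r,n}}\mathrm{Mat}_{m_{\mu}}(\widehat{H}^{\mu})$, with inverse $\Psi_{r,n}:=\bigoplus_{\mu\in\mathcal{C}_{r,n}}\Psi_{\mu}$.
   Context: **Degenerate affine Hecke algebra.** For $m\geq 1$, $\widehat{H}_{m}$ is the associative unital $\mathbb{K}$-algebra generated by $\bar{x}_1,\ldots,\bar{x}_m,\bar{s}_1,\ldots,\bar{s}_{m-1}$ with relations $\bar{s}_i^2=1$; $\bar{s}_i\bar{s}_{i+1}\bar{s}_i=\bar{s}_{i+1}\bar{s}_i\bar{s}_{i+1}$; $\bar{s}_i\bar{s}_j=\bar{s}_j\bar{s}_i$ if $|i-j|>1$; $\bar{x}_i\bar{x}_j=\bar{x}_j\bar{x}_i$; $\bar{s}_i\bar{x}_{i+1}=\bar{x}_i\bar{s}_i+1$; $\bar{s}_i\bar{x}_j=\bar{x}_j\bar{s}_i$ if $j\neq i,i+1$. For $w=s_{i_1}\cdots s_{i_k}\in\mathfrak{S}_m$ put $\bar{w}=\bar{s}_{i_1}\cdots\bar{s}_{i_k}$. It has $\mathbb{K}$-basis $\{\bar{x}_1^{\alpha_1}\cdots\bar{x}_m^{\alpha_m}\bar{w}\}$ ($\alpha_i\geq 0$, $w\in\mathfrak{S}_m$). Put $\widehat{H}_0=\mathbb{K}$. **Degenerate affine Yokonuma-Hecke algebra.** $\widehat{Y}_{r,n}$ is the associative unital $\mathbb{K}$-algebra generated by $t_1,\ldots,t_n,f_1,\ldots,f_{n-1},x_1,\ldots,x_n$ with relations: $f_if_j=f_jf_i$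 if $|i-j|\geq 2$; $f_if_{i+1}f_i=f_{i+1}f_if_{i+1}$; $t_it_j=t_jt_i$; $f_it_j=t_{s_i(j)}f_i$; $t_i^r=1$; $f_i^2=1$; $x_ix_j=x_jx_i$; $f_ix_{i+1}=x_if_i+e_i$; $f_ix_j=x_jf_i$ for $j\neq i,i+1$; $t_jx_i=x_it_j$ for all $i,j$; where $s_i=(i,i+1)$ and $e_i=\frac1r\sum_{s=0}^{r-1}t_i^st_{i+1}^{-s}$. For $w=s_{i_1}\cdots s_{i_k}\in\mathfrak{S}_n$ put $f_w=f_{i_1}\cdots f_{i_k}$. The elements $t_1^{\beta_1}\cdots t_n^{\beta_n}x_1^{\alpha_1}\cdots x_n^{\alpha_n}f_w$ ($0\leq\beta_i\leq r-1$, $\alpha_i\geq 0$, $w\in\mathfrak{S}_n$) form a $\mathbb{K}$-basis. **Characters and idempotents.** Let $\mathcal{T}_{r,n}$ be the commutative subalgebra generated by $t_1,\ldots,t_n$ (isomorphic to the group algebra of $(\mathbb{Z}/r\mathbb{Z})^n$), and let $\{\zeta_1,\ldots,\zeta_r\}$ be the set of all $r$-th roots of unity in $\mathbb{K}$. $\mathrm{Irr}(\mathcal{T}_{r,n})$ is the set of characters $\chi$ of $\mathcal{T}_{r,n}$, each given by a choice of $\chi(t_j)\in\{\zeta_1,\ldots,\zeta_r\}$ for $1\le j\le n$. $\mathfrak{S}_n$ acts by $w(\chi)(t_i)=\chi(t_{w^{-1}(i)})$. Put $E_\chi=\prod_{i=1}^n\big(\frac1r\sum_{s=0}^{r-1}\chi(t_i)^st_i^{-s}\big)$.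 For $\alpha\in\mathbb{Z}_{\geq0}^n$ write $x^\alpha=x_1^{\alpha_1}\cdots x_n^{\alpha_n}$, $\bar{x}^\alpha=\bar{x}_1^{\alpha_1}\cdots\bar{x}_n^{\alpha_n}$; $\mathfrak{S}_n$ acts on $\mathbb{Z}_{\geq0}^n$ by place permutation, $w(\alpha)_i=\alpha_{w^{-1}(i)}$. The elements $E_\chi x^\alpha f_w$ form a $\mathbb{K}$-basis of $\widehat{Y}_{r,n}$. **Compositions.** $\mathcal{C}_{r,n}$ is the set of $r$-compositions of $n$, i.e. $\mu=(\mu_1,\ldots,\mu_r)\in\mathbb{Z}_{\geq0}^r$ with $\sum_a\mu_a=n$ (written $\mu\models n$). For $\chi\in\mathrm{Irr}(\mathcal{T}_{r,n})$, $\mathrm{Comp}(\chi)=(\mu_1,\ldots,\mu_r)$ with $\mu_a=\#\{j:\chi(t_j)=\zeta_a\}$. For $\mu\models n$, $\chi_0^\mu$ is the character with $\chi_0^\mu(t_j)=\zeta_a$ for $\mu_1+\cdots+\mu_{a-1}<j\leq\mu_1+\cdots+\mu_a$; its stabilizer is the Young subgroup $\mathfrak{S}^\mu=\mathfrak{S}_{\mu_1}\times\cdots\times\mathfrak{S}_{\mu_r}$. For $\chi$ with $\mathrm{Comp}(\chi)=\mu$, $\pi_\chi\in\mathfrak{S}_n$ is the unique minimal length representative of its left coset in $\mathfrak{S}_n/\mathfrak{S}^\mu$ such that $\pi_\chi(\chi_0^\mu)=\chi$. Put $E_\mu=\sum_{\mathrm{Comp}(\chi)=\mu}E_\chi$;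 the $E_\mu$ are pairwise orthogonal central idempotents of $\widehat{Y}_{r,n}$ summing to $1$. **Matrix algebras.** $\widehat{H}^\mu=\widehat{H}_{\mu_1}\otimes\cdots\otimes\widehat{H}_{\mu_r}$, whose polynomial generators are numbered consecutively $\bar{x}_1,\ldots,\bar{x}_n$ (the $a$-th factor carrying the indices $\mu_1+\cdots+\mu_{a-1}+1,\ldots,\mu_1+\cdots+\mu_a$), with basis $\{\bar{x}^\alpha\bar{w}:\alpha\in\mathbb{Z}_{\geq0}^n,w\in\mathfrak{S}^\mu\}$. $m_\mu=n!/(\mu_1!\cdots\mu_r!)$ is the number of characters $\chi$ with $\mathrm{Comp}(\chi)=\mu$; rows and columns of matrices in $\mathrm{Mat}_{m_\mu}(\widehat{H}^\mu)$ are labelled by these characters, and $\bm{1}_{\chi,\chi'}$ denotes the matrix with $1$ in row $\chi$, column $\chi'$ and $0$ elsewhere. *)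

theory Defs
  imports
    "HOL-Algebra.QuotRing"
    "HOL-Algebra.Module"
    "HOL-Library.Poly_Mapping"
    "HOL-Combinatorics.Permutations"
    "HOL-Computational_Algebra.Polynomial"
begin

section \<open>Associative unital algebras over a field\<close>

text \<open>
  The ground field is a type \<open>'k\<close>; a \<open>'k\<close>-algebra is presented by a record of the HOL-Algebra
  type \<open>('k, 'a) module\<close>, which carries the ring operations together with a scalar multiplication.
\<close>

definition linear_maps :: "('k, 'a) module \<Rightarrow> ('k, 'b) module \<Rightarrow> ('a \<Rightarrow> 'b) set" where
  "linear_maps A B =
     {h \<in> carrier A \<rightarrow>\<^sub>E carrier B.
        (\<forall>x\<in>carrier A. \<forall>y\<in>carrier A. h (x \<oplus>\<^bsub>A\<^esub> y) = h x \<oplus>\<^bsub>B\<^esub> h y) \<and>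
        (\<forall>c. \<forall>x\<in>carrier A. h (c \<odot>\<^bsub>A\<^esub> x) = c \<odot>\<^bsub>B\<^esub> h x)}"

definition alg_hom :: "('k, 'a) module \<Rightarrow> ('k, 'b) module \<Rightarrow> ('a \<Rightarrow> 'b) set" where
  "alg_hom A B = linear_maps A B \<inter> ring_hom A B"

definition alg_iso :: "('k, 'a) module \<Rightarrow> ('k, 'b) module \<Rightarrow> ('a \<Rightarrow> 'b) set" where
  "alg_iso A B = linear_maps A B \<inter> ring_iso A B"

definition inverse_maps :: "('k, 'a) module \<Rightarrow> ('k, 'b) module \<Rightarrow> ('a \<Rightarrow> 'b) \<Rightarrow> ('b \<Rightarrow> 'a) \<Rightarrow> bool" where
  "inverse_maps A B h g \<longleftrightarrow>
     (\<forall>x\<in>carrier A. g (h x) = x) \<and> (\<forall>y\<in>carrier B. h (g y) = y)"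

definition ground_alg :: "('k::field, 'k) module" where
  "ground_alg = \<lparr>carrier = UNIV, monoid.mult = (*), one = 1, zero = 0, add = (+), module.smult = (*)\<rparr>"

text \<open>Product of a list in the (noncommutative) multiplicative monoid, in the order of the list.\<close>

definition list_prod :: "('k, 'a) module \<Rightarrow> 'a list \<Rightarrow> 'a" where
  "list_prod A ys = foldr (\<lambda>y z. y \<otimes>\<^bsub>A\<^esub> z) ys \<one>\<^bsub>A\<^esub>"

inductive_set gen_subalg :: "('k, 'a) module \<Rightarrow> 'a set \<Rightarrow> 'a set"
  for A :: "('k, 'a) module" and S :: "'a set" where
  gen_one: "\<one>\<^bsub>A\<^esub> \<in> gen_subalg A S"
| gen_incl: "y \<in> S \<Longrightarrow> y \<in> gen_subalg A S"
| gen_add: "y \<in> gen_subalg A S \<Longrightarrow> z \<in> gen_subalg A S \<Longrightarrow> y \<oplus>\<^bsub>A\<^esub> z \<in> gen_subalg A S"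
| gen_mult: "y \<in> gen_subalg A S \<Longrightarrow> z \<in> gen_subalg A S \<Longrightarrow> y \<otimes>\<^bsub>A\<^esub> z \<in> gen_subalg A S"
| gen_smult: "y \<in> gen_subalg A S \<Longrightarrow> c \<odot>\<^bsub>A\<^esub> y \<in> gen_subalg A S"

text \<open>For a central idempotent \<open>e\<close>, the algebra \<open>e A\<close> with unit \<open>e\<close>.\<close>

definition ideal_alg :: "('k, 'a) module \<Rightarrow> 'a \<Rightarrow> ('k, 'a) module" where
  "ideal_alg A e = A\<lparr>carrier := {e \<otimes>\<^bsub>A\<^esub> y | y. y \<in> carrier A}, one := e\<rparr>"

text \<open>
  Quotient by a two-sided ideal: the library's quotient ring, with the scalar multiplication
  \<open>c (I + y) = I + c y\<close>.
\<close>

definition quot_alg :: "('k, 'a) module \<Rightarrow> 'a set \<Rightarrow> ('k, 'a set) module" where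
  "quot_alg A I = ring.extend (A Quot I) (module.fields (\<lambda>c Y. \<Union>y\<in>Y. I +>\<^bsub>A\<^esub> (c \<odot>\<^bsub>A\<^esub> y)))"

text \<open>Square matrices with rows and columns labelled by a finite set \<open>L\<close>.\<close>

definition mat_alg :: "'l set \<Rightarrow> ('k, 'a) module \<Rightarrow> ('k, 'l \<times> 'l \<Rightarrow> 'a) module" where
  "mat_alg L A =
     \<lparr>carrier = L \<times> L \<rightarrow>\<^sub>E carrier A,
      monoid.mult = (\<lambda>M N. \<lambda>(i, j)\<in>L \<times> L. \<Oplus>\<^bsub>A\<^esub>l\<in>L. M (i, l) \<otimes>\<^bsub>A\<^esub> N (l, j)),
      one = (\<lambda>(i, j)\<in>L \<times> L. if i = j then \<one>\<^bsub>A\<^esub> else \<zero>\<^bsub>A\<^esub>),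
      zero = (\<lambda>_\<in>L \<times> L. \<zero>\<^bsub>A\<^esub>),
      add = (\<lambda>M N. \<lambda>p\<in>L \<times> L. M p \<oplus>\<^bsub>A\<^esub> N p),
      module.smult = (\<lambda>c M. \<lambda>p\<in>L \<times> L. c \<odot>\<^bsub>A\<^esub> M p)\<rparr>"

text \<open>\<open>mat_unit L A i j y\<close> is \<open>1_{i,j} y\<close>: entry \<open>y\<close> in row \<open>i\<close>, column \<open>j\<close>, and \<open>0\<close> elsewhere.\<close>

definition mat_unit :: "'l set \<Rightarrow> ('k, 'a) module \<Rightarrow> 'l \<Rightarrow> 'l \<Rightarrow> 'a \<Rightarrow> 'l \<times> 'l \<Rightarrow> 'a" where
  "mat_unit L A i j y = (\<lambda>p\<in>L \<times> L. if p = (i, j) then y else \<zero>\<^bsub>A\<^esub>)"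

definition direct_sum_alg :: "'i set \<Rightarrow> ('i \<Rightarrow> ('k, 'a) module) \<Rightarrow> ('k, 'i \<Rightarrow> 'a) module" where
  "direct_sum_alg I A =
     \<lparr>carrier = (\<Pi>\<^sub>E i\<in>I. carrier (A i)),
      monoid.mult = (\<lambda>u v. \<lambda>i\<in>I. u i \<otimes>\<^bsub>A i\<^esub> v i),
      one = (\<lambda>i\<in>I. \<one>\<^bsub>A i\<^esub>),
      zero = (\<lambda>i\<in>I. \<zero>\<^bsub>A i\<^esub>),
      add = (\<lambda>u v. \<lambda>i\<in>I. u i \<oplus>\<^bsub>A i\<^esub> v i),
      module.smult = (\<lambda>c u. \<lambda>i\<in>I. c \<odot>\<^bsub>A i\<^esub> u i)\<rparr>"


subsection \<open>Algebras given by generators and relations\<close>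

text \<open>
  The free algebra consists of the finitely supported functions from the free monoid on the
  generators to \<open>'k\<close>; the convolution product of \<open>HOL-Library.Poly_Mapping\<close> is then the
  concatenation product.
\<close>

datatype 'g free_monoid = FM (letters: "'g list")

instantiation free_monoid :: (type) monoid_add
begin

definition "0 = FM []"
definition "u + v = FM (letters u @ letters v)"

instance
  by standard (simp_all add: zero_free_monoid_def plus_free_monoid_def)

end

type_synonym ('g, 'k) free_algebra = "'g free_monoid \<Rightarrow>\<^sub>0 'k"

definition gvar :: "'g \<Rightarrow> ('g, 'k::field) free_algebra" where
  "gvar g = Poly_Mapping.single (FM [g]) 1"

definition free_alg :: "'g set \<Rightarrow> ('k::field, ('g, 'k) free_algebra) module" where
  "free_alg G =
     \<lparr>carrier = {p. \<forall>u\<in>Poly_Mapping.keys p. set (letters u) \<subseteq> G},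
      monoid.mult = (*), one = 1, zero = 0, add = (+),
      module.smult = (\<lambda>c p. Poly_Mapping.map ((*) c) p)\<rparr>"

definition rel_ideal ::
  "'g set \<Rightarrow> (('g, 'k::field) free_algebra \<times> ('g, 'k) free_algebra) set \<Rightarrow> ('g, 'k) free_algebra set" where
  "rel_ideal G R = Idl\<^bsub>free_alg G\<^esub> {p - q | p q. (p, q) \<in> R}"

definition presented_alg ::
  "'g set \<Rightarrow> (('g, 'k::field) free_algebra \<times> ('g, 'k) free_algebra) set
     \<Rightarrow> ('k, ('g, 'k) free_algebra set) module" where
  "presented_alg G R = quot_alg (free_alg G) (rel_ideal G R)"

definition presented_gen ::
  "'g set \<Rightarrow> (('g, 'k::field) free_algebra \<times> ('g, 'k) free_algebra) set \<Rightarrow> 'g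
     \<Rightarrow> ('g, 'k) free_algebra set" where
  "presented_gen G R g = rel_ideal G R +>\<^bsub>free_alg G\<^esub> gvar g"


subsection \<open>Tensor products\<close>

text \<open>
  \<open>tuple_alg I A\<close> is the vector space with basis the tuples \<open>(u i)\<^sub>i\<^sub>\<in>\<^sub>I\<close>, \<open>u i \<in> A i\<close>, multiplied
  componentwise. The tensor product is its quotient by the multilinearity relations. Multiplying
  such a relation by a tuple gives a relation of the same kind, so the ideal generated by the
  relations is just their linear span.
\<close>

definition tuple_alg :: "'i set \<Rightarrow> ('i \<Rightarrow> ('k::field, 'a) module) \<Rightarrow> ('k, ('i \<Rightarrow> 'a) \<Rightarrow>\<^sub>0 'k) module" where
  "tuple_alg I A =
     \<lparr>carrier = {p. Poly_Mapping.keys p \<subseteq> (\<Pi>\<^sub>E i\<in>I. carrier (A i))},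
      monoid.mult = (\<lambda>p q. \<Sum>u\<in>Poly_Mapping.keys p. \<Sum>v\<in>Poly_Mapping.keys q.
                Poly_Mapping.single (\<lambda>i\<in>I. u i \<otimes>\<^bsub>A i\<^esub> v i)
                  (Poly_Mapping.lookup p u * Poly_Mapping.lookup q v)),
      one = Poly_Mapping.single (\<lambda>i\<in>I. \<one>\<^bsub>A i\<^esub>) 1,
      zero = 0, add = (+),
      module.smult = (\<lambda>c p. Poly_Mapping.map ((*) c) p)\<rparr>"

definition multilinear_rels :: "'i set \<Rightarrow> ('i \<Rightarrow> ('k::field, 'a) module) \<Rightarrow> (('i \<Rightarrow> 'a) \<Rightarrow>\<^sub>0 'k) set" where
  "multilinear_rels I A =
     {Poly_Mapping.single (u(i := y \<oplus>\<^bsub>A i\<^esub> z)) 1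
        - (Poly_Mapping.single (u(i := y)) 1 + Poly_Mapping.single (u(i := z)) 1)
        | u i y z. u \<in> (\<Pi>\<^sub>E i\<in>I. carrier (A i)) \<and> i \<in> I \<and> y \<in> carrier (A i) \<and> z \<in> carrier (A i)} \<union>
     {Poly_Mapping.single (u(i := c \<odot>\<^bsub>A i\<^esub> y)) 1 - Poly_Mapping.single (u(i := y)) c
        | u i y c. u \<in> (\<Pi>\<^sub>E i\<in>I. carrier (A i)) \<and> i \<in> I \<and> y \<in> carrier (A i)}"

definition tensor_ideal :: "'i set \<Rightarrow> ('i \<Rightarrow> ('k::field, 'a) module) \<Rightarrow> (('i \<Rightarrow> 'a) \<Rightarrow>\<^sub>0 'k) set" where
  "tensor_ideal I A = Idl\<^bsub>tuple_alg I A\<^esub> (multilinear_rels I A)"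

definition tensor_alg ::
  "'i set \<Rightarrow> ('i \<Rightarrow> ('k::field, 'a) module) \<Rightarrow> ('k, (('i \<Rightarrow> 'a) \<Rightarrow>\<^sub>0 'k) set) module" where
  "tensor_alg I A = quot_alg (tuple_alg I A) (tensor_ideal I A)"

definition pure_tensor ::
  "'i set \<Rightarrow> ('i \<Rightarrow> ('k::field, 'a) module) \<Rightarrow> ('i \<Rightarrow> 'a) \<Rightarrow> (('i \<Rightarrow> 'a) \<Rightarrow>\<^sub>0 'k) set" where
  "pure_tensor I A u = tensor_ideal I A +>\<^bsub>tuple_alg I A\<^esub> Poly_Mapping.single (restrict u I) 1"


section \<open>The symmetric group\<close>

text \<open>
  \<open>\<SS>\<^sub>n\<close> is the set of all \<open>w :: nat \<Rightarrow> nat\<close> with \<open>w permutes {1..n}\<close>, under composition.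
\<close>

abbreviation simple_refl :: "nat \<Rightarrow> nat \<Rightarrow> nat" where
  "simple_refl i \<equiv> Transposition.transpose i (Suc i)"

definition word_perm :: "nat list \<Rightarrow> nat \<Rightarrow> nat" where
  "word_perm is = foldr (\<lambda>i w. simple_refl i \<circ> w) is id"

definition perm_words :: "nat \<Rightarrow> (nat \<Rightarrow> nat) \<Rightarrow> nat list set" where
  "perm_words n w = {is. set is \<subseteq> {1..<n} \<and> word_perm is = w}"

definition perm_length :: "nat \<Rightarrow> (nat \<Rightarrow> nat) \<Rightarrow> nat" where
  "perm_length n w = (LEAST l. \<exists>is\<in>perm_words n w. length is = l)"

text \<open>
  For elements \<open>s i\<close> satisfying the Coxeter relations of \<open>\<SS>\<^sub>n\<close>, the product
  \<open>s i\<^sub>1 \<cdots> s i\<^sub>k\<close> depends only on the permutation \<open>w = s\<^sub>i\<^sub>1 \<cdots> s\<^sub>i\<^sub>k\<close>, so any choice of word will do.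
\<close>

definition perm_elem :: "('k, 'a) module \<Rightarrow> (nat \<Rightarrow> 'a) \<Rightarrow> nat \<Rightarrow> (nat \<Rightarrow> nat) \<Rightarrow> 'a" where
  "perm_elem A s n w = list_prod A (map s (SOME is. is \<in> perm_words n w))"

text \<open>
  Place permutation \<open>w(\<alpha>)\<^sub>i = \<alpha>\<^bsub>w\<^sup>-\<^sup>1(i)\<^esub>\<close>. Exponent vectors in \<open>\<int>\<^sub>\<ge>\<^sub>0\<^sup>n\<close> are functions
  \<open>\<alpha> :: nat \<Rightarrow> nat\<close> of which only the values on \<open>{1..n}\<close> are ever used.
\<close>

definition place_perm :: "(nat \<Rightarrow> nat) \<Rightarrow> (nat \<Rightarrow> nat) \<Rightarrow> nat \<Rightarrow> nat" where
  "place_perm w \<alpha> = (\<lambda>i. \<alpha> (inv_into UNIV w i))"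


section \<open>Compositions and Young subgroups\<close>

definition compositions :: "nat \<Rightarrow> nat \<Rightarrow> (nat \<Rightarrow> nat) set" where
  "compositions r n = {\<mu>. (\<forall>a. a \<notin> {1..r} \<longrightarrow> \<mu> a = 0) \<and> (\<Sum>a=1..r. \<mu> a) = n}"

definition offset :: "(nat \<Rightarrow> nat) \<Rightarrow> nat \<Rightarrow> nat" where
  "offset \<mu> a = (\<Sum>b\<in>{1..<a}. \<mu> b)"

definition block :: "(nat \<Rightarrow> nat) \<Rightarrow> nat \<Rightarrow> nat set" where
  "block \<mu> a = {offset \<mu> a <.. offset \<mu> a + \<mu> a}"

definition young :: "nat \<Rightarrow> nat \<Rightarrow> (nat \<Rightarrow> nat) \<Rightarrow> (nat \<Rightarrow> nat) set" where
  "young r n \<mu> = {w. w permutes {1..n} \<and> (\<forall>a\<in>{1..r}. w ` block \<mu> a = block \<mu> a)}"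

text \<open>The component in \<open>\<SS>\<^bsub>\<mu> a\<^esub>\<close> of an element of the Young subgroup.\<close>

definition young_component :: "(nat \<Rightarrow> nat) \<Rightarrow> nat \<Rightarrow> (nat \<Rightarrow> nat) \<Rightarrow> nat \<Rightarrow> nat" where
  "young_component \<mu> a w = (\<lambda>j. if j \<in> {1..\<mu> a} then w (offset \<mu> a + j) - offset \<mu> a else j)"


section \<open>The degenerate affine Hecke algebra\<close>

datatype hecke_gen = HX nat | HS nat

definition hecke_gens :: "nat \<Rightarrow> hecke_gen set" where
  "hecke_gens m = HX ` {1..m} \<union> HS ` {1..<m}"

inductive_set hecke_rels ::
  "nat \<Rightarrow> ((hecke_gen, 'k::field) free_algebra \<times> (hecke_gen, 'k) free_algebra) set"
  for m :: nat where
  "i \<in> {1..<m} \<Longrightarrow> (gvar (HS i) ^ 2, 1) \<in> hecke_rels m"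
| "i \<in> {1..<m} \<Longrightarrow> i + 1 \<in> {1..<m} \<Longrightarrow>
     (gvar (HS i) * gvar (HS (i + 1)) * gvar (HS i),
      gvar (HS (i + 1)) * gvar (HS i) * gvar (HS (i + 1))) \<in> hecke_rels m"
| "i \<in> {1..<m} \<Longrightarrow> j \<in> {1..<m} \<Longrightarrow> i + 1 < j \<or> j + 1 < i \<Longrightarrow>
     (gvar (HS i) * gvar (HS j), gvar (HS j) * gvar (HS i)) \<in> hecke_rels m"
| "i \<in> {1..m} \<Longrightarrow> j \<in> {1..m} \<Longrightarrow>
     (gvar (HX i) * gvar (HX j), gvar (HX j) * gvar (HX i)) \<in> hecke_rels m"
| "i \<in> {1..<m} \<Longrightarrow>
     (gvar (HS i) * gvar (HX (i + 1)), gvar (HX i) * gvar (HS i) + 1) \<in> hecke_rels m"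
| "i \<in> {1..<m} \<Longrightarrow> j \<in> {1..m} \<Longrightarrow> j \<noteq> i \<Longrightarrow> j \<noteq> i + 1 \<Longrightarrow>
     (gvar (HS i) * gvar (HX j), gvar (HX j) * gvar (HS i)) \<in> hecke_rels m"

text \<open>For \<open>m = 0\<close> there are no generators and no relations, so the algebra is the ground field.\<close>

definition hecke :: "nat \<Rightarrow> ('k::field, (hecke_gen, 'k) free_algebra set) module" where
  "hecke m = presented_alg (hecke_gens m) (hecke_rels m)"

definition hecke_x :: "nat \<Rightarrow> nat \<Rightarrow> (hecke_gen, 'k::field) free_algebra set" where
  "hecke_x m i = presented_gen (hecke_gens m) (hecke_rels m) (HX i)"

definition hecke_s :: "nat \<Rightarrow> nat \<Rightarrow> (hecke_gen, 'k::field) free_algebra set" where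
  "hecke_s m i = presented_gen (hecke_gens m) (hecke_rels m) (HS i)"

definition hecke_perm :: "nat \<Rightarrow> (nat \<Rightarrow> nat) \<Rightarrow> (hecke_gen, 'k::field) free_algebra set" where
  "hecke_perm m w = perm_elem (hecke m) (hecke_s m) m w"


subsection \<open>The tensor product attached to a composition\<close>

type_synonym 'k hecke_tensor = "((nat \<Rightarrow> (hecke_gen, 'k) free_algebra set) \<Rightarrow>\<^sub>0 'k) set"

definition hecke_comp :: "nat \<Rightarrow> (nat \<Rightarrow> nat) \<Rightarrow> ('k::field, 'k hecke_tensor) module" where
  "hecke_comp r \<mu> = tensor_alg {1..r} (\<lambda>a. hecke (\<mu> a))"

text \<open>
  The polynomial generators are numbered consecutively: for \<open>i\<close> in the \<open>a\<close>-th block, the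
  \<open>i\<close>-th one is the generator number \<open>i - offset \<mu> a\<close> of the \<open>a\<close>-th factor.
\<close>

definition comp_x :: "nat \<Rightarrow> (nat \<Rightarrow> nat) \<Rightarrow> nat \<Rightarrow> 'k::field hecke_tensor" where
  "comp_x r \<mu> i = pure_tensor {1..r} (\<lambda>a. hecke (\<mu> a))
     (\<lambda>a. if i \<in> block \<mu> a then hecke_x (\<mu> a) (i - offset \<mu> a) else \<one>\<^bsub>hecke (\<mu> a)\<^esub>)"

definition comp_monom :: "nat \<Rightarrow> nat \<Rightarrow> (nat \<Rightarrow> nat) \<Rightarrow> (nat \<Rightarrow> nat) \<Rightarrow> 'k::field hecke_tensor" where
  "comp_monom r n \<mu> \<alpha> =
     list_prod (hecke_comp r \<mu>) (map (\<lambda>i. comp_x r \<mu> i [^]\<^bsub>hecke_comp r \<mu>\<^esub> \<alpha> i) [1..<n + 1])"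

text \<open>For \<open>w = (w\<^sub>1, \<dots>, w\<^sub>r)\<close> in the Young subgroup, the pure tensor of the elements attached to the \<open>w\<^sub>a\<close>.\<close>

definition comp_perm :: "nat \<Rightarrow> (nat \<Rightarrow> nat) \<Rightarrow> (nat \<Rightarrow> nat) \<Rightarrow> 'k::field hecke_tensor" where
  "comp_perm r \<mu> w = pure_tensor {1..r} (\<lambda>a. hecke (\<mu> a))
     (\<lambda>a. hecke_perm (\<mu> a) (young_component \<mu> a w))"


section \<open>The degenerate affine Yokonuma-Hecke algebra\<close>

datatype yh_gen = YT nat | YF nat | YX nat

definition yh_gens :: "nat \<Rightarrow> yh_gen set" where
  "yh_gens n = YT ` {1..n} \<union> YF ` {1..<n} \<union> YX ` {1..n}"

text \<open>
  The element \<open>e\<^sub>i\<close>, as an element of the free algebra. There \<open>t\<^bsub>i+1\<^esub>\<close> has no inverse; as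
  \<open>t\<^bsub>i+1\<^esub>\<^sup>r = 1\<close> is imposed, its inverse is written \<open>t\<^bsub>i+1\<^esub>\<^sup>r\<^sup>-\<^sup>1\<close>.
\<close>

definition yh_e :: "nat \<Rightarrow> nat \<Rightarrow> (yh_gen, 'k::field) free_algebra" where
  "yh_e r i = Poly_Mapping.map ((*) (inverse (of_nat r)))
     (\<Sum>s<r. gvar (YT i) ^ s * (gvar (YT (i + 1)) ^ (r - 1)) ^ s)"

inductive_set yh_rels ::
  "nat \<Rightarrow> nat \<Rightarrow> ((yh_gen, 'k::field) free_algebra \<times> (yh_gen, 'k) free_algebra) set"
  for r n :: nat where
  "i \<in> {1..<n} \<Longrightarrow> j \<in> {1..<n} \<Longrightarrow> i + 2 \<le> j \<or> j + 2 \<le> i \<Longrightarrow>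
     (gvar (YF i) * gvar (YF j), gvar (YF j) * gvar (YF i)) \<in> yh_rels r n"
| "i \<in> {1..<n} \<Longrightarrow> i + 1 \<in> {1..<n} \<Longrightarrow>
     (gvar (YF i) * gvar (YF (i + 1)) * gvar (YF i),
      gvar (YF (i + 1)) * gvar (YF i) * gvar (YF (i + 1))) \<in> yh_rels r n"
| "i \<in> {1..n} \<Longrightarrow> j \<in> {1..n} \<Longrightarrow>
     (gvar (YT i) * gvar (YT j), gvar (YT j) * gvar (YT i)) \<in> yh_rels r n"
| "i \<in> {1..<n} \<Longrightarrow> j \<in> {1..n} \<Longrightarrow>
     (gvar (YF i) * gvar (YT j), gvar (YT (simple_refl i j)) * gvar (YF i)) \<in> yh_rels r n"
| "i \<in> {1..n} \<Longrightarrow> (gvar (YT i) ^ r, 1) \<in> yh_rels r n"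
| "i \<in> {1..<n} \<Longrightarrow> (gvar (YF i) ^ 2, 1) \<in> yh_rels r n"
| "i \<in> {1..n} \<Longrightarrow> j \<in> {1..n} \<Longrightarrow>
     (gvar (YX i) * gvar (YX j), gvar (YX j) * gvar (YX i)) \<in> yh_rels r n"
| "i \<in> {1..<n} \<Longrightarrow>
     (gvar (YF i) * gvar (YX (i + 1)), gvar (YX i) * gvar (YF i) + yh_e r i) \<in> yh_rels r n"
| "i \<in> {1..<n} \<Longrightarrow> j \<in> {1..n} \<Longrightarrow> j \<noteq> i \<Longrightarrow> j \<noteq> i + 1 \<Longrightarrow>
     (gvar (YF i) * gvar (YX j), gvar (YX j) * gvar (YF i)) \<in> yh_rels r n"
| "i \<in> {1..n} \<Longrightarrow> j \<in> {1..n} \<Longrightarrow>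
     (gvar (YT j) * gvar (YX i), gvar (YX i) * gvar (YT j)) \<in> yh_rels r n"

type_synonym 'k yh = "(yh_gen, 'k) free_algebra set"

definition yh :: "nat \<Rightarrow> nat \<Rightarrow> ('k::field, 'k yh) module" where
  "yh r n = presented_alg (yh_gens n) (yh_rels r n)"

definition yh_t :: "nat \<Rightarrow> nat \<Rightarrow> nat \<Rightarrow> 'k::field yh" where
  "yh_t r n i = presented_gen (yh_gens n) (yh_rels r n) (YT i)"

definition yh_f :: "nat \<Rightarrow> nat \<Rightarrow> nat \<Rightarrow> 'k::field yh" where
  "yh_f r n i = presented_gen (yh_gens n) (yh_rels r n) (YF i)"

definition yh_x :: "nat \<Rightarrow> nat \<Rightarrow> nat \<Rightarrow> 'k::field yh" where
  "yh_x r n i = presented_gen (yh_gens n) (yh_rels r n) (YX i)"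

definition yh_perm :: "nat \<Rightarrow> nat \<Rightarrow> (nat \<Rightarrow> nat) \<Rightarrow> 'k::field yh" where
  "yh_perm r n w = perm_elem (yh r n) (yh_f r n) n w"

definition yh_monom :: "nat \<Rightarrow> nat \<Rightarrow> (nat \<Rightarrow> nat) \<Rightarrow> 'k::field yh" where
  "yh_monom r n \<alpha> = list_prod (yh r n) (map (\<lambda>i. yh_x r n i [^]\<^bsub>yh r n\<^esub> \<alpha> i) [1..<n + 1])"


subsection \<open>Characters and idempotents\<close>

definition torus_alg :: "nat \<Rightarrow> nat \<Rightarrow> ('k::field, 'k yh) module" where
  "torus_alg r n = (yh r n)\<lparr>carrier := gen_subalg (yh r n) (yh_t r n ` {1..n})\<rparr>"

definition Irr :: "nat \<Rightarrow> nat \<Rightarrow> ('k::field yh \<Rightarrow> 'k) set" where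
  "Irr r n = alg_hom (torus_alg r n) ground_alg"

text \<open>Characters are determined by their values on the generators \<open>t\<^sub>1, \<dots>, t\<^sub>n\<close>.\<close>

definition perm_char :: "nat \<Rightarrow> nat \<Rightarrow> (nat \<Rightarrow> nat) \<Rightarrow> ('k::field yh \<Rightarrow> 'k) \<Rightarrow> 'k yh \<Rightarrow> 'k" where
  "perm_char r n w \<chi> =
     (THE \<chi>'. \<chi>' \<in> Irr r n \<and> (\<forall>i\<in>{1..n}. \<chi>' (yh_t r n i) = \<chi> (yh_t r n (inv_into UNIV w i))))"

definition E_chi :: "nat \<Rightarrow> nat \<Rightarrow> ('k::field yh \<Rightarrow> 'k) \<Rightarrow> 'k yh" where
  "E_chi r n \<chi> = list_prod (yh r n)
     (map (\<lambda>i. inverse (of_nat r) \<odot>\<^bsub>yh r n\<^esub>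
        (\<Oplus>\<^bsub>yh r n\<^esub>s\<in>{..<r}. (\<chi> (yh_t r n i) ^ s) \<odot>\<^bsub>yh r n\<^esub>
           (inv\<^bsub>yh r n\<^esub> (yh_t r n i [^]\<^bsub>yh r n\<^esub> s)))) [1..<n + 1])"

text \<open>
  In the following, \<open>\<zeta> 1, \<dots>, \<zeta> r\<close> is the chosen enumeration of the \<open>r\<close>-th roots of unity.
\<close>

definition Comp :: "nat \<Rightarrow> nat \<Rightarrow> (nat \<Rightarrow> 'k) \<Rightarrow> ('k::field yh \<Rightarrow> 'k) \<Rightarrow> nat \<Rightarrow> nat" where
  "Comp r n \<zeta> \<chi> = (\<lambda>a. if a \<in> {1..r} then card {j \<in> {1..n}. \<chi> (yh_t r n j) = \<zeta> a} else 0)"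

definition chars :: "nat \<Rightarrow> nat \<Rightarrow> (nat \<Rightarrow> 'k) \<Rightarrow> (nat \<Rightarrow> nat) \<Rightarrow> ('k::field yh \<Rightarrow> 'k) set" where
  "chars r n \<zeta> \<mu> = {\<chi> \<in> Irr r n. Comp r n \<zeta> \<chi> = \<mu>}"

definition chi0 :: "nat \<Rightarrow> nat \<Rightarrow> (nat \<Rightarrow> 'k) \<Rightarrow> (nat \<Rightarrow> nat) \<Rightarrow> 'k::field yh \<Rightarrow> 'k" where
  "chi0 r n \<zeta> \<mu> =
     (THE \<chi>. \<chi> \<in> Irr r n \<and> (\<forall>a\<in>{1..r}. \<forall>j\<in>block \<mu> a. \<chi> (yh_t r n j) = \<zeta> a))"

definition pi_chi :: "nat \<Rightarrow> nat \<Rightarrow> (nat \<Rightarrow> 'k) \<Rightarrow> ('k::field yh \<Rightarrow> 'k) \<Rightarrow> nat \<Rightarrow> nat" where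
  "pi_chi r n \<zeta> \<chi> =
     (THE w. w permutes {1..n} \<and>
        perm_char r n w (chi0 r n \<zeta> (Comp r n \<zeta> \<chi>)) = \<chi> \<and>
        (\<forall>v\<in>young r n (Comp r n \<zeta> \<chi>). perm_length n w \<le> perm_length n (w \<circ> v)))"

definition E_mu :: "nat \<Rightarrow> nat \<Rightarrow> (nat \<Rightarrow> 'k) \<Rightarrow> (nat \<Rightarrow> nat) \<Rightarrow> 'k::field yh" where
  "E_mu r n \<zeta> \<mu> = (\<Oplus>\<^bsub>yh r n\<^esub>\<chi>\<in>chars r n \<zeta> \<mu>. E_chi r n \<chi>)"


section \<open>The maps\<close>

definition yh_mu :: "nat \<Rightarrow> nat \<Rightarrow> (nat \<Rightarrow> 'k) \<Rightarrow> (nat \<Rightarrow> nat) \<Rightarrow> ('k::field, 'k yh) module" where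
  "yh_mu r n \<zeta> \<mu> = ideal_alg (yh r n) (E_mu r n \<zeta> \<mu>)"

type_synonym 'k hecke_mat = "('k yh \<Rightarrow> 'k) \<times> ('k yh \<Rightarrow> 'k) \<Rightarrow> 'k hecke_tensor"

definition mat_mu :: "nat \<Rightarrow> nat \<Rightarrow> (nat \<Rightarrow> 'k) \<Rightarrow> (nat \<Rightarrow> nat) \<Rightarrow> ('k::field, 'k hecke_mat) module" where
  "mat_mu r n \<zeta> \<mu> = mat_alg (chars r n \<zeta> \<mu>) (hecke_comp r \<mu>)"

definition is_Phi ::
  "nat \<Rightarrow> nat \<Rightarrow> (nat \<Rightarrow> 'k) \<Rightarrow> (nat \<Rightarrow> nat) \<Rightarrow> ('k::field yh \<Rightarrow> 'k hecke_mat) \<Rightarrow> bool" where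
  "is_Phi r n \<zeta> \<mu> h \<longleftrightarrow>
     h \<in> linear_maps (yh_mu r n \<zeta> \<mu>) (mat_mu r n \<zeta> \<mu>) \<and>
     (\<forall>\<chi> \<alpha> w. \<chi> \<in> chars r n \<zeta> \<mu> \<longrightarrow> w permutes {1..n} \<longrightarrow>
        (let \<chi>' = perm_char r n (inv_into UNIV w) \<chi>;
             \<pi> = pi_chi r n \<zeta> \<chi>;
             \<pi>' = pi_chi r n \<zeta> \<chi>'
         in h (E_chi r n \<chi> \<otimes>\<^bsub>yh r n\<^esub> yh_monom r n \<alpha> \<otimes>\<^bsub>yh r n\<^esub> yh_perm r n w) =
            mat_unit (chars r n \<zeta> \<mu>) (hecke_comp r \<mu>) \<chi> \<chi>'
              (comp_monom r n \<mu> (place_perm (inv_into UNIV \<pi>) \<alpha>)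
                 \<otimes>\<^bsub>hecke_comp r \<mu>\<^esub> comp_perm r \<mu> (inv_into UNIV \<pi> \<circ> w \<circ> \<pi>'))))"

definition is_Psi ::
  "nat \<Rightarrow> nat \<Rightarrow> (nat \<Rightarrow> 'k) \<Rightarrow> (nat \<Rightarrow> nat) \<Rightarrow> ('k::field hecke_mat \<Rightarrow> 'k yh) \<Rightarrow> bool" where
  "is_Psi r n \<zeta> \<mu> g \<longleftrightarrow>
     g \<in> linear_maps (mat_mu r n \<zeta> \<mu>) (yh_mu r n \<zeta> \<mu>) \<and>
     (\<forall>\<chi> \<chi>' \<alpha> w. \<chi> \<in> chars r n \<zeta> \<mu> \<longrightarrow> \<chi>' \<in> chars r n \<zeta> \<mu> \<longrightarrow> w \<in> young r n \<mu> \<longrightarrow>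
        (let \<pi> = pi_chi r n \<zeta> \<chi>;
             \<pi>' = pi_chi r n \<zeta> \<chi>'
         in g (mat_unit (chars r n \<zeta> \<mu>) (hecke_comp r \<mu>) \<chi> \<chi>'
                 (comp_monom r n \<mu> \<alpha> \<otimes>\<^bsub>hecke_comp r \<mu>\<^esub> comp_perm r \<mu> w)) =
            E_chi r n \<chi> \<otimes>\<^bsub>yh r n\<^esub> yh_monom r n (place_perm \<pi> \<alpha>)
              \<otimes>\<^bsub>yh r n\<^esub> yh_perm r n (\<pi> \<circ> w \<circ> inv_into UNIV \<pi>')))"

text \<open>The linear maps determined by these formulas; that they exist is part of the theorem.\<close>

definition Phi :: "nat \<Rightarrow> nat \<Rightarrow> (nat \<Rightarrow> 'k) \<Rightarrow> (nat \<Rightarrow> nat) \<Rightarrow> 'k::field yh \<Rightarrow> 'k hecke_mat" where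
  "Phi r n \<zeta> \<mu> = (THE h. is_Phi r n \<zeta> \<mu> h)"

definition Psi :: "nat \<Rightarrow> nat \<Rightarrow> (nat \<Rightarrow> 'k) \<Rightarrow> (nat \<Rightarrow> nat) \<Rightarrow> 'k::field hecke_mat \<Rightarrow> 'k yh" where
  "Psi r n \<zeta> \<mu> = (THE g. is_Psi r n \<zeta> \<mu> g)"

definition mat_total ::
  "nat \<Rightarrow> nat \<Rightarrow> (nat \<Rightarrow> 'k) \<Rightarrow> ('k::field, (nat \<Rightarrow> nat) \<Rightarrow> 'k hecke_mat) module" where
  "mat_total r n \<zeta> = direct_sum_alg (compositions r n) (mat_mu r n \<zeta>)"

text \<open>
  The direct sums of the maps, where the algebra is identified with the direct sum of its ideals
  \<open>E\<^sub>\<mu> Y\<close> through \<open>y = (\<Sum>\<mu>. E\<^sub>\<mu> y)\<close>.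
\<close>

definition Phi_total :: "nat \<Rightarrow> nat \<Rightarrow> (nat \<Rightarrow> 'k) \<Rightarrow> 'k::field yh \<Rightarrow> (nat \<Rightarrow> nat) \<Rightarrow> 'k hecke_mat" where
  "Phi_total r n \<zeta> =
     (\<lambda>y\<in>carrier (yh r n). \<lambda>\<mu>\<in>compositions r n. Phi r n \<zeta> \<mu> (E_mu r n \<zeta> \<mu> \<otimes>\<^bsub>yh r n\<^esub> y))"

definition Psi_total :: "nat \<Rightarrow> nat \<Rightarrow> (nat \<Rightarrow> 'k) \<Rightarrow> ((nat \<Rightarrow> nat) \<Rightarrow> 'k hecke_mat) \<Rightarrow> 'k::field yh" where
  "Psi_total r n \<zeta> =
     (\<lambda>M\<in>carrier (mat_total r n \<zeta>). \<Oplus>\<^bsub>yh r n\<^esub>\<mu>\<in>compositions r n. Psi r n \<zeta> \<mu> (M \<mu>))"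

end

theory Submission
  imports Defs
begin

text \<open>
  No basis theorem is needed. The idea is to index the rows of a matrix algebra over \<open>A\<close> by the
  characters of composition \<open>\<mu>\<close>, where \<open>A\<close> satisfies the relations of the degenerate affine Hecke
  algebra of \<open>\<mu>\<close>. Letting \<open>t\<close> and \<open>x\<close> act by diagonal matrices and \<open>f\<close> by monomial matrices, all
  conjugated by the minimal coset representatives, respects the relations of the Yokonuma--Hecke
  algebra: at a simple reflection, either the colours of the two adjacent places differ, and then
  \<open>e\<close> acts by zero and the reflection only moves the row, or they agree, and then the coset
  representatives conjugate it to a simple reflection of the Young subgroup. For \<open>A\<close> the Hecke algebra
  itself this gives \<open>\<Phi>\<close>. In the other direction, the corner of the Yokonuma--Hecke algebra at the
  idempotent of the standard character satisfies the Hecke relations, since \<open>e\<close> acts there by one;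
  transporting the resulting homomorphism with the coset representatives gives \<open>\<Psi>\<close>. The two
  composites fix the spanning sets of monomials, so \<open>\<Phi>\<close> and \<open>\<Psi>\<close> are mutually inverse. A coset
  representative of minimal length is the inverse of a standardization.
\<close>

section \<open>Algebras over a field\<close>

text \<open>Neither a presented algebra nor a quotient tensor product shows that its monomials are
  independent, so the two maps cannot be introduced by their values on monomials. Both are built
  from universal properties and the prescribed formulas are computed afterwards; spanning sets then
  yield uniqueness. \<open>Psi\<close> is constructed as a linear map; that it inverts a
  homomorphism makes it multiplicative.

  The rows pose the same problem: it is not evident that every choice of roots of unity is realized
  by a character of the torus inside a presented algebra. Characters are therefore replaced by
  colourings, which record at each place the index of a root of unity, and the matrix representation
  takes an abstract label set with an injective colouring. Colourings as labels over the ground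
  field produce the characters; characters as labels over the Hecke algebra produce
  \<open>Phi\<close>. The ground field qualifies because the Hecke relation reads
  \<open>k + 1 = k + 1\<close> when every reflection acts by 1 and \<open>x_k\<close> by
  \<open>k\<close>.\<close>

locale kalg = ring A for A :: "('k::field, 'a) module" (structure) +
  assumes smult_closed [simp, intro]: "x \<in> carrier A \<Longrightarrow> c \<odot> x \<in> carrier A"
    and smult_l_distr: "x \<in> carrier A \<Longrightarrow> (c + d) \<odot> x = c \<odot> x \<oplus> d \<odot> x"
    and smult_r_distr: "x \<in> carrier A \<Longrightarrow> y \<in> carrier A \<Longrightarrow> c \<odot> (x \<oplus> y) = c \<odot> x \<oplus> c \<odot> y"
    and smult_smult: "x \<in> carrier A \<Longrightarrow> c \<odot> (d \<odot> x) = (c * d) \<odot> x"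
    and smult_one [simp]: "x \<in> carrier A \<Longrightarrow> 1 \<odot> x = x"
    and smult_mult_l: "x \<in> carrier A \<Longrightarrow> y \<in> carrier A \<Longrightarrow> (c \<odot> x) \<otimes> y = c \<odot> (x \<otimes> y)"
    and smult_mult_r: "x \<in> carrier A \<Longrightarrow> y \<in> carrier A \<Longrightarrow> x \<otimes> (c \<odot> y) = c \<odot> (x \<otimes> y)"
begin

lemma smult_zero_l [simp]:
  assumes "x \<in> carrier A" shows "0 \<odot> x = \<zero>"
proof -
  have "0 \<odot> x \<oplus> 0 \<odot> x = 0 \<odot> x"
    using smult_l_distr[OF assms, of 0 0] assms by simp
  thus ?thesis using assms by (metis add.l_cancel_one smult_closed zero_closed)
qed

lemma smult_zero_r [simp]: "c \<odot> \<zero> = \<zero>"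
proof -
  have "c \<odot> \<zero> \<oplus> c \<odot> \<zero> = c \<odot> \<zero>"
    using smult_r_distr[of \<zero> \<zero> c] by simp
  thus ?thesis by (metis add.l_cancel_one smult_closed zero_closed)
qed

lemma finsum_smult:
  assumes "f \<in> S \<rightarrow> carrier A"
  shows "c \<odot> finsum A f S = (\<Oplus>i\<in>S. c \<odot> f i)"
proof (cases "finite S")
  case True
  from True assms show ?thesis
  proof (induction S)
    case (insert x S)
    then have "f \<in> S \<rightarrow> carrier A" "f x \<in> carrier A" by auto
    with insert show ?case
      by (simp add: finsum_insert smult_r_distr Pi_def)
  qed simp
qed simp

lemma sum_smult:
  assumes "x \<in> carrier A"
  shows "(sum g S) \<odot> x = (\<Oplus>i\<in>S. g i \<odot> x)"
proof (cases "finite S")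
  case True
  then show ?thesis by induction (use assms in \<open>simp_all add: finsum_insert smult_l_distr\<close>)
qed (use assms in simp)

lemma finsum_swap:
  assumes "finite S" "finite T" "\<And>i j. i \<in> S \<Longrightarrow> j \<in> T \<Longrightarrow> f i j \<in> carrier A"
  shows "(\<Oplus>i\<in>S. \<Oplus>j\<in>T. f i j) = (\<Oplus>j\<in>T. \<Oplus>i\<in>S. f i j)"
  using assms(1,3)
proof (induction S)
  case (insert x S)
  have 1: "(\<lambda>i. \<Oplus>j\<in>T. f i j) \<in> S \<rightarrow> carrier A" "f x \<in> T \<rightarrow> carrier A"
    using insert by (auto intro!: finsum_closed)
  have 2: "(\<Oplus>j\<in>T. \<Oplus>i\<in>insert x S. f i j) = (\<Oplus>j\<in>T. f x j \<oplus> (\<Oplus>i\<in>S. f i j))"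
    by (rule finsum_cong') (use insert in \<open>auto intro!: finsum_closed simp: finsum_insert\<close>)
  have 3: "\<dots> = (\<Oplus>j\<in>T. f x j) \<oplus> (\<Oplus>j\<in>T. \<Oplus>i\<in>S. f i j)"
    using insert by (intro finsum_addf) (auto intro!: finsum_closed)
  show ?case
    using insert 1 by (simp add: finsum_insert 2 3 finsum_closed)
qed simp

lemma finsum_single:
  assumes "finite S" "i \<in> S" "y \<in> carrier A"
  shows "(\<Oplus>j\<in>S. if j = i then y else \<zero>) = y"
  using finsum_singleton[OF assms(2,1), of "\<lambda>_. y"] assms(3) by (simp add: eq_commute[of i])

text \<open>Turns negation into a scalar multiple, so that a set closed under sums and scalars, such
  as a span or the kernel of a linear map, is closed under negation without a separate
  clause.\<close>

lemma minus_smult: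
  assumes "x \<in> carrier A" shows "\<ominus> x = (-1) \<odot> x"
proof -
  have "(-1) \<odot> x \<oplus> x = (-1 + 1) \<odot> x" using smult_l_distr[OF assms, of "-1" 1] assms by simp
  also have "\<dots> = \<zero>" using assms by simp
  finally show ?thesis using assms by (intro minus_equality) auto
qed

section \<open>Products along lists in a noncommutative monoid\<close>

lemma list_prod_Nil [simp]: "list_prod A [] = \<one>"
  and list_prod_Cons [simp]: "list_prod A (y # ys) = y \<otimes> list_prod A ys"
  by (simp_all add: list_prod_def)

lemma list_prod_closed [intro]: "set ys \<subseteq> carrier A \<Longrightarrow> list_prod A ys \<in> carrier A"
  by (induction ys) auto

lemma list_prod_append:
  "set xs \<subseteq> carrier A \<Longrightarrow> set ys \<subseteq> carrier A \<Longrightarrow>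
     list_prod A (xs @ ys) = list_prod A xs \<otimes> list_prod A ys"
  by (induction xs) (auto simp: m_assoc list_prod_closed)

lemma list_prod_commute:
  assumes "y \<in> carrier A" "set xs \<subseteq> carrier A" "\<And>x. x \<in> set xs \<Longrightarrow> y \<otimes> x = x \<otimes> y"
  shows "y \<otimes> list_prod A xs = list_prod A xs \<otimes> y"
  using assms(2,3)
proof (induction xs)
  case (Cons x xs)
  have c: "x \<in> carrier A" "list_prod A xs \<in> carrier A" using Cons by (auto intro: list_prod_closed)
  have "y \<otimes> (x \<otimes> list_prod A xs) = (x \<otimes> y) \<otimes> list_prod A xs"
    using c assms(1) Cons.prems by (simp add: m_assoc[symmetric])
  also have "\<dots> = x \<otimes> (list_prod A xs \<otimes> y)"
    using c assms(1) Cons by (simp add: m_assoc)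
  finally show ?case using c assms(1) by (simp add: m_assoc)
qed (use assms(1) in simp)

lemma list_prod_remove1:
  assumes "set xs \<subseteq> carrier A" "\<And>x y. x \<in> set xs \<Longrightarrow> y \<in> set xs \<Longrightarrow> x \<otimes> y = y \<otimes> x" "z \<in> set xs"
  shows "list_prod A xs = z \<otimes> list_prod A (remove1 z xs)"
  using assms
proof (induction xs)
  case (Cons x xs)
  show ?case
  proof (cases "x = z")
    case False
    then have z: "z \<in> set xs" using Cons.prems by auto
    have c: "x \<in> carrier A" "z \<in> carrier A" "list_prod A (remove1 z xs) \<in> carrier A"
      using Cons.prems z set_remove1_subset[of z xs] by (auto intro!: list_prod_closed)
    have "list_prod A xs = z \<otimes> list_prod A (remove1 z xs)"
      using Cons.IH Cons.prems z by auto
    moreover have "x \<otimes> z = z \<otimes> x" using Cons.prems z by auto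
    ultimately show ?thesis using False c by (simp add: m_assoc[symmetric])
  qed simp
qed simp

lemma list_prod_perm:
  assumes "set xs \<subseteq> carrier A" "\<And>x y. x \<in> set xs \<Longrightarrow> y \<in> set xs \<Longrightarrow> x \<otimes> y = y \<otimes> x"
    "mset xs = mset ys"
  shows "list_prod A xs = list_prod A ys"
  using assms
proof (induction ys arbitrary: xs)
  case (Cons y ys)
  have y: "y \<in> set xs" using Cons.prems(3) by (metis list.set_intros(1) set_mset_mset)
  have m: "mset (remove1 y xs) = mset ys" using Cons.prems(3) y by simp
  have "list_prod A xs = y \<otimes> list_prod A (remove1 y xs)"
    using list_prod_remove1[OF Cons.prems(1,2) y] by auto
  also have "list_prod A (remove1 y xs) = list_prod A ys"
    using Cons.prems set_remove1_subset[of y xs] m by (intro Cons.IH) blast+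
  finally show ?case by simp
qed simp

text \<open>Reindexing a product of commuting factors; this is what later moves a permutation from
  the variables of a monomial to its exponents.\<close>

lemma list_prod_map_perm:
  assumes "w permutes {1..n::nat}"
    "\<And>i. i \<in> {1..n} \<Longrightarrow> g i \<in> carrier A"
    "\<And>i j. i \<in> {1..n} \<Longrightarrow> j \<in> {1..n} \<Longrightarrow> g i \<otimes> g j = g j \<otimes> g i"
  shows "list_prod A (map (\<lambda>i. g (w i)) [1..<n+1]) = list_prod A (map g [1..<n+1])"
proof (rule list_prod_perm)
  have w: "w i \<in> {1..n}" if "i \<in> {1..n}" for i using permutes_in_image[OF assms(1)] that by blast
  have s: "set [1..<n+1] = {1..n}" by auto
  show "set (map (\<lambda>i. g (w i)) [1..<n+1]) \<subseteq> carrier A" using w assms(2) s by force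
  show "x \<otimes> y = y \<otimes> x" if "x \<in> set (map (\<lambda>i. g (w i)) [1..<n+1])" "y \<in> set (map (\<lambda>i. g (w i)) [1..<n+1])" for x y
    using that w assms(3) s by (auto simp del: upt_Suc)
  have "mset (map w [1..<n+1]) = mset [1..<n+1]"
  proof -
    have "mset [1..<n+1] = mset_set {1..n}" by (metis s distinct_upt mset_set_set)
    moreover have "image_mset w (mset_set {1..n}) = mset_set (w ` {1..n})"
      using permutes_inj_on[OF assms(1)] by (intro image_mset_mset_set)
    ultimately show ?thesis using permutes_image[OF assms(1)] by (metis mset_map)
  qed
  then have "image_mset g (mset (map w [1..<n+1])) = image_mset g (mset [1..<n+1])" by simp
  then show "mset (map (\<lambda>i. g (w i)) [1..<n+1]) = mset (map g [1..<n+1])"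
    by (simp add: comp_def multiset.map_comp)
qed

end

lemma kalgI:
  assumes "ring A"
    and "\<And>x c. x \<in> carrier A \<Longrightarrow> c \<odot>\<^bsub>A\<^esub> x \<in> carrier A"
    and "\<And>x c d. x \<in> carrier A \<Longrightarrow> (c + d) \<odot>\<^bsub>A\<^esub> x = c \<odot>\<^bsub>A\<^esub> x \<oplus>\<^bsub>A\<^esub> d \<odot>\<^bsub>A\<^esub> x"
    and "\<And>x y c. x \<in> carrier A \<Longrightarrow> y \<in> carrier A \<Longrightarrow> c \<odot>\<^bsub>A\<^esub> (x \<oplus>\<^bsub>A\<^esub> y) = c \<odot>\<^bsub>A\<^esub> x \<oplus>\<^bsub>A\<^esub> c \<odot>\<^bsub>A\<^esub> y"
    and "\<And>x c d. x \<in> carrier A \<Longrightarrow> c \<odot>\<^bsub>A\<^esub> (d \<odot>\<^bsub>A\<^esub> x) = (c * d) \<odot>\<^bsub>A\<^esub> x"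
    and "\<And>x. x \<in> carrier A \<Longrightarrow> 1 \<odot>\<^bsub>A\<^esub> x = x"
    and "\<And>x y c. x \<in> carrier A \<Longrightarrow> y \<in> carrier A \<Longrightarrow> (c \<odot>\<^bsub>A\<^esub> x) \<otimes>\<^bsub>A\<^esub> y = c \<odot>\<^bsub>A\<^esub> (x \<otimes>\<^bsub>A\<^esub> y)"
    and "\<And>x y c. x \<in> carrier A \<Longrightarrow> y \<in> carrier A \<Longrightarrow> x \<otimes>\<^bsub>A\<^esub> (c \<odot>\<^bsub>A\<^esub> y) = c \<odot>\<^bsub>A\<^esub> (x \<otimes>\<^bsub>A\<^esub> y)"
  shows "kalg A"
  using assms unfolding kalg_def kalg_axioms_def by blast

lemma kalg_ground: "kalg (ground_alg :: ('k::field, 'k) module)"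
proof (rule kalgI)
  show "ring (ground_alg :: ('k::field, 'k) module)"
  proof (rule ringI)
    show "abelian_group (ground_alg :: ('k, 'k) module)"
      by (rule abelian_groupI) (auto simp: ground_alg_def algebra_simps intro: exI[of _ "- _"] left_minus)
    show "monoid (ground_alg :: ('k, 'k) module)"
      by (rule monoidI) (auto simp: ground_alg_def algebra_simps)
  qed (auto simp: ground_alg_def algebra_simps)
qed (auto simp: ground_alg_def algebra_simps)

subsection \<open>Homomorphisms and linear maps\<close>

lemma linear_mapsD:
  assumes "h \<in> linear_maps A B"
  shows "x \<in> carrier A \<Longrightarrow> h x \<in> carrier B"
    and "x \<in> carrier A \<Longrightarrow> y \<in> carrier A \<Longrightarrow> h (x \<oplus>\<^bsub>A\<^esub> y) = h x \<oplus>\<^bsub>B\<^esub> h y"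
    and "x \<in> carrier A \<Longrightarrow> h (c \<odot>\<^bsub>A\<^esub> x) = c \<odot>\<^bsub>B\<^esub> h x"
    and "x \<notin> carrier A \<Longrightarrow> h x = undefined"
  using assms by (auto simp: linear_maps_def)

lemma alg_homD:
  assumes "h \<in> alg_hom A B"
  shows "x \<in> carrier A \<Longrightarrow> h x \<in> carrier B"
    and "x \<in> carrier A \<Longrightarrow> y \<in> carrier A \<Longrightarrow> h (x \<oplus>\<^bsub>A\<^esub> y) = h x \<oplus>\<^bsub>B\<^esub> h y"
    and "x \<in> carrier A \<Longrightarrow> h (c \<odot>\<^bsub>A\<^esub> x) = c \<odot>\<^bsub>B\<^esub> h x"
    and "x \<in> carrier A \<Longrightarrow> y \<in> carrier A \<Longrightarrow> h (x \<otimes>\<^bsub>A\<^esub> y) = h x \<otimes>\<^bsub>B\<^esub> h y"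
    and "h \<one>\<^bsub>A\<^esub> = \<one>\<^bsub>B\<^esub>"
    and "x \<notin> carrier A \<Longrightarrow> h x = undefined"
    and "h \<in> linear_maps A B"
  using assms by (auto simp: alg_hom_def linear_maps_def ring_hom_def)

lemma alg_homI:
  assumes "h \<in> carrier A \<rightarrow>\<^sub>E carrier B"
    and "\<And>x y. x \<in> carrier A \<Longrightarrow> y \<in> carrier A \<Longrightarrow> h (x \<oplus>\<^bsub>A\<^esub> y) = h x \<oplus>\<^bsub>B\<^esub> h y"
    and "\<And>x c. x \<in> carrier A \<Longrightarrow> h (c \<odot>\<^bsub>A\<^esub> x) = c \<odot>\<^bsub>B\<^esub> h x"
    and "\<And>x y. x \<in> carrier A \<Longrightarrow> y \<in> carrier A \<Longrightarrow> h (x \<otimes>\<^bsub>A\<^esub> y) = h x \<otimes>\<^bsub>B\<^esub> h y"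
    and "h \<one>\<^bsub>A\<^esub> = \<one>\<^bsub>B\<^esub>"
  shows "h \<in> alg_hom A B"
  using assms by (auto simp: alg_hom_def linear_maps_def ring_hom_def)

lemma linear_maps_zero:
  assumes "kalg A" "kalg B" "h \<in> linear_maps A B"
  shows "h \<zero>\<^bsub>A\<^esub> = \<zero>\<^bsub>B\<^esub>"
proof -
  interpret A: kalg A by fact
  interpret B: kalg B by fact
  have "h (0 \<odot>\<^bsub>A\<^esub> \<zero>\<^bsub>A\<^esub>) = 0 \<odot>\<^bsub>B\<^esub> h \<zero>\<^bsub>A\<^esub>"
    using linear_mapsD[OF assms(3)] A.zero_closed by blast
  thus ?thesis using linear_mapsD(1)[OF assms(3)] by simp
qed

lemma linear_maps_finsum:
  assumes "kalg A" "kalg B" "h \<in> linear_maps A B" "f \<in> S \<rightarrow> carrier A"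
  shows "h (finsum A f S) = finsum B (\<lambda>i. h (f i)) S"
proof -
  interpret A: kalg A by fact
  interpret B: kalg B by fact
  show ?thesis
  proof (cases "finite S")
    case True
    then show ?thesis using assms(4)
    proof (induction S)
      case (insert x S)
      then show ?case
        by (simp add: A.finsum_insert B.finsum_insert Pi_def linear_mapsD[OF assms(3)] A.finsum_closed)
    qed (simp add: linear_maps_zero[OF assms(1-3)])
  qed (simp add: linear_maps_zero[OF assms(1-3)])
qed

lemma alg_hom_pow:
  assumes "kalg A" "kalg B" "h \<in> alg_hom A B" "x \<in> carrier A"
  shows "h (x [^]\<^bsub>A\<^esub> (m::nat)) = h x [^]\<^bsub>B\<^esub> m"
proof -
  interpret A: kalg A by fact
  interpret B: kalg B by fact
  show ?thesis by (induction m) (simp_all add: alg_homD[OF assms(3)] assms(4))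
qed

lemma alg_hom_list_prod:
  assumes "kalg A" "kalg B" "h \<in> alg_hom A B" "set xs \<subseteq> carrier A"
  shows "h (list_prod A xs) = list_prod B (map h xs)"
proof -
  interpret A: kalg A by fact
  interpret B: kalg B by fact
  show ?thesis using assms(4)
    by (induction xs) (simp_all add: alg_homD[OF assms(3)] A.list_prod_closed)
qed

lemma gen_subalg_subset:
  assumes "kalg A" "S \<subseteq> carrier A"
  shows "gen_subalg A S \<subseteq> carrier A"
proof
  interpret kalg A by fact
  show "y \<in> carrier A" if "y \<in> gen_subalg A S" for y
    using that by induction (use assms(2) in auto)
qed

lemma alg_hom_image_gen_subalg:
  assumes "kalg A" "h \<in> alg_hom A B" "S \<subseteq> carrier A" "y \<in> gen_subalg A S"
  shows "h y \<in> gen_subalg B (h ` S)"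
  using assms(4)
proof induction
  case (gen_add y z)
  then show ?case using gen_subalg_subset[OF assms(1,3)]
    by (simp add: subset_iff alg_homD[OF assms(2)] gen_subalg.gen_add)
next
  case (gen_mult y z)
  then show ?case using gen_subalg_subset[OF assms(1,3)]
    by (simp add: subset_iff alg_homD[OF assms(2)] gen_subalg.gen_mult)
next
  case (gen_smult y c)
  then show ?case using gen_subalg_subset[OF assms(1,3)]
    by (simp add: subset_iff alg_homD[OF assms(2)] gen_subalg.gen_smult)
qed (auto simp: alg_homD[OF assms(2)] intro: gen_subalg.intros)

lemma gen_subalg_mono:
  assumes "S \<subseteq> gen_subalg A T" shows "gen_subalg A S \<subseteq> gen_subalg A T"
proof
  show "y \<in> gen_subalg A T" if "y \<in> gen_subalg A S" for y
    using that by induction (use assms in \<open>auto intro: gen_subalg.intros\<close>)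
qed

text \<open>The centralizer of \<open>z\<close> is a subalgebra, so commutation has to be checked on
  generators only.\<close>

lemma gen_subalg_commute:
  assumes "kalg A" "S \<subseteq> carrier A" "z \<in> carrier A" "\<And>y. y \<in> S \<Longrightarrow> y \<otimes>\<^bsub>A\<^esub> z = z \<otimes>\<^bsub>A\<^esub> y"
    "y \<in> gen_subalg A S"
  shows "y \<otimes>\<^bsub>A\<^esub> z = z \<otimes>\<^bsub>A\<^esub> y"
proof -
  interpret kalg A by fact
  note sub = gen_subalg_subset[OF assms(1,2), THEN subsetD]
  show ?thesis using assms(5)
  proof induction
    case (gen_add y y')
    then show ?case using sub assms(3) by (simp add: l_distr r_distr)
  next
    case (gen_mult y y')
    then show ?case using sub assms(3) by (metis m_assoc)
  next
    case (gen_smult y c)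
    then show ?case using sub assms(3) by (simp add: smult_mult_l smult_mult_r)
  qed (use assms in auto)
qed

subsection \<open>Monoid algebras\<close>

text \<open>The element is rebuilt from its terms over its support, so every partial sum keeps its
  keys in \<open>U\<close>. Bilinear identities in monoid algebras are thereby reduced to single
  terms.\<close>

lemma poly_mapping_single_induct [consumes 1, case_names zero single]:
  assumes "Poly_Mapping.keys p \<subseteq> U"
    and "P 0"
    and step: "\<And>u c p. u \<in> U \<Longrightarrow> Poly_Mapping.keys p \<subseteq> U \<Longrightarrow> P p \<Longrightarrow> P (Poly_Mapping.single u c + p)"
  shows "P (p :: 'u \<Rightarrow>\<^sub>0 'k::comm_monoid_add)"
proof -
  have *: "Poly_Mapping.keys (\<Sum>u\<in>K. Poly_Mapping.single u (Poly_Mapping.lookup p u)) \<subseteq> U \<and>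
        P (\<Sum>u\<in>K. Poly_Mapping.single u (Poly_Mapping.lookup p u))" if "finite K" "K \<subseteq> U" for K
    using that
  proof induction
    case (insert u K)
    have "Poly_Mapping.keys (Poly_Mapping.single u (Poly_Mapping.lookup p u) + s) \<subseteq> U"
      if "Poly_Mapping.keys s \<subseteq> U" for s
      using that insert.prems keys_add[of "Poly_Mapping.single u (Poly_Mapping.lookup p u)" s]
      by (auto split: if_splits)
    with insert show ?case by (simp add: step)
  qed (simp add: assms(2))
  have "p = (\<Sum>u\<in>Poly_Mapping.keys p. Poly_Mapping.single u (Poly_Mapping.lookup p u))"
    by (rule poly_mapping_eqI) (simp add: lookup_sum lookup_single when_def in_keys_iff)
  then show ?thesis using *[OF finite_keys assms(1)] by simp
qed

text \<open>One construction covers both the free algebra (words under concatenation) and the tuple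
  algebra (tuples multiplied componentwise). The operation is a monoid on the set \<open>U\<close>
  only, since tuples with entries in given carriers do not fill a type.\<close>

definition monoid_alg :: "'u set \<Rightarrow> ('u \<Rightarrow> 'u \<Rightarrow> 'u) \<Rightarrow> 'u \<Rightarrow> ('k::field, 'u \<Rightarrow>\<^sub>0 'k) module" where
  "monoid_alg U f e =
     \<lparr>carrier = {p. Poly_Mapping.keys p \<subseteq> U},
      monoid.mult = (\<lambda>p q. \<Sum>u\<in>Poly_Mapping.keys p. \<Sum>v\<in>Poly_Mapping.keys q.
         Poly_Mapping.single (f u v) (Poly_Mapping.lookup p u * Poly_Mapping.lookup q v)),
      one = Poly_Mapping.single e 1, zero = 0, add = (+),
      module.smult = (\<lambda>c p. Poly_Mapping.map ((*) c) p)\<rparr>"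

lemma lookup_map_times [simp]:
  "Poly_Mapping.lookup (Poly_Mapping.map ((*) (c::'k::field)) p) u = c * Poly_Mapping.lookup p u"
  by (simp add: Poly_Mapping.map.rep_eq when_def)

lemma keys_map_times: "Poly_Mapping.keys (Poly_Mapping.map ((*) (c::'k::field)) p) \<subseteq> Poly_Mapping.keys p"
  by (auto simp: in_keys_iff)

lemma map_times_add:
  "Poly_Mapping.map ((*) (c::'k::field)) (p + q) = Poly_Mapping.map ((*) c) p + Poly_Mapping.map ((*) c) q"
  by (rule poly_mapping_eqI) (simp add: lookup_add algebra_simps)

lemma monoid_alg_simps [simp]:
  "carrier (monoid_alg U f e) = {p. Poly_Mapping.keys p \<subseteq> U}"
  "\<one>\<^bsub>monoid_alg U f e\<^esub> = Poly_Mapping.single e 1"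
  "\<zero>\<^bsub>monoid_alg U f e\<^esub> = 0"
  "p \<oplus>\<^bsub>monoid_alg U f e\<^esub> q = p + q"
  "c \<odot>\<^bsub>monoid_alg U f e\<^esub> p = Poly_Mapping.map ((*) c) p"
  by (simp_all add: monoid_alg_def)

text \<open>Terms outside the support vanish, so the sums may run over any finite larger set.
  Elements with different supports can then be summed over a common index set, which makes the
  product visibly bilinear.\<close>

lemma monoid_alg_mult_superset:
  assumes "finite K" "finite L" "Poly_Mapping.keys p \<subseteq> K" "Poly_Mapping.keys q \<subseteq> L"
  shows "p \<otimes>\<^bsub>monoid_alg U f e\<^esub> q = (\<Sum>u\<in>K. \<Sum>v\<in>L.
         Poly_Mapping.single (f u v) (Poly_Mapping.lookup p u * Poly_Mapping.lookup q v))"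
proof -
  have "(\<Sum>v\<in>Poly_Mapping.keys q. Poly_Mapping.single (f u v) (Poly_Mapping.lookup p u * Poly_Mapping.lookup q v))
     = (\<Sum>v\<in>L. Poly_Mapping.single (f u v) (Poly_Mapping.lookup p u * Poly_Mapping.lookup q v))" for u
    by (rule sum.mono_neutral_left) (use assms in \<open>auto simp: in_keys_iff\<close>)
  moreover have "(\<Sum>u\<in>Poly_Mapping.keys p. \<Sum>v\<in>L. Poly_Mapping.single (f u v) (Poly_Mapping.lookup p u * Poly_Mapping.lookup q v))
     = (\<Sum>u\<in>K. \<Sum>v\<in>L. Poly_Mapping.single (f u v) (Poly_Mapping.lookup p u * Poly_Mapping.lookup q v))"
    by (rule sum.mono_neutral_left) (use assms in \<open>auto simp: in_keys_iff\<close>)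
  ultimately show ?thesis by (simp add: monoid_alg_def)
qed

lemma monoid_alg_add_mult:
  "(p + p') \<otimes>\<^bsub>monoid_alg U f e\<^esub> q = p \<otimes>\<^bsub>monoid_alg U f e\<^esub> q + p' \<otimes>\<^bsub>monoid_alg U f e\<^esub> q"
  using keys_add[of p p']
  by (simp add: monoid_alg_mult_superset[of "Poly_Mapping.keys p \<union> Poly_Mapping.keys p'" "Poly_Mapping.keys q"]
      lookup_add algebra_simps single_add sum.distrib)

lemma monoid_alg_mult_add:
  "p \<otimes>\<^bsub>monoid_alg U f e\<^esub> (q + q') = p \<otimes>\<^bsub>monoid_alg U f e\<^esub> q + p \<otimes>\<^bsub>monoid_alg U f e\<^esub> q'"
  using keys_add[of q q']
  by (simp add: monoid_alg_mult_superset[of "Poly_Mapping.keys p" "Poly_Mapping.keys q \<union> Poly_Mapping.keys q'"]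
      lookup_add algebra_simps single_add sum.distrib)

lemma monoid_alg_mult_zero [simp]:
  "0 \<otimes>\<^bsub>monoid_alg U f e\<^esub> q = 0" "q \<otimes>\<^bsub>monoid_alg U f e\<^esub> 0 = 0"
  by (simp_all add: monoid_alg_def)

lemma monoid_alg_mult_single [simp]:
  "Poly_Mapping.single u c \<otimes>\<^bsub>monoid_alg U f e\<^esub> Poly_Mapping.single v d = Poly_Mapping.single (f u v) (c * d)"
  by (simp add: monoid_alg_mult_superset[of "{u}" "{v}"])

lemma monoid_alg_smult_mult:
  "Poly_Mapping.map ((*) c) p \<otimes>\<^bsub>monoid_alg U f e\<^esub> q = Poly_Mapping.map ((*) c) (p \<otimes>\<^bsub>monoid_alg U f e\<^esub> q)"
  "p \<otimes>\<^bsub>monoid_alg U f e\<^esub> Poly_Mapping.map ((*) c) q = Poly_Mapping.map ((*) c) (p \<otimes>\<^bsub>monoid_alg U f e\<^esub> q)"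
proof -
  have m: "Poly_Mapping.map ((*) c) (sum g K) = (\<Sum>i\<in>K. Poly_Mapping.map ((*) c) (g i))"
    for g :: "'x \<Rightarrow> 'a \<Rightarrow>\<^sub>0 'b" and K
    by (rule poly_mapping_eqI) (simp add: lookup_sum sum_distrib_left)
  have s: "Poly_Mapping.map ((*) c) (Poly_Mapping.single u d) = Poly_Mapping.single u (c * d)" for u :: 'a and d
    by (rule poly_mapping_eqI) (simp add: lookup_single when_def)
  show "Poly_Mapping.map ((*) c) p \<otimes>\<^bsub>monoid_alg U f e\<^esub> q = Poly_Mapping.map ((*) c) (p \<otimes>\<^bsub>monoid_alg U f e\<^esub> q)"
    by (simp add: monoid_alg_mult_superset[of "Poly_Mapping.keys p" "Poly_Mapping.keys q"] keys_map_times m s mult.assoc)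
  show "p \<otimes>\<^bsub>monoid_alg U f e\<^esub> Poly_Mapping.map ((*) c) q = Poly_Mapping.map ((*) c) (p \<otimes>\<^bsub>monoid_alg U f e\<^esub> q)"
    by (simp add: monoid_alg_mult_superset[of "Poly_Mapping.keys p" "Poly_Mapping.keys q"] keys_map_times m s mult.left_commute)
qed

locale carrier_monoid =
  fixes U :: "'u set" and f :: "'u \<Rightarrow> 'u \<Rightarrow> 'u" and e :: 'u
  assumes closed: "u \<in> U \<Longrightarrow> v \<in> U \<Longrightarrow> f u v \<in> U" and unit: "e \<in> U"
    and assoc: "u \<in> U \<Longrightarrow> v \<in> U \<Longrightarrow> w \<in> U \<Longrightarrow> f (f u v) w = f u (f v w)"
    and l_unit: "u \<in> U \<Longrightarrow> f e u = u" and r_unit: "u \<in> U \<Longrightarrow> f u e = u"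
begin

lemma keys_single_add:
  "u \<in> U \<Longrightarrow> Poly_Mapping.keys p \<subseteq> U \<Longrightarrow> Poly_Mapping.keys (Poly_Mapping.single u (c::'k::field) + p) \<subseteq> U"
  using keys_add[of "Poly_Mapping.single u c" p] by (auto split: if_splits)

lemma keys_mult:
  assumes "Poly_Mapping.keys p \<subseteq> U" "Poly_Mapping.keys q \<subseteq> U"
  shows "Poly_Mapping.keys (p \<otimes>\<^bsub>monoid_alg U f e\<^esub> (q :: 'u \<Rightarrow>\<^sub>0 'k::field)) \<subseteq> U"
proof -
  have *: "Poly_Mapping.keys (Poly_Mapping.single u c \<otimes>\<^bsub>monoid_alg U f e\<^esub> q) \<subseteq> U" if u: "u \<in> U" for u c
    using assms(2)
  proof (induction q rule: poly_mapping_single_induct)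
    case (single v d q)
    then show ?case using u by (simp add: monoid_alg_mult_add keys_single_add closed)
  qed simp
  from assms(1) show ?thesis
  proof (induction p rule: poly_mapping_single_induct)
    case (single u c p)
    have "Poly_Mapping.keys (a + b) \<subseteq> U" if "Poly_Mapping.keys a \<subseteq> U" "Poly_Mapping.keys b \<subseteq> U" for a b :: "'u \<Rightarrow>\<^sub>0 'k"
      using that keys_add[of a b] by blast
    then show ?case using single * by (simp add: monoid_alg_add_mult)
  qed simp
qed

lemma mult_assoc:
  assumes "Poly_Mapping.keys p \<subseteq> U" "Poly_Mapping.keys q \<subseteq> U" "Poly_Mapping.keys s \<subseteq> U"
  defines "M \<equiv> (monoid_alg U f e :: ('k::field, 'u \<Rightarrow>\<^sub>0 'k) module)"
  shows "(p \<otimes>\<^bsub>M\<^esub> q) \<otimes>\<^bsub>M\<^esub> s = p \<otimes>\<^bsub>M\<^esub> (q \<otimes>\<^bsub>M\<^esub> s)"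
  using assms(1)
proof (induction p rule: poly_mapping_single_induct)
  case (single u c p)
  have "(Poly_Mapping.single u c \<otimes>\<^bsub>M\<^esub> q) \<otimes>\<^bsub>M\<^esub> s = Poly_Mapping.single u c \<otimes>\<^bsub>M\<^esub> (q \<otimes>\<^bsub>M\<^esub> s)"
    using assms(2)
  proof (induction q rule: poly_mapping_single_induct)
    case (single v d q)
    have "(Poly_Mapping.single u c \<otimes>\<^bsub>M\<^esub> Poly_Mapping.single v d) \<otimes>\<^bsub>M\<^esub> s = Poly_Mapping.single u c \<otimes>\<^bsub>M\<^esub> (Poly_Mapping.single v d \<otimes>\<^bsub>M\<^esub> s)"
      using assms(3)
    proof (induction s rule: poly_mapping_single_induct)
      case (single w b s)
      then show ?case using \<open>u \<in> U\<close> \<open>v \<in> U\<close> by (simp add: M_def monoid_alg_mult_add assoc mult.assoc)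
    qed (simp add: M_def)
    with single show ?case by (simp add: M_def monoid_alg_add_mult monoid_alg_mult_add)
  qed (simp add: M_def)
  with single show ?case by (simp add: M_def monoid_alg_add_mult monoid_alg_mult_add)
qed (simp add: M_def)

lemma kalg_monoid_alg: "kalg (monoid_alg U f e :: ('k::field, 'u \<Rightarrow>\<^sub>0 'k) module)"
proof (rule kalgI)
  have ka: "Poly_Mapping.keys (a + b) \<subseteq> U" if "Poly_Mapping.keys a \<subseteq> U" "Poly_Mapping.keys b \<subseteq> U" for a b :: "'u \<Rightarrow>\<^sub>0 'k"
    using that keys_add[of a b] by blast
  show "ring (monoid_alg U f e :: ('k, 'u \<Rightarrow>\<^sub>0 'k) module)"
  proof (rule ringI)
    show "abelian_group (monoid_alg U f e :: ('k, 'u \<Rightarrow>\<^sub>0 'k) module)"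
    proof (rule abelian_groupI)
      show "\<exists>y\<in>carrier (monoid_alg U f e). y \<oplus>\<^bsub>monoid_alg U f e\<^esub> p = \<zero>\<^bsub>monoid_alg U f e\<^esub>"
        if "p \<in> carrier (monoid_alg U f e)" for p :: "'u \<Rightarrow>\<^sub>0 'k"
        by (rule bexI[of _ "- p"]) (use that in \<open>auto simp: in_keys_iff\<close>)
    qed (auto simp: ka algebra_simps)
    show "monoid (monoid_alg U f e :: ('k, 'u \<Rightarrow>\<^sub>0 'k) module)"
    proof (rule monoidI)
      fix p :: "'u \<Rightarrow>\<^sub>0 'k" assume p: "p \<in> carrier (monoid_alg U f e)"
      then have *: "Poly_Mapping.keys p \<subseteq> U" by simp
      then show "\<one>\<^bsub>monoid_alg U f e\<^esub> \<otimes>\<^bsub>monoid_alg U f e\<^esub> p = p"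
        by (induction rule: poly_mapping_single_induct) (auto simp: monoid_alg_mult_add l_unit)
      from * show "p \<otimes>\<^bsub>monoid_alg U f e\<^esub> \<one>\<^bsub>monoid_alg U f e\<^esub> = p"
        by (induction rule: poly_mapping_single_induct) (auto simp: monoid_alg_add_mult r_unit)
    qed (use keys_mult mult_assoc unit in \<open>simp_all del: monoid_alg_mult_single\<close>)
  qed (auto simp: monoid_alg_mult_add monoid_alg_add_mult)
  show "c \<odot>\<^bsub>monoid_alg U f e\<^esub> p \<in> carrier (monoid_alg U f e)" if "p \<in> carrier (monoid_alg U f e)" for p :: "'u \<Rightarrow>\<^sub>0 'k" and c
    using that keys_map_times[of c p] by auto
  show "(c + d) \<odot>\<^bsub>monoid_alg U f e\<^esub> p = c \<odot>\<^bsub>monoid_alg U f e\<^esub> p \<oplus>\<^bsub>monoid_alg U f e\<^esub> d \<odot>\<^bsub>monoid_alg U f e\<^esub> p" for p :: "'u \<Rightarrow>\<^sub>0 'k" and c d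
    by (rule poly_mapping_eqI) (simp add: lookup_add algebra_simps)
  show "c \<odot>\<^bsub>monoid_alg U f e\<^esub> (d \<odot>\<^bsub>monoid_alg U f e\<^esub> p) = (c * d) \<odot>\<^bsub>monoid_alg U f e\<^esub> p" for p :: "'u \<Rightarrow>\<^sub>0 'k" and c d
    by (rule poly_mapping_eqI) (simp add: algebra_simps)
  show "1 \<odot>\<^bsub>monoid_alg U f e\<^esub> p = p" for p :: "'u \<Rightarrow>\<^sub>0 'k"
    by (rule poly_mapping_eqI) simp
qed (simp_all add: map_times_add monoid_alg_smult_mult)

text \<open>Universal property of the monoid algebra. The linear extension of \<open>b\<close> is a
  sum over the support; enlarging two supports to a common finite set shows additivity, and
  multiplicativity follows one term at a time.\<close>

lemma monoid_alg_hom_exists: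
  fixes B :: "('k::field, 'b) module"
  assumes "kalg B" and b: "\<And>u. u \<in> U \<Longrightarrow> b u \<in> carrier B"
    and bm: "\<And>u v. u \<in> U \<Longrightarrow> v \<in> U \<Longrightarrow> b (f u v) = b u \<otimes>\<^bsub>B\<^esub> b v" and be: "b e = \<one>\<^bsub>B\<^esub>"
  shows "\<exists>h \<in> alg_hom (monoid_alg U f e) B. \<forall>u\<in>U. h (Poly_Mapping.single u 1) = b u"
proof -
  interpret B: kalg B by fact
  define L where "L p = (\<Oplus>\<^bsub>B\<^esub>u\<in>Poly_Mapping.keys p. Poly_Mapping.lookup p u \<odot>\<^bsub>B\<^esub> b u)" for p
  have L: "L p = (\<Oplus>\<^bsub>B\<^esub>u\<in>K. Poly_Mapping.lookup p u \<odot>\<^bsub>B\<^esub> b u)"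
    if "finite K" "Poly_Mapping.keys p \<subseteq> K" "K \<subseteq> U" for p K
    unfolding L_def
    by (rule B.add.finprod_mono_neutral_cong_left)
       (use that b in \<open>auto simp: in_keys_iff subset_iff\<close>)
  have Lc: "L p \<in> carrier B" if "Poly_Mapping.keys p \<subseteq> U" for p
    unfolding L_def using that b by (auto intro!: B.finsum_closed)
  have La: "L (p + q) = L p \<oplus>\<^bsub>B\<^esub> L q" if "Poly_Mapping.keys p \<subseteq> U" "Poly_Mapping.keys q \<subseteq> U" for p q
  proof -
    let ?K = "Poly_Mapping.keys p \<union> Poly_Mapping.keys q"
    have K: "finite ?K" "?K \<subseteq> U" using that by auto
    have "L (p + q) = (\<Oplus>\<^bsub>B\<^esub>u\<in>?K. Poly_Mapping.lookup p u \<odot>\<^bsub>B\<^esub> b u \<oplus>\<^bsub>B\<^esub> Poly_Mapping.lookup q u \<odot>\<^bsub>B\<^esub> b u)"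
      unfolding L[OF K(1) keys_add K(2)]
      by (rule B.finsum_cong') (use K b in \<open>auto simp: lookup_add B.smult_l_distr subset_iff\<close>)
    also have "\<dots> = L p \<oplus>\<^bsub>B\<^esub> L q"
      using K b by (subst B.finsum_addf) (auto simp: L[of ?K])
    finally show ?thesis .
  qed
  have Ls: "L (Poly_Mapping.map ((*) c) p) = c \<odot>\<^bsub>B\<^esub> L p" if "Poly_Mapping.keys p \<subseteq> U" for p c
  proof -
    have "L (Poly_Mapping.map ((*) c) p) = (\<Oplus>\<^bsub>B\<^esub>u\<in>Poly_Mapping.keys p. c \<odot>\<^bsub>B\<^esub> (Poly_Mapping.lookup p u \<odot>\<^bsub>B\<^esub> b u))"
      unfolding L[OF finite_keys keys_map_times that]
      by (rule B.finsum_cong') (use that b in \<open>auto simp: B.smult_smult subset_iff\<close>)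
    then show ?thesis unfolding L_def using that b by (subst B.finsum_smult) auto
  qed
  have L1: "L (Poly_Mapping.single u c) = c \<odot>\<^bsub>B\<^esub> b u" if "u \<in> U" for u c
    using that b by (subst L[of "{u}"]) (auto simp: B.finsum_insert)
  have L0: "L 0 = \<zero>\<^bsub>B\<^esub>" by (simp add: L_def)
  have Lm: "L (p \<otimes>\<^bsub>monoid_alg U f e\<^esub> q) = L p \<otimes>\<^bsub>B\<^esub> L q"
    if pq: "Poly_Mapping.keys p \<subseteq> U" "Poly_Mapping.keys q \<subseteq> U" for p q
    using pq(1)
  proof (induction p rule: poly_mapping_single_induct)
    case zero
    then show ?case using Lc[OF pq(2)] by (simp add: L0)
  next
    case (single u c p)
    have ku: "Poly_Mapping.keys (Poly_Mapping.single w d) \<subseteq> U" if "w \<in> U" for w and d :: 'k using that by simp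
    have "L (Poly_Mapping.single u c \<otimes>\<^bsub>monoid_alg U f e\<^esub> q) = (c \<odot>\<^bsub>B\<^esub> b u) \<otimes>\<^bsub>B\<^esub> L q"
      using pq(2)
    proof (induction q rule: poly_mapping_single_induct)
      case zero
      then show ?case using \<open>u \<in> U\<close> b by (simp add: L0)
    next
      case (single v d q)
      note uv = \<open>u \<in> U\<close> \<open>v \<in> U\<close>
      then show ?case
        using single b[of u] b[of v] Lc[OF single(2)]
        by (simp add: monoid_alg_mult_add La keys_mult ku closed L1 bm B.r_distr B.smult_mult_l B.smult_mult_r
            B.smult_smult mult.commute)
    qed
    with single Lc[OF pq(2)] Lc[OF single(2)] b show ?case
      by (simp add: monoid_alg_add_mult La keys_mult pq(2) ku L1 B.l_distr)
  qed
  show ?thesis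
  \<comment> \<open>Homomorphisms are required to be extensional, hence the restriction of
    \<open>L\<close> to the carrier.\<close>
  proof (intro bexI[of _ "restrict L (carrier (monoid_alg U f e))"] alg_homI ballI)
    interpret M: kalg "monoid_alg U f e" by (rule kalg_monoid_alg)
    fix p q :: "'u \<Rightarrow>\<^sub>0 'k" and c
    assume p: "p \<in> carrier (monoid_alg U f e)"
    let ?L = "restrict L (carrier (monoid_alg U f e))"
    show "?L (c \<odot>\<^bsub>monoid_alg U f e\<^esub> p) = c \<odot>\<^bsub>B\<^esub> ?L p"
      using p M.smult_closed[OF p, of c] Ls by simp
    assume q: "q \<in> carrier (monoid_alg U f e)"
    show "?L (p \<oplus>\<^bsub>monoid_alg U f e\<^esub> q) = ?L p \<oplus>\<^bsub>B\<^esub> ?L q"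
      using p q M.add.m_closed[OF p q] La by simp
    show "?L (p \<otimes>\<^bsub>monoid_alg U f e\<^esub> q) = ?L p \<otimes>\<^bsub>B\<^esub> ?L q"
      using p q M.m_closed[OF p q] Lm by simp
  qed (use unit b in \<open>auto simp: L1 be Lc\<close>)
qed

end

subsection \<open>Quotients\<close>

text \<open>The ring laws see only the ring fields of a record. The quotient algebra extends the
  record of the quotient ring by a scalar multiplication, so its laws are carried over field by
  field.\<close>

lemma ring_cong:
  assumes "ring R" "carrier S = carrier R" "monoid.mult S = monoid.mult R" "one S = one R"
    "zero S = zero R" "add S = add R"
  shows "ring S"
proof -
  interpret R: ring R by fact
  show ?thesis
  proof (rule ringI)
    show "abelian_group S"
    proof (rule abelian_groupI)
      show "\<exists>y\<in>carrier S. y \<oplus>\<^bsub>S\<^esub> x = \<zero>\<^bsub>S\<^esub>" if "x \<in> carrier S" for x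
        using that R.l_neg R.a_inv_closed by (auto simp: assms(2-))
    qed (auto simp: assms(2-) R.a_ac)
    show "monoid S" by (rule monoidI) (auto simp: assms(2-) R.m_assoc)
  qed (auto simp: assms(2-) R.l_distr R.r_distr)
qed

lemma quot_alg_simps:
  "carrier (quot_alg A I) = a_rcosets\<^bsub>A\<^esub> I"
  "monoid.mult (quot_alg A I) = rcoset_mult A I"
  "one (quot_alg A I) = I +>\<^bsub>A\<^esub> \<one>\<^bsub>A\<^esub>"
  "zero (quot_alg A I) = I"
  "add (quot_alg A I) = set_add A"
  "c \<odot>\<^bsub>quot_alg A I\<^esub> Y = (\<Union>y\<in>Y. I +>\<^bsub>A\<^esub> (c \<odot>\<^bsub>A\<^esub> y))"
  by (simp_all add: quot_alg_def FactRing_def ring.extend_def module.fields_def)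

definition quot_proj :: "('k, 'a) module \<Rightarrow> 'a set \<Rightarrow> 'a \<Rightarrow> 'a set" where
  "quot_proj A I = (\<lambda>x\<in>carrier A. I +>\<^bsub>A\<^esub> x)"

locale kalg_ideal = kalg A + ideal I A for A :: "('k::field, 'a) module" (structure) and I
begin

text \<open>The union over representatives collapses because an ideal is stable under scalars:
  \<open>c \<odot> i\<close> is the ring product of \<open>c \<odot> \<one>\<close> with
  \<open>i\<close>.\<close>

lemma quot_smult:
  assumes x: "x \<in> carrier A"
  shows "c \<odot>\<^bsub>quot_alg A I\<^esub> (I +> x) = I +> (c \<odot> x)"
proof -
  have "I +> (c \<odot> y) = I +> (c \<odot> x)" if "y \<in> I +> x" for y
  proof -
    from that obtain i where i: "i \<in> I" "y = i \<oplus> x" by (auto simp: a_r_coset_def')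
    have ic: "i \<in> carrier A" using i(1) by (rule a_Hcarr)
    have "c \<odot> i = (c \<odot> \<one>) \<otimes> i" using ic by (simp add: smult_mult_l)
    then have "c \<odot> i \<in> I" using i(1) by (simp add: I_l_closed)
    moreover have "c \<odot> y = c \<odot> i \<oplus> c \<odot> x" using i ic x by (simp add: smult_r_distr)
    ultimately have "c \<odot> y \<in> I +> (c \<odot> x)" by (auto simp: a_r_coset_def')
    then show ?thesis using x by (intro a_repr_independence[symmetric]) (auto simp: a_subgroup)
  qed
  moreover have "x \<in> I +> x" using x by (rule a_rcos_self)
  ultimately show ?thesis unfolding quot_alg_simps by blast
qed

lemma carrier_quot: "carrier (quot_alg A I) = quot_proj A I ` carrier A"
  by (auto simp: quot_alg_simps A_RCOSETS_def' quot_proj_def)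

lemma quot_add: "x \<in> carrier A \<Longrightarrow> y \<in> carrier A \<Longrightarrow> (I +> x) \<oplus>\<^bsub>quot_alg A I\<^esub> (I +> y) = I +> (x \<oplus> y)"
  by (simp add: quot_alg_simps a_rcos_sum)

lemma quot_mult: "x \<in> carrier A \<Longrightarrow> y \<in> carrier A \<Longrightarrow> (I +> x) \<otimes>\<^bsub>quot_alg A I\<^esub> (I +> y) = I +> (x \<otimes> y)"
  by (simp add: quot_alg_simps rcoset_mult_add)

lemma kalg_quot: "kalg (quot_alg A I)"
proof (rule kalgI)
  show "ring (quot_alg A I)"
    by (rule ring_cong[OF quotient_is_ring]) (simp_all add: quot_alg_simps FactRing_def)
qed (auto simp: carrier_quot quot_proj_def quot_smult quot_add quot_mult smult_l_distr smult_r_distr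
     smult_smult smult_mult_l smult_mult_r)

lemma quot_proj_hom: "quot_proj A I \<in> alg_hom A (quot_alg A I)"
  by (rule alg_homI) (auto simp: carrier_quot quot_proj_def quot_smult quot_add quot_mult quot_alg_simps(3))

lemma quot_proj_eq_iff:
  assumes "x \<in> carrier A" "y \<in> carrier A"
  shows "quot_proj A I x = quot_proj A I y \<longleftrightarrow> x \<ominus> y \<in> I"
  using quotient_eq_iff_same_a_r_cos[of I x y] assms ideal_axioms by (simp add: quot_proj_def)

text \<open>Two representatives of a coset differ by an element of \<open>I\<close>, which
  \<open>h\<close> kills, so an arbitrary choice of representatives defines the map; its laws are
  inherited through the projection.\<close>

lemma quot_hom_exists:
  assumes "kalg B" and h: "h \<in> alg_hom A B" and z: "\<And>x. x \<in> I \<Longrightarrow> h x = \<zero>\<^bsub>B\<^esub>"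
  shows "\<exists>g \<in> alg_hom (quot_alg A I) B. \<forall>x\<in>carrier A. g (quot_proj A I x) = h x"
proof -
  interpret B: kalg B by fact
  note hD = alg_homD[OF h]
  have wd: "h x = h y" if "x \<in> carrier A" "y \<in> carrier A" "quot_proj A I x = quot_proj A I y" for x y
  proof -
    have "x \<ominus> y \<in> I" using that quot_proj_eq_iff by blast
    then have "h (x \<ominus> y) = \<zero>\<^bsub>B\<^esub>" by (rule z)
    moreover have "x = (x \<ominus> y) \<oplus> y" using that by (simp add: minus_eq a_assoc l_neg)
    ultimately show ?thesis using that hD by (metis B.l_zero minus_closed)
  qed
  define g where "g = (\<lambda>Y\<in>carrier (quot_alg A I). h (SOME x. x \<in> carrier A \<and> quot_proj A I x = Y))"
  have g: "g (quot_proj A I x) = h x" if "x \<in> carrier A" for x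
  proof -
    have "(SOME x'. x' \<in> carrier A \<and> quot_proj A I x' = quot_proj A I x) \<in> carrier A \<and>
       quot_proj A I (SOME x'. x' \<in> carrier A \<and> quot_proj A I x' = quot_proj A I x) = quot_proj A I x"
      by (rule someI[of _ x]) (use that in simp)
    then have "h (SOME x'. x' \<in> carrier A \<and> quot_proj A I x' = quot_proj A I x) = h x"
      using wd that by blast
    moreover have "quot_proj A I x \<in> carrier (quot_alg A I)" using that carrier_quot by blast
    ultimately show ?thesis unfolding g_def by (simp only: restrict_apply if_True)
  qed
  interpret Q: kalg "quot_alg A I" by (rule kalg_quot)
  note pD = alg_homD[OF quot_proj_hom]
  have "g \<in> alg_hom (quot_alg A I) B"
  proof (rule alg_homI)
    show "g \<in> carrier (quot_alg A I) \<rightarrow>\<^sub>E carrier B"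
    proof (rule PiE_I)
      show "g Y \<in> carrier B" if "Y \<in> carrier (quot_alg A I)" for Y
        using that unfolding carrier_quot by (auto simp: g hD(1))
    qed (simp add: g_def)
    show "g \<one>\<^bsub>quot_alg A I\<^esub> = \<one>\<^bsub>B\<^esub>" using g[OF one_closed] by (simp add: pD hD)
    show "g (X \<oplus>\<^bsub>quot_alg A I\<^esub> Y) = g X \<oplus>\<^bsub>B\<^esub> g Y" if XY: "X \<in> carrier (quot_alg A I)" "Y \<in> carrier (quot_alg A I)" for X Y
    proof -
      obtain x y where "x \<in> carrier A" "y \<in> carrier A" "X = quot_proj A I x" "Y = quot_proj A I y"
        using XY by (auto simp: carrier_quot)
      then show ?thesis by (simp add: pD(2)[symmetric] g hD)
    qed
    show "g (X \<otimes>\<^bsub>quot_alg A I\<^esub> Y) = g X \<otimes>\<^bsub>B\<^esub> g Y" if XY: "X \<in> carrier (quot_alg A I)" "Y \<in> carrier (quot_alg A I)" for X Y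
    proof -
      obtain x y where "x \<in> carrier A" "y \<in> carrier A" "X = quot_proj A I x" "Y = quot_proj A I y"
        using XY by (auto simp: carrier_quot)
      then show ?thesis by (simp add: pD(4)[symmetric] g hD)
    qed
    show "g (c \<odot>\<^bsub>quot_alg A I\<^esub> X) = c \<odot>\<^bsub>B\<^esub> g X" if X: "X \<in> carrier (quot_alg A I)" for X c
    proof -
      obtain x where "x \<in> carrier A" "X = quot_proj A I x"
        using X by (auto simp: carrier_quot)
      then show ?thesis by (simp add: pD(3)[symmetric] g hD)
    qed
  qed
  then show ?thesis using g by blast
qed

end

text \<open>The kernel is an ideal and the generated ideal is the smallest one containing
  \<open>S\<close>. Hence only the relations themselves ever have to be checked.\<close>

lemma hom_vanishes_on_genideal:
  assumes "kalg A" "kalg B" "h \<in> alg_hom A B" "S \<subseteq> carrier A" "\<And>x. x \<in> S \<Longrightarrow> h x = \<zero>\<^bsub>B\<^esub>"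
    "x \<in> Idl\<^bsub>A\<^esub> S"
  shows "h x = \<zero>\<^bsub>B\<^esub>"
proof -
  interpret A: kalg A by fact
  interpret B: kalg B by fact
  note hD = alg_homD[OF assms(3)]
  have h0: "h \<zero>\<^bsub>A\<^esub> = \<zero>\<^bsub>B\<^esub>" using linear_maps_zero[OF assms(1,2) hD(7)] .
  have "ideal {x \<in> carrier A. h x = \<zero>\<^bsub>B\<^esub>} A"
  proof (rule idealI)
    show "subgroup {x \<in> carrier A. h x = \<zero>\<^bsub>B\<^esub>} (add_monoid A)"
    proof (rule A.add.subgroupI)
      show "\<ominus>\<^bsub>A\<^esub> a \<in> {x \<in> carrier A. h x = \<zero>\<^bsub>B\<^esub>}" if "a \<in> {x \<in> carrier A. h x = \<zero>\<^bsub>B\<^esub>}" for a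
        using that A.minus_smult[of a] hD(3)[of a "-1"] by auto
    qed (use h0 in \<open>auto simp: hD\<close>)
  qed (auto simp: A.ring_axioms hD)
  then have "Idl\<^bsub>A\<^esub> S \<subseteq> {x \<in> carrier A. h x = \<zero>\<^bsub>B\<^esub>}"
    by (rule A.genideal_minimal) (use assms(4,5) in auto)
  then show ?thesis using assms(6) by auto
qed

subsection \<open>Generators and relations\<close>

text \<open>Expanding both factors over their supports turns the convolution product into the double
  sum of \<open>monoid_alg\<close>, so the universal property proved there becomes available for
  words.\<close>

lemma free_alg_eq: "(free_alg G :: ('k::field, _) module) = monoid_alg {u. set (letters u) \<subseteq> G} (+) 0"
proof -
  have s: "p = (\<Sum>u\<in>Poly_Mapping.keys p. Poly_Mapping.single u (Poly_Mapping.lookup p u))" for p :: "('g, 'k) free_algebra"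
    by (rule poly_mapping_eqI) (simp add: lookup_sum lookup_single when_def in_keys_iff)
  have "p * q = (\<Sum>u\<in>Poly_Mapping.keys p. \<Sum>v\<in>Poly_Mapping.keys q.
         Poly_Mapping.single (u + v) (Poly_Mapping.lookup p u * Poly_Mapping.lookup q v))" for p q :: "('g, 'k) free_algebra"
    by (subst s[of p], subst s[of q]) (simp add: sum_product mult_single)
  then show ?thesis by (auto simp: free_alg_def monoid_alg_def)
qed

lemma carrier_monoid_free: "carrier_monoid {u. set (letters u) \<subseteq> G} (+) 0"
  by unfold_locales (auto simp: plus_free_monoid_def zero_free_monoid_def)

lemma kalg_free: "kalg (free_alg G :: ('k::field, _) module)"
  unfolding free_alg_eq by (rule carrier_monoid.kalg_monoid_alg[OF carrier_monoid_free])

lemma free_alg_simps [simp]: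
  "p \<otimes>\<^bsub>free_alg G\<^esub> q = p * q" "p \<oplus>\<^bsub>free_alg G\<^esub> q = p + q" "\<one>\<^bsub>free_alg G\<^esub> = 1" "\<zero>\<^bsub>free_alg G\<^esub> = 0"
  "c \<odot>\<^bsub>free_alg G\<^esub> p = Poly_Mapping.map ((*) c) p"
  by (simp_all add: free_alg_def)

lemma gvar_in_free [simp]: "gvar g \<in> carrier (free_alg G) \<longleftrightarrow> g \<in> G"
  by (simp add: free_alg_def gvar_def)

lemma free_alg_closed [simp]:
  assumes "p \<in> carrier (free_alg G)" "q \<in> carrier (free_alg G)"
  shows "p * q \<in> carrier (free_alg G)" "p + q \<in> carrier (free_alg G)"
    "p - q \<in> carrier (free_alg G)"
proof -
  interpret kalg "free_alg G" by (rule kalg_free)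
  show "p * q \<in> carrier (free_alg G)" "p + q \<in> carrier (free_alg G)"
    using m_closed[OF assms] a_closed[OF assms] by auto
  have "u \<in> Poly_Mapping.keys p \<or> u \<in> Poly_Mapping.keys q" if "u \<in> Poly_Mapping.keys (p - q)" for u
    using that by (auto simp: in_keys_iff lookup_minus)
  then show "p - q \<in> carrier (free_alg G)"
    using assms unfolding free_alg_def by fastforce
qed

lemma free_alg_closed' [simp]:
  "1 \<in> carrier (free_alg G)" "0 \<in> carrier (free_alg G)"
  "p \<in> carrier (free_alg G) \<Longrightarrow> Poly_Mapping.map ((*) c) p \<in> carrier (free_alg G)"
  "p \<in> carrier (free_alg G) \<Longrightarrow> p ^ m \<in> carrier (free_alg G)"
proof -
  interpret kalg "free_alg G" by (rule kalg_free)
  show 1: "1 \<in> carrier (free_alg G)" "0 \<in> carrier (free_alg G)"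
    using one_closed zero_closed by auto
  show "p \<in> carrier (free_alg G) \<Longrightarrow> Poly_Mapping.map ((*) c) p \<in> carrier (free_alg G)"
    using smult_closed[of p c] by auto
  show "p \<in> carrier (free_alg G) \<Longrightarrow> p ^ m \<in> carrier (free_alg G)"
    by (induction m) (use 1 in auto)
qed

lemma free_alg_sum_closed [simp]:
  "(\<And>i. i \<in> S \<Longrightarrow> p i \<in> carrier (free_alg G)) \<Longrightarrow> sum p S \<in> carrier (free_alg G)"
  by (induction S rule: infinite_finite_induct) auto

lemma free_hom_simps:
  fixes B :: "('k::field, 'b) module"
  assumes "kalg B" "h \<in> alg_hom (free_alg G) B"
  shows "p \<in> carrier (free_alg G) \<Longrightarrow> h p \<in> carrier B"
    and "p \<in> carrier (free_alg G) \<Longrightarrow> q \<in> carrier (free_alg G) \<Longrightarrow> h (p * q) = h p \<otimes>\<^bsub>B\<^esub> h q"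
    and "p \<in> carrier (free_alg G) \<Longrightarrow> q \<in> carrier (free_alg G) \<Longrightarrow> h (p + q) = h p \<oplus>\<^bsub>B\<^esub> h q"
    and "h 1 = \<one>\<^bsub>B\<^esub>" and "h 0 = \<zero>\<^bsub>B\<^esub>"
    and "p \<in> carrier (free_alg G) \<Longrightarrow> h (Poly_Mapping.map ((*) c) p) = c \<odot>\<^bsub>B\<^esub> h p"
    and "p \<in> carrier (free_alg G) \<Longrightarrow> h (p ^ m) = h p [^]\<^bsub>B\<^esub> m"
    and "(\<And>i. i \<in> S \<Longrightarrow> pp i \<in> carrier (free_alg G)) \<Longrightarrow> h (sum pp S) = (\<Oplus>\<^bsub>B\<^esub>i\<in>S. h (pp i))"
proof -
  interpret B: kalg B by fact
  note hD = alg_homD[OF assms(2)]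
  show *: "p \<in> carrier (free_alg G) \<Longrightarrow> h p \<in> carrier B"
    "p \<in> carrier (free_alg G) \<Longrightarrow> q \<in> carrier (free_alg G) \<Longrightarrow> h (p * q) = h p \<otimes>\<^bsub>B\<^esub> h q"
    "p \<in> carrier (free_alg G) \<Longrightarrow> q \<in> carrier (free_alg G) \<Longrightarrow> h (p + q) = h p \<oplus>\<^bsub>B\<^esub> h q"
    "h 1 = \<one>\<^bsub>B\<^esub>" "p \<in> carrier (free_alg G) \<Longrightarrow> h (Poly_Mapping.map ((*) c) p) = c \<odot>\<^bsub>B\<^esub> h p" for p q
    using hD(1)[of p] hD(2,4)[of p q] hD(5) hD(3)[of p c] by auto
  show 0: "h 0 = \<zero>\<^bsub>B\<^esub>" using linear_maps_zero[OF kalg_free assms(1) hD(7)] by simp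
  show "p \<in> carrier (free_alg G) \<Longrightarrow> h (p ^ m) = h p [^]\<^bsub>B\<^esub> m"
  proof (induction m)
    case (Suc m)
    have "p ^ Suc m = p ^ m * p" by (simp add: power_commutes)
    then show ?case using Suc * by simp
  qed (simp add: *)
  show "(\<And>i. i \<in> S \<Longrightarrow> pp i \<in> carrier (free_alg G)) \<Longrightarrow> h (sum pp S) = (\<Oplus>\<^bsub>B\<^esub>i\<in>S. h (pp i))"
    by (induction S rule: infinite_finite_induct) (auto simp: 0 * B.finsum_insert Pi_def)
qed

lemma free_alg_generated: "carrier (free_alg G) = gen_subalg (free_alg G) ((gvar ` G) :: ('g, 'k::field) free_algebra set)"
proof
  interpret kalg "free_alg G :: ('k, _) module" by (rule kalg_free)
  show "gen_subalg (free_alg G) (gvar ` G) \<subseteq> carrier (free_alg G :: ('k, _) module)"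
    by (rule gen_subalg_subset) (auto simp: kalg_free)
  have w: "Poly_Mapping.single (FM xs) 1 \<in> gen_subalg (free_alg G) ((gvar ` G) :: ('g, 'k) free_algebra set)" if "set xs \<subseteq> G" for xs
    using that
  proof (induction xs)
    case Nil
    have "Poly_Mapping.single (FM []) 1 = \<one>\<^bsub>free_alg G :: ('k, _) module\<^esub>"
      by (simp add: zero_free_monoid_def[symmetric])
    then show ?case by (metis gen_subalg.gen_one)
  next
    case (Cons x xs)
    have "Poly_Mapping.single (FM (x # xs)) 1 = gvar x \<otimes>\<^bsub>free_alg G :: ('k, _) module\<^esub> Poly_Mapping.single (FM xs) 1"
      by (simp add: gvar_def mult_single plus_free_monoid_def)
    moreover have "(gvar x :: ('g, 'k) free_algebra) \<in> gen_subalg (free_alg G) (gvar ` G)"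
      using Cons.prems by (auto intro: gen_subalg.gen_incl)
    ultimately show ?case using Cons by (metis gen_subalg.gen_mult insert_subset list.simps(15))
  qed
  show "carrier (free_alg G) \<subseteq> gen_subalg (free_alg G) ((gvar ` G) :: ('g, 'k) free_algebra set)"
  proof
    fix p :: "('g, 'k) free_algebra" assume "p \<in> carrier (free_alg G)"
    then have "Poly_Mapping.keys p \<subseteq> {u. set (letters u) \<subseteq> G}" by (auto simp: free_alg_def)
    then show "p \<in> gen_subalg (free_alg G) (gvar ` G)"
    proof (induction rule: poly_mapping_single_induct)
      case zero
      have "0 = 0 \<odot>\<^bsub>free_alg G :: ('k, _) module\<^esub> 1" by (rule poly_mapping_eqI) simp
      then show ?case by (metis gen_subalg.gen_smult gen_subalg.gen_one free_alg_simps(3))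
    next
      case (single u c p)
      have "Poly_Mapping.single u c = c \<odot>\<^bsub>free_alg G\<^esub> Poly_Mapping.single (FM (letters u)) 1"
        by (rule poly_mapping_eqI) (simp add: lookup_single when_def)
      moreover have "Poly_Mapping.single (FM (letters u)) 1 \<in> gen_subalg (free_alg G) ((gvar ` G) :: ('g, 'k) free_algebra set)"
        using single w by blast
      ultimately have "Poly_Mapping.single u c \<in> gen_subalg (free_alg G) (gvar ` G)"
        by (metis gen_subalg.gen_smult)
      from gen_subalg.gen_add[OF this single(3)] show ?case by simp
    qed
  qed
qed

lemma free_hom_exists:
  fixes B :: "('k::field, 'b) module"
  assumes "kalg B" "\<And>g. g \<in> G \<Longrightarrow> \<phi> g \<in> carrier B"
  shows "\<exists>h \<in> alg_hom (free_alg G) B. \<forall>g\<in>G. h (gvar g) = \<phi> g"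
proof -
  interpret B: kalg B by fact
  have "\<exists>h \<in> alg_hom (free_alg G) B. \<forall>u\<in>{u. set (letters u) \<subseteq> G}.
      h (Poly_Mapping.single u 1) = list_prod B (map \<phi> (letters u))"
    unfolding free_alg_eq
  proof (rule carrier_monoid.monoid_alg_hom_exists[OF carrier_monoid_free assms(1)])
    show "list_prod B (map \<phi> (letters u)) \<in> carrier B" if "u \<in> {u. set (letters u) \<subseteq> G}" for u
      using that assms(2) by (intro B.list_prod_closed) auto
    show "list_prod B (map \<phi> (letters (u + v))) = list_prod B (map \<phi> (letters u)) \<otimes>\<^bsub>B\<^esub> list_prod B (map \<phi> (letters v))"
      if "u \<in> {u. set (letters u) \<subseteq> G}" "v \<in> {u. set (letters u) \<subseteq> G}" for u v
      using that assms(2) by (simp add: plus_free_monoid_def) (intro B.list_prod_append; auto)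
  qed (simp add: zero_free_monoid_def)
  then obtain h where h: "h \<in> alg_hom (free_alg G) B"
    "\<And>u. set (letters u) \<subseteq> G \<Longrightarrow> h (Poly_Mapping.single u 1) = list_prod B (map \<phi> (letters u))"
    by blast
  show ?thesis
    by (rule bexI[OF _ h(1)]) (use assms(2) in \<open>auto simp: gvar_def h(2)\<close>)
qed

locale presentation =
  fixes G :: "'g set" and R :: "(('g, 'k::field) free_algebra \<times> ('g, 'k) free_algebra) set"
  assumes rels: "\<And>p q. (p, q) \<in> R \<Longrightarrow> p \<in> carrier (free_alg G) \<and> q \<in> carrier (free_alg G)"
begin

abbreviation "proj \<equiv> quot_proj (free_alg G) (rel_ideal G R)"

lemma rels_subset: "{p - q | p q. (p, q) \<in> R} \<subseteq> carrier (free_alg G)"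
  using rels by auto

lemma rel_kalg_ideal: "kalg_ideal (free_alg G) (rel_ideal G R)"
proof -
  interpret kalg "free_alg G :: ('k, _) module" by (rule kalg_free)
  show ?thesis unfolding rel_ideal_def
    by (intro kalg_ideal.intro kalg_free genideal_ideal[OF rels_subset])
qed

sublocale I: kalg_ideal "free_alg G" "rel_ideal G R"
  by (rule rel_kalg_ideal)

lemma kalg_presented: "kalg (presented_alg G R)"
  unfolding presented_alg_def by (rule I.kalg_quot)

lemma proj_hom: "proj \<in> alg_hom (free_alg G) (presented_alg G R)"
  unfolding presented_alg_def by (rule I.quot_proj_hom)

lemma proj_gvar [simp]: "g \<in> G \<Longrightarrow> proj (gvar g) = presented_gen G R g"
  by (simp add: quot_proj_def presented_gen_def)

lemma presented_gen_closed: "g \<in> G \<Longrightarrow> presented_gen G R g \<in> carrier (presented_alg G R)"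
  using alg_homD(1)[OF proj_hom, of "gvar g"] by simp

lemma proj_rel:
  assumes "(p, q) \<in> R" shows "proj p = proj q"
proof -
  have c: "p \<in> carrier (free_alg G)" "q \<in> carrier (free_alg G)" using rels assms by auto
  have "p \<ominus>\<^bsub>free_alg G\<^esub> q = p - q"
  proof -
    have "\<ominus>\<^bsub>free_alg G\<^esub> q = - q"
    proof (rule I.minus_equality)
      show "- q \<in> carrier (free_alg G)" using free_alg_closed(3)[of 0 G q] c by simp
    qed (use c in simp_all)
    then show ?thesis by (simp add: I.minus_eq)
  qed
  moreover have "p - q \<in> rel_ideal G R"
    unfolding rel_ideal_def using I.genideal_self[OF rels_subset] assms by auto
  ultimately show ?thesis using I.quot_proj_eq_iff[OF c] by simp
qed

lemma presented_generated: "carrier (presented_alg G R) = gen_subalg (presented_alg G R) (presented_gen G R ` G)"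
proof
  show "gen_subalg (presented_alg G R) (presented_gen G R ` G) \<subseteq> carrier (presented_alg G R)"
    by (intro gen_subalg_subset kalg_presented) (auto simp: presented_gen_closed)
  have im: "proj ` gvar ` G = presented_gen G R ` G" by (auto simp: image_image)
  show "carrier (presented_alg G R) \<subseteq> gen_subalg (presented_alg G R) (presented_gen G R ` G)"
  proof
    fix X assume "X \<in> carrier (presented_alg G R)"
    then obtain p where p: "p \<in> carrier (free_alg G)" "X = proj p"
      unfolding presented_alg_def I.carrier_quot by blast
    have "p \<in> gen_subalg (free_alg G) (gvar ` G)" using p(1) free_alg_generated by blast
    moreover have "gvar ` G \<subseteq> carrier (free_alg G :: ('k, ('g, 'k) free_algebra) module)" by auto
    ultimately show "X \<in> gen_subalg (presented_alg G R) (presented_gen G R ` G)"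
      using alg_hom_image_gen_subalg[OF kalg_free proj_hom] p(2) im by metis
  qed
qed

text \<open>The relations are checked for an arbitrary homomorphism \<open>h\<close> on the free
  algebra with the prescribed values. Each relation can then be evaluated by the rules for
  homomorphisms, without any formula for \<open>h\<close> on polynomials.\<close>

lemma presented_hom_exists:
  assumes "kalg B" "\<And>g. g \<in> G \<Longrightarrow> \<phi> g \<in> carrier B"
    and rel: "\<And>h p q. h \<in> alg_hom (free_alg G) B \<Longrightarrow> (\<And>g. g \<in> G \<Longrightarrow> h (gvar g) = \<phi> g) \<Longrightarrow> (p, q) \<in> R \<Longrightarrow> h p = h q"
  shows "\<exists>h \<in> alg_hom (presented_alg G R) B. \<forall>g\<in>G. h (presented_gen G R g) = \<phi> g"
proof -
  interpret B: kalg B by fact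
  obtain h where h: "h \<in> alg_hom (free_alg G) B" "\<forall>g\<in>G. h (gvar g) = \<phi> g"
    using free_hom_exists[OF assms(1), of G \<phi>] assms(2) by metis
  have "h x = \<zero>\<^bsub>B\<^esub>" if "x \<in> rel_ideal G R" for x
  proof (rule hom_vanishes_on_genideal[OF kalg_free assms(1) h(1) rels_subset _ that[unfolded rel_ideal_def]])
    fix x assume "x \<in> {p - q | p q. (p, q) \<in> R}"
    then obtain p q where pq: "(p, q) \<in> R" "x = p - q" by blast
    have c: "p \<in> carrier (free_alg G)" "q \<in> carrier (free_alg G)" using rels pq by auto
    have "h p = h q" using rel[OF h(1) _ pq(1)] h(2) by blast
    moreover have "h p = h x \<oplus>\<^bsub>B\<^esub> h q"
      using free_hom_simps(3)[OF assms(1) h(1) free_alg_closed(3)[OF c] c(2)] by (simp add: pq(2))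
    moreover have "h x \<in> carrier B" "h q \<in> carrier B"
      using c free_hom_simps(1)[OF assms(1) h(1)] free_alg_closed(3)[OF c] pq(2) by auto
    ultimately show "h x = \<zero>\<^bsub>B\<^esub>" by (metis B.add.r_cancel_one)
  qed
  from I.quot_hom_exists[OF assms(1) h(1) this]
  obtain k where k: "k \<in> alg_hom (presented_alg G R) B" "\<forall>x\<in>carrier (free_alg G). k (proj x) = h x"
    unfolding presented_alg_def by blast
  have "k (presented_gen G R g) = \<phi> g" if "g \<in> G" for g
  proof -
    have "k (proj (gvar g)) = h (gvar g)"
      using k(2)[THEN bspec, of "gvar g"] that unfolding gvar_in_free by blast
    then show ?thesis using h(2) that by simp
  qed
  with k(1) show ?thesis by blast
qed

end

subsection \<open>Matrices and corners\<close>

lemma mat_alg_simps: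
  "carrier (mat_alg L A) = L \<times> L \<rightarrow>\<^sub>E carrier A"
  "M \<otimes>\<^bsub>mat_alg L A\<^esub> N = (\<lambda>(i, j)\<in>L \<times> L. \<Oplus>\<^bsub>A\<^esub>l\<in>L. M (i, l) \<otimes>\<^bsub>A\<^esub> N (l, j))"
  "\<one>\<^bsub>mat_alg L A\<^esub> = (\<lambda>(i, j)\<in>L \<times> L. if i = j then \<one>\<^bsub>A\<^esub> else \<zero>\<^bsub>A\<^esub>)"
  "\<zero>\<^bsub>mat_alg L A\<^esub> = (\<lambda>_\<in>L \<times> L. \<zero>\<^bsub>A\<^esub>)"
  "M \<oplus>\<^bsub>mat_alg L A\<^esub> N = (\<lambda>p\<in>L \<times> L. M p \<oplus>\<^bsub>A\<^esub> N p)"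
  "c \<odot>\<^bsub>mat_alg L A\<^esub> M = (\<lambda>p\<in>L \<times> L. c \<odot>\<^bsub>A\<^esub> M p)"
  by (simp_all add: mat_alg_def)

lemma mat_eqI:
  assumes "M \<in> carrier (mat_alg L A)" "N \<in> carrier (mat_alg L A)"
    "\<And>i j. i \<in> L \<Longrightarrow> j \<in> L \<Longrightarrow> M (i, j) = N (i, j)"
  shows "M = N"
  using assms unfolding mat_alg_simps by (intro PiE_ext[of M "L \<times> L" "\<lambda>_. carrier A" N]) auto

lemma mat_closed: "M \<in> carrier (mat_alg L A) \<Longrightarrow> i \<in> L \<Longrightarrow> j \<in> L \<Longrightarrow> M (i, j) \<in> carrier A"
  by (auto simp: mat_alg_simps)

text \<open>All laws are verified entry by entry; associativity is the place where two finite sums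
  are exchanged.\<close>

lemma kalg_mat:
  assumes "kalg A" "finite L"
  shows "kalg (mat_alg L A)"
proof -
  interpret A: kalg A by fact
  let ?M = "mat_alg L A"
  note fc = A.finsum_closed
  have mc: "M \<otimes>\<^bsub>?M\<^esub> N \<in> carrier ?M" if "M \<in> carrier ?M" "N \<in> carrier ?M" for M N
    using that mat_closed[OF that(1)] mat_closed[OF that(2)] by (auto simp: mat_alg_simps(1,2) intro!: fc)
  have me: "(M \<otimes>\<^bsub>?M\<^esub> N) (i, j) = (\<Oplus>\<^bsub>A\<^esub>l\<in>L. M (i, l) \<otimes>\<^bsub>A\<^esub> N (l, j))" if "i \<in> L" "j \<in> L" for M N i j
    using that by (simp add: mat_alg_simps)
  have ac: "M \<oplus>\<^bsub>?M\<^esub> N \<in> carrier ?M" if "M \<in> carrier ?M" "N \<in> carrier ?M" for M N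
    using that by (auto simp: mat_alg_simps)
  have ae: "(M \<oplus>\<^bsub>?M\<^esub> N) (i, j) = M (i, j) \<oplus>\<^bsub>A\<^esub> N (i, j)" if "i \<in> L" "j \<in> L" for M N i j
    using that by (simp add: mat_alg_simps)
  have sc: "c \<odot>\<^bsub>?M\<^esub> N \<in> carrier ?M" if "N \<in> carrier ?M" for c N
    using that by (auto simp: mat_alg_simps)
  have se: "(c \<odot>\<^bsub>?M\<^esub> N) (i, j) = c \<odot>\<^bsub>A\<^esub> N (i, j)" if "i \<in> L" "j \<in> L" for c N i j
    using that by (simp add: mat_alg_simps)
  have oc: "\<one>\<^bsub>?M\<^esub> \<in> carrier ?M" "\<zero>\<^bsub>?M\<^esub> \<in> carrier ?M" by (auto simp: mat_alg_simps)
  have oe: "\<one>\<^bsub>?M\<^esub> (i, j) = (if i = j then \<one>\<^bsub>A\<^esub> else \<zero>\<^bsub>A\<^esub>)" "\<zero>\<^bsub>?M\<^esub> (i, j) = \<zero>\<^bsub>A\<^esub>" if "i \<in> L" "j \<in> L" for i j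
    using that by (simp_all add: mat_alg_simps)
  note e = me ae se oe and c = mc ac sc oc
  show ?thesis
  proof (rule kalgI)
    show "ring ?M"
    proof (rule ringI)
      show "abelian_group ?M"
      proof (rule abelian_groupI)
        show "\<exists>N\<in>carrier ?M. N \<oplus>\<^bsub>?M\<^esub> M = \<zero>\<^bsub>?M\<^esub>" if M: "M \<in> carrier ?M" for M
        proof (rule bexI[of _ "(-1) \<odot>\<^bsub>?M\<^esub> M"])
          show "((-1) \<odot>\<^bsub>?M\<^esub> M) \<oplus>\<^bsub>?M\<^esub> M = \<zero>\<^bsub>?M\<^esub>"
            by (rule mat_eqI[of _ L A]) (use M c mat_closed[OF M] in \<open>auto simp: e A.minus_smult[symmetric] A.l_neg\<close>)
        qed (use M c in auto)
      qed (auto intro!: c mat_eqI[of _ L A] simp: e mat_closed A.a_ac)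
      show "monoid ?M"
      proof (rule monoidI)
        show "(M \<otimes>\<^bsub>?M\<^esub> N) \<otimes>\<^bsub>?M\<^esub> K = M \<otimes>\<^bsub>?M\<^esub> (N \<otimes>\<^bsub>?M\<^esub> K)"
          if "M \<in> carrier ?M" "N \<in> carrier ?M" "K \<in> carrier ?M" for M N K
        proof (rule mat_eqI[of _ L A])
          fix i j assume ij: "i \<in> L" "j \<in> L"
          note cl = mat_closed[OF that(1)] mat_closed[OF that(2)] mat_closed[OF that(3)]
          have "((M \<otimes>\<^bsub>?M\<^esub> N) \<otimes>\<^bsub>?M\<^esub> K) (i, j) = (\<Oplus>\<^bsub>A\<^esub>l\<in>L. (\<Oplus>\<^bsub>A\<^esub>m\<in>L. M (i, m) \<otimes>\<^bsub>A\<^esub> N (m, l)) \<otimes>\<^bsub>A\<^esub> K (l, j))"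
            unfolding me[OF ij] by (rule A.finsum_cong') (use ij cl in \<open>auto simp: e intro!: fc\<close>)
          also have "\<dots> = (\<Oplus>\<^bsub>A\<^esub>l\<in>L. \<Oplus>\<^bsub>A\<^esub>m\<in>L. M (i, m) \<otimes>\<^bsub>A\<^esub> (N (m, l) \<otimes>\<^bsub>A\<^esub> K (l, j)))"
            by (rule A.finsum_cong') (use ij cl assms(2) in \<open>auto simp: A.finsum_ldistr A.m_assoc Pi_def intro!: fc A.finsum_cong'\<close>)
          also have "\<dots> = (\<Oplus>\<^bsub>A\<^esub>m\<in>L. \<Oplus>\<^bsub>A\<^esub>l\<in>L. M (i, m) \<otimes>\<^bsub>A\<^esub> (N (m, l) \<otimes>\<^bsub>A\<^esub> K (l, j)))"
            by (rule A.finsum_swap) (use ij cl assms(2) in auto)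
          also have "\<dots> = (\<Oplus>\<^bsub>A\<^esub>m\<in>L. M (i, m) \<otimes>\<^bsub>A\<^esub> (\<Oplus>\<^bsub>A\<^esub>l\<in>L. N (m, l) \<otimes>\<^bsub>A\<^esub> K (l, j)))"
            by (rule A.finsum_cong') (use ij cl assms(2) in \<open>auto simp: A.finsum_rdistr Pi_def intro!: fc\<close>)
          also have "\<dots> = (M \<otimes>\<^bsub>?M\<^esub> (N \<otimes>\<^bsub>?M\<^esub> K)) (i, j)"
            unfolding me[OF ij] by (rule A.finsum_cong') (use ij cl in \<open>auto simp: e intro!: fc\<close>)
          finally show "((M \<otimes>\<^bsub>?M\<^esub> N) \<otimes>\<^bsub>?M\<^esub> K) (i, j) = (M \<otimes>\<^bsub>?M\<^esub> (N \<otimes>\<^bsub>?M\<^esub> K)) (i, j)" .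
        qed (use that c in auto)
        fix M assume M: "M \<in> carrier ?M"
        note cl = mat_closed[OF M]
        show "\<one>\<^bsub>?M\<^esub> \<otimes>\<^bsub>?M\<^esub> M = M"
        proof (rule mat_eqI[of _ L A])
          fix i j assume ij: "i \<in> L" "j \<in> L"
          have "(\<one>\<^bsub>?M\<^esub> \<otimes>\<^bsub>?M\<^esub> M) (i, j) = (\<Oplus>\<^bsub>A\<^esub>l\<in>L. if l = i then M (i, j) else \<zero>\<^bsub>A\<^esub>)"
            unfolding me[OF ij] by (rule A.finsum_cong') (use ij cl in \<open>auto simp: e\<close>)
          then show "(\<one>\<^bsub>?M\<^esub> \<otimes>\<^bsub>?M\<^esub> M) (i, j) = M (i, j)"
            using A.finsum_single[OF assms(2) ij(1) cl[OF ij]] by simp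
        qed (use M c in auto)
        show "M \<otimes>\<^bsub>?M\<^esub> \<one>\<^bsub>?M\<^esub> = M"
        proof (rule mat_eqI[of _ L A])
          fix i j assume ij: "i \<in> L" "j \<in> L"
          have "(M \<otimes>\<^bsub>?M\<^esub> \<one>\<^bsub>?M\<^esub>) (i, j) = (\<Oplus>\<^bsub>A\<^esub>l\<in>L. if l = j then M (i, j) else \<zero>\<^bsub>A\<^esub>)"
            unfolding me[OF ij] by (rule A.finsum_cong') (use ij cl in \<open>auto simp: e\<close>)
          then show "(M \<otimes>\<^bsub>?M\<^esub> \<one>\<^bsub>?M\<^esub>) (i, j) = M (i, j)"
            using A.finsum_single[OF assms(2) ij(2) cl[OF ij]] by simp
        qed (use M c in auto)
      qed (use c in auto)
      fix M N K assume MNK: "M \<in> carrier ?M" "N \<in> carrier ?M" "K \<in> carrier ?M"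
      note cl = mat_closed[OF MNK(1)] mat_closed[OF MNK(2)] mat_closed[OF MNK(3)]
      show "(M \<oplus>\<^bsub>?M\<^esub> N) \<otimes>\<^bsub>?M\<^esub> K = M \<otimes>\<^bsub>?M\<^esub> K \<oplus>\<^bsub>?M\<^esub> N \<otimes>\<^bsub>?M\<^esub> K"
      proof (rule mat_eqI[of _ L A])
        fix i j assume ij: "i \<in> L" "j \<in> L"
        show "((M \<oplus>\<^bsub>?M\<^esub> N) \<otimes>\<^bsub>?M\<^esub> K) (i, j) = (M \<otimes>\<^bsub>?M\<^esub> K \<oplus>\<^bsub>?M\<^esub> N \<otimes>\<^bsub>?M\<^esub> K) (i, j)"
        proof -
          have "(\<Oplus>\<^bsub>A\<^esub>l\<in>L. (M \<oplus>\<^bsub>?M\<^esub> N) (i, l) \<otimes>\<^bsub>A\<^esub> K (l, j))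
            = (\<Oplus>\<^bsub>A\<^esub>l\<in>L. M (i, l) \<otimes>\<^bsub>A\<^esub> K (l, j) \<oplus>\<^bsub>A\<^esub> N (i, l) \<otimes>\<^bsub>A\<^esub> K (l, j))"
            by (rule A.finsum_cong') (use ij cl in \<open>auto simp: e A.l_distr\<close>)
          also have "\<dots> = (\<Oplus>\<^bsub>A\<^esub>l\<in>L. M (i, l) \<otimes>\<^bsub>A\<^esub> K (l, j)) \<oplus>\<^bsub>A\<^esub> (\<Oplus>\<^bsub>A\<^esub>l\<in>L. N (i, l) \<otimes>\<^bsub>A\<^esub> K (l, j))"
            by (rule A.finsum_addf) (use ij cl in auto)
          finally show ?thesis unfolding ae[OF ij] me[OF ij] .
        qed
      qed (use MNK c in auto)
      show "K \<otimes>\<^bsub>?M\<^esub> (M \<oplus>\<^bsub>?M\<^esub> N) = K \<otimes>\<^bsub>?M\<^esub> M \<oplus>\<^bsub>?M\<^esub> K \<otimes>\<^bsub>?M\<^esub> N"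
      proof (rule mat_eqI[of _ L A])
        fix i j assume ij: "i \<in> L" "j \<in> L"
        show "(K \<otimes>\<^bsub>?M\<^esub> (M \<oplus>\<^bsub>?M\<^esub> N)) (i, j) = (K \<otimes>\<^bsub>?M\<^esub> M \<oplus>\<^bsub>?M\<^esub> K \<otimes>\<^bsub>?M\<^esub> N) (i, j)"
        proof -
          have "(\<Oplus>\<^bsub>A\<^esub>l\<in>L. K (i, l) \<otimes>\<^bsub>A\<^esub> (M \<oplus>\<^bsub>?M\<^esub> N) (l, j))
            = (\<Oplus>\<^bsub>A\<^esub>l\<in>L. K (i, l) \<otimes>\<^bsub>A\<^esub> M (l, j) \<oplus>\<^bsub>A\<^esub> K (i, l) \<otimes>\<^bsub>A\<^esub> N (l, j))"
            by (rule A.finsum_cong') (use ij cl in \<open>auto simp: e A.r_distr\<close>)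
          also have "\<dots> = (\<Oplus>\<^bsub>A\<^esub>l\<in>L. K (i, l) \<otimes>\<^bsub>A\<^esub> M (l, j)) \<oplus>\<^bsub>A\<^esub> (\<Oplus>\<^bsub>A\<^esub>l\<in>L. K (i, l) \<otimes>\<^bsub>A\<^esub> N (l, j))"
            by (rule A.finsum_addf) (use ij cl in auto)
          finally show ?thesis unfolding ae[OF ij] me[OF ij] .
        qed
      qed (use MNK c in auto)
    qed
  next
    fix M N c assume MN: "M \<in> carrier ?M" "N \<in> carrier ?M"
    note cl = mat_closed[OF MN(1)] mat_closed[OF MN(2)]
    show "(c \<odot>\<^bsub>?M\<^esub> M) \<otimes>\<^bsub>?M\<^esub> N = c \<odot>\<^bsub>?M\<^esub> (M \<otimes>\<^bsub>?M\<^esub> N)"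
    proof (rule mat_eqI[of _ L A])
      fix i j assume ij: "i \<in> L" "j \<in> L"
      show "((c \<odot>\<^bsub>?M\<^esub> M) \<otimes>\<^bsub>?M\<^esub> N) (i, j) = (c \<odot>\<^bsub>?M\<^esub> (M \<otimes>\<^bsub>?M\<^esub> N)) (i, j)"
        unfolding se[OF ij] me[OF ij]
        by (subst A.finsum_smult) (use ij cl in \<open>auto simp: e A.smult_mult_l intro!: A.finsum_cong'\<close>)
    qed (use MN \<open>\<And>c N. N \<in> carrier ?M \<Longrightarrow> c \<odot>\<^bsub>?M\<^esub> N \<in> carrier ?M\<close> mc in auto)
    show "M \<otimes>\<^bsub>?M\<^esub> (c \<odot>\<^bsub>?M\<^esub> N) = c \<odot>\<^bsub>?M\<^esub> (M \<otimes>\<^bsub>?M\<^esub> N)"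
    proof (rule mat_eqI[of _ L A])
      fix i j assume ij: "i \<in> L" "j \<in> L"
      show "(M \<otimes>\<^bsub>?M\<^esub> (c \<odot>\<^bsub>?M\<^esub> N)) (i, j) = (c \<odot>\<^bsub>?M\<^esub> (M \<otimes>\<^bsub>?M\<^esub> N)) (i, j)"
        unfolding se[OF ij] me[OF ij]
        by (subst A.finsum_smult) (use ij cl in \<open>auto simp: e A.smult_mult_r intro!: A.finsum_cong'\<close>)
    qed (use MN \<open>\<And>c N. N \<in> carrier ?M \<Longrightarrow> c \<odot>\<^bsub>?M\<^esub> N \<in> carrier ?M\<close> mc in auto)
  qed (auto intro!: mat_eqI[of _ L A] sc ac simp: e mat_closed A.smult_l_distr A.smult_r_distr A.smult_smult)
qed

text \<open>The corner \<open>e A e\<close> with unit \<open>e\<close>, described by the equations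
  its elements satisfy. It serves both the central idempotent of a composition and the idempotent of
  a single character, which in general does not commute with the \<open>f\<close>.\<close>

definition corner_alg :: "('k, 'a) module \<Rightarrow> 'a \<Rightarrow> ('k, 'a) module" where
  "corner_alg A e = A\<lparr>carrier := {y \<in> carrier A. e \<otimes>\<^bsub>A\<^esub> y = y \<and> y \<otimes>\<^bsub>A\<^esub> e = y}, one := e\<rparr>"

lemma corner_alg_simps [simp]:
  "carrier (corner_alg A e) = {y \<in> carrier A. e \<otimes>\<^bsub>A\<^esub> y = y \<and> y \<otimes>\<^bsub>A\<^esub> e = y}"
  "\<one>\<^bsub>corner_alg A e\<^esub> = e" "\<zero>\<^bsub>corner_alg A e\<^esub> = \<zero>\<^bsub>A\<^esub>"
  "x \<otimes>\<^bsub>corner_alg A e\<^esub> y = x \<otimes>\<^bsub>A\<^esub> y" "x \<oplus>\<^bsub>corner_alg A e\<^esub> y = x \<oplus>\<^bsub>A\<^esub> y"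
  "c \<odot>\<^bsub>corner_alg A e\<^esub> y = c \<odot>\<^bsub>A\<^esub> y"
  by (simp_all add: corner_alg_def)

lemma kalg_corner:
  assumes "kalg A" "e \<in> carrier A" "e \<otimes>\<^bsub>A\<^esub> e = e"
  shows "kalg (corner_alg A e)"
proof -
  interpret A: kalg A by fact
  have as: "e \<otimes>\<^bsub>A\<^esub> (x \<otimes>\<^bsub>A\<^esub> y) = x \<otimes>\<^bsub>A\<^esub> y" if "x \<in> carrier A" "y \<in> carrier A" "e \<otimes>\<^bsub>A\<^esub> x = x" for x y
    using that assms(2) by (simp add: A.m_assoc[symmetric])
  show ?thesis
  proof (rule kalgI)
    show "ring (corner_alg A e)"
    proof (rule ringI)
      show "abelian_group (corner_alg A e)"
      proof (rule abelian_groupI)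
        show "\<exists>y\<in>carrier (corner_alg A e). y \<oplus>\<^bsub>corner_alg A e\<^esub> x = \<zero>\<^bsub>corner_alg A e\<^esub>"
          if "x \<in> carrier (corner_alg A e)" for x
          by (rule bexI[of _ "\<ominus>\<^bsub>A\<^esub> x"])
             (use that assms(2) in \<open>auto simp: A.l_neg A.r_minus A.l_minus\<close>)
      qed (use assms(2) in \<open>auto simp: A.r_distr A.l_distr A.a_ac\<close>)
      show "monoid (corner_alg A e)"
        by (rule monoidI) (use assms(2,3) as in \<open>auto simp: A.m_assoc\<close>)
    qed (auto simp: A.l_distr A.r_distr)
  qed (use assms(2) in \<open>auto simp: A.smult_l_distr A.smult_r_distr A.smult_smult A.smult_mult_l A.smult_mult_r\<close>)
qed

subsection \<open>Tensor products\<close>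

lemma (in kalg) gen_subalg_list_prod:
  "set xs \<subseteq> gen_subalg A S \<Longrightarrow> list_prod A xs \<in> gen_subalg A S"
  by (induction xs) (auto intro: gen_subalg.intros)

text \<open>Factors with the same index keep their order, so commutation is asked for different
  indices only. This is exactly how the images of distinct tensor factors behave.\<close>

lemma (in kalg) list_prod_mult_distrib:
  assumes "distinct is"
    and "\<And>i. i \<in> set is \<Longrightarrow> a i \<in> carrier A" "\<And>i. i \<in> set is \<Longrightarrow> b i \<in> carrier A"
    and "\<And>i j. i \<in> set is \<Longrightarrow> j \<in> set is \<Longrightarrow> i \<noteq> j \<Longrightarrow> a i \<otimes> b j = b j \<otimes> a i"
  shows "list_prod A (map (\<lambda>i. a i \<otimes> b i) is) = list_prod A (map a is) \<otimes> list_prod A (map b is)"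
  using assms
proof (induction "is")
  case (Cons i "is")
  have c: "a i \<in> carrier A" "b i \<in> carrier A" "set (map a is) \<subseteq> carrier A" "set (map b is) \<subseteq> carrier A"
    using Cons.prems by auto
  note lc = list_prod_closed[OF c(3)] list_prod_closed[OF c(4)]
  have "b i \<otimes> list_prod A (map a is) = list_prod A (map a is) \<otimes> b i"
  proof (rule list_prod_commute[OF c(2,3)])
    fix x assume "x \<in> set (map a is)"
    then obtain j where j: "j \<in> set is" "x = a j" by auto
    then have "j \<noteq> i" using Cons.prems(1) by auto
    then show "b i \<otimes> x = x \<otimes> b i" using Cons.prems(4)[of j i] j by simp
  qed
  then have "a i \<otimes> b i \<otimes> (list_prod A (map a is) \<otimes> list_prod A (map b is)) =
      a i \<otimes> list_prod A (map a is) \<otimes> (b i \<otimes> list_prod A (map b is))"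
    using c lc by (metis m_assoc m_closed)
  moreover have "list_prod A (map (\<lambda>i. a i \<otimes> b i) is) = list_prod A (map a is) \<otimes> list_prod A (map b is)"
    using Cons by simp
  ultimately show ?case by simp
qed simp

lemma tuple_alg_eq:
  "tuple_alg I A = monoid_alg (\<Pi>\<^sub>E i\<in>I. carrier (A i)) (\<lambda>u v. \<lambda>i\<in>I. u i \<otimes>\<^bsub>A i\<^esub> v i) (\<lambda>i\<in>I. \<one>\<^bsub>A i\<^esub>)"
  by (simp add: tuple_alg_def monoid_alg_def)

locale tensor_family =
  fixes I :: "'i set" and A :: "'i \<Rightarrow> ('k::field, 'a) module"
  assumes finite_index: "finite I" and factor: "i \<in> I \<Longrightarrow> kalg (A i)"
begin

abbreviation "U \<equiv> \<Pi>\<^sub>E i\<in>I. carrier (A i)"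
abbreviation "T \<equiv> tensor_alg I A"
abbreviation "pure \<equiv> pure_tensor I A"

lemma U_mem: "u \<in> U \<Longrightarrow> i \<in> I \<Longrightarrow> u i \<in> carrier (A i)"
  by auto

lemma carrier_monoid_tuple: "carrier_monoid U (\<lambda>u v. \<lambda>i\<in>I. u i \<otimes>\<^bsub>A i\<^esub> v i) (\<lambda>i\<in>I. \<one>\<^bsub>A i\<^esub>)"
proof -
  have m: "monoid (A i)" if "i \<in> I" for i using factor[OF that] kalg.axioms(1) ring.is_monoid by blast
  show ?thesis
    by unfold_locales
       (auto simp: m monoid.m_closed monoid.one_closed monoid.m_assoc U_mem fun_eq_iff restrict_def
          PiE_arb[of _ I "\<lambda>i. carrier (A i)"] monoid.l_one monoid.r_one)
qed

lemma kalg_tuple: "kalg (tuple_alg I A)"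
  unfolding tuple_alg_eq by (rule carrier_monoid.kalg_monoid_alg[OF carrier_monoid_tuple])

lemma tuple_simps [simp]:
  "carrier (tuple_alg I A) = {p. Poly_Mapping.keys p \<subseteq> U}"
  "\<zero>\<^bsub>tuple_alg I A\<^esub> = 0" "p \<oplus>\<^bsub>tuple_alg I A\<^esub> q = p + q"
  "c \<odot>\<^bsub>tuple_alg I A\<^esub> p = Poly_Mapping.map ((*) c) p"
  by (simp_all add: tuple_alg_eq)

lemma upd_in_U: "u \<in> U \<Longrightarrow> i \<in> I \<Longrightarrow> y \<in> carrier (A i) \<Longrightarrow> u(i := y) \<in> U"
  by (auto simp: PiE_iff extensional_def)

lemma keys_diff_U:
  "Poly_Mapping.keys p \<subseteq> U \<Longrightarrow> Poly_Mapping.keys q \<subseteq> U \<Longrightarrow> Poly_Mapping.keys (p - q :: _ \<Rightarrow>\<^sub>0 'k) \<subseteq> U"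
  "Poly_Mapping.keys p \<subseteq> U \<Longrightarrow> Poly_Mapping.keys q \<subseteq> U \<Longrightarrow> Poly_Mapping.keys (p + q :: _ \<Rightarrow>\<^sub>0 'k) \<subseteq> U"
proof -
  have "x \<in> Poly_Mapping.keys p \<or> x \<in> Poly_Mapping.keys q" if "x \<in> Poly_Mapping.keys (p - q)" for x
    using that by (auto simp: in_keys_iff lookup_minus)
  then show "Poly_Mapping.keys p \<subseteq> U \<Longrightarrow> Poly_Mapping.keys q \<subseteq> U \<Longrightarrow> Poly_Mapping.keys (p - q) \<subseteq> U"
    by (meson subset_iff)
  show "Poly_Mapping.keys p \<subseteq> U \<Longrightarrow> Poly_Mapping.keys q \<subseteq> U \<Longrightarrow> Poly_Mapping.keys (p + q) \<subseteq> U"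
    using keys_add[of p q] by (meson Un_subset_iff subset_trans)
qed

lemma single_in_tuple: "u \<in> U \<Longrightarrow> Poly_Mapping.keys (Poly_Mapping.single u (c::'k)) \<subseteq> U"
  by simp

lemma multilinear_cases:
  assumes "x \<in> multilinear_rels I A"
  obtains u i y z where "u \<in> U" "i \<in> I" "y \<in> carrier (A i)" "z \<in> carrier (A i)"
      "x = Poly_Mapping.single (u(i := y \<oplus>\<^bsub>A i\<^esub> z)) 1
        - (Poly_Mapping.single (u(i := y)) 1 + Poly_Mapping.single (u(i := z)) 1)"
  | u i y c where "u \<in> U" "i \<in> I" "y \<in> carrier (A i)"
      "x = Poly_Mapping.single (u(i := c \<odot>\<^bsub>A i\<^esub> y)) 1 - Poly_Mapping.single (u(i := y)) c"
  using assms unfolding multilinear_rels_def by blast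

lemma factor_closed:
  "i \<in> I \<Longrightarrow> y \<in> carrier (A i) \<Longrightarrow> z \<in> carrier (A i) \<Longrightarrow> y \<oplus>\<^bsub>A i\<^esub> z \<in> carrier (A i)"
  "i \<in> I \<Longrightarrow> y \<in> carrier (A i) \<Longrightarrow> z \<in> carrier (A i) \<Longrightarrow> y \<otimes>\<^bsub>A i\<^esub> z \<in> carrier (A i)"
  "i \<in> I \<Longrightarrow> y \<in> carrier (A i) \<Longrightarrow> c \<odot>\<^bsub>A i\<^esub> y \<in> carrier (A i)"
  "i \<in> I \<Longrightarrow> \<one>\<^bsub>A i\<^esub> \<in> carrier (A i)"
  using kalg.smult_closed[OF factor, of i y c] abelian_monoid.a_closed[of "A i" y z]
    monoid.m_closed[of "A i" y z] monoid.one_closed[of "A i"] factor[of i]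
    kalg.axioms(1)[of "A i"] ring.is_monoid[of "A i"] ring.is_abelian_group[of "A i"]
    abelian_group.axioms(1)[of "A i"] by auto

lemma multilinear_rels_closed: "multilinear_rels I A \<subseteq> carrier (tuple_alg I A)"
proof
  fix x assume "x \<in> multilinear_rels I A"
  then show "x \<in> carrier (tuple_alg I A)"
  proof (cases rule: multilinear_cases)
    case (1 u i y z)
    have "Poly_Mapping.keys x \<subseteq> U" unfolding 1(5)
      by (intro keys_diff_U single_in_tuple upd_in_U factor_closed 1)
    then show ?thesis by simp
  next
    case (2 u i y c)
    have "Poly_Mapping.keys x \<subseteq> U" unfolding 2(4)
      by (intro keys_diff_U single_in_tuple upd_in_U factor_closed 2)
    then show ?thesis by simp
  qed
qed

lemma tensor_kalg_ideal: "kalg_ideal (tuple_alg I A) (tensor_ideal I A)"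
proof -
  interpret kalg "tuple_alg I A" by (rule kalg_tuple)
  show ?thesis unfolding tensor_ideal_def
    by (intro kalg_ideal.intro kalg_tuple genideal_ideal[OF multilinear_rels_closed])
qed

sublocale Q: kalg_ideal "tuple_alg I A" "tensor_ideal I A"
  by (rule tensor_kalg_ideal)

abbreviation "proj \<equiv> quot_proj (tuple_alg I A) (tensor_ideal I A)"

lemma kalg_tensor: "kalg T"
  unfolding tensor_alg_def by (rule Q.kalg_quot)

sublocale T: kalg T by (rule kalg_tensor)

lemma proj_hom: "proj \<in> alg_hom (tuple_alg I A) T"
  unfolding tensor_alg_def by (rule Q.quot_proj_hom)

lemma pure_eq_proj:
  assumes "\<And>i. i \<in> I \<Longrightarrow> u i \<in> carrier (A i)"
  shows "pure u = proj (Poly_Mapping.single (restrict u I) 1)"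
  using assms by (simp add: pure_tensor_def quot_proj_def)

lemma pure_cong: "(\<And>i. i \<in> I \<Longrightarrow> u i = v i) \<Longrightarrow> pure u = pure v"
  unfolding pure_tensor_def by (metis restrict_ext)

lemma pure_closed [intro]:
  assumes "\<And>i. i \<in> I \<Longrightarrow> u i \<in> carrier (A i)"
  shows "pure u \<in> carrier T"
  using alg_homD(1)[OF proj_hom, of "Poly_Mapping.single (restrict u I) 1"] assms by (simp add: pure_eq_proj)

lemma pure_one: "pure (\<lambda>i. \<one>\<^bsub>A i\<^esub>) = \<one>\<^bsub>T\<^esub>"
proof -
  have "proj (\<one>\<^bsub>tuple_alg I A\<^esub>) = \<one>\<^bsub>T\<^esub>" using alg_homD(5)[OF proj_hom] .
  then show ?thesis by (simp add: pure_eq_proj factor_closed tuple_alg_eq)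
qed

lemma pure_mult:
  assumes "\<And>i. i \<in> I \<Longrightarrow> u i \<in> carrier (A i)" "\<And>i. i \<in> I \<Longrightarrow> v i \<in> carrier (A i)"
  shows "pure u \<otimes>\<^bsub>T\<^esub> pure v = pure (\<lambda>i. u i \<otimes>\<^bsub>A i\<^esub> v i)"
proof -
  let ?s = "\<lambda>u. Poly_Mapping.single (restrict u I) (1::'k)"
  have "pure u \<otimes>\<^bsub>T\<^esub> pure v = proj (?s u \<otimes>\<^bsub>tuple_alg I A\<^esub> ?s v)"
    using assms by (simp add: pure_eq_proj alg_homD(4)[OF proj_hom])
  also have "?s u \<otimes>\<^bsub>tuple_alg I A\<^esub> ?s v = Poly_Mapping.single (\<lambda>i\<in>I. restrict u I i \<otimes>\<^bsub>A i\<^esub> restrict v I i) 1"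
    by (simp add: tuple_alg_eq)
  also have "(\<lambda>i\<in>I. restrict u I i \<otimes>\<^bsub>A i\<^esub> restrict v I i) = (\<lambda>i\<in>I. u i \<otimes>\<^bsub>A i\<^esub> v i)" by auto
  finally show ?thesis using pure_eq_proj[of "\<lambda>i. u i \<otimes>\<^bsub>A i\<^esub> v i"] assms by (simp only: factor_closed)
qed

lemma proj_diff:
  assumes "p - q \<in> multilinear_rels I A" "Poly_Mapping.keys p \<subseteq> U" "Poly_Mapping.keys q \<subseteq> U"
  shows "proj p = proj q"
proof -
  have c: "p \<in> carrier (tuple_alg I A)" "q \<in> carrier (tuple_alg I A)" using assms by auto
  have "\<ominus>\<^bsub>tuple_alg I A\<^esub> q = - q"
  proof (rule Q.minus_equality)
    show "- q \<in> carrier (tuple_alg I A)" using assms(3) keys_diff_U(1)[of 0 q] by simp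
  qed (use assms in simp_all)
  then have "p \<ominus>\<^bsub>tuple_alg I A\<^esub> q = p - q" by (simp add: Q.minus_eq)
  moreover have "p - q \<in> tensor_ideal I A"
    unfolding tensor_ideal_def using Q.genideal_self[OF multilinear_rels_closed] assms(1) by auto
  ultimately show ?thesis using Q.quot_proj_eq_iff[OF c] by simp
qed

lemma pure_add:
  assumes u: "\<And>i. i \<in> I \<Longrightarrow> u i \<in> carrier (A i)" and i: "i \<in> I" "y \<in> carrier (A i)" "z \<in> carrier (A i)"
  shows "pure (u(i := y \<oplus>\<^bsub>A i\<^esub> z)) = pure (u(i := y)) \<oplus>\<^bsub>T\<^esub> pure (u(i := z))"
proof -
  have r: "restrict (u(i := x)) I = (restrict u I)(i := x)" for x using i by auto
  have U: "restrict u I \<in> U" using u by auto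
  have p: "pure (u(i := x)) = proj (Poly_Mapping.single ((restrict u I)(i := x)) 1)" if "x \<in> carrier (A i)" for x
    using that u by (subst pure_eq_proj) (auto simp: r)
  have "proj (Poly_Mapping.single ((restrict u I)(i := y \<oplus>\<^bsub>A i\<^esub> z)) 1) =
    proj (Poly_Mapping.single ((restrict u I)(i := y)) 1 + Poly_Mapping.single ((restrict u I)(i := z)) 1)"
  proof (rule proj_diff)
    show "Poly_Mapping.single ((restrict u I)(i := y \<oplus>\<^bsub>A i\<^esub> z)) 1 - (Poly_Mapping.single ((restrict u I)(i := y)) 1 + Poly_Mapping.single ((restrict u I)(i := z)) 1) \<in> multilinear_rels I A"
      unfolding multilinear_rels_def using U i by blast
  qed (intro keys_diff_U single_in_tuple upd_in_U factor_closed i U)+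
  also have "\<dots> = proj (Poly_Mapping.single ((restrict u I)(i := y)) 1) \<oplus>\<^bsub>T\<^esub> proj (Poly_Mapping.single ((restrict u I)(i := z)) 1)"
    using alg_homD(2)[OF proj_hom, of "Poly_Mapping.single ((restrict u I)(i := y)) 1" "Poly_Mapping.single ((restrict u I)(i := z)) 1"]
      upd_in_U[OF U i(1)] i by simp
  finally show ?thesis using i by (simp add: p factor_closed)
qed

lemma pure_smult:
  assumes u: "\<And>i. i \<in> I \<Longrightarrow> u i \<in> carrier (A i)" and i: "i \<in> I" "y \<in> carrier (A i)"
  shows "pure (u(i := c \<odot>\<^bsub>A i\<^esub> y)) = c \<odot>\<^bsub>T\<^esub> pure (u(i := y))"
proof -
  have r: "restrict (u(i := x)) I = (restrict u I)(i := x)" for x using i by auto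
  have U: "restrict u I \<in> U" using u by auto
  have p: "pure (u(i := x)) = proj (Poly_Mapping.single ((restrict u I)(i := x)) 1)" if "x \<in> carrier (A i)" for x
    using that u by (subst pure_eq_proj) (auto simp: r)
  have "proj (Poly_Mapping.single ((restrict u I)(i := c \<odot>\<^bsub>A i\<^esub> y)) 1) = proj (Poly_Mapping.single ((restrict u I)(i := y)) c)"
  proof (rule proj_diff)
    show "Poly_Mapping.single ((restrict u I)(i := c \<odot>\<^bsub>A i\<^esub> y)) 1 - Poly_Mapping.single ((restrict u I)(i := y)) c \<in> multilinear_rels I A"
      unfolding multilinear_rels_def using U i by blast
  qed (intro single_in_tuple upd_in_U factor_closed i U)+
  also have "\<dots> = c \<odot>\<^bsub>T\<^esub> proj (Poly_Mapping.single ((restrict u I)(i := y)) 1)"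
    using alg_homD(3)[OF proj_hom, of "Poly_Mapping.single ((restrict u I)(i := y)) 1" c]
      upd_in_U[OF U i] by simp
  finally show ?thesis using i by (simp add: p factor_closed)
qed

text \<open>The canonical algebra map of a factor into the tensor product. Through these maps
  arguments on multilinear expressions become arguments on homomorphisms.\<close>

definition emb :: "'i \<Rightarrow> 'a \<Rightarrow> (('i \<Rightarrow> 'a) \<Rightarrow>\<^sub>0 'k) set" where
  "emb i y = pure (\<lambda>j. if j = i then y else \<one>\<^bsub>A j\<^esub>)"

lemma emb_upd: "emb i y = pure ((\<lambda>j. \<one>\<^bsub>A j\<^esub>)(i := y))"
  by (simp add: emb_def fun_upd_def)

lemma emb_hom: "i \<in> I \<Longrightarrow> restrict (emb i) (carrier (A i)) \<in> alg_hom (A i) T"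
proof (rule alg_homI)
  assume i: "i \<in> I"
  show "restrict (emb i) (carrier (A i)) \<in> carrier (A i) \<rightarrow>\<^sub>E carrier T"
    by (auto simp: emb_def factor_closed intro!: pure_closed)
  show "restrict (emb i) (carrier (A i)) (y \<oplus>\<^bsub>A i\<^esub> z) = restrict (emb i) (carrier (A i)) y \<oplus>\<^bsub>T\<^esub> restrict (emb i) (carrier (A i)) z"
    if "y \<in> carrier (A i)" "z \<in> carrier (A i)" for y z
    using that i pure_add[of "\<lambda>j. \<one>\<^bsub>A j\<^esub>" i y z] by (simp add: emb_upd factor_closed)
  show "restrict (emb i) (carrier (A i)) (c \<odot>\<^bsub>A i\<^esub> y) = c \<odot>\<^bsub>T\<^esub> restrict (emb i) (carrier (A i)) y"
    if "y \<in> carrier (A i)" for y c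
    using that i pure_smult[of "\<lambda>j. \<one>\<^bsub>A j\<^esub>" i y c] by (simp add: emb_upd factor_closed)
  have m: "monoid (A i)" if "i \<in> I" for i using factor[OF that] kalg.axioms(1) ring.is_monoid by blast
  show "restrict (emb i) (carrier (A i)) (y \<otimes>\<^bsub>A i\<^esub> z) = restrict (emb i) (carrier (A i)) y \<otimes>\<^bsub>T\<^esub> restrict (emb i) (carrier (A i)) z"
    if "y \<in> carrier (A i)" "z \<in> carrier (A i)" for y z
    using that i
    by (simp add: emb_def factor_closed)
       (subst pure_mult; auto simp: factor_closed monoid.l_one[OF m] intro!: pure_cong)
  show "restrict (emb i) (carrier (A i)) \<one>\<^bsub>A i\<^esub> = \<one>\<^bsub>T\<^esub>"
    using i by (simp add: factor_closed emb_def pure_one[symmetric]) (rule pure_cong, simp)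
qed

lemmas emb_simps = alg_homD[OF emb_hom]

lemma emb_closed: "i \<in> I \<Longrightarrow> y \<in> carrier (A i) \<Longrightarrow> emb i y \<in> carrier T"
  using emb_simps(1)[of i y] by simp

lemma emb_commute:
  assumes "i \<in> I" "j \<in> I" "i \<noteq> j" "y \<in> carrier (A i)" "z \<in> carrier (A j)"
  shows "emb i y \<otimes>\<^bsub>T\<^esub> emb j z = emb j z \<otimes>\<^bsub>T\<^esub> emb i y"
proof -
  have m: "monoid (A i)" if "i \<in> I" for i using factor[OF that] kalg.axioms(1) ring.is_monoid by blast
  show ?thesis unfolding emb_def
    by (subst pure_mult; (subst pure_mult)?)
       (use assms in \<open>auto simp: factor_closed monoid.l_one[OF m] monoid.r_one[OF m] intro!: pure_cong\<close>)
qed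

text \<open>Exhibits pure tensors as products of embedded elements, from which it follows that the
  embedded factors generate the tensor product.\<close>

lemma list_prod_emb:
  assumes "distinct is" "set is \<subseteq> I" "\<And>i. i \<in> I \<Longrightarrow> u i \<in> carrier (A i)"
  shows "list_prod T (map (\<lambda>i. emb i (u i)) is) = pure (\<lambda>j. if j \<in> set is then u j else \<one>\<^bsub>A j\<^esub>)"
  using assms(1,2)
proof (induction "is")
  case (Cons i "is")
  have m: "monoid (A i)" if "i \<in> I" for i using factor[OF that] kalg.axioms(1) ring.is_monoid by blast
  have "list_prod T (map (\<lambda>i. emb i (u i)) (i # is)) = emb i (u i) \<otimes>\<^bsub>T\<^esub> pure (\<lambda>j. if j \<in> set is then u j else \<one>\<^bsub>A j\<^esub>)"
    using Cons by simp
  also have "\<dots> = pure (\<lambda>j. if j \<in> set (i # is) then u j else \<one>\<^bsub>A j\<^esub>)"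
    unfolding emb_def using Cons.prems assms(3)
    by (subst pure_mult) (auto simp: factor_closed monoid.l_one[OF m] monoid.r_one[OF m] intro!: pure_cong)
  finally show ?case .
qed (simp add: pure_one)

lemma tensor_generated: "carrier T = gen_subalg T (\<Union>i\<in>I. emb i ` carrier (A i))"
proof
  let ?S = "\<Union>i\<in>I. emb i ` carrier (A i)"
  show "gen_subalg T ?S \<subseteq> carrier T"
    by (rule gen_subalg_subset[OF kalg_tensor]) (auto intro: emb_closed)
  obtain "is" where d: "distinct is" "set is = I" using finite_distinct_list[OF finite_index] by blast
  have p: "pure u \<in> gen_subalg T ?S" if u: "u \<in> U" for u
  proof -
    have e: "list_prod T (map (\<lambda>i. emb i (u i)) is) = pure u"
      using u d(1) by (subst list_prod_emb) (simp_all add: d(2) U_mem cong: pure_cong)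
    have "set (map (\<lambda>i. emb i (u i)) is) \<subseteq> gen_subalg T ?S"
      using u d by (auto intro!: gen_subalg.gen_incl)
    from T.gen_subalg_list_prod[OF this] show ?thesis unfolding e .
  qed
  show "carrier T \<subseteq> gen_subalg T ?S"
  proof
    fix X assume "X \<in> carrier T"
    then obtain x where x: "Poly_Mapping.keys x \<subseteq> U" "X = proj x"
      unfolding tensor_alg_def Q.carrier_quot by auto
    have "proj x \<in> gen_subalg T ?S" using x(1)
    proof (induction rule: poly_mapping_single_induct)
      case zero
      have e: "proj 0 = 0 \<odot>\<^bsub>T\<^esub> \<one>\<^bsub>T\<^esub>" using linear_maps_zero[OF kalg_tuple kalg_tensor alg_homD(7)[OF proj_hom]] by simp
      show ?case unfolding e by (intro gen_subalg.gen_one gen_subalg.gen_smult)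
    next
      case (single u c q)
      have ru: "restrict u I = u" using single(1) by (rule PiE_restrict)
      have 1: "proj (Poly_Mapping.single u c) = c \<odot>\<^bsub>T\<^esub> pure u"
        using alg_homD(3)[OF proj_hom, of "Poly_Mapping.single u 1" c] single(1) ru
        by (subst pure_eq_proj) auto
      have 2: "proj (Poly_Mapping.single u c + q) = proj (Poly_Mapping.single u c) \<oplus>\<^bsub>T\<^esub> proj q"
        using alg_homD(2)[OF proj_hom, of "Poly_Mapping.single u c" q] single(1,2) by simp
      from p[OF single(1)] show ?case unfolding 1 2 using single(3)
        by (intro gen_subalg.gen_add gen_subalg.gen_smult)
    qed
    then show "X \<in> gen_subalg T ?S" using x by simp
  qed
qed

text \<open>Universal property of the tensor product of algebras. The product of the
  \<open>\<psi> i (u i)\<close> in a fixed order of the indices is multiplicative in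
  \<open>u\<close> since different factors commute. As a function of the entry \<open>y\<close> in
  slot \<open>i\<close> it has the shape \<open>P \<otimes> (\<psi> i y \<otimes> Q)\<close> with
  \<open>P\<close> and \<open>Q\<close> independent of \<open>y\<close>, so it respects the
  multilinearity relations.\<close>

lemma tensor_hom_exists:
  assumes B: "kalg B" and \<psi>: "\<And>i. i \<in> I \<Longrightarrow> \<psi> i \<in> alg_hom (A i) B"
    and comm: "\<And>i j y z. i \<in> I \<Longrightarrow> j \<in> I \<Longrightarrow> i \<noteq> j \<Longrightarrow> y \<in> carrier (A i) \<Longrightarrow> z \<in> carrier (A j) \<Longrightarrow>
        \<psi> i y \<otimes>\<^bsub>B\<^esub> \<psi> j z = \<psi> j z \<otimes>\<^bsub>B\<^esub> \<psi> i y"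
  shows "\<exists>h \<in> alg_hom T B. \<forall>i\<in>I. \<forall>y\<in>carrier (A i). h (emb i y) = \<psi> i y"
proof -
  interpret B: kalg B by fact
  obtain "is" where d: "distinct is" "set is = I" using finite_distinct_list[OF finite_index] by blast
  define b where "b u = list_prod B (map (\<lambda>i. \<psi> i (u i)) is)" for u
  have \<psi>c: "\<psi> i (u i) \<in> carrier B" if "u \<in> U" "i \<in> I" for u i
    using alg_homD(1)[OF \<psi>[OF that(2)]] that by auto
  have bc: "b u \<in> carrier B" if "u \<in> U" for u
    unfolding b_def using \<psi>c that d by (intro B.list_prod_closed) auto
  have split: "\<exists>P Q. P \<in> carrier B \<and> Q \<in> carrier B \<and> (\<forall>y\<in>carrier (A i). b (u(i := y)) = P \<otimes>\<^bsub>B\<^esub> (\<psi> i y \<otimes>\<^bsub>B\<^esub> Q))"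
    if u: "u \<in> U" and i: "i \<in> I" for u i
  proof -
    obtain xs ys where s: "is = xs @ i # ys" using i d by (metis split_list)
    have ni: "i \<notin> set xs" "i \<notin> set ys" and xy: "set xs \<subseteq> I" "set ys \<subseteq> I" using s d by auto
    have m: "map (\<lambda>j. \<psi> j ((u(i := y)) j)) xs = map (\<lambda>j. \<psi> j (u j)) xs"
      "map (\<lambda>j. \<psi> j ((u(i := y)) j)) ys = map (\<lambda>j. \<psi> j (u j)) ys" for y
      using ni by auto
    have c: "set (map (\<lambda>j. \<psi> j (u j)) xs) \<subseteq> carrier B" "set (map (\<lambda>j. \<psi> j (u j)) ys) \<subseteq> carrier B"
      using \<psi>c[OF u] xy by auto
    have "b (u(i := y)) = list_prod B (map (\<lambda>j. \<psi> j (u j)) xs) \<otimes>\<^bsub>B\<^esub> (\<psi> i y \<otimes>\<^bsub>B\<^esub> list_prod B (map (\<lambda>j. \<psi> j (u j)) ys))"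
      if y: "y \<in> carrier (A i)" for y
    proof -
      have yc: "\<psi> i y \<in> carrier B" using alg_homD(1)[OF \<psi>[OF i]] y by auto
      have "map (\<lambda>j. \<psi> j ((u(i := y)) j)) is = map (\<lambda>j. \<psi> j (u j)) xs @ \<psi> i y # map (\<lambda>j. \<psi> j (u j)) ys"
        unfolding s using m by simp
      then show ?thesis unfolding b_def
        using c yc by (subst \<open>map _ is = _\<close>, subst B.list_prod_append) auto
    qed
    then show ?thesis using B.list_prod_closed[OF c(1)] B.list_prod_closed[OF c(2)] by blast
  qed
  have "\<exists>h \<in> alg_hom (tuple_alg I A) B. \<forall>u\<in>U. h (Poly_Mapping.single u 1) = b u"
    unfolding tuple_alg_eq
  proof (rule carrier_monoid.monoid_alg_hom_exists[OF carrier_monoid_tuple B bc])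
    show "b (\<lambda>i\<in>I. \<one>\<^bsub>A i\<^esub>) = \<one>\<^bsub>B\<^esub>"
    proof -
      have "list_prod B (map (\<lambda>i. \<psi> i ((\<lambda>i\<in>I. \<one>\<^bsub>A i\<^esub>) i)) js) = \<one>\<^bsub>B\<^esub>" if "set js \<subseteq> I" for js
        using that by (induction js) (auto simp: alg_homD(5)[OF \<psi>])
      then show ?thesis unfolding b_def using d by simp
    qed
    show "b (\<lambda>i\<in>I. u i \<otimes>\<^bsub>A i\<^esub> v i) = b u \<otimes>\<^bsub>B\<^esub> b v" if uv: "u \<in> U" "v \<in> U" for u v
    proof -
      have "map (\<lambda>i. \<psi> i ((\<lambda>i\<in>I. u i \<otimes>\<^bsub>A i\<^esub> v i) i)) is = map (\<lambda>i. \<psi> i (u i) \<otimes>\<^bsub>B\<^esub> \<psi> i (v i)) is"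
        using uv alg_homD(4)[OF \<psi>] by (simp add: d(2) U_mem)
      then show ?thesis unfolding b_def
        using d uv \<psi>c by (simp only:) (rule B.list_prod_mult_distrib; auto intro!: comm simp: U_mem)
    qed
  qed
  then obtain h where h: "h \<in> alg_hom (tuple_alg I A) B" "\<And>u. u \<in> U \<Longrightarrow> h (Poly_Mapping.single u 1) = b u" by blast
  have hs: "h (Poly_Mapping.single u c) = c \<odot>\<^bsub>B\<^esub> b u" if "u \<in> U" for u c
    using alg_homD(3)[OF h(1), of "Poly_Mapping.single u 1" c] that h(2) by simp
  have hd: "h (p - q) = \<zero>\<^bsub>B\<^esub>" if "h p = h q" "Poly_Mapping.keys p \<subseteq> U" "Poly_Mapping.keys q \<subseteq> U" for p q
  proof -
    have c: "Poly_Mapping.keys (p - q) \<subseteq> U" using keys_diff_U(1) that by blast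
    have "h p = h (p - q) \<oplus>\<^bsub>B\<^esub> h q"
      using alg_homD(2)[OF h(1), of "p - q" q] c that by simp
    moreover have "h (p - q) \<in> carrier B" "h q \<in> carrier B" using alg_homD(1)[OF h(1)] c that by auto
    ultimately show ?thesis using that(1) by (metis B.add.r_cancel_one)
  qed
  have "h x = \<zero>\<^bsub>B\<^esub>" if "x \<in> tensor_ideal I A" for x
  proof (rule hom_vanishes_on_genideal[OF kalg_tuple B h(1) multilinear_rels_closed _ that[unfolded tensor_ideal_def]])
    fix x assume "x \<in> multilinear_rels I A"
    then show "h x = \<zero>\<^bsub>B\<^esub>"
    proof (cases rule: multilinear_cases)
      case (1 u i y z)
      note U = upd_in_U[OF 1(1,2)]
      note yz = factor_closed(1)[OF 1(2-4)]
      obtain P Q where PQ: "P \<in> carrier B" "Q \<in> carrier B" "\<forall>y\<in>carrier (A i). b (u(i := y)) = P \<otimes>\<^bsub>B\<^esub> (\<psi> i y \<otimes>\<^bsub>B\<^esub> Q)"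
        using split[OF 1(1,2)] by blast
      note \<psi>i = alg_homD[OF \<psi>[OF 1(2)]]
      show ?thesis unfolding 1(5)
      proof (rule hd)
        have "h (Poly_Mapping.single (u(i := y)) 1 + Poly_Mapping.single (u(i := z)) 1) = b (u(i := y)) \<oplus>\<^bsub>B\<^esub> b (u(i := z))"
          using alg_homD(2)[OF h(1), of "Poly_Mapping.single (u(i := y)) 1" "Poly_Mapping.single (u(i := z)) 1"]
            U[OF 1(3)] U[OF 1(4)] h(2) by simp
        also have "\<dots> = b (u(i := y \<oplus>\<^bsub>A i\<^esub> z))"
          using PQ 1(3,4) yz \<psi>i(1,2) by (simp add: B.r_distr B.l_distr)
        finally show "h (Poly_Mapping.single (u(i := y \<oplus>\<^bsub>A i\<^esub> z)) 1) =
           h (Poly_Mapping.single (u(i := y)) 1 + Poly_Mapping.single (u(i := z)) 1)"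
          using h(2) U[OF yz] by simp
      qed (intro keys_diff_U single_in_tuple U yz 1)+
    next
      case (2 u i y c)
      note U = upd_in_U[OF 2(1,2)]
      note cy = factor_closed(3)[OF 2(2,3)]
      obtain P Q where PQ: "P \<in> carrier B" "Q \<in> carrier B" "\<forall>y\<in>carrier (A i). b (u(i := y)) = P \<otimes>\<^bsub>B\<^esub> (\<psi> i y \<otimes>\<^bsub>B\<^esub> Q)"
        using split[OF 2(1,2)] by blast
      note \<psi>i = alg_homD[OF \<psi>[OF 2(2)]]
      show ?thesis unfolding 2(4)
      proof (rule hd)
        show "h (Poly_Mapping.single (u(i := c \<odot>\<^bsub>A i\<^esub> y)) 1) = h (Poly_Mapping.single (u(i := y)) c)"
          using PQ 2(3) cy \<psi>i(1,3) hs[OF U[OF 2(3)]] h(2)[OF U[OF cy]]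
          by (simp add: B.smult_mult_l B.smult_mult_r)
      qed (intro keys_diff_U single_in_tuple U cy 2)+
    qed
  qed
  from Q.quot_hom_exists[OF B h(1) this]
  obtain k where k: "k \<in> alg_hom T B" "\<forall>x\<in>carrier (tuple_alg I A). k (proj x) = h x"
    unfolding tensor_alg_def by blast
  have "k (emb i y) = \<psi> i y" if iy: "i \<in> I" "y \<in> carrier (A i)" for i y
  proof -
    let ?u = "\<lambda>j\<in>I. if j = i then y else \<one>\<^bsub>A j\<^esub>"
    have U: "?u \<in> U" using iy by (auto simp: factor_closed)
    have "emb i y = proj (Poly_Mapping.single ?u 1)"
      unfolding emb_def using iy by (subst pure_eq_proj) (auto simp: factor_closed)
    then have "k (emb i y) = h (Poly_Mapping.single ?u 1)" using k(2)[THEN bspec, of "Poly_Mapping.single ?u 1"] U by simp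
    also have "\<dots> = b ?u" using h(2)[OF U] .
    also have "\<dots> = \<psi> i y"
    proof -
      have c: "\<psi> i y \<in> carrier B" using alg_homD(1)[OF \<psi>] iy by blast
      have "list_prod B (map (\<lambda>j. \<psi> j (?u j)) js) = (if i \<in> set js then \<psi> i y else \<one>\<^bsub>B\<^esub>)"
        if "distinct js" "set js \<subseteq> I" for js
        using that c by (induction js) (auto simp: alg_homD(5)[OF \<psi>])
      from this[OF d(1)] show ?thesis unfolding b_def using d iy by simp
    qed
    finally show ?thesis .
  qed
  with k(1) show ?thesis by blast
qed

end

section \<open>Permutations, reduced words and standardization\<close>

abbreviation pinv :: "(nat \<Rightarrow> nat) \<Rightarrow> nat \<Rightarrow> nat" where
  "pinv \<equiv> inv_into UNIV"

lemma simple_refl_permutes: "i \<in> {1..<n} \<Longrightarrow> simple_refl i permutes {1..n}"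
  by (rule permutes_swap_id) auto

lemma simple_refl_comp_self [simp]: "simple_refl i \<circ> simple_refl i = id" "simple_refl i \<circ> (simple_refl i \<circ> w) = w"
  by (simp_all add: fun_eq_iff)

lemma word_perm_simps [simp]:
  "word_perm [] = id" "word_perm (i # is) = simple_refl i \<circ> word_perm is"
  by (simp_all add: word_perm_def)

lemma word_perm_append: "word_perm (xs @ ys) = word_perm xs \<circ> word_perm ys"
  by (induction xs) (simp_all add: comp_assoc)

lemma word_perm_permutes: "set is \<subseteq> {1..<n} \<Longrightarrow> word_perm is permutes {1..n}"
proof (induction "is")
  case (Cons i "is")
  then have "word_perm is permutes {1..n}" "i \<in> {1..<n}" by auto
  then show ?case using permutes_compose simple_refl_permutes by (metis word_perm_simps(2))
qed (simp add: permutes_id)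

section \<open>Inversions, length and reduced words\<close>

definition invs :: "nat \<Rightarrow> (nat \<Rightarrow> nat) \<Rightarrow> (nat \<times> nat) set" where
  "invs n w = {(i, j). 1 \<le> i \<and> i < j \<and> j \<le> n \<and> w j < w i}"

lemma finite_invs [simp]: "finite (invs n w)"
  by (rule finite_subset[of _ "{1..n} \<times> {1..n}"]) (auto simp: invs_def)

lemma invs_id [simp]: "invs n id = {}" by (auto simp: invs_def)

lemma simple_refl_less:
  assumes "x \<noteq> y" "(x, y) \<noteq> (i, Suc i)" "(x, y) \<noteq> (Suc i, i)"
  shows "simple_refl i x < simple_refl i y \<longleftrightarrow> x < y"
  using assms by (auto simp: Transposition.transpose_def)

text \<open>Composing with the reflection on the left exchanges the values \<open>i\<close> and
  \<open>Suc i\<close>. These are adjacent numbers, so the relative order changes for no pair of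
  positions other than the one carrying them.\<close>

lemma invs_descent:
  assumes w: "w permutes {1..n}" and i: "i \<in> {1..<n}" and d: "pinv w (Suc i) < pinv w i"
  shows "invs n w = insert (pinv w (Suc i), pinv w i) (invs n (simple_refl i \<circ> w))"
    and "(pinv w (Suc i), pinv w i) \<notin> invs n (simple_refl i \<circ> w)"
proof -
  have wi: "w (pinv w x) = x" "pinv w (w x) = x" for x using permutes_inverses[OF w] by auto
  have r: "pinv w i \<in> {1..n}" "pinv w (Suc i) \<in> {1..n}"
    using i permutes_in_image[OF permutes_inv[OF w]] by auto
  show "(pinv w (Suc i), pinv w i) \<notin> invs n (simple_refl i \<circ> w)"
    by (simp add: invs_def wi)
  have "(a, b) \<in> invs n w \<longleftrightarrow> (a, b) = (pinv w (Suc i), pinv w i) \<or> (a, b) \<in> invs n (simple_refl i \<circ> w)" for a b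
  proof (cases "(w a, w b) \<in> {(i, Suc i), (Suc i, i)}")
    case True
    then have "a = pinv w i \<and> b = pinv w (Suc i) \<or> a = pinv w (Suc i) \<and> b = pinv w i"
      using wi(2)[of a] wi(2)[of b] by auto
    then show ?thesis
    proof (elim disjE conjE)
      assume "a = pinv w i" "b = pinv w (Suc i)"
      then show ?thesis using d by (simp add: invs_def)
    next
      assume "a = pinv w (Suc i)" "b = pinv w i"
      then show ?thesis using d r by (simp add: invs_def wi(1))
    qed
  next
    case False
    have ne: "w b \<noteq> w a" if "a < b" using that wi by (metis less_irrefl)
    have "(a, b) \<noteq> (pinv w (Suc i), pinv w i)" using False wi by auto
    moreover have "a < b \<Longrightarrow> simple_refl i (w b) < simple_refl i (w a) \<longleftrightarrow> w b < w a"
      using False ne by (intro simple_refl_less) auto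
    ultimately show ?thesis by (auto simp: invs_def)
  qed
  then show "invs n w = insert (pinv w (Suc i), pinv w i) (invs n (simple_refl i \<circ> w))" by auto
qed

lemma card_invs_descent:
  assumes "w permutes {1..n}" "i \<in> {1..<n}" "pinv w (Suc i) < pinv w i"
  shows "card (invs n w) = Suc (card (invs n (simple_refl i \<circ> w)))"
  using invs_descent[OF assms] by (metis card_insert_disjoint finite_invs)

lemma inv_simple_refl_comp:
  assumes "w permutes {1..n}"
  shows "pinv (simple_refl i \<circ> w) x = pinv w (simple_refl i x)"
proof -
  have "pinv (simple_refl i \<circ> w) = pinv w \<circ> pinv (simple_refl i)"
    using permutes_bij[OF assms] by (intro o_inv_distrib) auto
  then show ?thesis by simp
qed

lemma card_invs_step:
  assumes "w permutes {1..n}" "i \<in> {1..<n}"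
  shows "card (invs n (simple_refl i \<circ> w)) \<le> Suc (card (invs n w))"
proof (cases "pinv w (Suc i) < pinv w i")
  case True
  then show ?thesis using card_invs_descent[OF assms] by simp
next
  case False
  let ?v = "simple_refl i \<circ> w"
  have v: "?v permutes {1..n}" using assms by (intro permutes_compose simple_refl_permutes)
  have "pinv w i \<noteq> pinv w (Suc i)" using permutes_inj[OF permutes_inv[OF assms(1)]] by (metis injD n_not_Suc_n)
  then have "pinv ?v (Suc i) < pinv ?v i" using False by (simp add: inv_simple_refl_comp[OF assms(1)])
  then show ?thesis using card_invs_descent[OF v assms(2)] by simp
qed

lemma card_invs_word: "set is \<subseteq> {1..<n} \<Longrightarrow> card (invs n (word_perm is)) \<le> length is"
proof (induction "is")
  case (Cons i "is")
  then have "card (invs n (word_perm is)) \<le> length is" "word_perm is permutes {1..n}" "i \<in> {1..<n}"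
    using word_perm_permutes by auto
  then have "card (invs n (simple_refl i \<circ> word_perm is)) \<le> Suc (length is)"
    using card_invs_step[of "word_perm is" n i] by linarith
  then show ?case by (simp only: word_perm_simps list.size add_Suc_right add_0_right)
qed simp

text \<open>Counting from the left end gives \<open>i \<le> v i\<close>, counting from the right end
  gives the reverse inequality.\<close>

lemma strict_mono_interval_id:
  fixes v :: "nat \<Rightarrow> nat"
  assumes im: "v ` {a<..b} = {a<..b}" and mono: "\<And>i. a < i \<Longrightarrow> i < b \<Longrightarrow> v i < v (Suc i)" and i: "i \<in> {a<..b}"
  shows "v i = i"
proof -
  have lo: "i \<le> v i" if "i \<in> {a<..b}" for i
    using that
  proof (induction i)
    case (Suc i)
    show ?case
    proof (cases "a < i")
      case True
      then have "i \<le> v i" using Suc by simp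
      moreover have "v i < v (Suc i)" using True Suc.prems by (intro mono) auto
      ultimately show ?thesis by simp
    next
      case False
      have "v (Suc i) \<in> {a<..b}" using im Suc.prems by blast
      then show ?thesis using False Suc.prems by auto
    qed
  qed simp
  \<comment> \<open>The upper bound descends from the right end, so the induction runs over the
    distance \<open>d\<close> to \<open>b\<close>.\<close>
  have hi: "v (b - d) \<le> b - d" if "d < b - a" for d
    using that
  proof (induction d)
    case 0
    then have "v b \<in> {a<..b}" using im by force
    then show ?case by simp
  next
    case (Suc d)
    have "v (b - Suc d) < v (Suc (b - Suc d))" using Suc.prems by (intro mono) auto
    moreover have "Suc (b - Suc d) = b - d" using Suc.prems by simp
    ultimately show ?case using Suc by simp
  qed
  have "b - i < b - a" "b - (b - i) = i" using i by auto
  then have "v i \<le> i" using hi[of "b - i"] by simp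
  then show ?thesis using lo[OF i] by simp
qed

text \<open>Without a descent the inverse permutation would be increasing on \<open>{1..n}\<close>,
  hence the identity.\<close>

lemma permutes_descent_exists:
  assumes "w permutes {1..n}" "w \<noteq> id"
  shows "\<exists>i\<in>{1..<n}. pinv w (Suc i) < pinv w i"
proof (rule ccontr)
  assume no: "\<not> ?thesis"
  note iw = permutes_inv[OF assms(1)]
  have e: "{0<..n} = {1..n}" by auto
  have "pinv w i = i" if "i \<in> {1..n}" for i
  proof (rule strict_mono_interval_id[of "pinv w" 0 n])
    show "pinv w ` {0<..n} = {0<..n}" using permutes_image[OF iw] e by simp
    show "pinv w i < pinv w (Suc i)" if "0 < i" "i < n" for i
    proof -
      have "pinv w i \<noteq> pinv w (Suc i)" using permutes_inj[OF iw] by (metis injD n_not_Suc_n)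
      moreover have "\<not> pinv w (Suc i) < pinv w i" using no that by auto
      ultimately show ?thesis by simp
    qed
  qed (use that in auto)
  then have "pinv w = id" using permutes_not_in[OF iw] by (metis eq_id_iff)
  then show False using assms by (metis inv_id permutes_inv_inv)
qed

text \<open>Induction along a reduced word: every step puts a letter on the left that raises the
  number of inversions. The hypothesis \<open>pinv w i < pinv w (Suc i)\<close> records the increase
  and later forces the two exchanged colours to differ.\<close>

lemma permutes_ascent_induct [consumes 1, case_names id step]:
  assumes "w permutes {1..n}" and "P id"
    and "\<And>i w. i \<in> {1..<n} \<Longrightarrow> w permutes {1..n} \<Longrightarrow> pinv w i < pinv w (Suc i) \<Longrightarrow> P w \<Longrightarrow> P (simple_refl i \<circ> w)"
  shows "P w"
  using assms(1)
proof (induction "card (invs n w)" arbitrary: w rule: less_induct)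
  case less
  show ?case
  proof (cases "w = id")
    case False
    then obtain i where i: "i \<in> {1..<n}" "pinv w (Suc i) < pinv w i"
      using permutes_descent_exists less.prems by blast
    let ?v = "simple_refl i \<circ> w"
    have v: "?v permutes {1..n}" using i less.prems by (intro permutes_compose simple_refl_permutes)
    have "P ?v" using card_invs_descent[OF less.prems i] v by (intro less.hyps) auto
    moreover have "pinv ?v i < pinv ?v (Suc i)" using i by (simp add: inv_simple_refl_comp[OF less.prems])
    ultimately have "P (simple_refl i \<circ> ?v)" using assms(3) i v by blast
    then show ?thesis by simp
  qed (use assms(2) in simp)
qed

lemma reduced_word_exists:
  assumes "w permutes {1..n}"
  shows "\<exists>is\<in>perm_words n w. length is = card (invs n w)"
  using assms
proof (induction w rule: permutes_ascent_induct)
  case id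
  have "[] \<in> perm_words n id" by (simp add: perm_words_def)
  then show ?case by (rule bexI[rotated]) (simp only: invs_id list.size card.empty)
next
  case (step i w)
  then obtain "is" where "is": "is \<in> perm_words n w" "length is = card (invs n w)" by blast
  let ?v = "simple_refl i \<circ> w"
  have v: "?v permutes {1..n}" using step by (intro permutes_compose simple_refl_permutes)
  have "pinv ?v (Suc i) < pinv ?v i" using step(3) by (simp add: inv_simple_refl_comp[OF step(2)])
  then have "card (invs n ?v) = Suc (card (invs n w))" using card_invs_descent[OF v step(1)] by simp
  moreover have "i # is \<in> perm_words n (simple_refl i \<circ> w)"
    using "is"(1) step(1) by (simp add: perm_words_def)
  moreover have "length (i # is) = Suc (card (invs n w))" using "is"(2) by simp
  ultimately show ?case by metis
qed

text \<open>Each letter creates at most one inversion, and removing descents one at a time produces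
  a word that attains this bound.\<close>

lemma perm_length_eq: "w permutes {1..n} \<Longrightarrow> perm_length n w = card (invs n w)"
  unfolding perm_length_def
  by (rule Least_equality) (use reduced_word_exists card_invs_word in \<open>auto simp: perm_words_def\<close>)

subsection \<open>Words with the same permutation\<close>

text \<open>
  Invariance of \<open>F\<close> under the Coxeter moves is the only information about \<open>F\<close>; every word can be
  moved to the form \<open>u s\<^sub>m s\<^sub>m\<^sub>-\<^sub>1 \<cdots> s\<^sub>k\<close> with \<open>u\<close> a word in smaller letters, and the permutation determines \<open>k\<close>.
\<close>

locale coxeter_invariant =
  fixes n :: nat and F :: "nat list \<Rightarrow> 'b"
  assumes quad: "set u \<subseteq> {1..<n} \<Longrightarrow> set v \<subseteq> {1..<n} \<Longrightarrow> i \<in> {1..<n} \<Longrightarrow> F (u @ [i, i] @ v) = F (u @ v)"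
    and braid: "set u \<subseteq> {1..<n} \<Longrightarrow> set v \<subseteq> {1..<n} \<Longrightarrow> i \<in> {1..<n} \<Longrightarrow> Suc i \<in> {1..<n} \<Longrightarrow>
       F (u @ [i, Suc i, i] @ v) = F (u @ [Suc i, i, Suc i] @ v)"
    and far: "set u \<subseteq> {1..<n} \<Longrightarrow> set v \<subseteq> {1..<n} \<Longrightarrow> i \<in> {1..<n} \<Longrightarrow> j \<in> {1..<n} \<Longrightarrow> Suc i < j \<Longrightarrow>
       F (u @ [i, j] @ v) = F (u @ [j, i] @ v)"
begin

text \<open>Equality of \<open>F\<close> in every context, which makes the relation a congruence.
  The clause on \<open>word_perm\<close> keeps the permutation readable after a word has been
  replaced by its normal form.\<close>

definition E :: "nat list \<Rightarrow> nat list \<Rightarrow> bool" where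
  "E xs ys \<longleftrightarrow> word_perm xs = word_perm ys \<and>
     (\<forall>u v. set u \<subseteq> {1..<n} \<longrightarrow> set v \<subseteq> {1..<n} \<longrightarrow> F (u @ xs @ v) = F (u @ ys @ v))"

lemma E_refl [simp]: "E xs xs" by (simp add: E_def)
lemma E_sym: "E xs ys \<Longrightarrow> E ys xs" by (simp add: E_def)
lemma E_trans [trans]: "E xs ys \<Longrightarrow> E ys zs \<Longrightarrow> E xs zs" by (simp add: E_def)

lemma E_ctx:
  assumes "E xs ys" "set u \<subseteq> {1..<n}" "set v \<subseteq> {1..<n}"
  shows "E (u @ xs @ v) (u @ ys @ v)"
  unfolding E_def
proof (intro conjI allI impI)
  show "word_perm (u @ xs @ v) = word_perm (u @ ys @ v)" using assms(1) by (simp add: E_def word_perm_append)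
  fix u' v' assume "set u' \<subseteq> {1..<n}" "set v' \<subseteq> {1..<n}"
  then have "F ((u' @ u) @ xs @ (v @ v')) = F ((u' @ u) @ ys @ (v @ v'))"
    using assms unfolding E_def by (metis Un_least set_append)
  then show "F (u' @ (u @ xs @ v) @ v') = F (u' @ (u @ ys @ v) @ v')" by simp
qed

lemma E_quad: "i \<in> {1..<n} \<Longrightarrow> E [i, i] []"
  using quad by (simp add: E_def)

lemma E_braid: "i \<in> {1..<n} \<Longrightarrow> Suc i \<in> {1..<n} \<Longrightarrow> E [i, Suc i, i] [Suc i, i, Suc i]"
  using braid by (auto simp: E_def fun_eq_iff Transposition.transpose_def)

lemma E_far:
  assumes "i \<in> {1..<n}" "j \<in> {1..<n}" "Suc i < j" shows "E [i, j] [j, i]"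
proof -
  have "simple_refl i \<circ> simple_refl j = simple_refl j \<circ> simple_refl i"
    using assms(3) by (auto simp: fun_eq_iff Transposition.transpose_def)
  then show ?thesis unfolding E_def using far[OF _ _ assms] by simp
qed

lemma E_far_word:
  assumes "set v \<subseteq> {1..<n}" "i \<in> {1..<n}" "\<And>j. j \<in> set v \<Longrightarrow> Suc i < j \<or> Suc j < i"
  shows "E (v @ [i]) (i # v)"
  using assms(1,3)
proof (induction v)
  case (Cons j v)
  have j: "j \<in> {1..<n}" using Cons.prems by auto
  have "E ([j] @ (v @ [i]) @ []) ([j] @ (i # v) @ [])" using Cons j by (intro E_ctx) auto
  then have 1: "E ((j # v) @ [i]) (j # i # v)" by simp
  have "E [j, i] [i, j]" using Cons.prems E_far[of i j] E_far[of j i] E_sym assms(2) j by auto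
  then have "E ([] @ [j, i] @ v) ([] @ [i, j] @ v)" using Cons.prems by (intro E_ctx) auto
  then have "E (j # i # v) (i # j # v)" by simp
  with 1 show ?case by (rule E_trans)
qed simp

text \<open>The words \<open>m, m-1, ..., k\<close>, empty for \<open>k = Suc m\<close>. They
  represent the cosets of the subgroup generated by the letters below \<open>m\<close> in the one
  generated by the letters up to \<open>m\<close>.\<close>

definition descw :: "nat \<Rightarrow> nat \<Rightarrow> nat list" where
  "descw m k = rev [k..<Suc m]"

lemma set_descw [simp]: "set (descw m k) = {k..m}"
  by (auto simp: descw_def)

lemma descw_split: "k \<le> j \<Longrightarrow> j \<le> Suc m \<Longrightarrow> 1 \<le> j \<Longrightarrow> descw m k = descw m j @ descw (j - 1) k"
proof -
  assume a: "k \<le> j" "j \<le> Suc m" "1 \<le> j"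
  have "[k..<Suc m] = [k..<j] @ [j..<Suc m]" using upt_add_eq_append[of k j "Suc m - j"] a by simp
  then show ?thesis using a by (simp add: descw_def del: upt_Suc)
qed

lemma descw_single [simp]: "descw k k = [k]" by (simp add: descw_def)
lemma descw_empty [simp]: "descw k (Suc k) = []" by (simp add: descw_def)

text \<open>Four things can happen to an appended letter \<open>i\<close>: it commutes past the
  whole word, it extends the word, it cancels the last letter, or a braid move carries it across and
  it comes out on the left as \<open>i - 1\<close>.\<close>

lemma descw_step:
  assumes m: "m < n" and i: "i \<in> {1..m}" and k: "k \<in> {1..Suc m}"
  shows "\<exists>u k'. set u \<subseteq> {1..<m} \<and> k' \<in> {1..Suc m} \<and> E (descw m k @ [i]) (u @ descw m k')"
proof -
  have dn: "set (descw a b) \<subseteq> {1..<n}" if "1 \<le> b" "a \<le> m" for a b using that m by auto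
  have "i \<in> {1..<n}" using i m by auto
  consider "Suc i < k" | "Suc i = k" | "i = k" | "k < i" by linarith
  then show ?thesis
  proof cases
    case 1
    have "E (descw m k @ [i]) (i # descw m k)" using 1 k dn \<open>i \<in> {1..<n}\<close> by (intro E_far_word) auto
    then show ?thesis using 1 k i by (intro exI[of _ "[i]"] exI[of _ k]) auto
  next
    case 2
    have "descw m i = descw m k @ [i]" using descw_split[of i k m] 2 i k by auto
    then show ?thesis using i by (intro exI[of _ "[]"] exI[of _ i]) auto
  next
    case 3
    have "descw m k = descw m (Suc k) @ [k]" using descw_split[of k "Suc k" m] 3 i by auto
    moreover have "E (descw m (Suc k) @ [k, k] @ []) (descw m (Suc k) @ [] @ [])"
      using dn k 3 \<open>i \<in> {1..<n}\<close> by (intro E_ctx E_quad) auto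
    ultimately show ?thesis using 3 i by (intro exI[of _ "[]"] exI[of _ "Suc k"]) auto
  next
    case 4
    \<comment> \<open>The letters of \<open>?D\<close> exceed \<open>i\<close> and those of
      \<open>?C\<close> lie below \<open>i - 1\<close>. So \<open>i\<close> passes
      \<open>?C\<close>, meets the pair \<open>i, i - 1\<close> in a braid, and the resulting
      \<open>i - 1\<close> passes \<open>?D\<close>.\<close>
    let ?D = "descw m (Suc i)" and ?C = "descw (i - 2) k"
    have i1: "i - 1 \<in> {1..<n}" "Suc (i - 1) = i" "1 \<le> i - 1" using 4 k m i by auto
    have D: "descw m k = ?D @ [i, i - 1] @ ?C"
    proof -
      have "descw m k = ?D @ descw i k" using descw_split[of k "Suc i" m] 4 i by simp
      also have "descw i k = [i] @ descw (i - 1) k" using descw_split[of k i i] 4 k by simp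
      also have "descw (i - 1) k = [i - 1] @ ?C"
        using descw_split[of k "i - 1" "i - 1"] 4 k i1 by (simp add: numeral_2_eq_2 diff_Suc split: nat.splits)
      finally show ?thesis by simp
    qed
    have Cn: "set ?C \<subseteq> {1..<n}" and Dn: "set ?D \<subseteq> {1..<n}" using k i m by auto
    have "E (?C @ [i]) (i # ?C)" using Cn k \<open>i \<in> {1..<n}\<close> by (intro E_far_word) auto
    then have "E ((?D @ [i, i - 1]) @ (?C @ [i]) @ []) ((?D @ [i, i - 1]) @ (i # ?C) @ [])"
      using i1 i m Dn by (intro E_ctx) auto
    then have 1: "E (descw m k @ [i]) (?D @ [i, i - 1, i] @ ?C)" using D by simp
    have "E [i, i - 1, i] [i - 1, i, i - 1]" using E_braid[of "i - 1"] i1 \<open>i \<in> {1..<n}\<close> E_sym by simp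
    then have 2: "E (?D @ [i, i - 1, i] @ ?C) (?D @ [i - 1, i, i - 1] @ ?C)" by (intro E_ctx Cn Dn)
    have "E (?D @ [i - 1]) ((i - 1) # ?D)" using Dn i1 by (intro E_far_word) auto
    then have "E ([] @ (?D @ [i - 1]) @ ([i, i - 1] @ ?C)) ([] @ ((i - 1) # ?D) @ ([i, i - 1] @ ?C))"
      using Cn i1 \<open>i \<in> {1..<n}\<close> by (intro E_ctx) auto
    then have 3: "E (?D @ [i - 1, i, i - 1] @ ?C) ([i - 1] @ descw m k)" using D by simp
    have "E (descw m k @ [i]) ([i - 1] @ descw m k)" using 1 2 3 E_trans by blast
    then show ?thesis using i1 i k by (intro exI[of _ "[i - 1]"] exI[of _ k]) auto
  qed
qed

lemma normal_form:
  assumes m: "m < n" and "set xs \<subseteq> {1..<Suc m}"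
  shows "\<exists>u k. set u \<subseteq> {1..<m} \<and> k \<in> {1..Suc m} \<and> E xs (u @ descw m k)"
  using assms(2)
proof (induction xs rule: rev_induct)
  case Nil
  show ?case by (intro exI[of _ "[]"] exI[of _ "Suc m"]) auto
next
  case (snoc i xs)
  then obtain u k where uk: "set u \<subseteq> {1..<m}" "k \<in> {1..Suc m}" "E xs (u @ descw m k)" by auto
  have i: "i \<in> {1..m}" using snoc.prems by auto
  obtain u' k' where u': "set u' \<subseteq> {1..<m}" "k' \<in> {1..Suc m}" "E (descw m k @ [i]) (u' @ descw m k')"
    using descw_step[OF m i uk(2)] by blast
  have "E ([] @ xs @ [i]) ([] @ (u @ descw m k) @ [i])" using uk i m by (intro E_ctx) auto
  moreover have "E (u @ (descw m k @ [i]) @ []) (u @ (u' @ descw m k') @ [])" using u' uk m by (intro E_ctx) auto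
  ultimately have "E (xs @ [i]) ((u @ u') @ descw m k')" using E_trans by simp
  then show ?case using u' uk by (intro exI[of _ "u @ u'"] exI[of _ k']) auto
qed

text \<open>Recovers \<open>k\<close> from a permutation in normal form: the prefix in smaller
  letters fixes \<open>Suc m\<close>, so \<open>k\<close> is the preimage of \<open>Suc m\<close>
  under the whole word.\<close>

lemma word_perm_descw: "k \<le> Suc m \<Longrightarrow> word_perm (descw m k) k = Suc m"
proof (induction m)
  case 0
  then show ?case by (cases k) (auto simp: descw_def)
next
  case (Suc m)
  show ?case
  proof (cases "k = Suc (Suc m)")
    case False
    then have "descw (Suc m) k = Suc m # descw m k" using Suc.prems by (simp add: descw_def)
    then show ?thesis using Suc False by simp
  qed simp
qed

lemma E_of_word_perm_eq:
  "m \<le> n \<Longrightarrow> set xs \<subseteq> {1..<m} \<Longrightarrow> set ys \<subseteq> {1..<m} \<Longrightarrow> word_perm xs = word_perm ys \<Longrightarrow> E xs ys"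
proof (induction m arbitrary: xs ys)
  case (Suc m)
  have m: "m < n" using Suc.prems by simp
  obtain u k where u: "set u \<subseteq> {1..<m}" "k \<in> {1..Suc m}" "E xs (u @ descw m k)"
    using normal_form[OF m Suc.prems(2)] by blast
  obtain v l where v: "set v \<subseteq> {1..<m}" "l \<in> {1..Suc m}" "E ys (v @ descw m l)"
    using normal_form[OF m Suc.prems(3)] by blast
  have eq: "word_perm u \<circ> word_perm (descw m k) = word_perm v \<circ> word_perm (descw m l)"
    using u(3) v(3) Suc.prems(4) by (simp add: E_def word_perm_append)
  have up: "word_perm u permutes {1..m}" "word_perm v permutes {1..m}"
    using word_perm_permutes u v by auto
  have "word_perm u (Suc m) = Suc m" "word_perm v (Suc m) = Suc m"
    using permutes_not_in[OF up(1)] permutes_not_in[OF up(2)] by auto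
  then have "(word_perm u \<circ> word_perm (descw m k)) k = Suc m" "(word_perm v \<circ> word_perm (descw m l)) l = Suc m"
    using u(2) v(2) by (auto simp: word_perm_descw)
  moreover have "inj (word_perm v \<circ> word_perm (descw m l))"
  proof -
    have "word_perm (descw m l) permutes {1..Suc m}" using v(2) by (intro word_perm_permutes) auto
    then show ?thesis using up(2) by (intro inj_compose permutes_inj)
  qed
  ultimately have kl: "k = l" using eq by (metis injD)
  have "bij (word_perm (descw m l))"
  proof -
    have "word_perm (descw m l) permutes {1..Suc m}" using v(2) by (intro word_perm_permutes) auto
    then show ?thesis by (rule permutes_bij)
  qed
  then have "word_perm u = word_perm v" using eq kl by (metis bij_is_surj surj_fun_eq comp_apply fun_eq_iff surjD)
  then have "E u v" using Suc u v by auto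
  then have "E ([] @ u @ descw m k) ([] @ v @ descw m k)" using u m by (intro E_ctx) auto
  then show ?case using u(3) v(3) kl E_trans E_sym by (metis append_Nil)
qed simp

lemma word_perm_eq_imp:
  assumes "set xs \<subseteq> {1..<n}" "set ys \<subseteq> {1..<n}" "word_perm xs = word_perm ys"
  shows "F xs = F ys"
proof -
  have "E xs ys" using E_of_word_perm_eq[of n] assms by blast
  then show ?thesis unfolding E_def by (metis append_Nil append_Nil2 empty_subsetI empty_set)
qed

end

text \<open>The product along a word is invariant under the Coxeter moves, so the arbitrary word
  chosen in \<open>perm_elem\<close> may be replaced by any other word of the same
  permutation.\<close>

lemma (in kalg) perm_elem_word:
  assumes s: "\<And>i. i \<in> {1..<n} \<Longrightarrow> s i \<in> carrier A"
    and quad: "\<And>i. i \<in> {1..<n} \<Longrightarrow> s i \<otimes> s i = \<one>"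
    and braid: "\<And>i. i \<in> {1..<n} \<Longrightarrow> Suc i \<in> {1..<n} \<Longrightarrow> s i \<otimes> s (Suc i) \<otimes> s i = s (Suc i) \<otimes> s i \<otimes> s (Suc i)"
    and far: "\<And>i j. i \<in> {1..<n} \<Longrightarrow> j \<in> {1..<n} \<Longrightarrow> Suc i < j \<Longrightarrow> s i \<otimes> s j = s j \<otimes> s i"
    and "set is \<subseteq> {1..<n}"
  shows "perm_elem A s n (word_perm is) = list_prod A (map s is)"
proof -
  have c: "set (map s u) \<subseteq> carrier A" if "set u \<subseteq> {1..<n}" for u using s that by auto
  have lc: "list_prod A (map s u) \<in> carrier A" if "set u \<subseteq> {1..<n}" for u using c[OF that] by (rule list_prod_closed)
  interpret coxeter_invariant n "\<lambda>u. list_prod A (map s u)"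
  proof
    fix u v :: "nat list" and i j assume uv: "set u \<subseteq> {1..<n}" "set v \<subseteq> {1..<n}" and i: "i \<in> {1..<n}"
    have sp: "list_prod A (map s (u @ zs @ v)) = list_prod A (map s u) \<otimes> (list_prod A (map s zs) \<otimes> list_prod A (map s v))"
      if "set zs \<subseteq> {1..<n}" for zs
      using uv that c lc by (simp add: list_prod_append)
    note l = lc[OF uv(1)] lc[OF uv(2)]
    show "list_prod A (map s (u @ [i, i] @ v)) = list_prod A (map s (u @ v))"
      using i l s uv c by (subst sp) (auto simp: quad list_prod_append m_assoc[symmetric])
    show "list_prod A (map s (u @ [i, j] @ v)) = list_prod A (map s (u @ [j, i] @ v))" if "j \<in> {1..<n}" "Suc i < j"
      using i l s that far[OF i that] by (subst sp; (subst sp)?) auto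
    show "list_prod A (map s (u @ [i, Suc i, i] @ v)) = list_prod A (map s (u @ [Suc i, i, Suc i] @ v))" if "Suc i \<in> {1..<n}"
      using i l s that braid[OF i that] by (subst sp; (subst sp)?) (auto simp: m_assoc)
  qed
  have "is \<in> perm_words n (word_perm is)" using assms(5) by (simp add: perm_words_def)
  then have "(SOME js. js \<in> perm_words n (word_perm is)) \<in> perm_words n (word_perm is)" by (rule someI)
  then show ?thesis unfolding perm_elem_def
    using assms(5) by (intro word_perm_eq_imp) (auto simp: perm_words_def)
qed

subsection \<open>Young subgroups and standardization of colourings\<close>

lemma pinv_simps:
  assumes "w permutes {1..n::nat}"
  shows "w (pinv w x) = x" "pinv w (w x) = x" "pinv w permutes {1..n}" "pinv (pinv w) = w"
    "x \<in> {1..n} \<Longrightarrow> w x \<in> {1..n}" "x \<in> {1..n} \<Longrightarrow> pinv w x \<in> {1..n}"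
    "w \<circ> pinv w = id" "pinv w \<circ> w = id"
  using permutes_inverses[OF assms] permutes_inv[OF assms] permutes_inv_inv[OF assms]
    permutes_in_image[OF assms] permutes_in_image[OF permutes_inv[OF assms]] permutes_inv_o[OF assms] by auto

lemma pinv_comp: "w permutes {1..n} \<Longrightarrow> v permutes {1..n} \<Longrightarrow> pinv (w \<circ> v) = pinv v \<circ> pinv w"
  by (intro o_inv_distrib permutes_bij)

text \<open>Combinatorial stand-ins for characters: \<open>c j\<close> is the index of the root of
  unity at place \<open>j\<close>. The value 0 outside \<open>{1..n}\<close> makes equality of
  functions the same as equality at the places, and the set finite.\<close>

definition colourings :: "nat \<Rightarrow> nat \<Rightarrow> (nat \<Rightarrow> nat) set" where
  "colourings r n = {c. (\<forall>j\<in>{1..n}. c j \<in> {1..r}) \<and> (\<forall>j. j \<notin> {1..n} \<longrightarrow> c j = 0)}"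

definition colourings_of :: "nat \<Rightarrow> nat \<Rightarrow> (nat \<Rightarrow> nat) \<Rightarrow> (nat \<Rightarrow> nat) set" where
  "colourings_of r n \<mu> = {c \<in> colourings r n. \<forall>a\<in>{1..r}. card {j \<in> {1..n}. c j = a} = \<mu> a}"

lemma finite_colourings: "finite (colourings r n)"
proof -
  have "colourings r n \<subseteq> {c. \<forall>j. (j \<in> {1..n} \<longrightarrow> c j \<in> {1..r}) \<and> (j \<notin> {1..n} \<longrightarrow> c j = 0)}"
    by (auto simp: colourings_def)
  moreover have "finite {c. \<forall>j. (j \<in> {1..n} \<longrightarrow> c j \<in> {1..r}) \<and> (j \<notin> {1..n} \<longrightarrow> c j = (0::nat))}"
    by (rule finite_set_of_finite_funs) auto
  ultimately show ?thesis by (rule finite_subset)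
qed

lemma colourings_ext:
  assumes "c \<in> colourings r n" "d \<in> colourings r n" "\<And>j. j \<in> {1..n} \<Longrightarrow> c j = d j"
  shows "c = d"
  using assms unfolding colourings_def by (intro ext) (metis (mono_tags, lifting) mem_Collect_eq)

lemma colourings_perm:
  assumes w: "w permutes {1..n}" and "c \<in> colourings r n"
  shows "c \<circ> pinv w \<in> colourings r n"
  using assms(2) permutes_in_image[OF permutes_inv[OF w]] by (auto simp: colourings_def)

lemma colourings_of_perm:
  assumes w: "w permutes {1..n}" and c: "c \<in> colourings_of r n \<mu>"
  shows "c \<circ> pinv w \<in> colourings_of r n \<mu>"
proof -
  have "card {j \<in> {1..n}. (c \<circ> pinv w) j = a} = card {j \<in> {1..n}. c j = a}" for a
  proof -
    have "{j \<in> {1..n}. (c \<circ> pinv w) j = a} = w ` {j \<in> {1..n}. c j = a}"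
    proof (intro equalityI subsetI)
      fix j assume "j \<in> {j \<in> {1..n}. (c \<circ> pinv w) j = a}"
      then show "j \<in> w ` {j \<in> {1..n}. c j = a}"
        using pinv_simps[OF w] by (intro image_eqI[of _ _ "pinv w j"]) auto
    next
      fix j assume "j \<in> w ` {j \<in> {1..n}. c j = a}"
      then show "j \<in> {j \<in> {1..n}. (c \<circ> pinv w) j = a}" using pinv_simps[OF w] by auto
    qed
    then show ?thesis using permutes_inj_on[OF w] by (simp add: card_image)
  qed
  then show ?thesis using c colourings_perm[OF w] by (simp add: colourings_of_def)
qed

text \<open>\<open>std n \<mu> c\<close> is the inverse of the paper's \<open>\<pi>\<close> for the character with colouring \<open>c\<close>.\<close>
definition std :: "nat \<Rightarrow> (nat \<Rightarrow> nat) \<Rightarrow> (nat \<Rightarrow> nat) \<Rightarrow> nat \<Rightarrow> nat" where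
  "std n \<mu> c j = (if j \<in> {1..n} then offset \<mu> (c j) + card {k \<in> {1..j}. c k = c j} else j)"

section \<open>Blocks, the Young subgroup and standardization\<close>

locale composition =
  fixes r n :: nat and \<mu> :: "nat \<Rightarrow> nat"
  assumes comp: "\<mu> \<in> compositions r n"
begin

lemma offset_Suc: "1 \<le> a \<Longrightarrow> offset \<mu> (Suc a) = offset \<mu> a + \<mu> a"
  by (simp add: offset_def atLeastLessThanSuc)

lemma offset_mono: "a \<le> b \<Longrightarrow> offset \<mu> a \<le> offset \<mu> b"
  unfolding offset_def by (intro sum_mono2) auto

lemma offset_top: "offset \<mu> (Suc r) = n"
  using comp by (simp add: compositions_def offset_def atLeastLessThanSuc_atLeastAtMost)

lemma block_subset: "a \<in> {1..r} \<Longrightarrow> block \<mu> a \<subseteq> {1..n}"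
  using offset_mono[of "Suc a" "Suc r"] by (auto simp: block_def offset_Suc offset_top)

lemma block_mem: "a \<in> {1..r} \<Longrightarrow> j \<in> block \<mu> a \<Longrightarrow> j \<in> {1..n}"
  using block_subset by blast

lemma block_less:
  assumes "1 \<le> a" "a < b" "i \<in> block \<mu> a" "j \<in> block \<mu> b"
  shows "i < j"
  using assms offset_mono[of "Suc a" b] by (auto simp: block_def offset_Suc)

lemma block_unique: "a \<in> {1..r} \<Longrightarrow> b \<in> {1..r} \<Longrightarrow> j \<in> block \<mu> a \<Longrightarrow> j \<in> block \<mu> b \<Longrightarrow> a = b"
  using block_less[of a b j j] block_less[of b a j j] by (cases a b rule: linorder_cases) auto

lemma block_exists: "j \<in> {1..n} \<Longrightarrow> \<exists>a\<in>{1..r}. j \<in> block \<mu> a"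
proof -
  assume j: "j \<in> {1..n}"
  \<comment> \<open>The block of \<open>j\<close> is the first one whose right end
    \<open>offset \<mu> (Suc a)\<close> reaches \<open>j\<close>; the index 0 is excluded because
    \<open>offset \<mu> 1 = 0\<close>.\<close>
  define a where "a = (LEAST a. j \<le> offset \<mu> (Suc a))"
  have t: "j \<le> offset \<mu> (Suc r)" using j by (simp add: offset_top)
  have a: "j \<le> offset \<mu> (Suc a)" unfolding a_def using t by (rule LeastI)
  have ar: "a \<le> r" unfolding a_def using t by (rule Least_le)
  have a0: "a \<noteq> 0" using a j by (cases "a = 0") (auto simp: offset_def)
  then have "\<not> j \<le> offset \<mu> (Suc (a - 1))" using not_less_Least[of "a - 1" "\<lambda>a. j \<le> offset \<mu> (Suc a)"] by (simp add: a_def)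
  then have "offset \<mu> a < j" using a0 by simp
  then show ?thesis using a ar a0 offset_Suc[of a] by (intro bexI[of _ a]) (auto simp: block_def)
qed

text \<open>The colouring of the standard character \<open>chi0\<close>, weakly increasing in the
  place.\<close>

definition c0 :: "nat \<Rightarrow> nat" where
  "c0 j = (if j \<in> {1..n} then THE a. a \<in> {1..r} \<and> j \<in> block \<mu> a else 0)"

lemma c0_block: "a \<in> {1..r} \<Longrightarrow> j \<in> block \<mu> a \<Longrightarrow> c0 j = a"
  unfolding c0_def using block_unique block_mem by (simp del: atLeastAtMost_iff) (blast intro: the_equality)

lemma c0_props:
  assumes "j \<in> {1..n}" shows "c0 j \<in> {1..r}" "j \<in> block \<mu> (c0 j)"
  using block_exists[OF assms] c0_block by auto

lemma c0_eq_iff: "j \<in> {1..n} \<Longrightarrow> a \<in> {1..r} \<Longrightarrow> c0 j = a \<longleftrightarrow> j \<in> block \<mu> a"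
  using c0_block c0_props by auto

lemma c0_less: "i \<in> {1..n} \<Longrightarrow> j \<in> {1..n} \<Longrightarrow> c0 i < c0 j \<Longrightarrow> i < j"
  using block_less[of "c0 i" "c0 j" i j] c0_props[of i] c0_props[of j] by auto

lemma c0_mono: "i \<in> {1..n} \<Longrightarrow> j \<in> {1..n} \<Longrightarrow> i \<le> j \<Longrightarrow> c0 i \<le> c0 j"
  using c0_less[of j i] by (meson leD leI)

lemma c0_colouring: "c0 \<in> colourings_of r n \<mu>"
proof -
  have "{j \<in> {1..n}. c0 j = a} = block \<mu> a" if "a \<in> {1..r}" for a
    using that c0_eq_iff block_mem by blast
  then show ?thesis using c0_props(1) by (auto simp: colourings_of_def colourings_def c0_def block_def)
qed

text \<open>The blocks are the fibres of \<open>c0\<close>. In the converse direction injectivity on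
  a finite block turns the inclusion of the image into equality.\<close>

lemma young_iff: "w \<in> young r n \<mu> \<longleftrightarrow> w permutes {1..n} \<and> (\<forall>j\<in>{1..n}. c0 (w j) = c0 j)"
proof
  assume w: "w \<in> young r n \<mu>"
  have "c0 (w j) = c0 j" if j: "j \<in> {1..n}" for j
  proof -
    have "w ` block \<mu> (c0 j) = block \<mu> (c0 j)" using w c0_props[OF j] by (auto simp: young_def)
    then have "w j \<in> block \<mu> (c0 j)" using c0_props[OF j] by blast
    then show ?thesis using c0_block c0_props[OF j] by blast
  qed
  then show "w permutes {1..n} \<and> (\<forall>j\<in>{1..n}. c0 (w j) = c0 j)" using w by (auto simp: young_def)
next
  assume w: "w permutes {1..n} \<and> (\<forall>j\<in>{1..n}. c0 (w j) = c0 j)"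
  have "w ` block \<mu> a = block \<mu> a" if a: "a \<in> {1..r}" for a
  proof -
    have "w ` block \<mu> a \<subseteq> block \<mu> a"
    proof (rule image_subsetI)
      fix j assume j: "j \<in> block \<mu> a"
      then have jn: "j \<in> {1..n}" using block_subset[OF a] by blast
      then have "c0 (w j) = a" using w c0_block[OF a j] by auto
      then show "w j \<in> block \<mu> a" using c0_props(2)[of "w j"] pinv_simps(5)[of w n j] w jn by simp
    qed
    moreover have "inj_on w (block \<mu> a)" using w permutes_inj_on by blast
    moreover have "finite (block \<mu> a)" by (simp add: block_def)
    ultimately show ?thesis by (intro endo_inj_surj)
  qed
  then show "w \<in> young r n \<mu>" using w by (auto simp: young_def)
qed

lemma young_permutes: "w \<in> young r n \<mu> \<Longrightarrow> w permutes {1..n}"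
  by (simp add: young_iff)

lemma young_id: "id \<in> young r n \<mu>" by (simp add: young_iff permutes_id)

lemma young_comp: "w \<in> young r n \<mu> \<Longrightarrow> v \<in> young r n \<mu> \<Longrightarrow> w \<circ> v \<in> young r n \<mu>"
  using pinv_simps(5) by (auto simp: young_iff intro: permutes_compose)

lemma young_inv: "w \<in> young r n \<mu> \<Longrightarrow> pinv w \<in> young r n \<mu>"
  unfolding young_iff using pinv_simps by metis

lemma young_simple: "a \<in> {1..r} \<Longrightarrow> k \<in> block \<mu> a \<Longrightarrow> Suc k \<in> block \<mu> a \<Longrightarrow> simple_refl k \<in> young r n \<mu>"
proof -
  assume a: "a \<in> {1..r}" "k \<in> block \<mu> a" "Suc k \<in> block \<mu> a"
  then have "k \<in> {1..<n}" using block_subset[OF a(1)] by auto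
  moreover have "c0 k = c0 (Suc k)" using c0_block a by simp
  ultimately show ?thesis using simple_refl_permutes by (auto simp: young_iff Transposition.transpose_def)
qed

text \<open>An element of the Young subgroup maps every block onto itself, so being increasing
  inside the blocks already forces it to be the identity. The uniqueness of standardization and the
  length estimate both rest on this.\<close>

lemma young_id_of_mono:
  assumes v: "v \<in> young r n \<mu>" and mono: "\<And>k. k \<in> {1..<n} \<Longrightarrow> c0 k = c0 (Suc k) \<Longrightarrow> v k < v (Suc k)"
  shows "v = id"
proof -
  have "v j = j" if j: "j \<in> {1..n}" for j
  proof -
    let ?a = "c0 j"
    have a: "?a \<in> {1..r}" using c0_props j by blast
    have b: "block \<mu> ?a = {offset \<mu> ?a<..offset \<mu> ?a + \<mu> ?a}" by (simp add: block_def)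
    show ?thesis
    proof (rule strict_mono_interval_id)
      show "v ` {offset \<mu> ?a<..offset \<mu> ?a + \<mu> ?a} = {offset \<mu> ?a<..offset \<mu> ?a + \<mu> ?a}"
        using v a unfolding b[symmetric] young_def by blast
      show "j \<in> {offset \<mu> ?a<..offset \<mu> ?a + \<mu> ?a}" using c0_props(2)[OF j] b by simp
      fix k assume k: "offset \<mu> ?a < k" "k < offset \<mu> ?a + \<mu> ?a"
      then have "k \<in> block \<mu> ?a" "Suc k \<in> block \<mu> ?a" using b by auto
      then show "v k < v (Suc k)" using block_subset[OF a] c0_block[OF a] by (intro mono) auto
    qed
  qed
  then show ?thesis using permutes_not_in[OF young_permutes[OF v]] by (metis eq_id_iff)
qed

text \<open>A nontrivial element has a descent inside some block, and removing it stays in the Young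
  subgroup. The group is thus generated by the simple reflections of its blocks.\<close>

lemma young_induct [consumes 1, case_names id step]:
  assumes "w \<in> young r n \<mu>" and "P id"
    and "\<And>a k w. a \<in> {1..r} \<Longrightarrow> k \<in> block \<mu> a \<Longrightarrow> Suc k \<in> block \<mu> a \<Longrightarrow> w \<in> young r n \<mu> \<Longrightarrow> P w \<Longrightarrow> P (simple_refl k \<circ> w)"
  shows "P w"
  using assms(1)
proof (induction "card (invs n w)" arbitrary: w rule: less_induct)
  case less
  note w = young_permutes[OF less.prems]
  show ?case
  proof (cases "w = id")
    case False
    have "pinv w \<noteq> id" using False w by (metis inv_id permutes_inv_inv)
    then obtain k where k: "k \<in> {1..<n}" "c0 k = c0 (Suc k)" "\<not> pinv w k < pinv w (Suc k)"
      using young_id_of_mono[OF young_inv[OF less.prems]] by blast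
    have "pinv w k \<noteq> pinv w (Suc k)" using permutes_inj[OF permutes_inv[OF w]] by (metis injD n_not_Suc_n)
    then have d: "pinv w (Suc k) < pinv w k" using k by simp
    have kn: "k \<in> {1..n}" "Suc k \<in> {1..n}" using k(1) by auto
    have a: "c0 k \<in> {1..r}" "k \<in> block \<mu> (c0 k)" "Suc k \<in> block \<mu> (c0 k)"
      using c0_props[OF kn(1)] c0_props[OF kn(2)] k(2) by auto
    let ?v = "simple_refl k \<circ> w"
    have v: "?v \<in> young r n \<mu>" using young_comp[OF young_simple[OF a] less.prems] .
    have "P ?v" using card_invs_descent[OF w k(1) d] v by (intro less.hyps) auto
    then have "P (simple_refl k \<circ> ?v)" using assms(3) a v by blast
    then show ?thesis by simp
  qed (use assms(2) in simp)
qed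

abbreviation "\<sigma> \<equiv> std n \<mu>"

context
  fixes c assumes c: "c \<in> colourings_of r n \<mu>"
begin

lemma colour_range: "j \<in> {1..n} \<Longrightarrow> c j \<in> {1..r}"
  using c by (auto simp: colourings_of_def colourings_def)

lemma std_block:
  assumes j: "j \<in> {1..n}"
  shows "\<sigma> c j \<in> block \<mu> (c j)"
proof -
  have "card {k \<in> {1..j}. c k = c j} \<le> card {k \<in> {1..n}. c k = c j}" using j by (intro card_mono) auto
  also have "\<dots> = \<mu> (c j)" using c colour_range[OF j] by (auto simp: colourings_of_def)
  finally have "card {k \<in> {1..j}. c k = c j} \<le> \<mu> (c j)" .
  moreover have "card {k \<in> {1..j}. c k = c j} \<noteq> 0"
  proof -
    have "j \<in> {k \<in> {1..j}. c k = c j}" using j by auto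
    moreover have "finite {k \<in> {1..j}. c k = c j}" by simp
    ultimately show ?thesis unfolding card_eq_0_iff by blast
  qed
  ultimately show ?thesis unfolding std_def block_def if_P[OF j] greaterThanAtMost_iff by linarith
qed

lemma c0_std: "j \<in> {1..n} \<Longrightarrow> c0 (\<sigma> c j) = c j"
  using std_block c0_block colour_range by blast

lemma std_mono:
  assumes "i \<in> {1..n}" "j \<in> {1..n}" "i < j" "c i = c j"
  shows "\<sigma> c i < \<sigma> c j"
proof -
  have "{k \<in> {1..i}. c k = c i} \<subset> {k \<in> {1..j}. c k = c j}"
  proof (rule psubsetI)
    show "{k \<in> {1..i}. c k = c i} \<subseteq> {k \<in> {1..j}. c k = c j}" using assms by auto
    have "j \<in> {k \<in> {1..j}. c k = c j}" "j \<notin> {k \<in> {1..i}. c k = c i}" using assms by auto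
    then show "{k \<in> {1..i}. c k = c i} \<noteq> {k \<in> {1..j}. c k = c j}" by blast
  qed
  then have "card {k \<in> {1..i}. c k = c i} < card {k \<in> {1..j}. c k = c j}" by (intro psubset_card_mono) auto
  then show ?thesis using assms by (simp add: std_def)
qed

lemma std_permutes: "\<sigma> c permutes {1..n}"
proof -
  have im: "\<sigma> c ` {1..n} \<subseteq> {1..n}" using std_block block_subset colour_range by blast
  have "inj_on (\<sigma> c) {1..n}"
  proof (rule linorder_inj_onI')
    fix i j assume ij: "i \<in> {1..n}" "j \<in> {1..n}" "i < j"
    show "\<sigma> c i \<noteq> \<sigma> c j" using std_mono[OF ij] c0_std[OF ij(1)] c0_std[OF ij(2)] by (metis less_irrefl)
  qed
  then have "bij_betw (\<sigma> c) {1..n} {1..n}" using im by (simp add: bij_betw_def endo_inj_surj)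
  then show ?thesis by (rule bij_imp_permutes) (unfold std_def, rule if_not_P)
qed

text \<open>Two permutations with these properties differ by an element of the Young subgroup that
  is increasing on every block, and only the identity is.\<close>

lemma std_unique:
  assumes s: "s permutes {1..n}" "\<And>j. j \<in> {1..n} \<Longrightarrow> c0 (s j) = c j"
    "\<And>i j. i \<in> {1..n} \<Longrightarrow> j \<in> {1..n} \<Longrightarrow> i < j \<Longrightarrow> c i = c j \<Longrightarrow> s i < s j"
  shows "s = \<sigma> c"
proof -
  note \<sigma>i = pinv_simps[OF std_permutes]
  let ?v = "s \<circ> pinv (\<sigma> c)"
  have "?v = id"
  proof (rule young_id_of_mono)
    have cc: "c0 (s (pinv (\<sigma> c) j)) = c0 j" if "j \<in> {1..n}" for j
      using that s(2)[of "pinv (\<sigma> c) j"] c0_std[of "pinv (\<sigma> c) j"] \<sigma>i by simp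
    then show "?v \<in> young r n \<mu>" using permutes_compose[OF \<sigma>i(3) s(1)] by (simp add: young_iff)
    fix k assume k: "k \<in> {1..<n}" "c0 k = c0 (Suc k)"
    then have kn: "k \<in> {1..n}" "Suc k \<in> {1..n}" by auto
    let ?p = "pinv (\<sigma> c) k" and ?q = "pinv (\<sigma> c) (Suc k)"
    have pq: "?p \<in> {1..n}" "?q \<in> {1..n}" using \<sigma>i(6) kn by blast+
    have cpq: "c ?p = c ?q" using c0_std[OF pq(1)] c0_std[OF pq(2)] k(2) \<sigma>i(1) by simp
    have "\<not> ?q < ?p" using std_mono[OF pq(2,1)] cpq \<sigma>i(1) by (metis Suc_lessD less_irrefl)
    moreover have "?p \<noteq> ?q" using \<sigma>i(1) by (metis n_not_Suc_n)
    ultimately have "?p < ?q" by simp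
    then show "?v k < ?v (Suc k)" using s(3)[OF pq] cpq by simp
  qed
  then have "s (pinv (\<sigma> c) (\<sigma> c j)) = \<sigma> c j" for j by (metis comp_apply id_apply)
  then show ?thesis using \<sigma>i(2) by (simp add: fun_eq_iff)
qed

text \<open>A value strictly in between would belong to the same block, so its place would have the
  same colour and lie strictly between \<open>i\<close> and \<open>Suc i\<close>. It follows that
  the reflection of two equally coloured adjacent places is conjugate to a simple reflection of the
  Young subgroup.\<close>

lemma std_adjacent:
  assumes i: "i \<in> {1..<n}" and "c i = c (Suc i)"
  shows "\<sigma> c (Suc i) = Suc (\<sigma> c i)"
proof (rule ccontr)
  note \<sigma>i = pinv_simps[OF std_permutes]
  assume ne: "\<not> ?thesis"
  have i': "i \<in> {1..n}" "Suc i \<in> {1..n}" using i by auto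
  have lt: "\<sigma> c i < \<sigma> c (Suc i)" using std_mono[OF i'] assms by simp
  let ?m = "Suc (\<sigma> c i)"
  have m: "\<sigma> c i < ?m" "?m < \<sigma> c (Suc i)" using lt ne by auto
  have mn: "?m \<in> {1..n}" using \<sigma>i(5)[OF i'(2)] m by auto
  have "?m \<in> block \<mu> (c i)" using std_block[OF i'(1)] std_block[OF i'(2)] assms(2) m by (auto simp: block_def)
  then have "c0 ?m = c i" using c0_block colour_range[OF i'(1)] by blast
  let ?k = "pinv (\<sigma> c) ?m"
  have k: "?k \<in> {1..n}" "\<sigma> c ?k = ?m" using \<sigma>i(6)[OF mn] \<sigma>i(1) by auto
  have ck: "c ?k = c i" using c0_std[OF k(1)] k(2) \<open>c0 ?m = c i\<close> by simp
  have "i < ?k"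
  proof (rule ccontr)
    assume "\<not> i < ?k"
    then have "?k < i \<or> ?k = i" by auto
    then show False using std_mono[OF k(1) i'(1)] ck k(2) m(1) by (metis less_asym less_irrefl)
  qed
  moreover have "?k < Suc i"
  proof (rule ccontr)
    assume "\<not> ?k < Suc i"
    then have "Suc i < ?k \<or> ?k = Suc i" by auto
    then show False using std_mono[OF i'(2) k(1)] ck k(2) m(2) assms(2) by (metis less_asym less_irrefl)
  qed
  ultimately show False by simp
qed

end

text \<open>Exchanging two adjacent places of different colours leaves the order within every colour
  intact, so \<open>std_unique\<close> applies. In the matrix representation such a reflection
  therefore only changes the row.\<close>

lemma std_swap:
  assumes c: "c \<in> colourings_of r n \<mu>" and i: "i \<in> {1..<n}" and ne: "c i \<noteq> c (Suc i)"
  shows "\<sigma> (c \<circ> simple_refl i) = \<sigma> c \<circ> simple_refl i"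
proof (rule std_unique[symmetric])
  have i': "i \<in> {1..n}" "Suc i \<in> {1..n}" using i by auto
  have p: "simple_refl i permutes {1..n}" using i by (rule simple_refl_permutes)
  show "c \<circ> simple_refl i \<in> colourings_of r n \<mu>"
    using colourings_of_perm[OF p c] by simp
  have r: "simple_refl i j \<in> {1..n}" if "j \<in> {1..n}" for j using that permutes_in_image[OF p] by blast
  show "\<sigma> c \<circ> simple_refl i permutes {1..n}" using std_permutes[OF c] p by (intro permutes_compose)
  show "c0 ((\<sigma> c \<circ> simple_refl i) j) = (c \<circ> simple_refl i) j" if "j \<in> {1..n}" for j
    using c0_std[OF c r[OF that]] by simp
  show "(\<sigma> c \<circ> simple_refl i) x < (\<sigma> c \<circ> simple_refl i) y"
    if xy: "x \<in> {1..n}" "y \<in> {1..n}" "x < y" "(c \<circ> simple_refl i) x = (c \<circ> simple_refl i) y" for x y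
  proof -
    have "(x, y) \<noteq> (i, Suc i)" using xy(4) ne by auto
    then have "simple_refl i x < simple_refl i y" using xy(3) by (subst simple_refl_less) auto
    then show ?thesis using std_mono[OF c r[OF xy(1)] r[OF xy(2)]] xy(4) by simp
  qed
qed

lemma std_young:
  assumes c: "c \<in> colourings_of r n \<mu>" and w: "w permutes {1..n}" "\<And>j. j \<in> {1..n} \<Longrightarrow> c (w j) = c0 j"
  shows "\<sigma> c \<circ> w \<in> young r n \<mu>"
  using c0_std[OF c] w pinv_simps(5)[OF w(1)] std_permutes[OF c]
  by (auto simp: young_iff intro: permutes_compose)

text \<open>Each standardization turns its colouring into \<open>c0\<close>, so the composite
  preserves \<open>c0\<close>. This element is the permutation part of the matrix entry by which
  \<open>f_w\<close> acts.\<close>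

lemma young_between:
  assumes c: "c \<in> colourings_of r n \<mu>" and w: "w permutes {1..n}"
  shows "\<sigma> c \<circ> w \<circ> pinv (\<sigma> (c \<circ> w)) \<in> young r n \<mu>"
proof -
  have d: "c \<circ> w \<in> colourings_of r n \<mu>"
    using colourings_of_perm[OF pinv_simps(3)[OF w] c] pinv_simps(4)[OF w] by simp
  note \<sigma>i = pinv_simps[OF std_permutes[OF d]]
  have "c ((w \<circ> pinv (\<sigma> (c \<circ> w))) j) = c0 j" if "j \<in> {1..n}" for j
    using c0_std[OF d \<sigma>i(6)[OF that]] \<sigma>i(1) by simp
  then show ?thesis using std_young[OF c permutes_compose[OF \<sigma>i(3) w]] by (simp add: comp_assoc)
qed

text \<open>The inversions of the representative involve different blocks only. Moving their places
  by \<open>pinv v\<close> keeps the order of the places and gives inversions of the product, while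
  a descent of \<open>v\<close> inside a block gives an inversion that is not obtained in this
  way.\<close>

lemma std_length_minimal:
  assumes c: "c \<in> colourings_of r n \<mu>" and v: "v \<in> young r n \<mu>" "v \<noteq> id"
  shows "perm_length n (pinv (\<sigma> c)) < perm_length n (pinv (\<sigma> c) \<circ> v)"
proof -
  note \<sigma>i = pinv_simps[OF std_permutes[OF c]]
  let ?p = "pinv (\<sigma> c)"
  note vp = young_permutes[OF v(1)]
  note vi = pinv_simps[OF vp]
  have cp: "c (?p j) = c0 j" if "j \<in> {1..n}" for j
    using c0_std[OF c \<sigma>i(6)[OF that]] \<sigma>i(1) by simp
  have pm: "?p i < ?p j" if "i \<in> {1..n}" "j \<in> {1..n}" "i < j" "c0 i = c0 j" for i j
  proof (rule ccontr)
    assume "\<not> ?p i < ?p j"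
    moreover have "?p i \<noteq> ?p j" using that(3) \<sigma>i(1) by (metis less_irrefl)
    ultimately have "?p j < ?p i" by simp
    then have "\<sigma> c (?p j) < \<sigma> c (?p i)" using that cp \<sigma>i(6) by (intro std_mono[OF c]) auto
    then show False using that(3) \<sigma>i(1) by simp
  qed
  have diff: "c0 i < c0 j" if "(i, j) \<in> invs n ?p" for i j
  proof -
    have ij: "i \<in> {1..n}" "j \<in> {1..n}" "i < j" "?p j < ?p i" using that by (auto simp: invs_def)
    then have "c0 i \<noteq> c0 j" using pm by force
    then show ?thesis using c0_mono[OF ij(1,2)] ij(3) by simp
  qed
  have vc: "c0 (pinv v j) = c0 j" if "j \<in> {1..n}" for j
    using young_inv[OF v(1)] that by (simp add: young_iff)
  let ?f = "\<lambda>(i, j). (pinv v i, pinv v j)"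
  have inj: "inj_on ?f (invs n ?p)" using vi(1) by (auto intro!: inj_onI) metis+
  have im: "?f ` invs n ?p \<subseteq> invs n (?p \<circ> v)"
  proof
    fix x assume "x \<in> ?f ` invs n ?p"
    then obtain i j where ij: "(i, j) \<in> invs n ?p" "x = (pinv v i, pinv v j)" by auto
    have ijn: "i \<in> {1..n}" "j \<in> {1..n}" "?p j < ?p i" using ij(1) by (auto simp: invs_def)
    have "pinv v i < pinv v j"
      using c0_less[OF vi(6)[OF ijn(1)] vi(6)[OF ijn(2)]] diff[OF ij(1)] vc[OF ijn(1)] vc[OF ijn(2)] by simp
    then show "x \<in> invs n (?p \<circ> v)" using ijn ij(2) vi(1) vi(6)[OF ijn(1)] vi(6)[OF ijn(2)] by (auto simp: invs_def)
  qed
  obtain k where k: "k \<in> {1..<n}" "c0 k = c0 (Suc k)" "\<not> v k < v (Suc k)"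
    using young_id_of_mono[OF v(1)] v(2) by blast
  have kn: "k \<in> {1..n}" "Suc k \<in> {1..n}" using k(1) by auto
  have "v k \<noteq> v (Suc k)" using permutes_inj[OF vp] by (metis injD n_not_Suc_n)
  then have "v (Suc k) < v k" using k(3) by simp
  moreover have "c0 (v (Suc k)) = c0 (v k)" using v(1) k(2) kn by (simp add: young_iff)
  ultimately have "?p (v (Suc k)) < ?p (v k)" using vi(5) kn by (intro pm) auto
  then have new: "(k, Suc k) \<in> invs n (?p \<circ> v)" using kn by (auto simp: invs_def)
  have "(k, Suc k) \<notin> ?f ` invs n ?p"
  proof
    assume "(k, Suc k) \<in> ?f ` invs n ?p"
    then obtain i j where ij: "(i, j) \<in> invs n ?p" "k = pinv v i" "Suc k = pinv v j" by auto
    then have "i \<in> {1..n}" "j \<in> {1..n}" by (auto simp: invs_def)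
    then show False using diff[OF ij(1)] vc ij k(2) by (metis less_irrefl)
  qed
  then have "?f ` invs n ?p \<subset> invs n (?p \<circ> v)" using im new by blast
  then have "card (invs n ?p) < card (invs n (?p \<circ> v))"
    using psubset_card_mono[OF finite_invs] card_image[OF inj] by metis
  then show ?thesis using \<sigma>i(3) permutes_compose[OF vp \<sigma>i(3)] by (simp add: perm_length_eq)
qed

section \<open>The Young subgroup as a product of symmetric groups\<close>

lemma young_component_permutes:
  assumes w: "w \<in> young r n \<mu>" and a: "a \<in> {1..r}"
  shows "young_component \<mu> a w permutes {1..\<mu> a}"
proof -
  have im: "w ` block \<mu> a = block \<mu> a" using w a by (auto simp: young_def)
  have b: "w (offset \<mu> a + j) \<in> block \<mu> a" if "j \<in> {1..\<mu> a}" for j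
    using im that by (force simp: block_def)
  have "inj_on (young_component \<mu> a w) {1..\<mu> a}"
  proof (rule inj_onI)
    fix i j assume ij: "i \<in> {1..\<mu> a}" "j \<in> {1..\<mu> a}" "young_component \<mu> a w i = young_component \<mu> a w j"
    then have "w (offset \<mu> a + i) = w (offset \<mu> a + j)"
      using b[OF ij(1)] b[OF ij(2)] by (auto simp: young_component_def block_def)
    then show "i = j" using permutes_inj[OF young_permutes[OF w]] by (metis add_left_cancel injD)
  qed
  moreover have "young_component \<mu> a w ` {1..\<mu> a} \<subseteq> {1..\<mu> a}"
    using b by (force simp: young_component_def block_def)
  ultimately have "bij_betw (young_component \<mu> a w) {1..\<mu> a} {1..\<mu> a}"
    by (simp add: bij_betw_def endo_inj_surj)
  then show ?thesis by (rule bij_imp_permutes) (auto simp: young_component_def)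
qed

lemma young_component_comp:
  assumes w: "w \<in> young r n \<mu>" "v \<in> young r n \<mu>" and a: "a \<in> {1..r}"
  shows "young_component \<mu> a (w \<circ> v) = young_component \<mu> a w \<circ> young_component \<mu> a v"
proof
  fix j
  have im: "v ` block \<mu> a = block \<mu> a" using w a by (auto simp: young_def)
  show "young_component \<mu> a (w \<circ> v) j = (young_component \<mu> a w \<circ> young_component \<mu> a v) j"
  proof (cases "j \<in> {1..\<mu> a}")
    case True
    then have "v (offset \<mu> a + j) \<in> block \<mu> a" using im by (force simp: block_def)
    then have "offset \<mu> a + (v (offset \<mu> a + j) - offset \<mu> a) = v (offset \<mu> a + j)"
      "v (offset \<mu> a + j) - offset \<mu> a \<in> {1..\<mu> a}" by (auto simp: block_def)
    then show ?thesis using True by (simp add: young_component_def)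
  qed (auto simp: young_component_def)
qed

lemma young_component_id: "young_component \<mu> a id = id"
  by (auto simp: young_component_def)

lemma young_component_simple:
  assumes b: "b \<in> {1..r}" "k \<in> block \<mu> b" "Suc k \<in> block \<mu> b" and a: "a \<in> {1..r}"
  shows "young_component \<mu> a (simple_refl k) = (if a = b then simple_refl (k - offset \<mu> b) else id)"
proof (cases "a = b")
  case True
  then show ?thesis using b by (auto simp: young_component_def Transposition.transpose_def block_def fun_eq_iff)
next
  case False
  have "offset \<mu> a + j \<noteq> k \<and> offset \<mu> a + j \<noteq> Suc k" if "j \<in> {1..\<mu> a}" for j
  proof -
    have "offset \<mu> a + j \<in> block \<mu> a" using that by (auto simp: block_def)
    then show ?thesis using block_unique[OF a b(1)] b False by metis
  qed
  then show ?thesis using False by (auto simp: young_component_def Transposition.transpose_def fun_eq_iff)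
qed

end

section \<open>Spans, monomials and intertwiners\<close>

inductive_set lspan :: "('k, 'a) module \<Rightarrow> 'a set \<Rightarrow> 'a set" for A S where
  zero: "\<zero>\<^bsub>A\<^esub> \<in> lspan A S"
| base: "y \<in> S \<Longrightarrow> y \<in> lspan A S"
| add: "y \<in> lspan A S \<Longrightarrow> z \<in> lspan A S \<Longrightarrow> y \<oplus>\<^bsub>A\<^esub> z \<in> lspan A S"
| smult: "y \<in> lspan A S \<Longrightarrow> c \<odot>\<^bsub>A\<^esub> y \<in> lspan A S"

lemma lspan_carrier:
  assumes "kalg A" "S \<subseteq> carrier A" "y \<in> lspan A S"
  shows "y \<in> carrier A"
proof -
  interpret kalg A by fact
  show ?thesis using assms(3) by induction (use assms(2) in auto)
qed

lemma lspan_finsum: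
  assumes "kalg A" "S \<subseteq> carrier A" "\<And>i. i \<in> I \<Longrightarrow> g i \<in> lspan A S"
  shows "(\<Oplus>\<^bsub>A\<^esub>i\<in>I. g i) \<in> lspan A S"
proof -
  interpret kalg A by fact
  show ?thesis using assms(3)
    by (induction I rule: infinite_finite_induct)
       (auto simp: finsum_insert Pi_def lspan_carrier[OF assms(1,2)] intro: lspan.intros)
qed

lemma lspan_linear_eq:
  assumes "kalg A" "kalg B" "S \<subseteq> carrier A" "h \<in> linear_maps A B" "k \<in> linear_maps A B"
    "\<And>y. y \<in> S \<Longrightarrow> h y = k y" "y \<in> lspan A S"
  shows "h y = k y"
  using assms(7)
proof induction
  case zero
  then show ?case using linear_maps_zero[OF assms(1,2,4)] linear_maps_zero[OF assms(1,2,5)] by simp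
next
  case (add y z)
  then show ?case using lspan_carrier[OF assms(1,3)]
    by (simp add: linear_mapsD(2)[OF assms(4)] linear_mapsD(2)[OF assms(5)])
next
  case (smult y c)
  then show ?case using lspan_carrier[OF assms(1,3)]
    by (simp add: linear_mapsD(3)[OF assms(4)] linear_mapsD(3)[OF assms(5)])
qed (use assms(6) in auto)

text \<open>Common form of \<open>yh_monom\<close> and \<open>comp_monom\<close>, so that
  commutation and reindexing are proved once for both.\<close>

definition monom_prod :: "('k, 'a) module \<Rightarrow> nat \<Rightarrow> (nat \<Rightarrow> 'a) \<Rightarrow> (nat \<Rightarrow> nat) \<Rightarrow> 'a" where
  "monom_prod A n X \<alpha> = list_prod A (map (\<lambda>i. X i [^]\<^bsub>A\<^esub> \<alpha> i) [1..<n + 1])"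

context kalg
begin

lemma commute_pow:
  "x \<otimes> y = y \<otimes> x \<Longrightarrow> x \<in> carrier A \<Longrightarrow> y \<in> carrier A \<Longrightarrow> x [^] (k::nat) \<otimes> y [^] (l::nat) = y [^] l \<otimes> x [^] k"
  using group_commutes_pow[of x y k] group_commutes_pow[of y "x [^] k" l] by simp

lemma commute_finsum:
  assumes "y \<in> carrier A" "\<And>i. i \<in> S \<Longrightarrow> g i \<in> carrier A" "\<And>i. i \<in> S \<Longrightarrow> y \<otimes> g i = g i \<otimes> y"
  shows "y \<otimes> (\<Oplus>i\<in>S. g i) = (\<Oplus>i\<in>S. g i) \<otimes> y"
  using assms(2,3)
proof (induction S rule: infinite_finite_induct)
  case (insert i S)
  then have "(\<Oplus>i\<in>S. g i) \<in> carrier A" by (auto intro: finsum_closed)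
  with insert assms(1) show ?case by (simp add: finsum_insert Pi_def l_distr r_distr)
qed (use assms(1) in simp_all)

lemma smult_pow: "y \<in> carrier A \<Longrightarrow> (c \<odot> y) [^] (k::nat) = (c ^ k) \<odot> (y [^] k)"
  by (induction k) (simp_all add: smult_mult_l smult_mult_r smult_smult mult.commute)

lemma intertwine_pow:
  assumes "g \<in> carrier A" "z \<in> carrier A" "z' \<in> carrier A" "g \<otimes> z = z' \<otimes> g"
  shows "g \<otimes> z [^] (k::nat) = z' [^] k \<otimes> g"
proof (induction k)
  case (Suc k)
  have "g \<otimes> (z [^] k \<otimes> z) = (z' [^] k \<otimes> g) \<otimes> z" using Suc assms by (simp add: m_assoc[symmetric])
  also have "\<dots> = z' [^] k \<otimes> (z' \<otimes> g)" using assms by (simp add: m_assoc)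
  finally show ?case using assms by (simp add: m_assoc)
qed (use assms in simp)

lemma intertwine_list_prod:
  assumes "g \<in> carrier A" "\<And>i. i \<in> set is \<Longrightarrow> z i \<in> carrier A" "\<And>i. i \<in> set is \<Longrightarrow> z' i \<in> carrier A"
    "\<And>i. i \<in> set is \<Longrightarrow> g \<otimes> z i = z' i \<otimes> g"
  shows "g \<otimes> list_prod A (map z is) = list_prod A (map z' is) \<otimes> g"
  using assms(2-4)
proof (induction "is")
  case (Cons i "is")
  have c: "list_prod A (map z is) \<in> carrier A" "list_prod A (map z' is) \<in> carrier A"
    "z i \<in> carrier A" "z' i \<in> carrier A"
    using Cons.prems by (auto intro!: list_prod_closed)
  have "g \<otimes> (z i \<otimes> list_prod A (map z is)) = z' i \<otimes> g \<otimes> list_prod A (map z is)"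
    using c assms(1) Cons.prems by (simp add: m_assoc[symmetric])
  also have "\<dots> = z' i \<otimes> (list_prod A (map z' is) \<otimes> g)"
    using c assms(1) Cons by (simp add: m_assoc)
  finally show ?case using c assms(1) by (simp add: m_assoc)
qed (use assms(1) in simp)

lemma monom_closed:
  "(\<And>i. i \<in> {1..n} \<Longrightarrow> X i \<in> carrier A) \<Longrightarrow> monom_prod A n X \<alpha> \<in> carrier A"
  unfolding monom_prod_def by (intro list_prod_closed) auto

lemma monom_zero: "monom_prod A n X (\<lambda>_. 0) = \<one>"
proof -
  have "list_prod A (map (\<lambda>i. X i [^] (0::nat)) is) = \<one>" for "is" by (induction "is") auto
  then show ?thesis unfolding monom_prod_def by blast
qed

lemma intertwine_monom:
  assumes "g \<in> carrier A" "\<And>i. i \<in> {1..n} \<Longrightarrow> X i \<in> carrier A" "\<And>i. i \<in> {1..n} \<Longrightarrow> X' i \<in> carrier A"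
    "\<And>i. i \<in> {1..n} \<Longrightarrow> g \<otimes> X i = X' i \<otimes> g"
  shows "g \<otimes> monom_prod A n X \<alpha> = monom_prod A n X' \<alpha> \<otimes> g"
  unfolding monom_prod_def
  by (rule intertwine_list_prod) (use assms in \<open>auto intro!: intertwine_pow\<close>)

text \<open>The variable \<open>X (w i)\<close> carries the exponent \<open>\<alpha> i\<close>,
  which is the entry of \<open>place_perm w \<alpha>\<close> at \<open>w i\<close>; commuting
  variables may then be put back in their natural order.\<close>

lemma monom_reindex:
  assumes "w permutes {1..n}" "\<And>i. i \<in> {1..n} \<Longrightarrow> X i \<in> carrier A"
    "\<And>i j. i \<in> {1..n} \<Longrightarrow> j \<in> {1..n} \<Longrightarrow> X i \<otimes> X j = X j \<otimes> X i"
  shows "monom_prod A n (\<lambda>i. X (w i)) \<alpha> = monom_prod A n X (place_perm w \<alpha>)"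
proof -
  have e: "map (\<lambda>i. X (w i) [^] \<alpha> i) [1..<n + 1] = map (\<lambda>i. X (w i) [^] (place_perm w \<alpha> (w i))) [1..<n + 1]"
    using permutes_inverses(2)[OF assms(1)] by (simp add: place_perm_def)
  show ?thesis
    unfolding monom_prod_def e
    using assms by (intro list_prod_map_perm) (auto intro!: commute_pow)
qed

lemma monom_Suc:
  assumes "j \<in> {1..n}" "\<And>i. i \<in> {1..n} \<Longrightarrow> X i \<in> carrier A"
    "\<And>i j. i \<in> {1..n} \<Longrightarrow> j \<in> {1..n} \<Longrightarrow> X i \<otimes> X j = X j \<otimes> X i"
  shows "X j \<otimes> monom_prod A n X \<alpha> = monom_prod A n X (\<alpha>(j := Suc (\<alpha> j)))"
proof -
  have d: "distinct [1..<n+1]" "set [1..<n+1] = {1..n}" by auto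
  obtain xs ys where s: "[1..<n+1] = xs @ j # ys" using assms(1) d(2) by (metis split_list)
  have xy: "set xs \<subseteq> {1..n}" "set ys \<subseteq> {1..n}" "j \<notin> set xs" "j \<notin> set ys"
    using d s by (metis Un_iff insert_iff list.set(2) set_append subsetI) (metis Un_iff insert_iff list.set(2) set_append subsetI d(2) s, metis d(1) s distinct_append disjoint_iff list.set_intros(1), metis d(1) s distinct.simps(2) distinct_append)
  let ?m = "\<lambda>\<alpha> zs. map (\<lambda>i. X i [^] (\<alpha> i :: nat)) zs"
  have c: "set (?m \<alpha> zs) \<subseteq> carrier A" if "set zs \<subseteq> {1..n}" for zs \<alpha> using that assms(2) by auto
  note lc = list_prod_closed[OF c]
  have Xj: "X j \<in> carrier A" using assms by blast
  have m: "?m (\<alpha>(j := Suc (\<alpha> j))) xs = ?m \<alpha> xs" "?m (\<alpha>(j := Suc (\<alpha> j))) ys = ?m \<alpha> ys"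
    using xy by auto
  have cm: "X j \<otimes> list_prod A (?m \<alpha> xs) = list_prod A (?m \<alpha> xs) \<otimes> X j"
  proof (rule list_prod_commute[OF Xj c[OF xy(1)]])
    fix y assume "y \<in> set (?m \<alpha> xs)"
    then obtain i where "i \<in> set xs" "y = X i [^] \<alpha> i" by auto
    then show "X j \<otimes> y = y \<otimes> X j" using commute_pow[of "X j" "X i" 1 "\<alpha> i"] assms xy(1) Xj by (simp add: subset_iff)
  qed
  have "X j \<otimes> monom_prod A n X \<alpha> = X j \<otimes> (list_prod A (?m \<alpha> xs) \<otimes> (X j [^] \<alpha> j \<otimes> list_prod A (?m \<alpha> ys)))"
    unfolding monom_prod_def s using c xy Xj by (simp add: list_prod_append)
  also have "\<dots> = list_prod A (?m \<alpha> xs) \<otimes> (X j \<otimes> X j [^] \<alpha> j \<otimes> list_prod A (?m \<alpha> ys))"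
    using cm lc[OF xy(1)] lc[OF xy(2)] Xj by (simp add: m_assoc) (simp add: m_assoc[symmetric])
  also have "X j \<otimes> X j [^] \<alpha> j = X j [^] Suc (\<alpha> j)" using Xj by (simp add: nat_pow_Suc2[symmetric] del: nat_pow_Suc)
  also have "list_prod A (?m \<alpha> xs) \<otimes> (X j [^] Suc (\<alpha> j) \<otimes> list_prod A (?m \<alpha> ys)) = monom_prod A n X (\<alpha>(j := Suc (\<alpha> j)))"
    unfolding monom_prod_def s map_append list.map m fun_upd_same
    using c xy Xj by (simp add: list_prod_append del: nat_pow_Suc)
  finally show ?thesis .
qed

end

locale coxeter_elems = kalg +
  fixes n :: nat and s :: "nat \<Rightarrow> 'b"
  assumes s_closed: "i \<in> {1..<n} \<Longrightarrow> s i \<in> carrier A"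
    and s_quad: "i \<in> {1..<n} \<Longrightarrow> s i \<otimes> s i = \<one>"
    and s_braid: "i \<in> {1..<n} \<Longrightarrow> Suc i \<in> {1..<n} \<Longrightarrow> s i \<otimes> s (Suc i) \<otimes> s i = s (Suc i) \<otimes> s i \<otimes> s (Suc i)"
    and s_far: "i \<in> {1..<n} \<Longrightarrow> j \<in> {1..<n} \<Longrightarrow> Suc i < j \<Longrightarrow> s i \<otimes> s j = s j \<otimes> s i"
begin

lemma perm_elem_word_perm:
  "set is \<subseteq> {1..<n} \<Longrightarrow> perm_elem A s n (word_perm is) = list_prod A (map s is)"
  using s_closed s_quad s_braid s_far by (rule perm_elem_word)

lemma word_of_perm:
  assumes "w permutes {1..n}"
  obtains "is" where "set is \<subseteq> {1..<n}" "word_perm is = w"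
  using reduced_word_exists[OF assms] by (auto simp: perm_words_def)

lemma list_prod_s_closed: "set is \<subseteq> {1..<n} \<Longrightarrow> list_prod A (map s is) \<in> carrier A"
  using s_closed by (intro list_prod_closed) auto

lemma perm_elem_closed: "w permutes {1..n} \<Longrightarrow> perm_elem A s n w \<in> carrier A"
  by (metis word_of_perm perm_elem_word_perm list_prod_s_closed)

lemma perm_elem_id: "perm_elem A s n id = \<one>"
  using perm_elem_word_perm[of "[]"] by simp

lemma perm_elem_simple: "i \<in> {1..<n} \<Longrightarrow> perm_elem A s n (simple_refl i) = s i"
  using perm_elem_word_perm[of "[i]"] s_closed by simp

lemma perm_elem_mult:
  assumes "w permutes {1..n}" "v permutes {1..n}"
  shows "perm_elem A s n (w \<circ> v) = perm_elem A s n w \<otimes> perm_elem A s n v"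
proof -
  obtain xs where xs: "set xs \<subseteq> {1..<n}" "word_perm xs = w" using word_of_perm[OF assms(1)] .
  obtain ys where ys: "set ys \<subseteq> {1..<n}" "word_perm ys = v" using word_of_perm[OF assms(2)] .
  have "perm_elem A s n (word_perm (xs @ ys)) = list_prod A (map s (xs @ ys))"
    using xs ys by (intro perm_elem_word_perm) auto
  also have "\<dots> = perm_elem A s n (word_perm xs) \<otimes> perm_elem A s n (word_perm ys)"
    unfolding perm_elem_word_perm[OF xs(1)] perm_elem_word_perm[OF ys(1)] map_append
    using xs(1) ys(1) s_closed by (intro list_prod_append) auto
  finally show ?thesis using xs ys by (simp add: word_perm_append)
qed

end

section \<open>Idempotents of the torus\<close>

text \<open>Multiplication by a root \<open>z0\<close> with \<open>z0 ^ s \<noteq> 1\<close>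
  permutes the roots, so the sum equals \<open>z0 ^ s\<close> times itself and vanishes. Such a root
  exists because \<open>X^s - 1\<close> has at most \<open>s < r\<close> zeros, whereas there are
  \<open>r\<close> roots of unity.\<close>

lemma sum_roots_power:
  fixes \<zeta> :: "nat \<Rightarrow> 'k::field"
  assumes bij: "bij_betw \<zeta> {1..r} {z. z ^ r = 1}" and s: "s < r"
  shows "(\<Sum>a=1..r. \<zeta> a ^ s) = (if s = 0 then of_nat r else 0)"
proof (cases "s = 0")
  case False
  let ?Z = "{z::'k. z ^ r = 1}"
  have fin: "finite ?Z" "card ?Z = r" using bij_betw_finite[OF bij] bij_betw_same_card[OF bij] by auto
  have "\<exists>z\<in>?Z. z ^ s \<noteq> 1"
  proof (rule ccontr)
    assume "\<not> ?thesis"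
    then have sub: "?Z \<subseteq> {z. poly (monom 1 s - 1) z = 0}" by (auto simp: poly_monom)
    have d: "degree (monom (1::'k) s - 1) = s"
    proof -
      have "degree (monom (1::'k) s + (- 1)) = degree (monom (1::'k) s)"
        using False by (intro degree_add_eq_left) (auto simp: degree_monom_eq)
      then show ?thesis by (simp add: degree_monom_eq)
    qed
    then have nz: "monom (1::'k) s - 1 \<noteq> 0" using False by auto
    have "card ?Z \<le> card {z. poly (monom (1::'k) s - 1) z = 0}"
      by (rule card_mono[OF poly_roots_finite[OF nz] sub])
    also have "\<dots> \<le> s" using card_poly_roots_bound[OF nz] d by simp
    finally show False using fin s by simp
  qed
  then obtain z0 :: 'k where z0: "z0 ^ r = 1" "z0 ^ s \<noteq> 1" by blast
  have z00: "z0 \<noteq> 0" using z0(1) s by (metis power_0_left not_less_zero one_neq_zero)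
  have b: "bij_betw ((*) z0) ?Z ?Z"
    by (rule bij_betw_byWitness[where f' = "\<lambda>z. z / z0"]) (use z0 z00 in \<open>auto simp: power_mult_distrib power_divide\<close>)
  have "(\<Sum>z\<in>?Z. z ^ s) = (\<Sum>z\<in>?Z. (z0 * z) ^ s)"
    using sum.reindex_bij_betw[OF b, of "\<lambda>z. z ^ s"] by simp
  also have "\<dots> = z0 ^ s * (\<Sum>z\<in>?Z. z ^ s)" by (simp add: power_mult_distrib sum_distrib_left)
  finally have "(z0 ^ s - 1) * (\<Sum>z\<in>?Z. z ^ s) = 0" by (simp add: algebra_simps)
  then have "(\<Sum>z\<in>?Z. z ^ s) = 0" using z0 by simp
  moreover have "(\<Sum>a=1..r. \<zeta> a ^ s) = (\<Sum>z\<in>?Z. z ^ s)"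
    using sum.reindex_bij_betw[OF bij, of "\<lambda>z. z ^ s"] by simp
  ultimately show ?thesis using False by simp
qed simp

lemma sum_powers_root:
  fixes w :: "'k::field"
  assumes "w ^ r = 1"
  shows "(\<Sum>s<r. w ^ s) = (if w = 1 then of_nat r else 0)"
  using assms geometric_sum[of w r] by auto

text \<open>Separates the relations and the generation statement from the quotient construction; the
  idempotents and the spanning set are deduced from these alone.\<close>

locale yokonuma = kalg Y for Y :: "('k::field, 'a) module" (structure) +
  fixes r n :: nat and \<zeta> :: "nat \<Rightarrow> 'k" and t f x :: "nat \<Rightarrow> 'a"
  assumes r_pos: "1 \<le> r" and r_inv: "of_nat r \<noteq> (0::'k)" and roots: "bij_betw \<zeta> {1..r} {z. z ^ r = 1}"
    and t_closed [simp]: "\<And>i. i \<in> {1..n} \<Longrightarrow> t i \<in> carrier Y"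
    and f_closed [simp]: "\<And>i. i \<in> {1..<n} \<Longrightarrow> f i \<in> carrier Y"
    and x_closed [simp]: "\<And>i. i \<in> {1..n} \<Longrightarrow> x i \<in> carrier Y"
    and generated: "carrier Y = gen_subalg Y (t ` {1..n} \<union> f ` {1..<n} \<union> x ` {1..n})"
    and f_far: "\<And>i j. i \<in> {1..<n} \<Longrightarrow> j \<in> {1..<n} \<Longrightarrow> Suc i < j \<Longrightarrow> f i \<otimes> f j = f j \<otimes> f i"
    and f_braid: "\<And>i. i \<in> {1..<n} \<Longrightarrow> Suc i \<in> {1..<n} \<Longrightarrow> f i \<otimes> f (Suc i) \<otimes> f i = f (Suc i) \<otimes> f i \<otimes> f (Suc i)"
    and f_quad: "\<And>i. i \<in> {1..<n} \<Longrightarrow> f i \<otimes> f i = \<one>"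
    and t_comm: "\<And>i j. i \<in> {1..n} \<Longrightarrow> j \<in> {1..n} \<Longrightarrow> t i \<otimes> t j = t j \<otimes> t i"
    and f_t: "\<And>i j. i \<in> {1..<n} \<Longrightarrow> j \<in> {1..n} \<Longrightarrow> f i \<otimes> t j = t (simple_refl i j) \<otimes> f i"
    and t_pow: "\<And>i. i \<in> {1..n} \<Longrightarrow> t i [^] r = \<one>"
    and x_comm: "\<And>i j. i \<in> {1..n} \<Longrightarrow> j \<in> {1..n} \<Longrightarrow> x i \<otimes> x j = x j \<otimes> x i"
    and f_x_Suc: "\<And>i. i \<in> {1..<n} \<Longrightarrow> f i \<otimes> x (Suc i) = x i \<otimes> f i \<oplus>
        inverse (of_nat r) \<odot> (\<Oplus>s\<in>{..<r}. t i [^] s \<otimes> (t (Suc i) [^] (r - 1)) [^] s)"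
    and f_x_far: "\<And>i j. i \<in> {1..<n} \<Longrightarrow> j \<in> {1..n} \<Longrightarrow> j \<noteq> i \<Longrightarrow> j \<noteq> Suc i \<Longrightarrow> f i \<otimes> x j = x j \<otimes> f i"
    and t_x: "\<And>i j. i \<in> {1..n} \<Longrightarrow> j \<in> {1..n} \<Longrightarrow> t j \<otimes> x i = x i \<otimes> t j"
begin

text \<open>The inverse of \<open>t i\<close>, since \<open>t i [^] r = \<one>\<close>.\<close>

definition u :: "nat \<Rightarrow> 'a" where "u i = t i [^] (r - 1)"

text \<open>For a root of unity \<open>z\<close>, the projector onto the \<open>z\<close>-eigenspace
  of left multiplication by \<open>t i\<close>.\<close>

definition P :: "nat \<Rightarrow> 'k \<Rightarrow> 'a" where
  "P i z = inverse (of_nat r) \<odot> (\<Oplus>s\<in>{..<r}. (z ^ s) \<odot> (inv (t i [^] s)))"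

definition e :: "nat \<Rightarrow> 'a" where
  "e i = inverse (of_nat r) \<odot> (\<Oplus>s\<in>{..<r}. t i [^] s \<otimes> (t (Suc i) [^] (r - 1)) [^] s)"

text \<open>The idempotent \<open>E_chi\<close> in terms of the colouring of the character, so that
  it is available before any character is known to exist.\<close>

definition Ec :: "(nat \<Rightarrow> nat) \<Rightarrow> 'a" where
  "Ec c = list_prod Y (map (\<lambda>i. P i (\<zeta> (c i))) [1..<n + 1])"

abbreviation "Col \<equiv> colourings r n"

lemma u_closed [simp]: "i \<in> {1..n} \<Longrightarrow> u i \<in> carrier Y"
  by (simp add: u_def)

lemma t_u: "i \<in> {1..n} \<Longrightarrow> t i \<otimes> u i = \<one>" and u_t: "i \<in> {1..n} \<Longrightarrow> u i \<otimes> t i = \<one>"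
proof -
  assume i: "i \<in> {1..n}"
  have r: "Suc (r - 1) = r" using r_pos by simp
  show "u i \<otimes> t i = \<one>" using t_pow[OF i] nat_pow_Suc[of "t i" "r - 1"] unfolding r u_def by simp
  show "t i \<otimes> u i = \<one>" using t_pow[OF i] nat_pow_Suc2[of "t i" "r - 1"] i unfolding r u_def by simp
qed

lemma inv_t_pow:
  assumes i: "i \<in> {1..n}" shows "inv (t i [^] (s::nat)) = u i [^] s"
proof -
  have "t i [^] s \<otimes> u i [^] s = \<one>"
  proof (induction s)
    case (Suc s)
    have "t i [^] s \<otimes> t i \<otimes> (u i [^] s \<otimes> u i) = t i [^] s \<otimes> (t i \<otimes> u i) \<otimes> u i [^] s"
      using i by (simp add: m_assoc nat_pow_Suc2[symmetric] del: nat_pow_Suc)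
    then show ?case using Suc i t_u by simp
  qed simp
  moreover from this have "u i [^] s \<otimes> t i [^] s = \<one>"
    using i commute_pow[of "t i" "u i" s s] t_u u_t by simp
  ultimately show ?thesis using i by (intro inv_char) auto
qed

lemma P_eq: "i \<in> {1..n} \<Longrightarrow> P i z = inverse (of_nat r) \<odot> (\<Oplus>s\<in>{..<r}. (z ^ s) \<odot> (u i [^] s))"
  unfolding P_def by (simp add: inv_t_pow)

lemma P_closed [simp]: "i \<in> {1..n} \<Longrightarrow> P i z \<in> carrier Y"
  by (simp add: P_eq finsum_closed)

lemma zeta_root: "a \<in> {1..r} \<Longrightarrow> \<zeta> a ^ r = 1"
  using roots by (auto simp: bij_betw_def)

lemma zeta_nonzero: "a \<in> {1..r} \<Longrightarrow> \<zeta> a \<noteq> 0"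
  using zeta_root r_pos by (metis not_one_le_zero power_0_left zero_neq_one)

lemma zeta_inj: "a \<in> {1..r} \<Longrightarrow> b \<in> {1..r} \<Longrightarrow> \<zeta> a = \<zeta> b \<longleftrightarrow> a = b"
  using bij_betw_imp_inj_on[OF roots] by (metis inj_on_eq_iff)

text \<open>The sum is cyclic: multiplication by \<open>z \<odot> u i\<close> shifts the index by
  one, and the term for \<open>r\<close> equals the term for \<open>0\<close>.\<close>

lemma t_P:
  assumes i: "i \<in> {1..n}" and z: "z ^ r = 1"
  shows "t i \<otimes> P i z = z \<odot> P i z"
proof -
  have z0: "z \<noteq> 0" using z r_pos by (metis not_one_le_zero power_0_left zero_neq_one)
  define v where "v s = (z ^ s) \<odot> (u i [^] s)" for s :: nat
  have vc: "v s \<in> carrier Y" for s using i by (simp add: v_def)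
  define S where "S = (\<Oplus>s\<in>{..<r}. v s)"
  have Sc: "S \<in> carrier Y" using vc by (simp add: S_def finsum_closed)
  have ur: "u i [^] r = \<one>" using i t_pow by (simp add: u_def nat_pow_pow mult.commute nat_pow_pow[symmetric])
  have "(\<Oplus>s\<in>{..<Suc r}. v s) = v r \<oplus> S"
    unfolding S_def using vc by (simp add: lessThan_Suc finsum_insert)
  moreover have "(\<Oplus>s\<in>{..<Suc r}. v s) = v 0 \<oplus> (\<Oplus>s\<in>{..<r}. v (Suc s))"
    using vc unfolding lessThan_Suc_eq_insert_0 by (subst finsum_insert) (auto simp: finsum_reindex)
  moreover have "v r = v 0" using z ur by (simp add: v_def)
  ultimately have sh: "S = (\<Oplus>s\<in>{..<r}. v (Suc s))"
    using Sc vc by (simp add: finsum_closed)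
  have "(z \<odot> u i) \<otimes> S = (\<Oplus>s\<in>{..<r}. (z \<odot> u i) \<otimes> v s)"
    unfolding S_def using vc i by (intro finsum_rdistr) auto
  also have "\<dots> = (\<Oplus>s\<in>{..<r}. v (Suc s))"
    using i by (intro finsum_cong') (auto simp: v_def smult_mult_l smult_mult_r smult_smult mult.commute nat_pow_Suc2[symmetric] simp del: nat_pow_Suc)
  finally have zS: "(z \<odot> u i) \<otimes> S = S" using sh by simp
  have "z \<odot> S = z \<odot> (t i \<otimes> u i \<otimes> S)" using t_u i Sc by simp
  also have "\<dots> = t i \<otimes> ((z \<odot> u i) \<otimes> S)" using i Sc by (simp add: m_assoc smult_mult_l smult_mult_r)
  finally have "t i \<otimes> S = z \<odot> S" using zS by simp
  moreover have "P i z = inverse (of_nat r) \<odot> S" using i by (simp add: P_eq S_def v_def)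
  ultimately show ?thesis using i Sc by (simp add: smult_mult_r smult_smult mult.commute)
qed

lemma u_eigen:
  assumes i: "i \<in> {1..n}" and y: "y \<in> carrier Y" and z: "z \<noteq> 0" and ty: "t i \<otimes> y = z \<odot> y"
  shows "u i [^] (s::nat) \<otimes> y = (inverse z ^ s) \<odot> y"
proof (induction s)
  case (Suc s)
  have "u i \<otimes> (t i \<otimes> y) = y" using i y u_t by (simp add: m_assoc[symmetric])
  then have "u i \<otimes> (inverse z \<odot> (z \<odot> y)) = inverse z \<odot> y" using ty i y by (simp add: smult_mult_r)
  then have uy: "u i \<otimes> y = inverse z \<odot> y" using y z by (simp add: smult_smult)
  have "u i [^] Suc s \<otimes> y = u i [^] s \<otimes> (u i \<otimes> y)" using i y by (simp add: m_assoc)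
  then show ?case using Suc uy i y by (simp add: smult_mult_r smult_smult mult.commute)
qed (use y in simp)

text \<open>On an eigenvector the projector becomes the average of the powers of
  \<open>z' / z\<close>, a geometric sum equal to 1 or 0.\<close>

lemma P_eigen:
  assumes i: "i \<in> {1..n}" and y: "y \<in> carrier Y" and z: "z ^ r = 1" and z': "z' ^ r = 1" and ty: "t i \<otimes> y = z \<odot> y"
  shows "P i z' \<otimes> y = (if z = z' then y else \<zero>)"
proof -
  have z0: "z \<noteq> 0" using z r_pos by (metis not_one_le_zero power_0_left zero_neq_one)
  have "(\<Oplus>s\<in>{..<r}. (z' ^ s) \<odot> (u i [^] s)) \<otimes> y = (\<Oplus>s\<in>{..<r}. ((z' ^ s) \<odot> (u i [^] s)) \<otimes> y)"
    using i y by (intro finsum_ldistr) auto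
  also have "\<dots> = (\<Oplus>s\<in>{..<r}. ((z' / z) ^ s) \<odot> y)"
    using i y u_eigen[OF i y z0 ty] by (intro finsum_cong') (auto simp: smult_mult_l smult_smult power_mult_distrib divide_inverse)
  also have "\<dots> = (\<Sum>s<r. (z' / z) ^ s) \<odot> y" using y by (rule sum_smult[symmetric])
  also have "\<dots> = (if z = z' then of_nat r else 0) \<odot> y"
    using sum_powers_root[of "z' / z" r] z z' z0 by (simp add: power_divide)
  finally show ?thesis using i y r_inv by (simp add: P_eq smult_mult_l finsum_closed smult_smult)
qed

text \<open>After the two sums are exchanged, orthogonality of the roots of unity leaves only the
  term \<open>s = 0\<close>.\<close>

lemma sum_P:
  assumes i: "i \<in> {1..n}" shows "(\<Oplus>a\<in>{1..r}. P i (\<zeta> a)) = \<one>"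
proof -
  have "(\<Oplus>a\<in>{1..r}. P i (\<zeta> a)) = inverse (of_nat r) \<odot> (\<Oplus>a\<in>{1..r}. \<Oplus>s\<in>{..<r}. (\<zeta> a ^ s) \<odot> (u i [^] s))"
    using i by (subst finsum_smult) (auto simp: P_eq finsum_closed intro!: finsum_cong')
  also have "(\<Oplus>a\<in>{1..r}. \<Oplus>s\<in>{..<r}. (\<zeta> a ^ s) \<odot> (u i [^] s)) = (\<Oplus>s\<in>{..<r}. \<Oplus>a\<in>{1..r}. (\<zeta> a ^ s) \<odot> (u i [^] s))"
    using i by (intro finsum_swap) auto
  also have "\<dots> = (\<Oplus>s\<in>{..<r}. if s = 0 then of_nat r \<odot> \<one> else \<zero>)"
    using i by (intro finsum_cong') (auto simp: sum_smult[symmetric] sum_roots_power[OF roots] simp del: One_nat_def)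
  also have "\<dots> = of_nat r \<odot> \<one>" using r_pos by (intro finsum_single) auto
  finally show ?thesis using r_inv by (simp add: smult_smult)
qed

lemma P_commute:
  assumes i: "i \<in> {1..n}" and y: "y \<in> carrier Y" and "y \<otimes> t i = t i \<otimes> y"
  shows "y \<otimes> P i z = P i z \<otimes> y"
proof -
  have "y \<otimes> u i [^] s = u i [^] s \<otimes> y" for s :: nat
    using commute_pow[of y "t i" 1 "(r - 1) * s"] assms by (simp add: u_def nat_pow_pow)
  then have "y \<otimes> (\<Oplus>s\<in>{..<r}. (z ^ s) \<odot> (u i [^] s)) = (\<Oplus>s\<in>{..<r}. (z ^ s) \<odot> (u i [^] s)) \<otimes> y"
    using i y by (intro commute_finsum) (auto simp: smult_mult_l smult_mult_r)
  then show ?thesis using i y by (simp add: P_eq smult_mult_l smult_mult_r finsum_closed)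
qed

lemma P_P_commute: "i \<in> {1..n} \<Longrightarrow> j \<in> {1..n} \<Longrightarrow> P i z \<otimes> P j z' = P j z' \<otimes> P i z"
  by (intro P_commute) (auto simp: P_commute t_comm)

lemma Ec_closed [simp]: "Ec c \<in> carrier Y"
  unfolding Ec_def by (intro list_prod_closed) auto

lemma t_Ec:
  assumes j: "j \<in> {1..n}" and c: "c \<in> Col"
  shows "t j \<otimes> Ec c = \<zeta> (c j) \<odot> Ec c"
proof -
  let ?xs = "map (\<lambda>i. P i (\<zeta> (c i))) [1..<n + 1]"
  have cl: "set ?xs \<subseteq> carrier Y" by auto
  have mem: "P j (\<zeta> (c j)) \<in> set ?xs" using j by (auto simp del: upt_Suc)
  have "list_prod Y ?xs = P j (\<zeta> (c j)) \<otimes> list_prod Y (remove1 (P j (\<zeta> (c j))) ?xs)"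
    by (rule list_prod_remove1[OF cl _ mem]) (auto simp: P_P_commute simp del: upt_Suc)
  moreover have "list_prod Y (remove1 (P j (\<zeta> (c j))) ?xs) \<in> carrier Y"
    using order_trans[OF set_remove1_subset cl] by (rule list_prod_closed)
  moreover have "\<zeta> (c j) ^ r = 1" using c j by (intro zeta_root) (auto simp: colourings_def)
  ultimately show ?thesis unfolding Ec_def using j t_P[OF j, of "\<zeta> (c j)"]
    by (simp add: m_assoc[symmetric] smult_mult_l del: upt_Suc)
qed

definition eigen :: "(nat \<Rightarrow> nat) \<Rightarrow> 'a \<Rightarrow> bool" where
  "eigen c y \<longleftrightarrow> y \<in> carrier Y \<and> (\<forall>j\<in>{1..n}. t j \<otimes> y = \<zeta> (c j) \<odot> y)"

lemma eigen_Ec: "c \<in> Col \<Longrightarrow> eigen c (Ec c)"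
  by (simp add: eigen_def t_Ec)

lemma eigen_mult: "eigen c y \<Longrightarrow> z \<in> carrier Y \<Longrightarrow> eigen c (y \<otimes> z)"
  by (auto simp: eigen_def m_assoc[symmetric] smult_mult_l)

text \<open>Every factor of \<open>Ec d\<close> either fixes \<open>y\<close> or kills it, and all
  of them fix it exactly when the colours agree at every place.\<close>

lemma Ec_eigen:
  assumes c: "c \<in> Col" and d: "d \<in> Col" and y: "eigen c y"
  shows "Ec d \<otimes> y = (if c = d then y else \<zero>)"
proof -
  have cr: "c j \<in> {1..r}" "d j \<in> {1..r}" if "j \<in> {1..n}" for j using c d that by (auto simp: colourings_def)
  have yc: "y \<in> carrier Y" using y by (simp add: eigen_def)
  have P: "P j (\<zeta> (d j)) \<otimes> y = (if c j = d j then y else \<zero>)" if "j \<in> {1..n}" for j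
    using that y cr[OF that] by (subst P_eigen[of j y "\<zeta> (c j)"]) (auto simp: zeta_root zeta_inj eigen_def)
  have L: "list_prod Y (map (\<lambda>i. P i (\<zeta> (d i))) is) \<otimes> y = (if \<forall>j\<in>set is. c j = d j then y else \<zero>)"
    if "set is \<subseteq> {1..n}" for "is"
    using that
  proof (induction "is")
    case (Cons i "is")
    have "list_prod Y (map (\<lambda>i. P i (\<zeta> (d i))) is) \<in> carrier Y"
      using Cons.prems by (intro list_prod_closed) auto
    then show ?case using Cons P[of i] yc by (auto simp: m_assoc)
  qed (use yc in simp)
  have s: "set [1..<n+1] = {1..n}" by auto
  then have "(\<forall>j\<in>set [1..<n+1]. c j = d j) \<longleftrightarrow> c = d" using colourings_ext[OF c d] by metis
  then show ?thesis unfolding Ec_def using L[of "[1..<n+1]", OF equalityD1[OF s]] by (simp del: upt_Suc)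
qed

lemma Ec_Ec: "c \<in> Col \<Longrightarrow> d \<in> Col \<Longrightarrow> Ec d \<otimes> Ec c = (if c = d then Ec c else \<zero>)"
  using Ec_eigen eigen_Ec by blast

text \<open>Rather than expanding the product of the partitions of unity \<open>sum_P\<close> over
  all places, the proof inserts them one after another: if \<open>D\<close> fixes every
  \<open>?L c is \<otimes> y\<close>, then it fixes \<open>y\<close>, by induction on the list of
  places.\<close>

lemma sum_Ec: "(\<Oplus>c\<in>Col. Ec c) = \<one>"
proof -
  define D where "D = (\<Oplus>c\<in>Col. Ec c)"
  have Dc: "D \<in> carrier Y" by (simp add: D_def finsum_closed)
  have DE: "D \<otimes> Ec c = Ec c" if "c \<in> Col" for c
  proof -
    have "D \<otimes> Ec c = (\<Oplus>d\<in>Col. Ec d \<otimes> Ec c)" unfolding D_def by (intro finsum_ldistr) (auto simp: finite_colourings)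
    also have "\<dots> = (\<Oplus>d\<in>Col. if d = c then Ec c else \<zero>)"
      by (intro finsum_cong') (use that in \<open>auto simp: Ec_Ec\<close>)
    also have "\<dots> = Ec c" using that by (intro finsum_single finite_colourings) auto
    finally show ?thesis .
  qed
  let ?L = "\<lambda>c is. list_prod Y (map (\<lambda>i. P i (\<zeta> (c i))) is)"
  have Lc: "?L c is \<in> carrier Y" if "set is \<subseteq> {1..n}" for c "is"
    using that by (intro list_prod_closed) auto
  have main: "D \<otimes> y = y" if "distinct is" "set is \<subseteq> {1..n}" "y \<in> carrier Y"
      "\<And>c. c \<in> Col \<Longrightarrow> D \<otimes> (?L c is \<otimes> y) = ?L c is \<otimes> y" for "is" y
    using that
  proof (induction "is" arbitrary: y)
    case Nil
    \<comment> \<open>With no factors left the hypothesis says the same for every colouring, so any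
      one witness will do; colour 1 exists because \<open>1 \<le> r\<close>.\<close>
    have "(\<lambda>j. if j \<in> {1..n} then 1 else 0) \<in> Col" using r_pos by (auto simp: colourings_def)
    then show ?case using Nil by force
  next
    case (Cons i "is")
    have i: "i \<in> {1..n}" "i \<notin> set is" "set is \<subseteq> {1..n}" using Cons.prems by auto
    have ya: "D \<otimes> (P i (\<zeta> a) \<otimes> y) = P i (\<zeta> a) \<otimes> y" if a: "a \<in> {1..r}" for a
    proof (rule Cons.IH)
      fix c assume c: "c \<in> Col"
      \<comment> \<open>Recolouring place \<open>i\<close> by \<open>a\<close> absorbs the extra
        factor \<open>P i (\<zeta> a)\<close> into the product over \<open>i # is\<close>.\<close>
      have c': "c(i := a) \<in> Col" using c a i by (auto simp: colourings_def)
      have L': "?L (c(i := a)) is = ?L c is" using i by (intro arg_cong[of _ _ "list_prod Y"] map_cong) auto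
      have cm: "P i (\<zeta> a) \<otimes> ?L c is = ?L c is \<otimes> P i (\<zeta> a)"
        using i by (intro list_prod_commute) (auto simp: P_P_commute subset_iff)
      have "?L c is \<otimes> (P i (\<zeta> a) \<otimes> y) = P i (\<zeta> a) \<otimes> ?L c is \<otimes> y"
        using cm i Lc[of "is" c] Cons.prems(3) by (simp add: m_assoc)
      also have "\<dots> = ?L (c(i := a)) (i # is) \<otimes> y" using L' i by simp
      finally show "D \<otimes> (?L c is \<otimes> (P i (\<zeta> a) \<otimes> y)) = ?L c is \<otimes> (P i (\<zeta> a) \<otimes> y)"
        using Cons.prems(4)[OF c'] by simp
    qed (use Cons.prems i in auto)
    have "y = (\<Oplus>a\<in>{1..r}. P i (\<zeta> a)) \<otimes> y" using sum_P[OF i(1)] Cons.prems by simp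
    also have "\<dots> = (\<Oplus>a\<in>{1..r}. P i (\<zeta> a) \<otimes> y)" using i Cons.prems by (intro finsum_ldistr) auto
    finally have y: "y = (\<Oplus>a\<in>{1..r}. P i (\<zeta> a) \<otimes> y)" .
    have "D \<otimes> (\<Oplus>a\<in>{1..r}. P i (\<zeta> a) \<otimes> y) = (\<Oplus>a\<in>{1..r}. D \<otimes> (P i (\<zeta> a) \<otimes> y))"
      using i Cons.prems Dc by (intro finsum_rdistr) auto
    also have "\<dots> = (\<Oplus>a\<in>{1..r}. P i (\<zeta> a) \<otimes> y)" using ya i Cons.prems by (intro finsum_cong') auto
    finally show ?case using y by simp
  qed
  have "D \<otimes> \<one> = \<one>"
  proof (rule main[of "[1..<n+1]"])
    show "D \<otimes> (?L c [1..<n+1] \<otimes> \<one>) = ?L c [1..<n+1] \<otimes> \<one>" if "c \<in> Col" for c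
      using DE[OF that] unfolding Ec_def[symmetric] by simp
  qed auto
  then show ?thesis using Dc by (simp add: D_def)
qed

lemma eq_by_Ec:
  assumes "y \<in> carrier Y" "z \<in> carrier Y" "\<And>c. c \<in> Col \<Longrightarrow> y \<otimes> Ec c = z \<otimes> Ec c"
  shows "y = z"
proof -
  have "y = y \<otimes> (\<Oplus>c\<in>Col. Ec c)" using assms by (simp add: sum_Ec)
  also have "\<dots> = (\<Oplus>c\<in>Col. y \<otimes> Ec c)" using assms by (intro finsum_rdistr finite_colourings) auto
  also have "\<dots> = (\<Oplus>c\<in>Col. z \<otimes> Ec c)" using assms by (intro finsum_cong') auto
  also have "\<dots> = z \<otimes> (\<Oplus>c\<in>Col. Ec c)" using assms by (intro finsum_rdistr[symmetric] finite_colourings) auto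
  finally show ?thesis using assms by (simp add: sum_Ec)
qed

text \<open>An element that permutes the \<open>t j\<close> permutes their joint eigenspaces, so
  \<open>y \<otimes> Ec d\<close> is an eigenvector with the transported colours. Comparing both
  sides on every \<open>Ec d\<close> suffices, as these sum to 1. The rules for \<open>x\<close>,
  \<open>f\<close> and all \<open>f_w\<close> are instances.\<close>

lemma twist_Ec:
  assumes w: "w permutes {1..n}" and y: "y \<in> carrier Y"
    and ty: "\<And>j. j \<in> {1..n} \<Longrightarrow> t (w j) \<otimes> y = y \<otimes> t j" and c: "c \<in> Col"
  shows "y \<otimes> Ec c = Ec (c \<circ> pinv w) \<otimes> y"
proof -
  note wi = pinv_simps[OF w]
  have ei: "eigen (d \<circ> pinv w) (y \<otimes> Ec d)" if d: "d \<in> Col" for d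
    unfolding eigen_def
  proof (intro conjI ballI)
    fix j assume j: "j \<in> {1..n}"
    have "t j \<otimes> (y \<otimes> Ec d) = t (w (pinv w j)) \<otimes> y \<otimes> Ec d" using j y wi(1) by (simp add: m_assoc)
    also have "\<dots> = y \<otimes> (t (pinv w j) \<otimes> Ec d)" using ty[OF wi(6)[OF j]] y wi(6)[OF j] by (simp add: m_assoc)
    also have "\<dots> = \<zeta> ((d \<circ> pinv w) j) \<odot> (y \<otimes> Ec d)" using t_Ec[OF wi(6)[OF j] d] y by (simp add: smult_mult_r)
    finally show "t j \<otimes> (y \<otimes> Ec d) = \<zeta> ((d \<circ> pinv w) j) \<odot> (y \<otimes> Ec d)" .
  qed (use y in simp)
  show ?thesis
  proof (rule eq_by_Ec)
    fix d assume d: "d \<in> Col"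
    note cp = colourings_perm[OF w c] and dp = colourings_perm[OF w d]
    have "d \<circ> pinv w = c \<circ> pinv w \<longleftrightarrow> d = c" using wi by (metis comp_assoc comp_id)
    then have "Ec (c \<circ> pinv w) \<otimes> (y \<otimes> Ec d) = (if d = c then y \<otimes> Ec d else \<zero>)"
      using Ec_eigen[OF dp cp ei[OF d]] by simp
    moreover have "y \<otimes> Ec c \<otimes> Ec d = (if d = c then y \<otimes> Ec d else \<zero>)"
      using Ec_Ec[OF d c] y by (auto simp: m_assoc)
    ultimately show "y \<otimes> Ec c \<otimes> Ec d = Ec (c \<circ> pinv w) \<otimes> y \<otimes> Ec d" using y by (simp add: m_assoc)
  qed (use y in auto)
qed

lemma x_Ec: "i \<in> {1..n} \<Longrightarrow> c \<in> Col \<Longrightarrow> x i \<otimes> Ec c = Ec c \<otimes> x i"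
  using twist_Ec[of id "x i" c] by (simp add: permutes_id t_x inv_id)

lemma f_Ec: "i \<in> {1..<n} \<Longrightarrow> c \<in> Col \<Longrightarrow> f i \<otimes> Ec c = Ec (c \<circ> simple_refl i) \<otimes> f i"
  using twist_Ec[OF simple_refl_permutes, of i "f i" c] by (simp add: f_t)

lemma e_closed [simp]: "i \<in> {1..<n} \<Longrightarrow> e i \<in> carrier Y"
  unfolding e_def by (intro smult_closed finsum_closed) auto

lemma f_x_e: "i \<in> {1..<n} \<Longrightarrow> f i \<otimes> x (Suc i) = x i \<otimes> f i \<oplus> e i"
  using f_x_Suc by (simp add: e_def)

text \<open>On a joint eigenvector \<open>e i\<close> is the average of the powers of
  \<open>\<zeta> (c i) / \<zeta> (c (Suc i))\<close>, so it detects whether the two colours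
  agree.\<close>

lemma e_eigen:
  assumes i: "i \<in> {1..<n}" and c: "c \<in> Col" and y: "eigen c y"
  shows "e i \<otimes> y = (if c i = c (Suc i) then y else \<zero>)"
proof -
  have i': "i \<in> {1..n}" "Suc i \<in> {1..n}" using i by auto
  have yc: "y \<in> carrier Y" using y by (simp add: eigen_def)
  have cr: "c i \<in> {1..r}" "c (Suc i) \<in> {1..r}" using c i' by (auto simp: colourings_def)
  let ?z = "\<zeta> (c i)" and ?z' = "\<zeta> (c (Suc i))"
  have tp: "t i [^] s \<otimes> y = (?z ^ s) \<odot> y" for s :: nat
  proof (induction s)
    case (Suc s)
    then show ?case using i'(1) yc y by (simp add: m_assoc eigen_def smult_mult_r smult_smult mult.commute)
  qed (use yc in simp)
  have up: "u (Suc i) [^] s \<otimes> y = (inverse ?z' ^ s) \<odot> y" for s :: nat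
    using u_eigen[OF i'(2) yc zeta_nonzero[OF cr(2)]] y i' by (simp add: eigen_def)
  have "(\<Oplus>s\<in>{..<r}. t i [^] s \<otimes> u (Suc i) [^] s) \<otimes> y = (\<Oplus>s\<in>{..<r}. t i [^] s \<otimes> u (Suc i) [^] s \<otimes> y)"
    using i' yc by (intro finsum_ldistr) auto
  also have "\<dots> = (\<Oplus>s\<in>{..<r}. ((?z / ?z') ^ s) \<odot> y)"
    using i' yc by (intro finsum_cong') (auto simp: m_assoc up tp smult_mult_r smult_smult power_mult_distrib divide_inverse mult.commute)
  also have "\<dots> = (\<Sum>s<r. (?z / ?z') ^ s) \<odot> y" using yc by (rule sum_smult[symmetric])
  also have "(\<Sum>s<r. (?z / ?z') ^ s) = (if c i = c (Suc i) then of_nat r else 0)"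
  proof -
    have "(?z / ?z') ^ r = 1" using zeta_root[OF cr(1)] zeta_root[OF cr(2)] by (simp add: power_divide)
    moreover have "?z / ?z' = 1 \<longleftrightarrow> c i = c (Suc i)" using zeta_inj[OF cr] zeta_nonzero[OF cr(2)] by simp
    ultimately show ?thesis using sum_powers_root[of "?z / ?z'" r] by simp
  qed
  finally have S: "(\<Oplus>s\<in>{..<r}. t i [^] s \<otimes> u (Suc i) [^] s) \<otimes> y = (if c i = c (Suc i) then of_nat r else 0) \<odot> y" .
  have "(\<Oplus>s\<in>{..<r}. t i [^] s \<otimes> u (Suc i) [^] s) \<in> carrier Y" using i' by (intro finsum_closed) auto
  moreover have "e i = inverse (of_nat r) \<odot> (\<Oplus>s\<in>{..<r}. t i [^] s \<otimes> u (Suc i) [^] s)"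
    unfolding e_def u_def ..
  ultimately show ?thesis using yc r_inv S by (simp add: smult_mult_l smult_smult)
qed

text \<open>\<open>f i\<close> exchanges the colours at \<open>i\<close> and \<open>Suc i\<close>,
  which does not affect whether they agree, and this is all that \<open>e i\<close> detects.\<close>

lemma f_e: "i \<in> {1..<n} \<Longrightarrow> f i \<otimes> e i = e i \<otimes> f i"
proof (rule eq_by_Ec)
  fix c assume i: "i \<in> {1..<n}" and c: "c \<in> Col"
  have c': "c \<circ> simple_refl i \<in> Col" using colourings_perm[OF simple_refl_permutes[OF i] c] by simp
  have "e i \<otimes> (f i \<otimes> Ec c) = (if c i = c (Suc i) then f i \<otimes> Ec c else \<zero>)"
    using e_eigen[OF i c' eigen_mult[OF eigen_Ec[OF c'], of "f i"]] i by (auto simp: f_Ec[OF i c])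
  then show "f i \<otimes> e i \<otimes> Ec c = e i \<otimes> f i \<otimes> Ec c"
    using e_eigen[OF i c eigen_Ec[OF c]] i by (auto simp: m_assoc)
qed auto

text \<open>Conjugating the relation for \<open>x (Suc i)\<close> by the involution
  \<open>f i\<close>, which commutes with \<open>e i\<close>, gives the relation for
  \<open>x i\<close>.\<close>

lemma f_x: "i \<in> {1..<n} \<Longrightarrow> f i \<otimes> x i = x (Suc i) \<otimes> f i \<ominus> e i"
proof -
  assume i: "i \<in> {1..<n}"
  have i': "i \<in> {1..n}" "Suc i \<in> {1..n}" using i by auto
  have "f i \<otimes> (f i \<otimes> x (Suc i)) \<otimes> f i = f i \<otimes> (x i \<otimes> f i \<oplus> e i) \<otimes> f i" using f_x_e[OF i] by simp
  moreover have "f i \<otimes> (f i \<otimes> x (Suc i)) \<otimes> f i = x (Suc i) \<otimes> f i" using i i' f_quad[OF i] by (simp add: m_assoc[symmetric])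
  moreover have "f i \<otimes> (x i \<otimes> f i \<oplus> e i) \<otimes> f i = f i \<otimes> x i \<otimes> (f i \<otimes> f i) \<oplus> e i \<otimes> (f i \<otimes> f i)"
    using i i' f_e[OF i] by (simp add: r_distr l_distr m_assoc)
  ultimately have "x (Suc i) \<otimes> f i = f i \<otimes> x i \<oplus> e i" using i i' f_quad[OF i] by simp
  then show ?thesis using i i' by (simp add: minus_eq a_assoc r_neg)
qed

end

section \<open>Spanning set of the Yokonuma--Hecke algebra\<close>

context yokonuma
begin

sublocale F: coxeter_elems Y n f
  by unfold_locales (use f_quad f_braid f_far in auto)

abbreviation "fw \<equiv> perm_elem Y f n"
abbreviation "xm \<equiv> monom_prod Y n x"

lemmas fw_closed [simp] = F.perm_elem_closed

lemma xm_closed [simp]: "xm \<alpha> \<in> carrier Y"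
  by (rule monom_closed) simp

lemma fw_step: "i \<in> {1..<n} \<Longrightarrow> w permutes {1..n} \<Longrightarrow> fw (simple_refl i \<circ> w) = f i \<otimes> fw w"
  using F.perm_elem_mult[OF simple_refl_permutes, of i w] by (simp add: F.perm_elem_simple)

lemma t_fw:
  assumes "w permutes {1..n}" shows "\<forall>j\<in>{1..n}. t (w j) \<otimes> fw w = fw w \<otimes> t j"
  using assms
proof (induction w rule: permutes_ascent_induct)
  case id
  show ?case unfolding F.perm_elem_id by simp
next
  case (step i w)
  show ?case
  proof
    fix j assume j: "j \<in> {1..n}"
    have wj: "w j \<in> {1..n}" using pinv_simps(5)[OF step(2) j] .
    have swj: "simple_refl i (w j) \<in> {1..n}" using pinv_simps(5)[OF simple_refl_permutes[OF step(1)] wj] .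
    have "t (simple_refl i (w j)) \<otimes> (f i \<otimes> fw w) = f i \<otimes> t (w j) \<otimes> fw w"
      using f_t[OF step(1) wj] step(1,2) swj wj by (simp add: m_assoc[symmetric])
    also have "\<dots> = f i \<otimes> (fw w \<otimes> t j)" using step wj j by (simp add: m_assoc)
    finally show "t ((simple_refl i \<circ> w) j) \<otimes> fw (simple_refl i \<circ> w) = fw (simple_refl i \<circ> w) \<otimes> t j"
      using step(1,2) j unfolding fw_step[OF step(1,2)] by (simp add: m_assoc)
  qed
qed

lemma fw_Ec: "w permutes {1..n} \<Longrightarrow> c \<in> Col \<Longrightarrow> fw w \<otimes> Ec c = Ec (c \<circ> pinv w) \<otimes> fw w"
  using t_fw by (intro twist_Ec) auto

lemma xm_Ec: "c \<in> Col \<Longrightarrow> Ec c \<otimes> xm \<alpha> = xm \<alpha> \<otimes> Ec c"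
  by (rule intertwine_monom) (auto simp: x_Ec)

text \<open>The correction term carries a factor \<open>e i\<close>, which acts by zero where the
  two colours differ; what remains of the relations is a mere permutation of the
  \<open>x\<close>.\<close>

lemma f_x_eigen:
  assumes i: "i \<in> {1..<n}" and c: "c \<in> Col" "c i \<noteq> c (Suc i)" and y: "eigen c y" and k: "k \<in> {1..n}"
  shows "f i \<otimes> (x k \<otimes> y) = x (simple_refl i k) \<otimes> (f i \<otimes> y)"
proof -
  have i': "i \<in> {1..n}" "Suc i \<in> {1..n}" using i by auto
  have yc: "y \<in> carrier Y" using y by (simp add: eigen_def)
  have ey: "e i \<otimes> y = \<zero>" using e_eigen[OF i c(1) y] c(2) by simp
  have "f i \<otimes> x k \<otimes> y = x (simple_refl i k) \<otimes> f i \<otimes> y"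
  proof (cases "k = i \<or> k = Suc i")
    case True
    then show ?thesis
    proof
      assume "k = i"
      then show ?thesis using f_x[OF i] i i' yc ey by (simp add: minus_eq l_distr l_minus)
    next
      assume "k = Suc i"
      then show ?thesis using f_x_e[OF i] i i' yc ey by (simp add: l_distr)
    qed
  next
    case False
    then show ?thesis using f_x_far[OF i k] by (simp add: Transposition.transpose_def)
  qed
  moreover have "simple_refl i k \<in> {1..n}" using pinv_simps(5)[OF simple_refl_permutes[OF i] k] .
  ultimately show ?thesis using i k yc by (simp add: m_assoc)
qed

text \<open>
  Where the relation \<open>f\<^sub>i x\<^sub>i\<^sub>+\<^sub>1 = x\<^sub>i f\<^sub>i + e\<^sub>i\<close> is applied along a reduced word of \<open>w\<close>, the two colours that are
  exchanged differ, so the term \<open>e\<^sub>i\<close> is killed by the idempotent.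
\<close>

lemma fw_x_Ec:
  assumes "w permutes {1..n}"
  shows "\<forall>c\<in>Col. (\<forall>i j. i \<in> {1..n} \<longrightarrow> j \<in> {1..n} \<longrightarrow> i < j \<longrightarrow> c i = c j \<longrightarrow> w i < w j) \<longrightarrow>
     (\<forall>k\<in>{1..n}. fw w \<otimes> (x k \<otimes> Ec c) = x (w k) \<otimes> (fw w \<otimes> Ec c))"
  using assms
proof (induction w rule: permutes_ascent_induct)
  case id
  show ?case unfolding F.perm_elem_id by simp
next
  case (step i w)
  note wi = pinv_simps[OF step(2)]
  have i': "i \<in> {1..n}" "Suc i \<in> {1..n}" using step(1) by auto
  show ?case
  proof (intro ballI impI)
    fix c k assume c: "c \<in> Col" and k: "k \<in> {1..n}"
      and mono: "\<forall>p q. p \<in> {1..n} \<longrightarrow> q \<in> {1..n} \<longrightarrow> p < q \<longrightarrow> c p = c q \<longrightarrow> (simple_refl i \<circ> w) p < (simple_refl i \<circ> w) q"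
    let ?a = "pinv w i" and ?b = "pinv w (Suc i)"
    have ab: "?a \<in> {1..n}" "?b \<in> {1..n}" using wi(6) i' by blast+
    have cab: "c ?a \<noteq> c ?b"
    proof
      assume "c ?a = c ?b"
      then have "(simple_refl i \<circ> w) ?a < (simple_refl i \<circ> w) ?b" using mono ab step(3) by blast
      then show False using wi(1) by simp
    qed
    \<comment> \<open>Removing the letter \<open>i\<close> reverses only the pair with values
      \<open>i\<close> and \<open>Suc i\<close>. That pair has different colours, so the order
      condition within colours passes to \<open>w\<close>.\<close>
    have "w p < w q" if pq: "p \<in> {1..n}" "q \<in> {1..n}" "p < q" "c p = c q" for p q
    proof -
      have lt: "simple_refl i (w p) < simple_refl i (w q)" using mono pq by auto
      have p: "p = pinv w (w p)" "q = pinv w (w q)" using wi(2) by auto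
      have "(w p, w q) \<noteq> (i, Suc i)" "(w p, w q) \<noteq> (Suc i, i)"
        using p pq(4) cab by (metis prod.inject)+
      moreover have "w p \<noteq> w q" using p pq(3) by (metis less_irrefl)
      ultimately show ?thesis using lt simple_refl_less by blast
    qed
    then have IH: "fw w \<otimes> (x k \<otimes> Ec c) = x (w k) \<otimes> (fw w \<otimes> Ec c)" using step(4) c k by blast
    let ?d = "c \<circ> pinv w"
    have d: "?d \<in> Col" by (rule colourings_perm[OF step(2) c])
    have ed: "eigen ?d (fw w \<otimes> Ec c)"
      unfolding fw_Ec[OF step(2) c] using step(2) by (intro eigen_mult eigen_Ec d) simp
    have "f i \<otimes> fw w \<otimes> (x k \<otimes> Ec c) = f i \<otimes> (x (w k) \<otimes> (fw w \<otimes> Ec c))"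
      using IH step(1,2) k by (simp add: m_assoc)
    also have "\<dots> = x (simple_refl i (w k)) \<otimes> (f i \<otimes> (fw w \<otimes> Ec c))"
      using f_x_eigen[OF step(1) d _ ed wi(5)[OF k]] cab by simp
    finally show "fw (simple_refl i \<circ> w) \<otimes> (x k \<otimes> Ec c) = x ((simple_refl i \<circ> w) k) \<otimes> (fw (simple_refl i \<circ> w) \<otimes> Ec c)"
      using step(1,2) unfolding fw_step[OF step(1,2)] by (simp add: m_assoc)
  qed
qed

lemma fw_xm_Ec:
  assumes w: "w permutes {1..n}" and c: "c \<in> Col"
    and mono: "\<And>i j. i \<in> {1..n} \<Longrightarrow> j \<in> {1..n} \<Longrightarrow> i < j \<Longrightarrow> c i = c j \<Longrightarrow> w i < w j"
  shows "fw w \<otimes> Ec c \<otimes> xm \<alpha> = xm (place_perm w \<alpha>) \<otimes> (fw w \<otimes> Ec c)"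
proof -
  have "fw w \<otimes> Ec c \<otimes> xm \<alpha> = monom_prod Y n (\<lambda>i. x (w i)) \<alpha> \<otimes> (fw w \<otimes> Ec c)"
  proof (rule intertwine_monom)
    fix i assume i: "i \<in> {1..n}"
    then show "x (w i) \<in> carrier Y" using pinv_simps(5)[OF w] by simp
    have "fw w \<otimes> Ec c \<otimes> x i = fw w \<otimes> (x i \<otimes> Ec c)" using w i x_Ec[OF i c] by (simp add: m_assoc)
    also have "\<dots> = x (w i) \<otimes> (fw w \<otimes> Ec c)" using fw_x_Ec[OF w] c mono i by blast
    finally show "fw w \<otimes> Ec c \<otimes> x i = x (w i) \<otimes> (fw w \<otimes> Ec c)" .
  qed (use w in auto)
  also have "monom_prod Y n (\<lambda>i. x (w i)) \<alpha> = xm (place_perm w \<alpha>)"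
    by (rule monom_reindex[OF w]) (auto simp: x_comm)
  finally show ?thesis .
qed

text \<open>The monomials \<open>E_chi x^\<alpha> f_w\<close> of the theorem, indexed by the
  colouring of the character.\<close>

definition B :: "(nat \<Rightarrow> nat) \<Rightarrow> (nat \<Rightarrow> nat) \<Rightarrow> (nat \<Rightarrow> nat) \<Rightarrow> 'a" where
  "B c \<alpha> w = Ec c \<otimes> xm \<alpha> \<otimes> fw w"

definition Bs :: "(nat \<Rightarrow> nat) set \<Rightarrow> 'a set" where
  "Bs C = {B c \<alpha> w | c \<alpha> w. c \<in> C \<and> w permutes {1..n}}"

lemma B_closed [simp]: "w permutes {1..n} \<Longrightarrow> B c \<alpha> w \<in> carrier Y"
  by (simp add: B_def)

lemma Bs_closed: "Bs C \<subseteq> carrier Y"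
  by (auto simp: Bs_def)

lemma kalg_Y: "kalg Y" ..

text \<open>A form of the span in which closure under left multiplication by \<open>x\<close> and
  \<open>t\<close> is built in. Only \<open>f\<close> has to be pushed to the right by means of the
  relations, after which \<open>V\<close> is stable under all generators.\<close>

inductive_set V :: "'a set" where
  base: "w permutes {1..n} \<Longrightarrow> fw w \<in> V"
| add: "y \<in> V \<Longrightarrow> z \<in> V \<Longrightarrow> y \<oplus> z \<in> V"
| smult: "y \<in> V \<Longrightarrow> c \<odot> y \<in> V"
| x: "i \<in> {1..n} \<Longrightarrow> y \<in> V \<Longrightarrow> x i \<otimes> y \<in> V"
| t: "i \<in> {1..n} \<Longrightarrow> y \<in> V \<Longrightarrow> t i \<otimes> y \<in> V"

lemma V_closed: "y \<in> V \<Longrightarrow> y \<in> carrier Y"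
  by (induction rule: V.induct) auto

lemma V_t_pow: "i \<in> {1..n} \<Longrightarrow> y \<in> V \<Longrightarrow> t i [^] (s::nat) \<otimes> y \<in> V"
proof (induction s arbitrary: y)
  case (Suc s)
  then have "t i [^] s \<otimes> (t i \<otimes> y) \<in> V" by (intro Suc.IH V.t)
  then show ?case using Suc V_closed by (simp add: m_assoc)
qed (simp add: V_closed)

lemma V_e:
  assumes i: "i \<in> {1..<n}" and y: "y \<in> V" shows "e i \<otimes> y \<in> V"
proof -
  have i': "i \<in> {1..n}" "Suc i \<in> {1..n}" using i by auto
  have yc: "y \<in> carrier Y" using V_closed[OF y] .
  have "\<zero> \<in> V" using V.smult[OF y, of 0] yc by simp
  then have s: "(\<Oplus>s\<in>S. g s) \<in> V" if "\<And>s. s \<in> S \<Longrightarrow> g s \<in> V" for S and g :: "nat \<Rightarrow> 'a"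
    using that by (induction S rule: infinite_finite_induct) (auto simp: finsum_insert Pi_def V_closed V.add)
  have g: "t i [^] s \<otimes> (t (Suc i) [^] (r - 1)) [^] s \<otimes> y \<in> V" for s :: nat
    using V_t_pow[OF i'(1) V_t_pow[OF i'(2) y, of "(r - 1) * s"], of s] i' yc
    by (simp add: m_assoc nat_pow_pow)
  have "e i \<otimes> y = inverse (of_nat r) \<odot> (\<Oplus>s\<in>{..<r}. t i [^] s \<otimes> (t (Suc i) [^] (r - 1)) [^] s \<otimes> y)"
    unfolding e_def using i' yc by (subst smult_mult_l) (auto intro!: finsum_closed simp: finsum_ldistr Pi_def)
  then show ?thesis using s[of "{..<r}", OF g] V.smult by simp
qed

text \<open>\<open>f i\<close> moves through \<open>x\<close> and \<open>t\<close> until it reaches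
  the permutation part. The correction terms contain \<open>e i\<close>, a combination of products
  of powers of \<open>t\<close>, and therefore remain in \<open>V\<close>.\<close>

lemma V_f:
  assumes i: "i \<in> {1..<n}" and y: "y \<in> V" shows "f i \<otimes> y \<in> V"
  using y
proof induction
  case (base w)
  then show ?case using fw_step[OF i, of w] V.base[OF permutes_compose[OF base simple_refl_permutes[OF i]]] by simp
next
  case (add y z)
  then show ?case using i V_closed by (simp add: r_distr V.add)
next
  case (smult y c)
  then show ?case using i V_closed by (simp add: smult_mult_r V.smult)
next
  case (x j y)
  have i': "i \<in> {1..n}" "Suc i \<in> {1..n}" using i by auto
  note yc = V_closed[OF x(2)]
  have m: "\<ominus> z \<in> V" if "z \<in> V" for z using V.smult[OF that, of "-1"] minus_smult[OF V_closed[OF that]] by simp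
  have a: "f i \<otimes> (x j \<otimes> y) = (f i \<otimes> x j) \<otimes> y" using i x(1) yc by (simp add: m_assoc)
  consider "j = i" | "j = Suc i" | "j \<noteq> i" "j \<noteq> Suc i" by blast
  then show ?case
  proof cases
    case 1
    then have "f i \<otimes> (x j \<otimes> y) = x (Suc i) \<otimes> (f i \<otimes> y) \<oplus> \<ominus> (e i \<otimes> y)"
      unfolding a using f_x[OF i] i i' yc by (simp add: minus_eq l_distr l_minus m_assoc)
    then show ?thesis using V.add[OF V.x[OF i'(2) x(3)] m[OF V_e[OF i x(2)]]] by simp
  next
    case 2
    then have "f i \<otimes> (x j \<otimes> y) = x i \<otimes> (f i \<otimes> y) \<oplus> e i \<otimes> y"
      unfolding a using f_x_e[OF i] i i' yc by (simp add: l_distr m_assoc)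
    then show ?thesis using V.add[OF V.x[OF i'(1) x(3)] V_e[OF i x(2)]] by simp
  next
    case 3
    then have "f i \<otimes> (x j \<otimes> y) = x j \<otimes> (f i \<otimes> y)"
      unfolding a using f_x_far[OF i x(1)] i x(1) yc by (simp add: m_assoc)
    then show ?thesis using V.x[OF x(1,3)] by simp
  qed
next
  case (t j y)
  have sj: "simple_refl i j \<in> {1..n}" using pinv_simps(5)[OF simple_refl_permutes[OF i] t(1)] .
  have "f i \<otimes> (t j \<otimes> y) = t (simple_refl i j) \<otimes> (f i \<otimes> y)"
    using f_t[OF i t(1)] i t(1) sj V_closed[OF t(2)] by (simp add: m_assoc[symmetric])
  then show ?case using V.t[OF sj t(3)] by simp
qed

text \<open>The elements that map \<open>V\<close> into itself by left multiplication form a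
  subalgebra containing the generators, and \<open>V\<close> contains the unit.\<close>

lemma V_all: "carrier Y \<subseteq> V"
proof
  fix y assume "y \<in> carrier Y"
  then have g: "y \<in> gen_subalg Y (t ` {1..n} \<union> f ` {1..<n} \<union> x ` {1..n})" using generated by simp
  have sub: "z \<in> carrier Y" if "z \<in> gen_subalg Y (t ` {1..n} \<union> f ` {1..<n} \<union> x ` {1..n})" for z
    using that generated by simp
  have "\<forall>v\<in>V. y \<otimes> v \<in> V" using g
  proof induction
    case (gen_incl y)
    then show ?case using V.x V.t V_f by auto
  next
    case (gen_add y z)
    then show ?case using sub V_closed by (simp add: l_distr V.add)
  next
    case (gen_mult y z)
    then show ?case using sub V_closed by (simp add: m_assoc)
  next
    case (gen_smult y c)
    then show ?case using sub V_closed by (simp add: smult_mult_l V.smult)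
  qed (simp add: V_closed)
  moreover have "\<one> \<in> V" using V.base[OF permutes_id] F.perm_elem_id by simp
  ultimately have "y \<otimes> \<one> \<in> V" by blast
  then show "y \<in> V" using \<open>y \<in> carrier Y\<close> by simp
qed

lemma x_B: "i \<in> {1..n} \<Longrightarrow> c \<in> Col \<Longrightarrow> w permutes {1..n} \<Longrightarrow> x i \<otimes> B c \<alpha> w = B c (\<alpha>(i := Suc (\<alpha> i))) w"
proof -
  assume a: "i \<in> {1..n}" "c \<in> Col" "w permutes {1..n}"
  have "x i \<otimes> (Ec c \<otimes> xm \<alpha> \<otimes> fw w) = Ec c \<otimes> (x i \<otimes> xm \<alpha>) \<otimes> fw w"
    using a x_Ec[OF a(1,2)] by (simp add: m_assoc[symmetric])
  also have "x i \<otimes> xm \<alpha> = xm (\<alpha>(i := Suc (\<alpha> i)))" using a by (intro monom_Suc) (auto simp: x_comm)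
  finally show ?thesis by (simp add: B_def)
qed

lemma t_B: "i \<in> {1..n} \<Longrightarrow> c \<in> Col \<Longrightarrow> w permutes {1..n} \<Longrightarrow> t i \<otimes> B c \<alpha> w = \<zeta> (c i) \<odot> B c \<alpha> w"
  unfolding B_def by (simp add: m_assoc[symmetric] t_Ec smult_mult_l)

text \<open>On each monomial \<open>x i\<close> raises an exponent and \<open>t i\<close> acts by a
  scalar, so the span inherits the closure properties of \<open>V\<close>. The starting elements
  \<open>fw w\<close> enter through the partition of unity.\<close>

theorem Bs_span: "carrier Y = lspan Y (Bs Col)"
proof
  show "lspan Y (Bs Col) \<subseteq> carrier Y" using lspan_carrier[OF kalg_Y Bs_closed] by blast
  have l: "z \<otimes> y \<in> lspan Y (Bs Col)" if z: "z \<in> carrier Y" "\<And>c \<alpha> w. c \<in> Col \<Longrightarrow> w permutes {1..n} \<Longrightarrow> z \<otimes> B c \<alpha> w \<in> lspan Y (Bs Col)"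
      and y: "y \<in> lspan Y (Bs Col)" for y z
    using y
  proof induction
    case zero
    then show ?case using z(1) by (simp add: lspan.zero)
  next
    case (base y)
    then show ?case using z by (auto simp: Bs_def)
  next
    case (add y y')
    then show ?case using z(1) lspan_carrier[OF kalg_Y Bs_closed] by (simp add: r_distr lspan.add)
  next
    case (smult y c)
    then show ?case using z(1) lspan_carrier[OF kalg_Y Bs_closed] by (simp add: smult_mult_r lspan.smult)
  qed
  have "y \<in> lspan Y (Bs Col)" if "y \<in> V" for y
    using that
  proof induction
    case (base w)
    have "fw w = (\<Oplus>c\<in>Col. Ec c) \<otimes> fw w" using base by (simp add: sum_Ec)
    also have "\<dots> = (\<Oplus>c\<in>Col. Ec c \<otimes> fw w)" using base by (intro finsum_ldistr finite_colourings) auto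
    also have "\<dots> = (\<Oplus>c\<in>Col. B c (\<lambda>_. 0) w)" using base by (simp add: B_def monom_zero)
    also have "\<dots> \<in> lspan Y (Bs Col)" using base
      by (intro lspan_finsum[OF kalg_Y Bs_closed] lspan.base) (auto simp: Bs_def)
    finally show ?case .
  next
    case (x i y)
    show ?case by (rule l[OF _ _ x(3)]) (use x in \<open>auto simp: x_B Bs_def intro!: lspan.base\<close>)
  next
    case (t i y)
    show ?case by (rule l[OF _ _ t(3)]) (use t in \<open>auto simp: t_B Bs_def intro!: lspan.base lspan.smult\<close>)
  qed (auto intro: lspan.intros)
  then show "carrier Y \<subseteq> lspan Y (Bs Col)" using V_all by blast
qed

text \<open>With \<open>C\<close> the colourings of one composition this is the central idempotent
  \<open>E_mu\<close>.\<close>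

definition EC :: "(nat \<Rightarrow> nat) set \<Rightarrow> 'a" where
  "EC C = (\<Oplus>c\<in>C. Ec c)"

lemma EC_closed [simp]: "EC C \<in> carrier Y" by (simp add: EC_def finsum_closed)

lemma EC_Ec:
  assumes "C \<subseteq> Col" "c \<in> Col" shows "EC C \<otimes> Ec c = (if c \<in> C then Ec c else \<zero>)"
proof -
  have fin: "finite C" using assms(1) finite_colourings finite_subset by blast
  have "EC C \<otimes> Ec c = (\<Oplus>d\<in>C. Ec d \<otimes> Ec c)" unfolding EC_def using fin by (intro finsum_ldistr) auto
  also have "\<dots> = (\<Oplus>d\<in>C. if d = c then Ec c else \<zero>)" using assms by (intro finsum_cong') (auto simp: Ec_Ec subset_iff)
  also have "\<dots> = (if c \<in> C then Ec c else \<zero>)"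
  proof (cases "c \<in> C")
    case False
    then have "(\<Oplus>d\<in>C. if d = c then Ec c else \<zero>) = (\<Oplus>d\<in>C. \<zero>)" by (intro finsum_cong') auto
    then show ?thesis using False by simp
  qed (use fin in \<open>simp add: finsum_single\<close>)
  finally show ?thesis .
qed

lemma EC_B: "C \<subseteq> Col \<Longrightarrow> c \<in> Col \<Longrightarrow> w permutes {1..n} \<Longrightarrow> EC C \<otimes> B c \<alpha> w = (if c \<in> C then B c \<alpha> w else \<zero>)"
  unfolding B_def by (simp add: m_assoc[symmetric] EC_Ec)

lemma EC_EC:
  assumes "C \<subseteq> Col" "D \<subseteq> Col" shows "EC C \<otimes> EC D = EC (C \<inter> D)"
proof -
  have fin: "finite D" using assms(2) finite_colourings finite_subset by blast
  have "EC C \<otimes> EC D = (\<Oplus>d\<in>D. EC C \<otimes> Ec d)" unfolding EC_def[of D] using fin by (intro finsum_rdistr) auto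
  also have "\<dots> = (\<Oplus>d\<in>D. if d \<in> C then Ec d else \<zero>)" using assms by (intro finsum_cong') (auto simp: EC_Ec subset_iff)
  also have "\<dots> = EC (C \<inter> D)" unfolding EC_def using fin by (intro add.finprod_mono_neutral_cong_right) auto
  finally show ?thesis .
qed

text \<open>Multiplication by \<open>EC C\<close> keeps the monomials coloured in \<open>C\<close>
  and kills all others.\<close>

lemma EC_span:
  assumes C: "C \<subseteq> Col" and y: "y \<in> carrier Y"
  shows "EC C \<otimes> y \<in> lspan Y (Bs C)"
proof -
  have "y \<in> lspan Y (Bs Col)" using y Bs_span by simp
  then show ?thesis
  proof induction
    case (base y)
    then obtain c \<alpha> w where "y = B c \<alpha> w" "c \<in> Col" "w permutes {1..n}" by (auto simp: Bs_def)
    then show ?case using EC_B[OF C, of c w \<alpha>] by (auto simp: Bs_def intro: lspan.zero lspan.base)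
  next
    case (add y z)
    then show ?case using lspan_carrier[OF kalg_Y Bs_closed] by (simp add: r_distr lspan.add)
  next
    case (smult y c)
    then show ?case using lspan_carrier[OF kalg_Y Bs_closed] by (simp add: smult_mult_r lspan.smult)
  qed (simp add: lspan.zero)
qed

end

section \<open>Presentation of the Yokonuma--Hecke algebra\<close>

lemma yh_gens_simps [simp]:
  "YT i \<in> yh_gens n \<longleftrightarrow> i \<in> {1..n}" "YF i \<in> yh_gens n \<longleftrightarrow> i \<in> {1..<n}" "YX i \<in> yh_gens n \<longleftrightarrow> i \<in> {1..n}"
  by (auto simp: yh_gens_def)

lemma simple_refl_range: "i \<in> {1..<n} \<Longrightarrow> j \<in> {1..n} \<Longrightarrow> simple_refl i j \<in> {1..n}"
  using permutes_in_image[OF simple_refl_permutes] by blast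

lemma yh_e_closed: "i \<in> {1..<n} \<Longrightarrow> yh_e r i \<in> carrier (free_alg (yh_gens n))"
  unfolding yh_e_def by (intro free_alg_closed' free_alg_sum_closed free_alg_closed) auto

lemma presentation_yh: "presentation (yh_gens n) (yh_rels r n)"
proof
  fix p q :: "(yh_gen, 'k::field) free_algebra"
  assume "(p, q) \<in> yh_rels r n"
  then show "p \<in> carrier (free_alg (yh_gens n)) \<and> q \<in> carrier (free_alg (yh_gens n))"
    by cases (use simple_refl_range in \<open>auto simp: yh_e_closed simp del: One_nat_def\<close>)
qed

lemma yokonuma_yh:
  fixes \<zeta> :: "nat \<Rightarrow> 'k::field"
  assumes "1 \<le> r" "of_nat r \<noteq> (0::'k)" "bij_betw \<zeta> {1..r} {z. z ^ r = 1}"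
  shows "yokonuma (yh r n :: ('k, 'k yh) module) r n \<zeta> (yh_t r n) (yh_f r n) (yh_x r n)"
proof -
  interpret P: presentation "yh_gens n" "yh_rels r n :: ((yh_gen, 'k) free_algebra \<times> (yh_gen, 'k) free_algebra) set"
    by (rule presentation_yh)
  let ?Y = "yh r n :: ('k, 'k yh) module"
  have Y: "presented_alg (yh_gens n) (yh_rels r n) = ?Y" by (simp add: yh_def)
  interpret Y: kalg ?Y using P.kalg_presented Y by simp
  note hs = free_hom_simps[OF Y.kalg_axioms P.proj_hom[unfolded Y]]
  have g: "P.proj (gvar (YT i)) = yh_t r n i" "P.proj (gvar (YX i)) = yh_x r n i" if "i \<in> {1..n}" for i
    using that by (simp_all add: yh_t_def yh_x_def)
  have gf: "P.proj (gvar (YF i)) = yh_f r n i" if "i \<in> {1..<n}" for i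
    using that by (simp add: yh_f_def)
  have cl: "yh_t r n i \<in> carrier ?Y" "yh_x r n i \<in> carrier ?Y" if "i \<in> {1..n}" for i
    using that P.presented_gen_closed[of "YT i"] P.presented_gen_closed[of "YX i"] by (simp_all add: yh_t_def yh_x_def yh_def)
  have clf: "yh_f r n i \<in> carrier ?Y" if "i \<in> {1..<n}" for i
    using that P.presented_gen_closed[of "YF i"] by (simp add: yh_f_def yh_def)
  have i': "i \<in> {1..n}" "Suc i \<in> {1..n}" if "i \<in> {1..<n}" for i using that by auto
  note P.proj_gvar [simp del]
  note R = P.proj_rel[OF yh_rels.intros(1)] P.proj_rel[OF yh_rels.intros(2)] P.proj_rel[OF yh_rels.intros(3)]
     P.proj_rel[OF yh_rels.intros(4)] P.proj_rel[OF yh_rels.intros(5)] P.proj_rel[OF yh_rels.intros(6)]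
     P.proj_rel[OF yh_rels.intros(7)] P.proj_rel[OF yh_rels.intros(8)] P.proj_rel[OF yh_rels.intros(9)]
     P.proj_rel[OF yh_rels.intros(10)]
  show ?thesis
  proof
    show "carrier ?Y = gen_subalg ?Y (yh_t r n ` {1..n} \<union> yh_f r n ` {1..<n} \<union> yh_x r n ` {1..n})"
    proof -
      have "presented_gen (yh_gens n) (yh_rels r n) ` yh_gens n =
          (yh_t r n ` {1..n} \<union> yh_f r n ` {1..<n} \<union> yh_x r n ` {1..n} :: 'k yh set)"
        unfolding yh_t_def yh_f_def yh_x_def by (subst (2) yh_gens_def) (simp add: image_Un image_image)
      then show ?thesis using P.presented_generated unfolding Y by simp
    qed
    show "yh_f r n i \<otimes>\<^bsub>?Y\<^esub> yh_f r n j = yh_f r n j \<otimes>\<^bsub>?Y\<^esub> yh_f r n i" if "i \<in> {1..<n}" "j \<in> {1..<n}" "Suc i < j" for i j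
      using R(1)[of i j] that by (simp add: hs gf)
    show "yh_f r n i \<otimes>\<^bsub>?Y\<^esub> yh_f r n (Suc i) \<otimes>\<^bsub>?Y\<^esub> yh_f r n i = yh_f r n (Suc i) \<otimes>\<^bsub>?Y\<^esub> yh_f r n i \<otimes>\<^bsub>?Y\<^esub> yh_f r n (Suc i)"
      if "i \<in> {1..<n}" "Suc i \<in> {1..<n}" for i
      using R(2)[of i] that by (simp add: hs gf)
    show "yh_f r n i \<otimes>\<^bsub>?Y\<^esub> yh_f r n i = \<one>\<^bsub>?Y\<^esub>" if "i \<in> {1..<n}" for i
      using R(6)[of i] that clf by (simp add: hs gf power2_eq_square)
    show "yh_t r n i \<otimes>\<^bsub>?Y\<^esub> yh_t r n j = yh_t r n j \<otimes>\<^bsub>?Y\<^esub> yh_t r n i" if "i \<in> {1..n}" "j \<in> {1..n}" for i j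
      using R(3)[of i j] that by (simp add: hs g)
    show "yh_f r n i \<otimes>\<^bsub>?Y\<^esub> yh_t r n j = yh_t r n (simple_refl i j) \<otimes>\<^bsub>?Y\<^esub> yh_f r n i" if "i \<in> {1..<n}" "j \<in> {1..n}" for i j
      using R(4)[of i j] that simple_refl_range[OF that] by (simp add: hs g gf del: atLeastAtMost_iff)
    show "yh_t r n i [^]\<^bsub>?Y\<^esub> r = \<one>\<^bsub>?Y\<^esub>" if "i \<in> {1..n}" for i
      using R(5)[of i] that by (simp add: hs g)
    show "yh_x r n i \<otimes>\<^bsub>?Y\<^esub> yh_x r n j = yh_x r n j \<otimes>\<^bsub>?Y\<^esub> yh_x r n i" if "i \<in> {1..n}" "j \<in> {1..n}" for i j
      using R(7)[of i j] that by (simp add: hs g)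
    show "yh_f r n i \<otimes>\<^bsub>?Y\<^esub> yh_x r n (Suc i) = yh_x r n i \<otimes>\<^bsub>?Y\<^esub> yh_f r n i \<oplus>\<^bsub>?Y\<^esub>
        inverse (of_nat r) \<odot>\<^bsub>?Y\<^esub> (\<Oplus>\<^bsub>?Y\<^esub>s\<in>{..<r}. yh_t r n i [^]\<^bsub>?Y\<^esub> s \<otimes>\<^bsub>?Y\<^esub> (yh_t r n (Suc i) [^]\<^bsub>?Y\<^esub> (r - 1)) [^]\<^bsub>?Y\<^esub> s)"
      if "i \<in> {1..<n}" for i
      using R(8)[of i] that i'[OF that] yh_e_closed[OF that, of r] unfolding yh_e_def by (simp add: hs g gf)
    show "yh_f r n i \<otimes>\<^bsub>?Y\<^esub> yh_x r n j = yh_x r n j \<otimes>\<^bsub>?Y\<^esub> yh_f r n i" if "i \<in> {1..<n}" "j \<in> {1..n}" "j \<noteq> i" "j \<noteq> Suc i" for i j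
      using R(9)[of i j] that by (simp add: hs g gf)
    show "yh_t r n j \<otimes>\<^bsub>?Y\<^esub> yh_x r n i = yh_x r n i \<otimes>\<^bsub>?Y\<^esub> yh_t r n j" if "i \<in> {1..n}" "j \<in> {1..n}" for i j
      using R(10)[of i j] that by (simp add: hs g)
  qed (use assms cl clf in auto)
qed

section \<open>The degenerate affine Hecke algebra of a composition\<close>

lemma hecke_gens_simps [simp]:
  "HX i \<in> hecke_gens m \<longleftrightarrow> i \<in> {1..m}" "HS i \<in> hecke_gens m \<longleftrightarrow> i \<in> {1..<m}"
  by (auto simp: hecke_gens_def)

lemma presentation_hecke: "presentation (hecke_gens m) (hecke_rels m)"
proof
  fix p q :: "(hecke_gen, 'k::field) free_algebra"
  assume "(p, q) \<in> hecke_rels m"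
  then show "p \<in> carrier (free_alg (hecke_gens m)) \<and> q \<in> carrier (free_alg (hecke_gens m))"
    by cases (auto simp del: One_nat_def)
qed

lemma kalg_hecke: "kalg (hecke m)"
  unfolding hecke_def by (rule presentation.kalg_presented[OF presentation_hecke])

lemma hecke_x_closed: "i \<in> {1..m} \<Longrightarrow> hecke_x m i \<in> carrier (hecke m)"
  and hecke_s_closed: "i \<in> {1..<m} \<Longrightarrow> hecke_s m i \<in> carrier (hecke m)"
  unfolding hecke_def hecke_x_def hecke_s_def by (simp_all add: presentation.presented_gen_closed[OF presentation_hecke])

lemma hecke_generated: "carrier (hecke m) = gen_subalg (hecke m) (hecke_x m ` {1..m} \<union> hecke_s m ` {1..<m})"
proof -
  have "presented_gen (hecke_gens m) (hecke_rels m) ` hecke_gens m = (hecke_x m ` {1..m} \<union> hecke_s m ` {1..<m})"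
    unfolding hecke_x_def hecke_s_def by (subst (2) hecke_gens_def) (simp add: image_Un image_image)
  then show ?thesis using presentation.presented_generated[OF presentation_hecke] unfolding hecke_def by metis
qed

lemma hecke_rels_hold:
  fixes m :: nat
  defines "H \<equiv> (hecke m :: ('k::field, _) module)"
  shows "i \<in> {1..<m} \<Longrightarrow> hecke_s m i \<otimes>\<^bsub>H\<^esub> hecke_s m i = \<one>\<^bsub>H\<^esub>"
    and "i \<in> {1..<m} \<Longrightarrow> Suc i \<in> {1..<m} \<Longrightarrow> hecke_s m i \<otimes>\<^bsub>H\<^esub> hecke_s m (Suc i) \<otimes>\<^bsub>H\<^esub> hecke_s m i
          = hecke_s m (Suc i) \<otimes>\<^bsub>H\<^esub> hecke_s m i \<otimes>\<^bsub>H\<^esub> hecke_s m (Suc i)"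
    and "i \<in> {1..<m} \<Longrightarrow> j \<in> {1..<m} \<Longrightarrow> Suc i < j \<Longrightarrow> hecke_s m i \<otimes>\<^bsub>H\<^esub> hecke_s m j = hecke_s m j \<otimes>\<^bsub>H\<^esub> hecke_s m i"
    and "i \<in> {1..m} \<Longrightarrow> j \<in> {1..m} \<Longrightarrow> hecke_x m i \<otimes>\<^bsub>H\<^esub> hecke_x m j = hecke_x m j \<otimes>\<^bsub>H\<^esub> hecke_x m i"
    and "i \<in> {1..<m} \<Longrightarrow> hecke_s m i \<otimes>\<^bsub>H\<^esub> hecke_x m (Suc i) = hecke_x m i \<otimes>\<^bsub>H\<^esub> hecke_s m i \<oplus>\<^bsub>H\<^esub> \<one>\<^bsub>H\<^esub>"
    and "i \<in> {1..<m} \<Longrightarrow> j \<in> {1..m} \<Longrightarrow> j \<noteq> i \<Longrightarrow> j \<noteq> Suc i \<Longrightarrow> hecke_s m i \<otimes>\<^bsub>H\<^esub> hecke_x m j = hecke_x m j \<otimes>\<^bsub>H\<^esub> hecke_s m i"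
proof -
  interpret P: presentation "hecke_gens m" "hecke_rels m :: ((hecke_gen, 'k) free_algebra \<times> _) set"
    by (rule presentation_hecke)
  have H: "presented_alg (hecke_gens m) (hecke_rels m) = H" by (simp add: H_def hecke_def)
  interpret H: kalg H unfolding H_def by (rule kalg_hecke)
  note hs = free_hom_simps[OF H.kalg_axioms P.proj_hom[unfolded H]]
  have g: "P.proj (gvar (HX i)) = hecke_x m i" if "i \<in> {1..m}" for i
    using that by (simp add: hecke_x_def)
  have gs: "P.proj (gvar (HS i)) = hecke_s m i" if "i \<in> {1..<m}" for i
    using that by (simp add: hecke_s_def)
  note P.proj_gvar [simp del]
  note R = P.proj_rel[OF hecke_rels.intros(1)] P.proj_rel[OF hecke_rels.intros(2)] P.proj_rel[OF hecke_rels.intros(3)]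
     P.proj_rel[OF hecke_rels.intros(4)] P.proj_rel[OF hecke_rels.intros(5)] P.proj_rel[OF hecke_rels.intros(6)]
  show "i \<in> {1..<m} \<Longrightarrow> hecke_s m i \<otimes>\<^bsub>H\<^esub> hecke_s m i = \<one>\<^bsub>H\<^esub>"
    using R(1)[of i] by (simp add: hs gs power2_eq_square)
  show "i \<in> {1..<m} \<Longrightarrow> Suc i \<in> {1..<m} \<Longrightarrow> hecke_s m i \<otimes>\<^bsub>H\<^esub> hecke_s m (Suc i) \<otimes>\<^bsub>H\<^esub> hecke_s m i
          = hecke_s m (Suc i) \<otimes>\<^bsub>H\<^esub> hecke_s m i \<otimes>\<^bsub>H\<^esub> hecke_s m (Suc i)"
    using R(2)[of i] by (simp add: hs gs)
  show "i \<in> {1..<m} \<Longrightarrow> j \<in> {1..<m} \<Longrightarrow> Suc i < j \<Longrightarrow> hecke_s m i \<otimes>\<^bsub>H\<^esub> hecke_s m j = hecke_s m j \<otimes>\<^bsub>H\<^esub> hecke_s m i"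
    using R(3)[of i j] by (simp add: hs gs)
  show "i \<in> {1..m} \<Longrightarrow> j \<in> {1..m} \<Longrightarrow> hecke_x m i \<otimes>\<^bsub>H\<^esub> hecke_x m j = hecke_x m j \<otimes>\<^bsub>H\<^esub> hecke_x m i"
    using R(4)[of i j] by (simp add: hs g)
  show "i \<in> {1..<m} \<Longrightarrow> hecke_s m i \<otimes>\<^bsub>H\<^esub> hecke_x m (Suc i) = hecke_x m i \<otimes>\<^bsub>H\<^esub> hecke_s m i \<oplus>\<^bsub>H\<^esub> \<one>\<^bsub>H\<^esub>"
    using R(5)[of i] by (simp add: hs g gs)
  show "i \<in> {1..<m} \<Longrightarrow> j \<in> {1..m} \<Longrightarrow> j \<noteq> i \<Longrightarrow> j \<noteq> Suc i \<Longrightarrow> hecke_s m i \<otimes>\<^bsub>H\<^esub> hecke_x m j = hecke_x m j \<otimes>\<^bsub>H\<^esub> hecke_s m i"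
    using R(6)[of i j] by (simp add: hs g gs)
qed

lemma hecke_hom_exists:
  fixes B :: "('k::field, 'b) module"
  assumes B: "kalg B" and \<xi>: "\<And>i. i \<in> {1..m} \<Longrightarrow> \<xi> i \<in> carrier B" and \<tau>: "\<And>i. i \<in> {1..<m} \<Longrightarrow> \<tau> i \<in> carrier B"
    and quad: "\<And>i. i \<in> {1..<m} \<Longrightarrow> \<tau> i \<otimes>\<^bsub>B\<^esub> \<tau> i = \<one>\<^bsub>B\<^esub>"
    and braid: "\<And>i. i \<in> {1..<m} \<Longrightarrow> Suc i \<in> {1..<m} \<Longrightarrow> \<tau> i \<otimes>\<^bsub>B\<^esub> \<tau> (Suc i) \<otimes>\<^bsub>B\<^esub> \<tau> i = \<tau> (Suc i) \<otimes>\<^bsub>B\<^esub> \<tau> i \<otimes>\<^bsub>B\<^esub> \<tau> (Suc i)"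
    and far: "\<And>i j. i \<in> {1..<m} \<Longrightarrow> j \<in> {1..<m} \<Longrightarrow> Suc i < j \<Longrightarrow> \<tau> i \<otimes>\<^bsub>B\<^esub> \<tau> j = \<tau> j \<otimes>\<^bsub>B\<^esub> \<tau> i"
    and xx: "\<And>i j. i \<in> {1..m} \<Longrightarrow> j \<in> {1..m} \<Longrightarrow> \<xi> i \<otimes>\<^bsub>B\<^esub> \<xi> j = \<xi> j \<otimes>\<^bsub>B\<^esub> \<xi> i"
    and sx: "\<And>i. i \<in> {1..<m} \<Longrightarrow> \<tau> i \<otimes>\<^bsub>B\<^esub> \<xi> (Suc i) = \<xi> i \<otimes>\<^bsub>B\<^esub> \<tau> i \<oplus>\<^bsub>B\<^esub> \<one>\<^bsub>B\<^esub>"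
    and sxf: "\<And>i j. i \<in> {1..<m} \<Longrightarrow> j \<in> {1..m} \<Longrightarrow> j \<noteq> i \<Longrightarrow> j \<noteq> Suc i \<Longrightarrow> \<tau> i \<otimes>\<^bsub>B\<^esub> \<xi> j = \<xi> j \<otimes>\<^bsub>B\<^esub> \<tau> i"
  shows "\<exists>h \<in> alg_hom (hecke m) B. (\<forall>i\<in>{1..m}. h (hecke_x m i) = \<xi> i) \<and> (\<forall>i\<in>{1..<m}. h (hecke_s m i) = \<tau> i)"
proof -
  interpret P: presentation "hecke_gens m" "hecke_rels m :: ((hecke_gen, 'k) free_algebra \<times> _) set"
    by (rule presentation_hecke)
  interpret B: kalg B by fact
  let ?\<phi> = "\<lambda>g. case g of HX i \<Rightarrow> \<xi> i | HS i \<Rightarrow> \<tau> i"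
  have "\<exists>h \<in> alg_hom (presented_alg (hecke_gens m) (hecke_rels m)) B.
      \<forall>g\<in>hecke_gens m. h (presented_gen (hecke_gens m) (hecke_rels m) g) = ?\<phi> g"
  proof (rule P.presented_hom_exists[OF B])
    show "?\<phi> g \<in> carrier B" if "g \<in> hecke_gens m" for g
      using that \<xi> \<tau> by (cases g) auto
    fix h and p q :: "(hecke_gen, 'k) free_algebra"
    assume h: "h \<in> alg_hom (free_alg (hecke_gens m)) B" and hg: "\<And>g. g \<in> hecke_gens m \<Longrightarrow> h (gvar g) = ?\<phi> g"
      and "(p, q) \<in> hecke_rels m"
    note hs = free_hom_simps[OF B h]
    have hx: "h (gvar (HX i)) = \<xi> i" if "i \<in> {1..m}" for i using hg[of "HX i"] that by simp
    have ht: "h (gvar (HS i)) = \<tau> i" if "i \<in> {1..<m}" for i using hg[of "HS i"] that by simp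
    show "h p = h q" using \<open>(p, q) \<in> hecke_rels m\<close>
    proof cases
      case (1 i)
      then show ?thesis using quad \<tau> by (simp add: hs ht power2_eq_square)
    next
      case (2 i)
      then show ?thesis using braid by (simp add: hs ht)
    next
      case (3 i j)
      then show ?thesis using far[of i j] far[of j i] by (auto simp: hs ht)
    next
      case (4 i j)
      then show ?thesis using xx by (simp add: hs hx)
    next
      case (5 i)
      then show ?thesis using sx by (simp add: hs hx ht)
    next
      case (6 i j)
      then show ?thesis using sxf by (simp add: hs hx ht)
    qed
  qed
  then obtain h where h: "h \<in> alg_hom (hecke m) B"
    "\<And>g. g \<in> hecke_gens m \<Longrightarrow> h (presented_gen (hecke_gens m) (hecke_rels m) g) = ?\<phi> g"
    unfolding hecke_def by blast
  show ?thesis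
    using h(2)[of "HX _"] h(2)[of "HS _"] by (intro bexI[OF _ h(1)]) (auto simp: hecke_x_def hecke_s_def)
qed

lemma coxeter_elems_hecke: "coxeter_elems (hecke m) m (hecke_s m)"
  by (intro coxeter_elems.intro coxeter_elems_axioms.intro kalg_hecke hecke_s_closed hecke_rels_hold(1-3))

lemma simple_refl_commute:
  assumes "Suc k < l \<or> Suc l < k" shows "simple_refl k \<circ> simple_refl l = simple_refl l \<circ> simple_refl k"
  using assms by (auto simp: fun_eq_iff Transposition.transpose_def)

lemma simple_refl_braid:
  "simple_refl i \<circ> simple_refl (Suc i) \<circ> simple_refl i = simple_refl (Suc i) \<circ> simple_refl i \<circ> simple_refl (Suc i)"
  by (auto simp: fun_eq_iff Transposition.transpose_def)

text \<open>The Hecke relations of a composition, with \<open>S\<close> given on the whole Young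
  subgroup so that the Coxeter relations become multiplicativity. Three models occur: the tensor
  product of Hecke algebras, a corner of the Yokonuma-Hecke algebra, and the ground field.\<close>

locale hecke_data = composition r n \<mu> + kalg A
  for r n \<mu> and A :: "('k::field, 'b) module" (structure) +
  fixes X :: "nat \<Rightarrow> 'b" and S :: "(nat \<Rightarrow> nat) \<Rightarrow> 'b"
  assumes X_closed [simp]: "k \<in> {1..n} \<Longrightarrow> X k \<in> carrier A"
    and S_closed [simp]: "w \<in> young r n \<mu> \<Longrightarrow> S w \<in> carrier A"
    and S_id: "S id = \<one>"
    and S_mult: "w \<in> young r n \<mu> \<Longrightarrow> v \<in> young r n \<mu> \<Longrightarrow> S (w \<circ> v) = S w \<otimes> S v"
    and X_comm: "k \<in> {1..n} \<Longrightarrow> l \<in> {1..n} \<Longrightarrow> X k \<otimes> X l = X l \<otimes> X k"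
    and S_X: "a \<in> {1..r} \<Longrightarrow> k \<in> block \<mu> a \<Longrightarrow> Suc k \<in> block \<mu> a \<Longrightarrow>
        S (simple_refl k) \<otimes> X (Suc k) = X k \<otimes> S (simple_refl k) \<oplus> \<one>"
    and S_X_far: "a \<in> {1..r} \<Longrightarrow> k \<in> block \<mu> a \<Longrightarrow> Suc k \<in> block \<mu> a \<Longrightarrow> j \<in> {1..n} \<Longrightarrow> j \<noteq> k \<Longrightarrow> j \<noteq> Suc k \<Longrightarrow>
        S (simple_refl k) \<otimes> X j = X j \<otimes> S (simple_refl k)"
begin

lemma S_simple_sq: "a \<in> {1..r} \<Longrightarrow> k \<in> block \<mu> a \<Longrightarrow> Suc k \<in> block \<mu> a \<Longrightarrow>
    S (simple_refl k) \<otimes> S (simple_refl k) = \<one>"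
  using S_mult[of "simple_refl k" "simple_refl k"] young_simple by (simp add: S_id)

lemma S_X':
  assumes k: "a \<in> {1..r}" "k \<in> block \<mu> a" "Suc k \<in> block \<mu> a"
  shows "S (simple_refl k) \<otimes> X k = X (Suc k) \<otimes> S (simple_refl k) \<oplus> \<ominus> \<one>"
proof -
  let ?s = "S (simple_refl k)"
  note kn = block_mem[OF k(1,2)] block_mem[OF k(1,3)]
  have s: "?s \<in> carrier A" "?s \<otimes> ?s = \<one>" using young_simple[OF k] S_simple_sq[OF k] by auto
  have "?s \<otimes> (?s \<otimes> X (Suc k)) \<otimes> ?s = ?s \<otimes> (X k \<otimes> ?s \<oplus> \<one>) \<otimes> ?s" using S_X[OF k] by simp
  moreover have "?s \<otimes> (?s \<otimes> X (Suc k)) \<otimes> ?s = X (Suc k) \<otimes> ?s" using kn s by (simp add: m_assoc[symmetric])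
  moreover have "?s \<otimes> (X k \<otimes> ?s \<oplus> \<one>) \<otimes> ?s = ?s \<otimes> X k \<otimes> (?s \<otimes> ?s) \<oplus> ?s \<otimes> ?s"
    using kn s(1) by (simp add: r_distr l_distr m_assoc)
  ultimately have "X (Suc k) \<otimes> ?s = ?s \<otimes> X k \<oplus> \<one>" using kn s by simp
  then show ?thesis using kn s by (simp add: a_assoc r_neg)
qed

lemma M_closed [simp]: "monom_prod A n X \<alpha> \<in> carrier A"
  by (rule monom_closed) simp

definition Ms :: "'b set" where
  "Ms = {monom_prod A n X \<alpha> \<otimes> S w | \<alpha> w. w \<in> young r n \<mu>}"

lemma kalg_A: "kalg A" ..

lemma Ms_closed: "Ms \<subseteq> carrier A"
  by (auto simp: Ms_def)

text \<open>The same device as for the Yokonuma-Hecke algebra: left multiplication by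
  \<open>X\<close> is built in, and only the reflections have to be pushed to the right.\<close>

inductive_set V :: "'b set" where
  base: "w \<in> young r n \<mu> \<Longrightarrow> S w \<in> V"
| add: "y \<in> V \<Longrightarrow> z \<in> V \<Longrightarrow> y \<oplus> z \<in> V"
| smult: "y \<in> V \<Longrightarrow> c \<odot> y \<in> V"
| x: "i \<in> {1..n} \<Longrightarrow> y \<in> V \<Longrightarrow> X i \<otimes> y \<in> V"

lemma V_closed: "y \<in> V \<Longrightarrow> y \<in> carrier A"
  by (induction rule: V.induct) auto

lemma V_s:
  assumes k: "a \<in> {1..r}" "k \<in> block \<mu> a" "Suc k \<in> block \<mu> a" and y: "y \<in> V"
  shows "S (simple_refl k) \<otimes> y \<in> V"
  using y
proof induction
  case (base w)
  then show ?case using S_mult[OF young_simple[OF k] base] V.base[OF young_comp[OF young_simple[OF k] base]] by simp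
next
  case (add y z)
  then show ?case using young_simple[OF k] V_closed by (simp add: r_distr V.add)
next
  case (smult y c)
  then show ?case using young_simple[OF k] V_closed by (simp add: smult_mult_r V.smult)
next
  case (x j y)
  let ?s = "S (simple_refl k)"
  note kn = block_mem[OF k(1,2)] block_mem[OF k(1,3)]
  note yc = V_closed[OF x(2)]
  have s: "?s \<in> carrier A" using young_simple[OF k] by simp
  have a: "?s \<otimes> (X j \<otimes> y) = (?s \<otimes> X j) \<otimes> y" using s x(1) yc by (simp add: m_assoc)
  consider "j = k" | "j = Suc k" | "j \<noteq> k" "j \<noteq> Suc k" by blast
  then show ?case
  proof cases
    case 1
    then have "?s \<otimes> (X j \<otimes> y) = X (Suc k) \<otimes> (?s \<otimes> y) \<oplus> (-1) \<odot> y"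
      unfolding a using S_X'[OF k] s kn yc by (simp add: l_distr m_assoc minus_smult smult_mult_l)
    then show ?thesis using V.add[OF V.x[OF kn(2) x(3)] V.smult[OF x(2)]] by simp
  next
    case 2
    then have "?s \<otimes> (X j \<otimes> y) = X k \<otimes> (?s \<otimes> y) \<oplus> y"
      unfolding a using S_X[OF k] s kn yc by (simp add: l_distr m_assoc)
    then show ?thesis using V.add[OF V.x[OF kn(1) x(3)] x(2)] by simp
  next
    case 3
    then have "?s \<otimes> (X j \<otimes> y) = X j \<otimes> (?s \<otimes> y)"
      unfolding a using S_X_far[OF k x(1)] s x(1) yc by (simp add: m_assoc)
    then show ?thesis using V.x[OF x(1,3)] by simp
  qed
qed

lemma V_S: "w \<in> young r n \<mu> \<Longrightarrow> \<forall>y\<in>V. S w \<otimes> y \<in> V"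
proof (induction w rule: young_induct)
  case id
  show ?case unfolding S_id using V_closed by simp
next
  case (step a k w)
  show ?case
  proof
    fix y assume y: "y \<in> V"
    have "S (simple_refl k) \<otimes> (S w \<otimes> y) \<in> V" using step y by (intro V_s) auto
    then show "S (simple_refl k \<circ> w) \<otimes> y \<in> V"
      using step(4) young_simple[OF step(1-3)] V_closed[OF y] by (simp add: S_mult m_assoc)
  qed
qed

lemma span:
  assumes gen: "carrier A = gen_subalg A (X ` {1..n} \<union> S ` young r n \<mu>)"
  shows "carrier A = lspan A Ms"
proof
  show "lspan A Ms \<subseteq> carrier A" using lspan_carrier[OF kalg_A Ms_closed] by blast
  have VA: "y \<in> V" if yA: "y \<in> carrier A" for y
  proof -
    have sub: "z \<in> carrier A" if "z \<in> gen_subalg A (X ` {1..n} \<union> S ` young r n \<mu>)" for z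
      using that gen by simp
    have "y \<in> gen_subalg A (X ` {1..n} \<union> S ` young r n \<mu>)" using yA gen by simp
    then have "\<forall>v\<in>V. y \<otimes> v \<in> V"
    proof induction
      case (gen_incl y)
      then show ?case using V.x V_S by auto
    next
      case (gen_add y z)
      then show ?case using sub V_closed by (simp add: l_distr V.add)
    next
      case (gen_mult y z)
      then show ?case using sub V_closed by (simp add: m_assoc)
    next
      case (gen_smult y c)
      then show ?case using sub V_closed by (simp add: smult_mult_l V.smult)
    qed (simp add: V_closed)
    moreover have "\<one> \<in> V" using V.base[OF young_id] S_id by simp
    ultimately have "y \<otimes> \<one> \<in> V" by blast
    then show "y \<in> V" using yA by simp
  qed
  have xl: "X i \<otimes> y \<in> lspan A Ms" if i: "i \<in> {1..n}" and y: "y \<in> lspan A Ms" for i y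
    using y
  proof induction
    case (base y)
    then obtain \<alpha> w where y: "y = monom_prod A n X \<alpha> \<otimes> S w" "w \<in> young r n \<mu>" by (auto simp: Ms_def)
    have "X i \<otimes> y = (X i \<otimes> monom_prod A n X \<alpha>) \<otimes> S w" using i y by (simp add: m_assoc)
    also have "X i \<otimes> monom_prod A n X \<alpha> = monom_prod A n X (\<alpha>(i := Suc (\<alpha> i)))"
      by (rule monom_Suc[OF i]) (auto simp: X_comm)
    finally show ?case using y(2) by (auto simp: Ms_def intro: lspan.base)
  next
    case (add y y')
    then show ?case using i lspan_carrier[OF kalg_A Ms_closed] by (simp add: r_distr lspan.add)
  next
    case (smult y c)
    then show ?case using i lspan_carrier[OF kalg_A Ms_closed] by (simp add: smult_mult_r lspan.smult)
  qed (use i in \<open>simp add: lspan.zero\<close>)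
  have "y \<in> lspan A Ms" if "y \<in> V" for y
    using that
  proof induction
    case (base w)
    have "S w = monom_prod A n X (\<lambda>_. 0) \<otimes> S w" using base by (simp add: monom_zero)
    then show ?case using base by (intro lspan.base) (auto simp: Ms_def)
  qed (auto intro: lspan.intros xl)
  then show "carrier A \<subseteq> lspan A Ms" using VA by blast
qed

end

section \<open>The tensor product of Hecke algebras as a model of the Hecke relations\<close>

context composition
begin

lemma tensor_family_hecke: "tensor_family {1..r} (\<lambda>a. hecke (\<mu> a))"
  by (rule tensor_family.intro) (simp_all add: kalg_hecke)

sublocale H: tensor_family "{1..r}" "\<lambda>a. hecke (\<mu> a)"
  by (rule tensor_family_hecke)

abbreviation "Hc \<equiv> hecke_comp r \<mu>"

lemma Hc_eq: "Hc = tensor_alg {1..r} (\<lambda>a. hecke (\<mu> a))"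
  by (simp add: hecke_comp_def)

lemma kalg_Hc: "kalg Hc"
  unfolding Hc_eq by (rule H.kalg_tensor)

lemma block_shift: "k \<in> block \<mu> a \<Longrightarrow> k - offset \<mu> a \<in> {1..\<mu> a} \<and> offset \<mu> a + (k - offset \<mu> a) = k"
  by (auto simp: block_def)

lemma block_shift': "k \<in> block \<mu> a \<Longrightarrow> Suc k \<in> block \<mu> a \<Longrightarrow> k - offset \<mu> a \<in> {1..<\<mu> a} \<and> Suc k - offset \<mu> a = Suc (k - offset \<mu> a)"
  by (auto simp: block_def)

lemma block_add: "i \<in> {1..\<mu> a} \<Longrightarrow> offset \<mu> a + i \<in> block \<mu> a"
  by (auto simp: block_def)

lemma comp_x_emb:
  assumes "a \<in> {1..r}" "k \<in> block \<mu> a"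
  shows "comp_x r \<mu> k = H.emb a (hecke_x (\<mu> a) (k - offset \<mu> a))"
  unfolding comp_x_def H.emb_def
  by (rule H.pure_cong) (use assms block_unique in \<open>auto simp del: atLeastAtMost_iff\<close>)

lemma hecke_perm_closed: "w permutes {1..m} \<Longrightarrow> hecke_perm m w \<in> carrier (hecke m)"
  unfolding hecke_perm_def by (rule coxeter_elems.perm_elem_closed[OF coxeter_elems_hecke])

text \<open>A simple reflection inside a block has a single nontrivial component, again a simple
  reflection, so the pure tensor has a unit in every other slot.\<close>

lemma comp_perm_simple:
  assumes "a \<in> {1..r}" "k \<in> block \<mu> a" "Suc k \<in> block \<mu> a"
  shows "comp_perm r \<mu> (simple_refl k) = H.emb a (hecke_s (\<mu> a) (k - offset \<mu> a))"
  unfolding comp_perm_def H.emb_def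
proof (rule H.pure_cong)
  interpret C: coxeter_elems "hecke (\<mu> b)" "\<mu> b" "hecke_s (\<mu> b)" for b by (rule coxeter_elems_hecke)
  fix b assume b: "b \<in> {1..r}"
  have "k - offset \<mu> a \<in> {1..<\<mu> a}" using block_shift' assms by blast
  then show "hecke_perm (\<mu> b) (young_component \<mu> b (simple_refl k)) = (if b = a then hecke_s (\<mu> a) (k - offset \<mu> a) else \<one>\<^bsub>hecke (\<mu> b)\<^esub>)"
    unfolding young_component_simple[OF assms b] hecke_perm_def
    using C.perm_elem_simple[of _ b] C.perm_elem_id[of b] by (cases "b = a") (simp_all only: if_True if_False simp_thms)
qed

text \<open>Inside one block the relations are those of a single factor, transported by the
  embedding; across blocks embedded elements commute.\<close>

lemma hecke_data_Hc: "hecke_data r n \<mu> (Hc :: ('k::field, 'k hecke_tensor) module) (comp_x r \<mu>) (comp_perm r \<mu>)"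
proof -
  let ?H = "Hc :: ('k, 'k hecke_tensor) module"
  interpret Hk: kalg ?H by (rule kalg_Hc)
  interpret C: coxeter_elems "hecke (\<mu> b) :: ('k, _) module" "\<mu> b" "hecke_s (\<mu> b)" for b by (rule coxeter_elems_hecke)
  have em: "H.emb a y \<otimes>\<^bsub>?H\<^esub> H.emb a z = H.emb a (y \<otimes>\<^bsub>hecke (\<mu> a)\<^esub> z)"
    if "a \<in> {1..r}" "y \<in> carrier (hecke (\<mu> a))" "z \<in> carrier (hecke (\<mu> a))" for a y z
    using H.emb_simps(4)[OF that] that C.m_closed[of y a z] by (simp add: Hc_eq)
  have ea: "H.emb a y \<oplus>\<^bsub>?H\<^esub> H.emb a z = H.emb a (y \<oplus>\<^bsub>hecke (\<mu> a)\<^esub> z)"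
    if "a \<in> {1..r}" "y \<in> carrier (hecke (\<mu> a))" "z \<in> carrier (hecke (\<mu> a))" for a y z
    using H.emb_simps(2)[OF that] that C.a_closed[of y a z] by (simp add: Hc_eq)
  have e1: "H.emb a \<one>\<^bsub>hecke (\<mu> a)\<^esub> = \<one>\<^bsub>?H\<^esub>" if "a \<in> {1..r}" for a
  proof -
    have "restrict (H.emb a) (carrier (hecke (\<mu> a) :: ('k, _) module)) \<one>\<^bsub>hecke (\<mu> a)\<^esub> = \<one>\<^bsub>?H\<^esub>"
      unfolding Hc_eq by (rule H.emb_simps(5)[OF that])
    then show ?thesis using C.one_closed[of a] by simp
  qed
  have ec: "H.emb a y \<otimes>\<^bsub>?H\<^esub> H.emb b z = H.emb b z \<otimes>\<^bsub>?H\<^esub> H.emb a y"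
    if "a \<in> {1..r}" "b \<in> {1..r}" "a \<noteq> b" "y \<in> carrier (hecke (\<mu> a))" "z \<in> carrier (hecke (\<mu> b))" for a b y z
    unfolding Hc_eq using that by (rule H.emb_commute)
  have yp: "hecke_perm (\<mu> a) (young_component \<mu> a w) \<in> carrier (hecke (\<mu> a))" if "w \<in> young r n \<mu>" "a \<in> {1..r}" for a w
    using hecke_perm_closed young_component_permutes[OF that] by blast
  show ?thesis
  proof
    show "comp_x r \<mu> k \<in> carrier ?H" if k: "k \<in> {1..n}" for k
    proof -
      obtain a where a: "a \<in> {1..r}" "k \<in> block \<mu> a" using block_exists[OF k] by blast
      then show ?thesis unfolding comp_x_emb[OF a] Hc_eq using block_shift
        by (intro H.emb_closed hecke_x_closed) auto
    qed
    show "comp_perm r \<mu> w \<in> carrier ?H" if "w \<in> young r n \<mu>" for w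
      unfolding comp_perm_def Hc_eq using yp that by (intro H.pure_closed) auto
    show "comp_perm r \<mu> id = \<one>\<^bsub>?H\<^esub>"
      unfolding comp_perm_def Hc_eq H.pure_one[symmetric] young_component_id hecke_perm_def C.perm_elem_id ..
    show "comp_perm r \<mu> (w \<circ> v) = comp_perm r \<mu> w \<otimes>\<^bsub>?H\<^esub> comp_perm r \<mu> v" if wv: "w \<in> young r n \<mu>" "v \<in> young r n \<mu>" for w v
    proof -
      have "comp_perm r \<mu> w \<otimes>\<^bsub>?H\<^esub> comp_perm r \<mu> v = H.pure (\<lambda>a. hecke_perm (\<mu> a) (young_component \<mu> a w)
          \<otimes>\<^bsub>hecke (\<mu> a)\<^esub> hecke_perm (\<mu> a) (young_component \<mu> a v))"
        unfolding comp_perm_def Hc_eq using yp wv by (intro H.pure_mult) auto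
      also have "\<dots> = comp_perm r \<mu> (w \<circ> v)"
        unfolding comp_perm_def
      proof (rule H.pure_cong)
        fix a assume a: "a \<in> {1..r}"
        show "hecke_perm (\<mu> a) (young_component \<mu> a w) \<otimes>\<^bsub>hecke (\<mu> a)\<^esub> hecke_perm (\<mu> a) (young_component \<mu> a v)
            = (hecke_perm (\<mu> a) (young_component \<mu> a (w \<circ> v)) :: (hecke_gen, 'k) free_algebra set)"
          unfolding young_component_comp[OF wv a] hecke_perm_def
          by (rule C.perm_elem_mult[symmetric]; rule young_component_permutes; fact)
      qed
      finally show ?thesis by simp
    qed
    show "comp_x r \<mu> k \<otimes>\<^bsub>?H\<^esub> comp_x r \<mu> l = comp_x r \<mu> l \<otimes>\<^bsub>?H\<^esub> comp_x r \<mu> k" if kl: "k \<in> {1..n}" "l \<in> {1..n}" for k l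
    proof -
      obtain a where a: "a \<in> {1..r}" "k \<in> block \<mu> a" using block_exists[OF kl(1)] by blast
      obtain b where b: "b \<in> {1..r}" "l \<in> block \<mu> b" using block_exists[OF kl(2)] by blast
      have ka: "k - offset \<mu> a \<in> {1..\<mu> a}" and lb: "l - offset \<mu> b \<in> {1..\<mu> b}" using block_shift a b by blast+
      show ?thesis
      proof (cases "a = b")
        case True
        then show ?thesis unfolding comp_x_emb[OF a] comp_x_emb[OF b]
          using ka lb a by (simp only: em hecke_x_closed hecke_rels_hold(4))
      next
        case False
        then show ?thesis unfolding comp_x_emb[OF a] comp_x_emb[OF b]
          using ka lb a b by (intro ec hecke_x_closed)
      qed
    qed
    fix a k assume k: "a \<in> {1..r}" "k \<in> block \<mu> a" "Suc k \<in> block \<mu> a"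
    have k1: "k - offset \<mu> a \<in> {1..<\<mu> a}" "Suc k - offset \<mu> a = Suc (k - offset \<mu> a)" using block_shift'[OF k(2,3)] by auto
    then have k2: "k - offset \<mu> a \<in> {1..\<mu> a}" "Suc (k - offset \<mu> a) \<in> {1..\<mu> a}" by auto
    have hc: "hecke_x (\<mu> a) (k - offset \<mu> a) \<in> carrier (hecke (\<mu> a) :: ('k, _) module)"
      "hecke_x (\<mu> a) (Suc (k - offset \<mu> a)) \<in> carrier (hecke (\<mu> a) :: ('k, _) module)"
      "hecke_s (\<mu> a) (k - offset \<mu> a) \<in> carrier (hecke (\<mu> a) :: ('k, _) module)"
      using hecke_x_closed[OF k2(1)] hecke_x_closed[OF k2(2)] hecke_s_closed[OF k1(1)] by blast+
    show "comp_perm r \<mu> (simple_refl k) \<otimes>\<^bsub>?H\<^esub> comp_x r \<mu> (Suc k) = comp_x r \<mu> k \<otimes>\<^bsub>?H\<^esub> comp_perm r \<mu> (simple_refl k) \<oplus>\<^bsub>?H\<^esub> \<one>\<^bsub>?H\<^esub>"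
      unfolding comp_perm_simple[OF k] comp_x_emb[OF k(1,2)] comp_x_emb[OF k(1,3)] k1(2) e1[OF k(1), symmetric]
      using k(1) hc by (simp only: em ea C.m_closed C.one_closed hecke_rels_hold(5)[OF k1(1)])
    show "comp_perm r \<mu> (simple_refl k) \<otimes>\<^bsub>?H\<^esub> comp_x r \<mu> j = comp_x r \<mu> j \<otimes>\<^bsub>?H\<^esub> comp_perm r \<mu> (simple_refl k)"
      if j: "j \<in> {1..n}" "j \<noteq> k" "j \<noteq> Suc k" for j
    proof -
      obtain b where b: "b \<in> {1..r}" "j \<in> block \<mu> b" using block_exists[OF j(1)] by blast
      have jb: "j - offset \<mu> b \<in> {1..\<mu> b}" using block_shift b by blast
      then have jc: "hecke_x (\<mu> b) (j - offset \<mu> b) \<in> carrier (hecke (\<mu> b) :: ('k, _) module)" by (rule hecke_x_closed)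
      show ?thesis
      proof (cases "a = b")
        case True
        have ne: "j - offset \<mu> a \<noteq> k - offset \<mu> a" "j - offset \<mu> a \<noteq> Suc (k - offset \<mu> a)"
          using j block_shift[OF b(2)] block_shift[OF k(2)] True by auto
        show ?thesis unfolding comp_perm_simple[OF k] comp_x_emb[OF b] True[symmetric]
            em[OF k(1) hc(3) jc[folded True]] em[OF k(1) jc[folded True] hc(3)]
            hecke_rels_hold(6)[OF k1(1) jb[folded True] ne] ..
      next
        case False
        then show ?thesis unfolding comp_perm_simple[OF k] comp_x_emb[OF b]
          using hc jc k(1) b by (intro ec)
      qed
    qed
  qed
qed

text \<open>The embedded generators of the factors all occur among the \<open>comp_x\<close> and the
  \<open>comp_perm\<close> of simple reflections, and the embedded factors generate the tensor
  product.\<close>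

lemma Hc_generated:
  "carrier (Hc :: ('k::field, 'k hecke_tensor) module) = gen_subalg Hc (comp_x r \<mu> ` {1..n} \<union> comp_perm r \<mu> ` young r n \<mu>)"
  (is "carrier ?H = gen_subalg ?H ?G")
proof
  interpret D: hecke_data r n \<mu> ?H "comp_x r \<mu>" "comp_perm r \<mu>" by (rule hecke_data_Hc)
  show "gen_subalg ?H ?G \<subseteq> carrier ?H" by (rule gen_subalg_subset[OF kalg_Hc]) auto
  have "H.emb a y \<in> gen_subalg ?H ?G" if a: "a \<in> {1..r}" and y: "y \<in> carrier (hecke (\<mu> a) :: ('k, _) module)" for a y
  proof -
    let ?Ga = "hecke_x (\<mu> a) ` {1..\<mu> a} \<union> hecke_s (\<mu> a) ` {1..<\<mu> a} :: (hecke_gen, 'k) free_algebra set set"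
    have Gc: "?Ga \<subseteq> carrier (hecke (\<mu> a))" using hecke_x_closed hecke_s_closed by blast
    have r1: "restrict (H.emb a) (carrier (hecke (\<mu> a))) y \<in> gen_subalg ?H (restrict (H.emb a) (carrier (hecke (\<mu> a))) ` ?Ga)"
      unfolding Hc_eq
      by (rule alg_hom_image_gen_subalg[OF kalg_hecke H.emb_hom[OF a] Gc]) (use y hecke_generated in blast)
    have r2: "restrict (H.emb a) (carrier (hecke (\<mu> a))) ` ?Ga \<subseteq> gen_subalg ?H ?G"
    proof
      fix z assume "z \<in> restrict (H.emb a) (carrier (hecke (\<mu> a))) ` ?Ga"
      then obtain g where g: "g \<in> ?Ga" "z = H.emb a g" using Gc by (auto simp: subset_iff)
      show "z \<in> gen_subalg ?H ?G"
      proof (cases "g \<in> hecke_x (\<mu> a) ` {1..\<mu> a}")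
        case True
        then obtain i where i: "i \<in> {1..\<mu> a}" "g = hecke_x (\<mu> a) i" by blast
        have "z = comp_x r \<mu> (offset \<mu> a + i)" unfolding comp_x_emb[OF a block_add[OF i(1)]] g i by simp
        then show ?thesis using block_mem[OF a block_add[OF i(1)]] by (auto intro: gen_subalg.gen_incl)
      next
        case False
        then obtain i where i: "i \<in> {1..<\<mu> a}" "g = hecke_s (\<mu> a) i" using g by blast
        have b: "offset \<mu> a + i \<in> block \<mu> a" "Suc (offset \<mu> a + i) \<in> block \<mu> a" using i by (auto simp: block_def)
        have "z = comp_perm r \<mu> (simple_refl (offset \<mu> a + i))" unfolding comp_perm_simple[OF a b] g i by simp
        then show ?thesis using young_simple[OF a b] by (auto intro: gen_subalg.gen_incl)
      qed
    qed
    have "restrict (H.emb a) (carrier (hecke (\<mu> a))) y \<in> gen_subalg ?H ?G"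
      by (rule subsetD[OF gen_subalg_mono[OF r2] r1])
    then show ?thesis using y by (simp only: restrict_apply if_True)
  qed
  then have sub: "(\<Union>a\<in>{1..r}. H.emb a ` carrier (hecke (\<mu> a))) \<subseteq> gen_subalg ?H ?G" by blast
  have "carrier ?H = gen_subalg ?H (\<Union>a\<in>{1..r}. H.emb a ` carrier (hecke (\<mu> a)))"
    unfolding Hc_eq by (rule H.tensor_generated)
  then show "carrier ?H \<subseteq> gen_subalg ?H ?G" using gen_subalg_mono[OF sub] by (simp only:)
qed

end

section \<open>Homomorphisms out of the tensor product\<close>

context hecke_data
begin

text \<open>Each factor maps to \<open>A\<close> by its presentation. The images of different
  factors commute because they are generated by elements with indices in different blocks, so the
  maps combine on the tensor product. The value at a general \<open>comp_perm\<close> then follows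
  by \<open>young_induct\<close>.\<close>

lemma Hc_hom_exists:
  "\<exists>h \<in> alg_hom (Hc :: ('k, 'k hecke_tensor) module) A.
     (\<forall>k\<in>{1..n}. h (comp_x r \<mu> k) = X k) \<and> (\<forall>w\<in>young r n \<mu>. h (comp_perm r \<mu> w) = S w)"
proof -
  let ?\<xi> = "\<lambda>a i. X (offset \<mu> a + i)" and ?\<tau> = "\<lambda>a i. S (simple_refl (offset \<mu> a + i))"
  have bl: "offset \<mu> a + i \<in> block \<mu> a" "Suc (offset \<mu> a + i) \<in> block \<mu> a" if "i \<in> {1..<\<mu> a}" for a i
    using that by (auto simp: block_def)
  have \<xi>c: "?\<xi> a i \<in> carrier A" if "a \<in> {1..r}" "i \<in> {1..\<mu> a}" for a i
    using block_mem[OF that(1) block_add[OF that(2)]] by simp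
  have yg: "simple_refl (offset \<mu> a + i) \<in> young r n \<mu>" if "a \<in> {1..r}" "i \<in> {1..<\<mu> a}" for a i
    using young_simple[OF that(1) bl[OF that(2)]] .
  have \<tau>c: "?\<tau> a i \<in> carrier A" if "a \<in> {1..r}" "i \<in> {1..<\<mu> a}" for a i
    using yg[OF that] by simp
  have "\<forall>a\<in>{1..r}. \<exists>h \<in> alg_hom (hecke (\<mu> a) :: ('k, _) module) A. (\<forall>i\<in>{1..\<mu> a}. h (hecke_x (\<mu> a) i) = ?\<xi> a i) \<and>
      (\<forall>i\<in>{1..<\<mu> a}. h (hecke_s (\<mu> a) i) = ?\<tau> a i)"
  proof
    fix a assume a: "a \<in> {1..r}"
    have mem: "offset \<mu> a + i \<in> {1..n}" if "i \<in> {1..\<mu> a}" for i using block_mem[OF a block_add[OF that]] .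
    show "\<exists>h \<in> alg_hom (hecke (\<mu> a) :: ('k, _) module) A. (\<forall>i\<in>{1..\<mu> a}. h (hecke_x (\<mu> a) i) = ?\<xi> a i) \<and>
      (\<forall>i\<in>{1..<\<mu> a}. h (hecke_s (\<mu> a) i) = ?\<tau> a i)"
    proof (rule hecke_hom_exists[OF kalg_A])
      fix i assume i: "i \<in> {1..<\<mu> a}"
      show "?\<tau> a i \<otimes> ?\<tau> a i = \<one>" using S_simple_sq[OF a bl[OF i]] .
      show "?\<tau> a i \<otimes> ?\<xi> a (Suc i) = ?\<xi> a i \<otimes> ?\<tau> a i \<oplus> \<one>" using S_X[OF a bl[OF i]] by simp
      show "?\<tau> a i \<otimes> ?\<xi> a j = ?\<xi> a j \<otimes> ?\<tau> a i" if "j \<in> {1..\<mu> a}" "j \<noteq> i" "j \<noteq> Suc i" for j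
        using S_X_far[OF a bl[OF i] mem[OF that(1)]] that by simp
      show "?\<tau> a i \<otimes> ?\<tau> a j = ?\<tau> a j \<otimes> ?\<tau> a i" if j: "j \<in> {1..<\<mu> a}" "Suc i < j" for j
        unfolding S_mult[OF yg[OF a i] yg[OF a j(1)], symmetric] S_mult[OF yg[OF a j(1)] yg[OF a i], symmetric]
        using j(2) by (subst simple_refl_commute) auto
      show "?\<tau> a i \<otimes> ?\<tau> a (Suc i) \<otimes> ?\<tau> a i = ?\<tau> a (Suc i) \<otimes> ?\<tau> a i \<otimes> ?\<tau> a (Suc i)" if j: "Suc i \<in> {1..<\<mu> a}"
        using simple_refl_braid[of "offset \<mu> a + i"] yg[OF a i] yg[OF a j] young_comp
        by (simp add: S_mult[symmetric])
    qed (use \<xi>c[OF a] \<tau>c[OF a] mem in \<open>auto simp: X_comm\<close>)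
  qed
  then obtain \<psi> where \<psi>: "\<And>a. a \<in> {1..r} \<Longrightarrow> \<psi> a \<in> alg_hom (hecke (\<mu> a) :: ('k, _) module) A"
    "\<And>a i. a \<in> {1..r} \<Longrightarrow> i \<in> {1..\<mu> a} \<Longrightarrow> \<psi> a (hecke_x (\<mu> a) i) = ?\<xi> a i"
    "\<And>a i. a \<in> {1..r} \<Longrightarrow> i \<in> {1..<\<mu> a} \<Longrightarrow> \<psi> a (hecke_s (\<mu> a) i) = ?\<tau> a i"
    by metis
  let ?G = "\<lambda>a. ?\<xi> a ` {1..\<mu> a} \<union> ?\<tau> a ` {1..<\<mu> a}"
  have Gc: "?G a \<subseteq> carrier A" if "a \<in> {1..r}" for a using \<xi>c[OF that] \<tau>c[OF that] by blast
  have \<psi>G: "\<psi> a y \<in> gen_subalg A (?G a)" if a: "a \<in> {1..r}" and y: "y \<in> carrier (hecke (\<mu> a))" for a y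
  proof -
    have "\<psi> a ` (hecke_x (\<mu> a) ` {1..\<mu> a} \<union> hecke_s (\<mu> a) ` {1..<\<mu> a}) = ?G a"
      unfolding image_Un image_image using \<psi>(2,3)[OF a] by (intro arg_cong2[of _ _ _ _ "(\<union>)"] image_cong) auto
    moreover have "\<psi> a y \<in> gen_subalg A (\<psi> a ` (hecke_x (\<mu> a) ` {1..\<mu> a} \<union> hecke_s (\<mu> a) ` {1..<\<mu> a}))"
      by (rule alg_hom_image_gen_subalg[OF kalg_hecke \<psi>(1)[OF a]])
         (use hecke_x_closed hecke_s_closed y hecke_generated in blast)+
    ultimately show ?thesis by simp
  qed
  have sep: "offset \<mu> a + i \<noteq> offset \<mu> b + j" if "a \<in> {1..r}" "b \<in> {1..r}" "a \<noteq> b" "i \<in> {1..\<mu> a}" "j \<in> {1..\<mu> b}" for a b i j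
    using block_unique[OF that(1,2) block_add[OF that(4)]] block_add[OF that(5)] that(3) by metis
  have gcomm: "y \<otimes> z = z \<otimes> y" if ab: "a \<in> {1..r}" "b \<in> {1..r}" "a \<noteq> b" and y: "y \<in> ?G a" and z: "z \<in> ?G b" for a b y z
  proof -
    have xs: "?\<tau> a i \<otimes> ?\<xi> b j = ?\<xi> b j \<otimes> ?\<tau> a i" if ab: "a \<in> {1..r}" "b \<in> {1..r}" "a \<noteq> b" and i: "i \<in> {1..<\<mu> a}" and j: "j \<in> {1..\<mu> b}" for a b i j
    proof (rule S_X_far[OF ab(1) bl[OF i]])
      show "offset \<mu> b + j \<in> {1..n}" using block_mem[OF ab(2) block_add[OF j]] .
      show "offset \<mu> b + j \<noteq> offset \<mu> a + i" using sep[of b a j i] ab i j by auto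
      show "offset \<mu> b + j \<noteq> Suc (offset \<mu> a + i)" using sep[of b a j "Suc i"] ab i j by auto
    qed
    have ss: "?\<tau> a i \<otimes> ?\<tau> b j = ?\<tau> b j \<otimes> ?\<tau> a i" if i: "i \<in> {1..<\<mu> a}" and j: "j \<in> {1..<\<mu> b}" for i j
    proof -
      have "offset \<mu> a + i \<noteq> offset \<mu> b + j" "Suc (offset \<mu> a + i) \<noteq> offset \<mu> b + j" "offset \<mu> a + i \<noteq> Suc (offset \<mu> b + j)"
        using sep[OF ab, of i j] sep[OF ab, of "Suc i" j] sep[OF ab, of i "Suc j"] i j by auto
      then have "simple_refl (offset \<mu> a + i) \<circ> simple_refl (offset \<mu> b + j) = simple_refl (offset \<mu> b + j) \<circ> simple_refl (offset \<mu> a + i)"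
        by (intro simple_refl_commute) linarith
      then show ?thesis using S_mult[OF yg[OF ab(1) i] yg[OF ab(2) j]] S_mult[OF yg[OF ab(2) j] yg[OF ab(1) i]] by simp
    qed
    have xx: "?\<xi> a i \<otimes> ?\<xi> b j = ?\<xi> b j \<otimes> ?\<xi> a i" if "i \<in> {1..\<mu> a}" "j \<in> {1..\<mu> b}" for i j
      using block_mem[OF ab(1) block_add[OF that(1)]] block_mem[OF ab(2) block_add[OF that(2)]] by (rule X_comm)
    from y z show ?thesis
      using xs[OF ab] xs[OF ab(2,1) ab(3)[symmetric]] ss xx by (elim UnE imageE) metis+
  qed
  have "\<exists>h \<in> alg_hom (tensor_alg {1..r} (\<lambda>a. hecke (\<mu> a)) :: ('k, 'k hecke_tensor) module) A.
      \<forall>a\<in>{1..r}. \<forall>y\<in>carrier (hecke (\<mu> a)). h (H.emb a y) = \<psi> a y"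
  proof (rule H.tensor_hom_exists[OF kalg_A \<psi>(1)])
    fix a b y z assume ab: "a \<in> {1..r}" "b \<in> {1..r}" "a \<noteq> b" and y: "y \<in> carrier (hecke (\<mu> a) :: ('k, _) module)"
      and z: "z \<in> carrier (hecke (\<mu> b) :: ('k, _) module)"
    note zc = alg_homD(1)[OF \<psi>(1)[OF ab(2)] z]
    \<comment> \<open>Commutation passes from generators to the generated subalgebras one side at a
      time.\<close>
    have "g \<otimes> \<psi> b z = \<psi> b z \<otimes> g" if g: "g \<in> ?G a" for g
    proof -
      have gA: "g \<in> carrier A" using Gc[OF ab(1)] g by (rule subsetD)
      show ?thesis
        by (rule gen_subalg_commute[OF kalg_A Gc[OF ab(2)] gA _ \<psi>G[OF ab(2) z], symmetric])
           (rule gcomm[OF ab g, symmetric])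
    qed
    then show "\<psi> a y \<otimes> \<psi> b z = \<psi> b z \<otimes> \<psi> a y"
      by (rule gen_subalg_commute[OF kalg_A Gc[OF ab(1)] zc _ \<psi>G[OF ab(1) y]])
  qed
  then obtain h where h: "h \<in> alg_hom (Hc :: ('k, 'k hecke_tensor) module) A"
    "\<And>a y. a \<in> {1..r} \<Longrightarrow> y \<in> carrier (hecke (\<mu> a)) \<Longrightarrow> h (H.emb a y) = \<psi> a y"
    unfolding Hc_eq by blast
  interpret D: hecke_data r n \<mu> "Hc :: ('k, 'k hecke_tensor) module" "comp_x r \<mu>" "comp_perm r \<mu>" by (rule hecke_data_Hc)
  have hx: "h (comp_x r \<mu> k) = X k" if k: "k \<in> {1..n}" for k
  proof -
    obtain a where a: "a \<in> {1..r}" "k \<in> block \<mu> a" using block_exists[OF k] by blast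
    have s: "k - offset \<mu> a \<in> {1..\<mu> a}" "offset \<mu> a + (k - offset \<mu> a) = k" using block_shift[OF a(2)] by auto
    show ?thesis unfolding comp_x_emb[OF a] h(2)[OF a(1) hecke_x_closed[OF s(1)]] \<psi>(2)[OF a(1) s(1)] s(2) ..
  qed
  have "h (comp_perm r \<mu> w) = S w" if "w \<in> young r n \<mu>" for w
    using that
  proof (induction w rule: young_induct)
    case id
    show ?case unfolding D.S_id S_id using alg_homD(5)[OF h(1)] .
  next
    case (step a k w)
    have s: "k - offset \<mu> a \<in> {1..<\<mu> a}" "offset \<mu> a + (k - offset \<mu> a) = k"
      using block_shift'[OF step(2,3)] block_shift[OF step(2)] by auto
    have "h (comp_perm r \<mu> (simple_refl k)) = S (simple_refl k)"
      unfolding comp_perm_simple[OF step(1-3)] h(2)[OF step(1) hecke_s_closed[OF s(1)]] \<psi>(3)[OF step(1) s(1)] s(2) ..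
    then show ?case
      unfolding D.S_mult[OF young_simple[OF step(1-3)] step(4)] S_mult[OF young_simple[OF step(1-3)] step(4)]
      using step(4,5) young_simple[OF step(1-3)] alg_homD(4)[OF h(1)] by simp
  qed
  with h(1) hx show ?thesis by blast
qed

end

section \<open>Monomial matrices\<close>

text \<open>The column is given as a function of the row, so a product of matrices composes these
  functions in reverse order. This is why \<open>Fm w\<close> below uses the action of the inverse
  of \<open>w\<close>.\<close>

definition mono_mat :: "'l set \<Rightarrow> ('k, 'b) module \<Rightarrow> ('l \<Rightarrow> 'l) \<Rightarrow> ('l \<Rightarrow> 'b) \<Rightarrow> 'l \<times> 'l \<Rightarrow> 'b" where
  "mono_mat L A p g = (\<lambda>(i, j)\<in>L \<times> L. if j = p i then g i else \<zero>\<^bsub>A\<^esub>)"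

locale matrices = kalg A for A :: "('k::field, 'b) module" (structure) +
  fixes L :: "'l set"
  assumes finite_L: "finite L"
begin

abbreviation "M \<equiv> mat_alg L A"
abbreviation "mm \<equiv> mono_mat L A"

lemma kalg_M: "kalg M"
  using kalg_axioms finite_L by (rule kalg_mat)

sublocale M: kalg M by (rule kalg_M)

lemma mm_entry: "i \<in> L \<Longrightarrow> j \<in> L \<Longrightarrow> mm p g (i, j) = (if j = p i then g i else \<zero>)"
  by (simp add: mono_mat_def)

lemma mm_closed [intro]: "(\<And>i. i \<in> L \<Longrightarrow> g i \<in> carrier A) \<Longrightarrow> mm p g \<in> carrier M"
  by (auto simp: mat_alg_simps mono_mat_def)

lemma mm_cong: "(\<And>i. i \<in> L \<Longrightarrow> p i = q i) \<Longrightarrow> (\<And>i. i \<in> L \<Longrightarrow> g i = h i) \<Longrightarrow> mm p g = mm q h"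
  by (auto simp: mono_mat_def fun_eq_iff restrict_def)

lemma mm_mult:
  assumes p: "\<And>i. i \<in> L \<Longrightarrow> p i \<in> L" and g: "\<And>i. i \<in> L \<Longrightarrow> g i \<in> carrier A" and h: "\<And>i. i \<in> L \<Longrightarrow> h i \<in> carrier A"
  shows "mm p g \<otimes>\<^bsub>M\<^esub> mm q h = mm (\<lambda>i. q (p i)) (\<lambda>i. g i \<otimes> h (p i))"
proof (rule mat_eqI)
  fix i j assume ij: "i \<in> L" "j \<in> L"
  have "(mm p g \<otimes>\<^bsub>M\<^esub> mm q h) (i, j) = (\<Oplus>l\<in>L. mm p g (i, l) \<otimes> mm q h (l, j))"
    using ij by (simp add: mat_alg_simps)
  also have "\<dots> = (\<Oplus>l\<in>L. if l = p i then g i \<otimes> mm q h (p i, j) else \<zero>)"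
    using ij g h p by (intro finsum_cong') (auto simp: mm_entry)
  also have "\<dots> = g i \<otimes> mm q h (p i, j)"
    using ij g h p by (intro finsum_single finite_L) (auto simp: mm_entry)
  finally show "(mm p g \<otimes>\<^bsub>M\<^esub> mm q h) (i, j) = mm (\<lambda>i. q (p i)) (\<lambda>i. g i \<otimes> h (p i)) (i, j)"
    using ij p g by (simp add: mm_entry)
qed (use p g h in \<open>auto intro!: mm_closed M.m_closed\<close>)

abbreviation "dg \<equiv> mm (\<lambda>i. i)"

lemma dg_mult:
  assumes "\<And>i. i \<in> L \<Longrightarrow> g i \<in> carrier A" "\<And>i. i \<in> L \<Longrightarrow> h i \<in> carrier A"
  shows "dg g \<otimes>\<^bsub>M\<^esub> dg h = dg (\<lambda>i. g i \<otimes> h i)"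
  using assms by (intro mm_mult) auto

lemma dg_one: "dg (\<lambda>_. \<one>) = \<one>\<^bsub>M\<^esub>"
  by (auto simp: mono_mat_def mat_alg_simps fun_eq_iff restrict_def)

lemma dg_add:
  "(\<And>i. i \<in> L \<Longrightarrow> g i \<in> carrier A) \<Longrightarrow> (\<And>i. i \<in> L \<Longrightarrow> h i \<in> carrier A) \<Longrightarrow> dg g \<oplus>\<^bsub>M\<^esub> dg h = dg (\<lambda>i. g i \<oplus> h i)"
  by (auto simp: mono_mat_def mat_alg_simps fun_eq_iff restrict_def)

lemma dg_smult: "c \<odot>\<^bsub>M\<^esub> dg g = dg (\<lambda>i. c \<odot> g i)"
  by (auto simp: mono_mat_def mat_alg_simps fun_eq_iff restrict_def)

lemma dg_pow:
  assumes "\<And>i. i \<in> L \<Longrightarrow> g i \<in> carrier A"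
  shows "dg g [^]\<^bsub>M\<^esub> (k::nat) = dg (\<lambda>i. g i [^] k)"
  by (induction k) (use assms in \<open>auto simp: dg_one dg_mult\<close>)

lemma dg_list_prod:
  assumes "\<And>j i. j \<in> set js \<Longrightarrow> i \<in> L \<Longrightarrow> g j i \<in> carrier A"
  shows "list_prod M (map (\<lambda>j. dg (g j)) js) = dg (\<lambda>i. list_prod A (map (\<lambda>j. g j i) js))"
  using assms
proof (induction js)
  case (Cons j js)
  then show ?case by (simp, subst dg_mult) (auto intro!: list_prod_closed)
qed (simp add: dg_one)

lemma dg_scalar_sum:
  "(\<Oplus>\<^bsub>M\<^esub>s\<in>I. dg (\<lambda>i. c s i \<odot> \<one>)) = dg (\<lambda>i. (\<Sum>s\<in>I. c s i) \<odot> \<one>)"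
proof (induction I rule: infinite_finite_induct)
  case (insert s I)
  have "(\<Oplus>\<^bsub>M\<^esub>s\<in>insert s I. dg (\<lambda>i. c s i \<odot> \<one>)) = dg (\<lambda>i. c s i \<odot> \<one>) \<oplus>\<^bsub>M\<^esub> (\<Oplus>\<^bsub>M\<^esub>s\<in>I. dg (\<lambda>i. c s i \<odot> \<one>))"
    using insert.hyps by (intro M.finsum_insert) (auto intro!: mm_closed)
  then show ?case using insert by (simp add: dg_add smult_l_distr)
qed (auto simp: mono_mat_def mat_alg_simps fun_eq_iff restrict_def)

lemma mat_unit_closed: "y \<in> carrier A \<Longrightarrow> mat_unit L A i j y \<in> carrier M"
  by (auto simp: mat_unit_def mat_alg_simps)

lemma mat_unit_mm:
  assumes "i \<in> L" "p i = j"
  shows "mat_unit L A i j (g i) = mm p (\<lambda>l. if l = i then g l else \<zero>)"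
  using assms by (auto simp: mat_unit_def mono_mat_def fun_eq_iff restrict_def)

lemma mat_unit_add: "mat_unit L A i j y \<oplus>\<^bsub>M\<^esub> mat_unit L A i j z = mat_unit L A i j (y \<oplus> z)"
  by (auto simp: mat_unit_def mat_alg_simps fun_eq_iff restrict_def)

lemma mat_unit_smult: "c \<odot>\<^bsub>M\<^esub> mat_unit L A i j y = mat_unit L A i j (c \<odot> y)"
  by (auto simp: mat_unit_def mat_alg_simps fun_eq_iff restrict_def)

lemma mat_unit_zero: "mat_unit L A i j \<zero> = \<zero>\<^bsub>M\<^esub>"
  by (auto simp: mat_unit_def mat_alg_simps fun_eq_iff restrict_def)

lemma mat_entry_finsum:
  assumes "\<And>s. s \<in> I \<Longrightarrow> N s \<in> carrier M" "p \<in> L \<times> L"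
  shows "(\<Oplus>\<^bsub>M\<^esub>s\<in>I. N s) p = (\<Oplus>s\<in>I. N s p)"
  using assms(1)
proof (induction I rule: infinite_finite_induct)
  case (insert s I)
  have "N q p \<in> carrier A" if "q \<in> insert s I" for q
    using insert.prems[OF that] assms(2) by (auto simp: mat_alg_simps)
  then show ?case using insert assms(2) by (simp add: M.finsum_insert finsum_insert Pi_def) (simp add: mat_alg_simps)
qed (use assms(2) in \<open>auto simp: mat_alg_simps\<close>)

lemma mat_decomp:
  assumes N: "N \<in> carrier M"
  shows "N = (\<Oplus>\<^bsub>M\<^esub>q\<in>L \<times> L. mat_unit L A (fst q) (snd q) (N q))"
proof (rule mat_eqI)
  have c: "mat_unit L A (fst q) (snd q) (N q) \<in> carrier M" if "q \<in> L \<times> L" for q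
    using mat_closed[OF N] that by (intro mat_unit_closed) auto
  then show "(\<Oplus>\<^bsub>M\<^esub>q\<in>L \<times> L. mat_unit L A (fst q) (snd q) (N q)) \<in> carrier M" by (intro M.finsum_closed) auto
  fix i j assume ij: "i \<in> L" "j \<in> L"
  have "(\<Oplus>\<^bsub>M\<^esub>q\<in>L \<times> L. mat_unit L A (fst q) (snd q) (N q)) (i, j) = (\<Oplus>q\<in>L \<times> L. mat_unit L A (fst q) (snd q) (N q) (i, j))"
    using c ij by (intro mat_entry_finsum) auto
  also have "\<dots> = (\<Oplus>q\<in>L \<times> L. if q = (i, j) then N (i, j) else \<zero>)"
    using ij mat_closed[OF N] by (intro finsum_cong') (auto simp: mat_unit_def)
  also have "\<dots> = N (i, j)" using ij mat_closed[OF N] finite_L by (intro finsum_single) auto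
  finally show "N (i, j) = (\<Oplus>\<^bsub>M\<^esub>q\<in>L \<times> L. mat_unit L A (fst q) (snd q) (N q)) (i, j)" ..
qed (use N in simp)

lemma mat_unit_in_lspan:
  assumes "y \<in> lspan A G" "\<And>g. g \<in> G \<Longrightarrow> mat_unit L A i j g \<in> S"
  shows "mat_unit L A i j y \<in> lspan M S"
  using assms(1)
  by induction (auto simp: mat_unit_zero mat_unit_add[symmetric] mat_unit_smult[symmetric] intro: lspan.intros assms(2))

end

section \<open>Matrix representations of the Yokonuma--Hecke algebra\<close>

lemma yh_hom_exists:
  fixes B :: "('k::field, 'b) module"
  assumes B: "kalg B" and tc: "\<And>i. i \<in> {1..n} \<Longrightarrow> t i \<in> carrier B" and fc: "\<And>i. i \<in> {1..<n} \<Longrightarrow> f i \<in> carrier B"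
    and xc: "\<And>i. i \<in> {1..n} \<Longrightarrow> x i \<in> carrier B"
    and f_far: "\<And>i j. i \<in> {1..<n} \<Longrightarrow> j \<in> {1..<n} \<Longrightarrow> Suc i < j \<Longrightarrow> f i \<otimes>\<^bsub>B\<^esub> f j = f j \<otimes>\<^bsub>B\<^esub> f i"
    and f_braid: "\<And>i. i \<in> {1..<n} \<Longrightarrow> Suc i \<in> {1..<n} \<Longrightarrow> f i \<otimes>\<^bsub>B\<^esub> f (Suc i) \<otimes>\<^bsub>B\<^esub> f i = f (Suc i) \<otimes>\<^bsub>B\<^esub> f i \<otimes>\<^bsub>B\<^esub> f (Suc i)"
    and f_quad: "\<And>i. i \<in> {1..<n} \<Longrightarrow> f i \<otimes>\<^bsub>B\<^esub> f i = \<one>\<^bsub>B\<^esub>"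
    and t_comm: "\<And>i j. i \<in> {1..n} \<Longrightarrow> j \<in> {1..n} \<Longrightarrow> t i \<otimes>\<^bsub>B\<^esub> t j = t j \<otimes>\<^bsub>B\<^esub> t i"
    and f_t: "\<And>i j. i \<in> {1..<n} \<Longrightarrow> j \<in> {1..n} \<Longrightarrow> f i \<otimes>\<^bsub>B\<^esub> t j = t (simple_refl i j) \<otimes>\<^bsub>B\<^esub> f i"
    and t_pow: "\<And>i. i \<in> {1..n} \<Longrightarrow> t i [^]\<^bsub>B\<^esub> r = \<one>\<^bsub>B\<^esub>"
    and x_comm: "\<And>i j. i \<in> {1..n} \<Longrightarrow> j \<in> {1..n} \<Longrightarrow> x i \<otimes>\<^bsub>B\<^esub> x j = x j \<otimes>\<^bsub>B\<^esub> x i"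
    and f_x: "\<And>i. i \<in> {1..<n} \<Longrightarrow> f i \<otimes>\<^bsub>B\<^esub> x (Suc i) = x i \<otimes>\<^bsub>B\<^esub> f i \<oplus>\<^bsub>B\<^esub>
        inverse (of_nat r) \<odot>\<^bsub>B\<^esub> (\<Oplus>\<^bsub>B\<^esub>s\<in>{..<r}. t i [^]\<^bsub>B\<^esub> s \<otimes>\<^bsub>B\<^esub> (t (Suc i) [^]\<^bsub>B\<^esub> (r - 1)) [^]\<^bsub>B\<^esub> s)"
    and f_x_far: "\<And>i j. i \<in> {1..<n} \<Longrightarrow> j \<in> {1..n} \<Longrightarrow> j \<noteq> i \<Longrightarrow> j \<noteq> Suc i \<Longrightarrow> f i \<otimes>\<^bsub>B\<^esub> x j = x j \<otimes>\<^bsub>B\<^esub> f i"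
    and t_x: "\<And>i j. i \<in> {1..n} \<Longrightarrow> j \<in> {1..n} \<Longrightarrow> t j \<otimes>\<^bsub>B\<^esub> x i = x i \<otimes>\<^bsub>B\<^esub> t j"
  shows "\<exists>h \<in> alg_hom (yh r n) B. (\<forall>i\<in>{1..n}. h (yh_t r n i) = t i) \<and> (\<forall>i\<in>{1..<n}. h (yh_f r n i) = f i)
     \<and> (\<forall>i\<in>{1..n}. h (yh_x r n i) = x i)"
proof -
  interpret P: presentation "yh_gens n" "yh_rels r n :: ((yh_gen, 'k) free_algebra \<times> _) set"
    by (rule presentation_yh)
  interpret B: kalg B by fact
  let ?\<phi> = "\<lambda>g. case g of YT i \<Rightarrow> t i | YF i \<Rightarrow> f i | YX i \<Rightarrow> x i"
  have "\<exists>h \<in> alg_hom (presented_alg (yh_gens n) (yh_rels r n)) B.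
      \<forall>g\<in>yh_gens n. h (presented_gen (yh_gens n) (yh_rels r n) g) = ?\<phi> g"
  proof (rule P.presented_hom_exists[OF B])
    show "?\<phi> g \<in> carrier B" if "g \<in> yh_gens n" for g
      using that tc fc xc by (cases g) auto
    fix h and p q :: "(yh_gen, 'k) free_algebra"
    assume h: "h \<in> alg_hom (free_alg (yh_gens n)) B" and hg: "\<And>g. g \<in> yh_gens n \<Longrightarrow> h (gvar g) = ?\<phi> g"
      and pq: "(p, q) \<in> yh_rels r n"
    note hs = free_hom_simps[OF B h]
    have hx: "h (gvar (YX i)) = x i" "h (gvar (YT i)) = t i" if "i \<in> {1..n}" for i
      using hg[of "YX i"] hg[of "YT i"] that by simp_all
    have hf: "h (gvar (YF i)) = f i" if "i \<in> {1..<n}" for i using hg[of "YF i"] that by simp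
    show "h p = h q" using pq
    proof cases
      case (1 i j)
      then show ?thesis using f_far[of i j] f_far[of j i] by (auto simp: hs hf)
    next
      case (2 i)
      then show ?thesis using f_braid by (simp add: hs hf)
    next
      case (3 i j)
      then show ?thesis using t_comm by (simp add: hs hx)
    next
      case (4 i j)
      then show ?thesis using f_t[OF 4(3,4)] simple_refl_range[OF 4(3,4)] by (simp add: hs hx hf del: atLeastAtMost_iff)
    next
      case (5 i)
      then show ?thesis using t_pow by (simp add: hs hx)
    next
      case (6 i)
      then show ?thesis using f_quad fc by (simp add: hs hf power2_eq_square)
    next
      case (7 i j)
      then show ?thesis using x_comm by (simp add: hs hx)
    next
      case (8 i)
      then have "h (yh_e r i) = inverse (of_nat r) \<odot>\<^bsub>B\<^esub> (\<Oplus>\<^bsub>B\<^esub>s\<in>{..<r}. t i [^]\<^bsub>B\<^esub> s \<otimes>\<^bsub>B\<^esub> (t (Suc i) [^]\<^bsub>B\<^esub> (r - 1)) [^]\<^bsub>B\<^esub> s)"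
        unfolding yh_e_def by (simp add: hs hx)
      moreover have "(yh_e r i :: (yh_gen, 'k) free_algebra) \<in> carrier (free_alg (yh_gens n))"
        using 8(3) by (rule yh_e_closed)
      ultimately show ?thesis using 8 f_x[OF 8(3)] by (simp add: hs hx hf)
    next
      case (9 i j)
      then show ?thesis using f_x_far by (simp add: hs hx hf)
    next
      case (10 i j)
      then show ?thesis using t_x by (simp add: hs hx)
    qed
  qed
  then obtain h where h: "h \<in> alg_hom (yh r n) B"
    "\<And>g. g \<in> yh_gens n \<Longrightarrow> h (presented_gen (yh_gens n) (yh_rels r n) g) = ?\<phi> g"
    unfolding yh_def by blast
  show ?thesis
    using h(2)[of "YT _"] h(2)[of "YX _"] h(2)[of "YF _"]
    by (intro bexI[OF _ h(1)]) (auto simp: yh_t_def yh_x_def yh_f_def)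
qed

lemma conj_transpose:
  assumes s: "s permutes {1..n::nat}" "s (Suc i) = Suc (s i)"
  shows "s \<circ> simple_refl i \<circ> pinv s = simple_refl (s i)"
proof
  fix x
  note si = pinv_simps[OF s(1)]
  have "pinv s x = i \<longleftrightarrow> x = s i" "pinv s x = Suc i \<longleftrightarrow> x = Suc (s i)" using si(1,2) s(2) by metis+
  then show "(s \<circ> simple_refl i \<circ> pinv s) x = simple_refl (s i) x"
    using si(1) s(2) by (auto simp: Transposition.transpose_def)
qed

locale root_data =
  fixes r :: nat and \<zeta> :: "nat \<Rightarrow> 'k::field"
  assumes r1: "1 \<le> r" and rinv: "of_nat r \<noteq> (0::'k)" and zroots: "bij_betw \<zeta> {1..r} {z. z ^ r = 1}"

text \<open>Since \<open>col\<close> is injective, the equation for \<open>col (act w l)\<close>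
  alone makes \<open>act\<close> a group action.\<close>

locale matrix_rep = hecke_data r n \<mu> A X S + matrices A L + root_data r \<zeta>
  for r n \<mu> and A :: "('k::field, 'b) module" (structure) and X S and L :: "'l set" and \<zeta> :: "nat \<Rightarrow> 'k" +
  fixes act :: "(nat \<Rightarrow> nat) \<Rightarrow> 'l \<Rightarrow> 'l" and col :: "'l \<Rightarrow> nat \<Rightarrow> nat"
  assumes col_mem: "l \<in> L \<Longrightarrow> col l \<in> colourings_of r n \<mu>"
    and col_inj: "inj_on col L"
    and act_mem: "w permutes {1..n} \<Longrightarrow> l \<in> L \<Longrightarrow> act w l \<in> L"
    and col_act: "w permutes {1..n} \<Longrightarrow> l \<in> L \<Longrightarrow> col (act w l) = col l \<circ> pinv w"
begin

sublocale Y: yokonuma "yh r n :: ('k, 'k yh) module" r n \<zeta> "yh_t r n" "yh_f r n" "yh_x r n"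
  using r1 rinv zroots by (rule yokonuma_yh)

lemma col_range: "l \<in> L \<Longrightarrow> j \<in> {1..n} \<Longrightarrow> col l j \<in> {1..r}"
  using col_mem by (auto simp: colourings_of_def colourings_def)

lemma col_Col: "l \<in> L \<Longrightarrow> col l \<in> colourings r n"
  using col_mem by (auto simp: colourings_of_def)

abbreviation s where "s l \<equiv> std n \<mu> (col l)"

lemma s_permutes: "l \<in> L \<Longrightarrow> s l permutes {1..n}"
  using col_mem std_permutes by blast

lemma act_id: "l \<in> L \<Longrightarrow> act id l = l"
  using col_act[OF permutes_id, of l] act_mem[OF permutes_id, of l] col_inj by (simp add: inv_id inj_on_eq_iff)

lemma act_comp: "w permutes {1..n} \<Longrightarrow> v permutes {1..n} \<Longrightarrow> l \<in> L \<Longrightarrow> act (w \<circ> v) l = act w (act v l)"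
proof -
  assume a: "w permutes {1..n}" "v permutes {1..n}" "l \<in> L"
  have "col (act (w \<circ> v) l) = col (act w (act v l))"
    using a col_act[OF permutes_compose[OF a(2,1)] a(3)] col_act[OF a(1) act_mem[OF a(2,3)]] col_act[OF a(2,3)]
      pinv_comp[OF a(1,2)] by (simp add: comp_assoc)
  then show ?thesis using a col_inj act_mem permutes_compose[OF a(2,1)] by (simp add: inj_on_eq_iff)
qed

text \<open>The permutation in the formula for \<open>Phi\<close>. It is a cocycle with values in
  the Young subgroup: in \<open>wt w l \<circ> wt v (act (pinv w) l)\<close> the two inner
  standardizations cancel and leave \<open>wt (w \<circ> v) l\<close>.\<close>

definition wt :: "(nat \<Rightarrow> nat) \<Rightarrow> 'l \<Rightarrow> nat \<Rightarrow> nat" where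
  "wt w l = s l \<circ> w \<circ> pinv (s (act (pinv w) l))"

lemma wt_young: "w permutes {1..n} \<Longrightarrow> l \<in> L \<Longrightarrow> wt w l \<in> young r n \<mu>"
  using young_between[OF col_mem, of l w] col_act[OF pinv_simps(3), of w l] by (simp add: wt_def pinv_simps(4))

definition Fm :: "(nat \<Rightarrow> nat) \<Rightarrow> 'l \<times> 'l \<Rightarrow> 'b" where
  "Fm w = mm (act (pinv w)) (\<lambda>l. S (wt w l))"

definition Tm :: "nat \<Rightarrow> 'l \<times> 'l \<Rightarrow> 'b" where
  "Tm j = dg (\<lambda>l. \<zeta> (col l j) \<odot> \<one>)"

definition Xm :: "nat \<Rightarrow> 'l \<times> 'l \<Rightarrow> 'b" where
  "Xm j = dg (\<lambda>l. X (s l j))"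

lemma X_s_closed: "l \<in> L \<Longrightarrow> j \<in> {1..n} \<Longrightarrow> X (s l j) \<in> carrier A"
  using pinv_simps(5)[OF s_permutes] by simp

lemma Fm_closed: "w permutes {1..n} \<Longrightarrow> Fm w \<in> carrier M"
  unfolding Fm_def using wt_young by (intro mm_closed) simp

lemma Tm_closed: "Tm j \<in> carrier M"
  unfolding Tm_def by (intro mm_closed) simp

lemma Xm_closed: "j \<in> {1..n} \<Longrightarrow> Xm j \<in> carrier M"
  unfolding Xm_def using X_s_closed by (intro mm_closed) simp

lemma Fm_mult:
  assumes w: "w permutes {1..n}" and v: "v permutes {1..n}"
  shows "Fm w \<otimes>\<^bsub>M\<^esub> Fm v = Fm (w \<circ> v)"
proof -
  note wi = pinv_simps(3)[OF w] and vi = pinv_simps(3)[OF v]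
  have "Fm w \<otimes>\<^bsub>M\<^esub> Fm v = mm (\<lambda>l. act (pinv v) (act (pinv w) l)) (\<lambda>l. S (wt w l) \<otimes> S (wt v (act (pinv w) l)))"
    unfolding Fm_def using w v wt_young act_mem[OF wi] by (intro mm_mult) auto
  also have "\<dots> = Fm (w \<circ> v)"
    unfolding Fm_def
  proof (rule mm_cong)
    fix l assume l: "l \<in> L"
    show a: "act (pinv v) (act (pinv w) l) = act (pinv (w \<circ> v)) l"
      using act_comp[OF vi wi l] pinv_comp[OF w v] by simp
    have "wt w l \<circ> wt v (act (pinv w) l) = s l \<circ> w \<circ> (pinv (s (act (pinv w) l)) \<circ> s (act (pinv w) l)) \<circ> v \<circ> pinv (s (act (pinv v) (act (pinv w) l)))"
      by (simp add: wt_def comp_assoc)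
    also have "\<dots> = wt (w \<circ> v) l"
      unfolding pinv_simps(8)[OF s_permutes[OF act_mem[OF wi l]]] a by (simp add: wt_def comp_assoc)
    finally show "S (wt w l) \<otimes> S (wt v (act (pinv w) l)) = S (wt (w \<circ> v) l)"
      using S_mult[OF wt_young[OF w l] wt_young[OF v act_mem[OF wi l]]] by simp
  qed
  finally show ?thesis .
qed

lemma Fm_id: "Fm id = \<one>\<^bsub>M\<^esub>"
  unfolding Fm_def dg_one[symmetric]
proof (rule mm_cong)
  fix l assume l: "l \<in> L"
  show "act (pinv id) l = l" using act_id[OF l] by (simp add: inv_id)
  then show "S (wt id l) = \<one>"
    using pinv_simps(7)[OF s_permutes[OF l]] S_id by (simp add: wt_def)
qed

text \<open>Different colours are settled by \<open>std_swap\<close>. For equal colours the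
  colouring does not change, so by injectivity neither does the label, and
  \<open>std_adjacent\<close> identifies the conjugated reflection.\<close>

lemma simple_step:
  assumes i: "i \<in> {1..<n}" and l: "l \<in> L"
  shows "col l i \<noteq> col l (Suc i) \<Longrightarrow> s (act (simple_refl i) l) = s l \<circ> simple_refl i \<and> wt (simple_refl i) l = id"
    and "col l i = col l (Suc i) \<Longrightarrow> act (simple_refl i) l = l \<and> wt (simple_refl i) l = simple_refl (s l i) \<and>
        s l (Suc i) = Suc (s l i) \<and> col l i \<in> {1..r} \<and> s l i \<in> block \<mu> (col l i) \<and> Suc (s l i) \<in> block \<mu> (col l i)"
proof -
  have i': "i \<in> {1..n}" "Suc i \<in> {1..n}" using i by auto
  have p: "simple_refl i permutes {1..n}" using i by (rule simple_refl_permutes)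
  have ca: "col (act (simple_refl i) l) = col l \<circ> simple_refl i" using col_act[OF p l] by simp
  {
    assume ne: "col l i \<noteq> col l (Suc i)"
    have e: "s (act (simple_refl i) l) = s l \<circ> simple_refl i"
      unfolding ca by (rule std_swap[OF col_mem[OF l] i ne])
    have q: "s l \<circ> simple_refl i permutes {1..n}" using s_permutes[OF l] p by (intro permutes_compose)
    have "wt (simple_refl i) l = id"
      using pinv_simps(7)[OF q] by (simp add: wt_def e)
    then show "s (act (simple_refl i) l) = s l \<circ> simple_refl i \<and> wt (simple_refl i) l = id" using e by simp
  next
    assume eq: "col l i = col l (Suc i)"
    then have "col l \<circ> simple_refl i = col l" by (auto simp: fun_eq_iff Transposition.transpose_def)
    then have a: "act (simple_refl i) l = l" using ca col_inj act_mem[OF p l] l by (simp add: inj_on_eq_iff)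
    have S: "s l (Suc i) = Suc (s l i)" by (rule std_adjacent[OF col_mem[OF l] i eq])
    have "wt (simple_refl i) l = simple_refl (s l i)"
      using conj_transpose[OF s_permutes[OF l] S] by (simp add: wt_def a)
    then show "act (simple_refl i) l = l \<and> wt (simple_refl i) l = simple_refl (s l i) \<and>
        s l (Suc i) = Suc (s l i) \<and> col l i \<in> {1..r} \<and> s l i \<in> block \<mu> (col l i) \<and> Suc (s l i) \<in> block \<mu> (col l i)"
      using a S col_range[OF l i'(1)] std_block[OF col_mem[OF l] i'(1)] std_block[OF col_mem[OF l] i'(2)] eq by simp
  }
qed

lemma scalar_pow: "(c \<odot> \<one>) [^] (k::nat) = (c ^ k) \<odot> \<one>"
  by (simp add: smult_pow)

lemma Tm_pow: "Tm j [^]\<^bsub>M\<^esub> (k::nat) = dg (\<lambda>l. (\<zeta> (col l j) ^ k) \<odot> \<one>)"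
  unfolding Tm_def by (simp add: dg_pow scalar_pow)

text \<open>\<open>w ^ (r - 1)\<close> is the inverse of \<open>w\<close>, so the sum is geometric
  in \<open>z / w\<close>.\<close>

lemma root_average:
  assumes "z ^ r = 1" "w ^ r = 1"
  shows "inverse (of_nat r) * (\<Sum>a<r. z ^ a * (w ^ (r - 1)) ^ a) = (if z = w then 1 else (0::'k))"
proof -
  have w0: "w \<noteq> 0" using assms(2) r1 by (metis not_one_le_zero power_0_left zero_neq_one)
  have "w ^ (r - 1) * w = 1" using assms(2) r1 by (metis Suc_diff_1 le_eq_less_or_eq less_one linorder_not_less not_less_eq power_Suc2 zero_less_iff_neq_zero)
  then have "w ^ (r - 1) = inverse w" using w0 by (simp add: field_simps)
  then have "z ^ a * (w ^ (r - 1)) ^ a = (z / w) ^ a" for a by (simp add: divide_inverse power_mult_distrib)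
  moreover have "(z / w) ^ r = 1" using assms by (simp add: power_divide)
  ultimately show ?thesis using sum_powers_root[of "z / w" r] w0 rinv by (simp add: divide_eq_1_iff)
qed

lemma zeta_col: "l \<in> L \<Longrightarrow> j \<in> {1..n} \<Longrightarrow> \<zeta> (col l j) ^ r = 1"
  using Y.zeta_root col_range by blast

lemma zeta_col_eq: "l \<in> L \<Longrightarrow> j \<in> {1..n} \<Longrightarrow> a \<in> {1..r} \<Longrightarrow> \<zeta> (col l j) = \<zeta> a \<longleftrightarrow> col l j = a"
  using Y.zeta_inj col_range by blast

lemma e_matrix:
  assumes i: "i \<in> {1..<n}"
  shows "inverse (of_nat r) \<odot>\<^bsub>M\<^esub> (\<Oplus>\<^bsub>M\<^esub>a\<in>{..<r}. Tm i [^]\<^bsub>M\<^esub> a \<otimes>\<^bsub>M\<^esub> (Tm (Suc i) [^]\<^bsub>M\<^esub> (r - 1)) [^]\<^bsub>M\<^esub> a)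
     = dg (\<lambda>l. if col l i = col l (Suc i) then \<one> else \<zero>)"
proof -
  have i': "i \<in> {1..n}" "Suc i \<in> {1..n}" using i by auto
  have t: "Tm i [^]\<^bsub>M\<^esub> a \<otimes>\<^bsub>M\<^esub> (Tm (Suc i) [^]\<^bsub>M\<^esub> (r - 1)) [^]\<^bsub>M\<^esub> a
     = dg (\<lambda>l. (\<zeta> (col l i) ^ a * (\<zeta> (col l (Suc i)) ^ (r - 1)) ^ a) \<odot> \<one>)" for a :: nat
    unfolding Tm_pow by (simp add: dg_pow dg_mult scalar_pow smult_mult_l smult_smult)
  have "inverse (of_nat r) \<odot>\<^bsub>M\<^esub> (\<Oplus>\<^bsub>M\<^esub>a\<in>{..<r}. Tm i [^]\<^bsub>M\<^esub> a \<otimes>\<^bsub>M\<^esub> (Tm (Suc i) [^]\<^bsub>M\<^esub> (r - 1)) [^]\<^bsub>M\<^esub> a)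
     = dg (\<lambda>l. (inverse (of_nat r) * (\<Sum>a<r. \<zeta> (col l i) ^ a * (\<zeta> (col l (Suc i)) ^ (r - 1)) ^ a)) \<odot> \<one>)"
    unfolding t dg_scalar_sum dg_smult by (simp add: smult_smult)
  also have "\<dots> = dg (\<lambda>l. if col l i = col l (Suc i) then \<one> else \<zero>)"
  proof (rule mm_cong)
    fix l assume l: "l \<in> L"
    show "(inverse (of_nat r) * (\<Sum>a<r. \<zeta> (col l i) ^ a * (\<zeta> (col l (Suc i)) ^ (r - 1)) ^ a)) \<odot> \<one>
        = (if col l i = col l (Suc i) then \<one> else \<zero>)"
      unfolding root_average[OF zeta_col[OF l i'(1)] zeta_col[OF l i'(2)]]
        zeta_col_eq[OF l i'(1) col_range[OF l i'(2)]] by simp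
  qed simp
  finally show ?thesis .
qed

lemma pinv_refl [simp]: "pinv (simple_refl i) = simple_refl i"
  by simp

text \<open>Because \<open>Fm\<close> is multiplicative on all permutations, the relations among the
  \<open>f\<close> are relations in the symmetric group. Only the relations involving
  \<open>x\<close> draw on those imposed on \<open>X\<close>.\<close>

theorem rep_exists:
  "\<exists>h \<in> alg_hom (yh r n :: ('k, 'k yh) module) M. (\<forall>i\<in>{1..n}. h (yh_t r n i) = Tm i) \<and>
     (\<forall>i\<in>{1..<n}. h (yh_f r n i) = Fm (simple_refl i)) \<and> (\<forall>i\<in>{1..n}. h (yh_x r n i) = Xm i)"
proof (rule yh_hom_exists[OF kalg_M])
  note sp = simple_refl_permutes
  show "Fm (simple_refl i) \<otimes>\<^bsub>M\<^esub> Fm (simple_refl j) = Fm (simple_refl j) \<otimes>\<^bsub>M\<^esub> Fm (simple_refl i)"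
    if ij: "i \<in> {1..<n}" "j \<in> {1..<n}" "Suc i < j" for i j
    unfolding Fm_mult[OF sp[OF ij(1)] sp[OF ij(2)]] Fm_mult[OF sp[OF ij(2)] sp[OF ij(1)]]
    using ij(3) by (subst simple_refl_commute) auto
  show "Fm (simple_refl i) \<otimes>\<^bsub>M\<^esub> Fm (simple_refl (Suc i)) \<otimes>\<^bsub>M\<^esub> Fm (simple_refl i) =
      Fm (simple_refl (Suc i)) \<otimes>\<^bsub>M\<^esub> Fm (simple_refl i) \<otimes>\<^bsub>M\<^esub> Fm (simple_refl (Suc i))"
    if i: "i \<in> {1..<n}" "Suc i \<in> {1..<n}" for i
    unfolding Fm_mult[OF sp[OF i(1)] sp[OF i(2)]] Fm_mult[OF sp[OF i(2)] sp[OF i(1)]]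
      Fm_mult[OF permutes_compose[OF sp[OF i(2)] sp[OF i(1)]] sp[OF i(1)]]
      Fm_mult[OF permutes_compose[OF sp[OF i(1)] sp[OF i(2)]] sp[OF i(2)]] simple_refl_braid ..
  show "Fm (simple_refl i) \<otimes>\<^bsub>M\<^esub> Fm (simple_refl i) = \<one>\<^bsub>M\<^esub>" if i: "i \<in> {1..<n}" for i
    unfolding Fm_mult[OF sp[OF i] sp[OF i]] by (simp only: simple_refl_comp_self Fm_id)
  show "Tm i \<otimes>\<^bsub>M\<^esub> Tm j = Tm j \<otimes>\<^bsub>M\<^esub> Tm i" for i j
    unfolding Tm_def by (simp add: dg_mult smult_mult_l smult_smult mult.commute)
  show "Tm i [^]\<^bsub>M\<^esub> r = \<one>\<^bsub>M\<^esub>" if "i \<in> {1..n}" for i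
    unfolding Tm_pow dg_one[symmetric] using that by (intro mm_cong) (simp_all add: zeta_col)
  show "Xm i \<otimes>\<^bsub>M\<^esub> Xm j = Xm j \<otimes>\<^bsub>M\<^esub> Xm i" if ij: "i \<in> {1..n}" "j \<in> {1..n}" for i j
    unfolding Xm_def using X_s_closed ij pinv_simps(5)[OF s_permutes]
    by (subst dg_mult, simp, simp, subst dg_mult, simp, simp) (intro mm_cong, simp, simp add: X_comm)
  show "Tm j \<otimes>\<^bsub>M\<^esub> Xm i = Xm i \<otimes>\<^bsub>M\<^esub> Tm j" if ij: "i \<in> {1..n}" "j \<in> {1..n}" for i j
    unfolding Xm_def Tm_def using X_s_closed ij
    by (subst dg_mult, simp, simp, subst dg_mult, simp, simp) (intro mm_cong, simp, simp add: smult_mult_l smult_mult_r)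
  fix i assume i: "i \<in> {1..<n}"
  note wy = wt_young[OF sp[OF i]]
  have am: "act (simple_refl i) l \<in> L" if "l \<in> L" for l using act_mem[OF sp[OF i] that] .
  show "Fm (simple_refl i) \<otimes>\<^bsub>M\<^esub> Tm j = Tm (simple_refl i j) \<otimes>\<^bsub>M\<^esub> Fm (simple_refl i)" if j: "j \<in> {1..n}" for j
  proof -
    have "Fm (simple_refl i) \<otimes>\<^bsub>M\<^esub> Tm j = mm (act (simple_refl i)) (\<lambda>l. S (wt (simple_refl i) l) \<otimes> (\<zeta> (col (act (simple_refl i) l) j) \<odot> \<one>))"
      unfolding Fm_def Tm_def pinv_refl using wy am by (intro mm_mult) auto
    moreover have "Tm (simple_refl i j) \<otimes>\<^bsub>M\<^esub> Fm (simple_refl i) = mm (act (simple_refl i)) (\<lambda>l. (\<zeta> (col l (simple_refl i j)) \<odot> \<one>) \<otimes> S (wt (simple_refl i) l))"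
      unfolding Fm_def Tm_def pinv_refl using wy am by (intro mm_mult) auto
    moreover have "col (act (simple_refl i) l) j = col l (simple_refl i j)" if "l \<in> L" for l
      using col_act[OF sp[OF i] that] by simp
    ultimately show ?thesis using wy by (auto intro!: mm_cong simp: smult_mult_l smult_mult_r)
  qed
  have FX: "Fm (simple_refl i) \<otimes>\<^bsub>M\<^esub> Xm j = mm (act (simple_refl i)) (\<lambda>l. S (wt (simple_refl i) l) \<otimes> X (s (act (simple_refl i) l) j))"
    if j: "j \<in> {1..n}" for j
    unfolding Fm_def Xm_def pinv_refl using wy am X_s_closed j by (intro mm_mult) auto
  have XF: "Xm j \<otimes>\<^bsub>M\<^esub> Fm (simple_refl i) = mm (act (simple_refl i)) (\<lambda>l. X (s l j) \<otimes> S (wt (simple_refl i) l))"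
    if j: "j \<in> {1..n}" for j
    unfolding Fm_def Xm_def pinv_refl using wy am X_s_closed j by (intro mm_mult) auto
  show "Fm (simple_refl i) \<otimes>\<^bsub>M\<^esub> Xm j = Xm j \<otimes>\<^bsub>M\<^esub> Fm (simple_refl i)" if j: "j \<in> {1..n}" "j \<noteq> i" "j \<noteq> Suc i" for j
    unfolding FX[OF j(1)] XF[OF j(1)]
  proof (rule mm_cong)
    fix l assume l: "l \<in> L"
    show "S (wt (simple_refl i) l) \<otimes> X (s (act (simple_refl i) l) j) = X (s l j) \<otimes> S (wt (simple_refl i) l)"
    proof (cases "col l i = col l (Suc i)")
      case False
      have "simple_refl i j = j" using j by simp
      then show ?thesis using simple_step(1)[OF i l False] S_id X_s_closed[OF l j(1)] by simp
    next
      case True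
      note st = simple_step(2)[OF i l True]
      have inj: "inj (s l)" using permutes_inj[OF s_permutes[OF l]] .
      have "s l j \<noteq> s l i" "s l j \<noteq> s l (Suc i)" using inj j by (auto simp: inj_eq)
      then have "S (simple_refl (s l i)) \<otimes> X (s l j) = X (s l j) \<otimes> S (simple_refl (s l i))"
        using st pinv_simps(5)[OF s_permutes[OF l] j(1)] by (intro S_X_far[of "col l i"]) auto
      then show ?thesis using st by simp
    qed
  qed simp
  have i': "i \<in> {1..n}" "Suc i \<in> {1..n}" using i by auto
  show "Fm (simple_refl i) \<otimes>\<^bsub>M\<^esub> Xm (Suc i) = Xm i \<otimes>\<^bsub>M\<^esub> Fm (simple_refl i) \<oplus>\<^bsub>M\<^esub>
     inverse (of_nat r) \<odot>\<^bsub>M\<^esub> (\<Oplus>\<^bsub>M\<^esub>a\<in>{..<r}. Tm i [^]\<^bsub>M\<^esub> a \<otimes>\<^bsub>M\<^esub> (Tm (Suc i) [^]\<^bsub>M\<^esub> (r - 1)) [^]\<^bsub>M\<^esub> a)"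
    unfolding e_matrix[OF i] FX[OF i'(2)] XF[OF i'(1)]
  proof (rule mat_eqI)
    let ?D = "dg (\<lambda>l. if col l i = col l (Suc i) then \<one> else \<zero>)"
    let ?N = "mm (act (simple_refl i)) (\<lambda>l. X (s l i) \<otimes> S (wt (simple_refl i) l))"
    have Nc: "?N \<in> carrier M" "?D \<in> carrier M" using wy X_s_closed i' by (auto intro!: mm_closed)
    show "?N \<oplus>\<^bsub>M\<^esub> ?D \<in> carrier M" by (rule M.a_closed[OF Nc])
    show "mm (act (simple_refl i)) (\<lambda>l. S (wt (simple_refl i) l) \<otimes> X (s (act (simple_refl i) l) (Suc i))) \<in> carrier M"
      using wy X_s_closed am i' by (intro mm_closed) simp
    fix l m assume l: "l \<in> L" and m: "m \<in> L"
    have a: "(?N \<oplus>\<^bsub>M\<^esub> ?D) (l, m) = ?N (l, m) \<oplus> ?D (l, m)" using l m by (simp add: mat_alg_simps)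
    have wc: "S (wt (simple_refl i) l) \<in> carrier A" using wy[OF l] by simp
    show "mm (act (simple_refl i)) (\<lambda>l. S (wt (simple_refl i) l) \<otimes> X (s (act (simple_refl i) l) (Suc i))) (l, m) = (?N \<oplus>\<^bsub>M\<^esub> ?D) (l, m)"
    proof (cases "col l i = col l (Suc i)")
      case False
      have "simple_refl i (Suc i) = i" by simp
      then show ?thesis unfolding a mm_entry[OF l m]
        using simple_step(1)[OF i l False] False S_id X_s_closed[OF l i'(1)] by simp
    next
      case True
      \<comment> \<open>The row is fixed here, so the monomial matrix and the diagonal matrix of
        \<open>e\<close> have their entries in the same position, and the sum is the right-hand side
        of the Hecke relation.\<close>
      note st = simple_step(2)[OF i l True]
      have sn: "s l i \<in> {1..n}" using pinv_simps(5)[OF s_permutes[OF l] i'(1)] .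
      have y: "simple_refl (s l i) \<in> young r n \<mu>" using st young_simple by blast
      have "S (simple_refl (s l i)) \<otimes> X (Suc (s l i)) = X (s l i) \<otimes> S (simple_refl (s l i)) \<oplus> \<one>"
        using st by (intro S_X[of "col l i"]) auto
      then show ?thesis unfolding a mm_entry[OF l m] using st True sn y by auto
    qed
  qed
qed (use Fm_closed Tm_closed Xm_closed simple_refl_permutes in auto)

definition rep :: "'k yh \<Rightarrow> 'l \<times> 'l \<Rightarrow> 'b" where
  "rep = (SOME h. h \<in> alg_hom (yh r n :: ('k, 'k yh) module) M \<and> (\<forall>i\<in>{1..n}. h (yh_t r n i) = Tm i) \<and>
     (\<forall>i\<in>{1..<n}. h (yh_f r n i) = Fm (simple_refl i)) \<and> (\<forall>i\<in>{1..n}. h (yh_x r n i) = Xm i))"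

lemma rep_props:
  "rep \<in> alg_hom (yh r n) M" "i \<in> {1..n} \<Longrightarrow> rep (yh_t r n i) = Tm i"
  "j \<in> {1..<n} \<Longrightarrow> rep (yh_f r n j) = Fm (simple_refl j)" "i \<in> {1..n} \<Longrightarrow> rep (yh_x r n i) = Xm i"
proof -
  have ex: "\<exists>h. h \<in> alg_hom (yh r n :: ('k, 'k yh) module) M \<and> (\<forall>i\<in>{1..n}. h (yh_t r n i) = Tm i) \<and>
     (\<forall>i\<in>{1..<n}. h (yh_f r n i) = Fm (simple_refl i)) \<and> (\<forall>i\<in>{1..n}. h (yh_x r n i) = Xm i)"
    using rep_exists by blast
  have "rep \<in> alg_hom (yh r n) M \<and> (\<forall>i\<in>{1..n}. rep (yh_t r n i) = Tm i) \<and>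
     (\<forall>i\<in>{1..<n}. rep (yh_f r n i) = Fm (simple_refl i)) \<and> (\<forall>i\<in>{1..n}. rep (yh_x r n i) = Xm i)"
    unfolding rep_def by (rule someI_ex[OF ex])
  then show "rep \<in> alg_hom (yh r n) M" "i \<in> {1..n} \<Longrightarrow> rep (yh_t r n i) = Tm i"
    "j \<in> {1..<n} \<Longrightarrow> rep (yh_f r n j) = Fm (simple_refl j)" "i \<in> {1..n} \<Longrightarrow> rep (yh_x r n i) = Xm i" by blast+
qed

lemmas rep_hom = alg_homD[OF rep_props(1)]

lemma rep_fw: "w permutes {1..n} \<Longrightarrow> rep (Y.fw w) = Fm w"
proof (induction w rule: permutes_ascent_induct)
  case id
  show ?case unfolding Y.F.perm_elem_id Fm_id by (rule rep_hom(5))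
next
  case (step i w)
  have "rep (yh_f r n i \<otimes>\<^bsub>yh r n\<^esub> Y.fw w) = rep (yh_f r n i) \<otimes>\<^bsub>M\<^esub> rep (Y.fw w)"
    using step(1,2) by (intro rep_hom(4)) auto
  then show ?case unfolding Y.fw_step[OF step(1,2)] rep_props(3)[OF step(1)] step(4)
    using Fm_mult[OF simple_refl_permutes[OF step(1)] step(2)] by (rule trans)
qed

lemma rep_xm: "rep (Y.xm \<alpha>) = dg (\<lambda>l. monom_prod A n X (place_perm (s l) \<alpha>))"
proof -
  have "rep (Y.xm \<alpha>) = list_prod M (map (\<lambda>i. rep (yh_x r n i [^]\<^bsub>yh r n\<^esub> \<alpha> i)) [1..<n+1])"
    unfolding monom_prod_def
    by (subst alg_hom_list_prod[OF Y.kalg_Y kalg_M rep_props(1)]) (auto simp: comp_def)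
  also have "map (\<lambda>i. rep (yh_x r n i [^]\<^bsub>yh r n\<^esub> \<alpha> i)) [1..<n+1] = map (\<lambda>i. dg (\<lambda>l. X (s l i) [^] \<alpha> i)) [1..<n+1]"
    using X_s_closed by (intro map_cong) (auto simp: alg_hom_pow[OF Y.kalg_Y kalg_M rep_props(1)] rep_props(4) Xm_def dg_pow)
  also have "list_prod M \<dots> = dg (\<lambda>l. list_prod A (map (\<lambda>i. X (s l i) [^] \<alpha> i) [1..<n+1]))"
    using X_s_closed by (intro dg_list_prod) auto
  also have "\<dots> = dg (\<lambda>l. monom_prod A n X (place_perm (s l) \<alpha>))"
    unfolding monom_prod_def[symmetric]
    using s_permutes X_comm by (intro mm_cong monom_reindex) auto
  finally show ?thesis .
qed

lemma rep_P:
  assumes i: "i \<in> {1..n}" and z: "z ^ r = 1"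
  shows "rep (Y.P i z) = dg (\<lambda>l. if z = \<zeta> (col l i) then \<one> else \<zero>)"
proof -
  have u: "rep (Y.u i [^]\<^bsub>yh r n\<^esub> a) = dg (\<lambda>l. ((\<zeta> (col l i) ^ (r - 1)) ^ a) \<odot> \<one>)" for a :: nat
    unfolding Y.u_def using i
    by (simp add: alg_hom_pow[OF Y.kalg_Y kalg_M rep_props(1)] rep_props(2) Tm_pow dg_pow scalar_pow)
  have "rep (Y.P i z) = inverse (of_nat r) \<odot>\<^bsub>M\<^esub> rep (\<Oplus>\<^bsub>yh r n\<^esub>a\<in>{..<r}. (z ^ a) \<odot>\<^bsub>yh r n\<^esub> (Y.u i [^]\<^bsub>yh r n\<^esub> a))"
    unfolding Y.P_eq[OF i] using i by (intro rep_hom(3) Y.finsum_closed) auto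
  also have "rep (\<Oplus>\<^bsub>yh r n\<^esub>a\<in>{..<r}. (z ^ a) \<odot>\<^bsub>yh r n\<^esub> (Y.u i [^]\<^bsub>yh r n\<^esub> a)) = (\<Oplus>\<^bsub>M\<^esub>a\<in>{..<r}. rep ((z ^ a) \<odot>\<^bsub>yh r n\<^esub> (Y.u i [^]\<^bsub>yh r n\<^esub> a)))"
    using i by (intro linear_maps_finsum[OF Y.kalg_Y kalg_M rep_hom(7)]) auto
  also have "\<dots> = (\<Oplus>\<^bsub>M\<^esub>a\<in>{..<r}. dg (\<lambda>l. (z ^ a * (\<zeta> (col l i) ^ (r - 1)) ^ a) \<odot> \<one>))"
    using i by (intro M.finsum_cong') (auto simp: rep_hom(3) u dg_smult smult_smult)
  also have "inverse (of_nat r) \<odot>\<^bsub>M\<^esub> \<dots> = dg (\<lambda>l. (inverse (of_nat r) * (\<Sum>a<r. z ^ a * (\<zeta> (col l i) ^ (r - 1)) ^ a)) \<odot> \<one>)"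
    unfolding dg_scalar_sum dg_smult by (simp add: smult_smult)
  also have "\<dots> = dg (\<lambda>l. if z = \<zeta> (col l i) then \<one> else \<zero>)"
  proof (rule mm_cong)
    fix l assume l: "l \<in> L"
    show "(inverse (of_nat r) * (\<Sum>a<r. z ^ a * (\<zeta> (col l i) ^ (r - 1)) ^ a)) \<odot> \<one> = (if z = \<zeta> (col l i) then \<one> else \<zero>)"
      unfolding root_average[OF z zeta_col[OF l i]] by simp
  qed simp
  finally show ?thesis .
qed

lemma rep_Ec:
  assumes c: "c \<in> colourings r n"
  shows "rep (Y.Ec c) = dg (\<lambda>l. if col l = c then \<one> else \<zero>)"
proof -
  have cr: "c i \<in> {1..r}" if "i \<in> {1..n}" for i using c that by (auto simp: colourings_def)
  let ?g = "\<lambda>i l. if \<zeta> (c i) = \<zeta> (col l i) then \<one> else \<zero>"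
  have "rep (Y.Ec c) = list_prod M (map (\<lambda>i. rep (Y.P i (\<zeta> (c i)))) [1..<n+1])"
    unfolding Y.Ec_def
    by (subst alg_hom_list_prod[OF Y.kalg_Y kalg_M rep_props(1)]) (auto simp: comp_def)
  also have "map (\<lambda>i. rep (Y.P i (\<zeta> (c i)))) [1..<n+1] = map (\<lambda>i. dg (?g i)) [1..<n+1]"
    using cr Y.zeta_root by (intro map_cong) (auto simp: rep_P)
  also have "list_prod M \<dots> = dg (\<lambda>l. list_prod A (map (\<lambda>i. ?g i l) [1..<n+1]))"
    by (intro dg_list_prod) auto
  also have "\<dots> = dg (\<lambda>l. if col l = c then \<one> else \<zero>)"
  proof (rule mm_cong)
    fix l assume l: "l \<in> L"
    have "list_prod A (map (\<lambda>i. ?g i l) is) = (if \<forall>i\<in>set is. \<zeta> (c i) = \<zeta> (col l i) then \<one> else \<zero>)" for "is"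
    proof (induction "is")
      case (Cons i "is")
      have "list_prod A (map (\<lambda>i. ?g i l) is) \<in> carrier A" by (intro list_prod_closed) auto
      then show ?case using Cons by auto
    qed simp
    moreover have "set [1..<n+1] = {1..n}" by auto
    moreover have "(\<forall>i\<in>{1..n}. \<zeta> (c i) = \<zeta> (col l i)) \<longleftrightarrow> col l = c"
      using zeta_col_eq[OF l _ cr] colourings_ext[OF col_Col[OF l] c] by metis
    ultimately show "list_prod A (map (\<lambda>i. ?g i l) [1..<n+1]) = (if col l = c then \<one> else \<zero>)" by simp
  qed simp
  finally show ?thesis .
qed

text \<open>Since \<open>col\<close> is injective, the idempotent of \<open>col l\<close> acts by
  the diagonal matrix unit at \<open>l\<close> and cuts out row \<open>l\<close> of a monomial
  matrix. The result is the formula that characterizes \<open>Phi\<close>.\<close>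

lemma rep_B:
  assumes l: "l \<in> L" and w: "w permutes {1..n}"
  shows "rep (Y.B (col l) \<alpha> w) = mat_unit L A l (act (pinv w) l) (monom_prod A n X (place_perm (s l) \<alpha>) \<otimes> S (wt w l))"
proof -
  have "rep (Y.B (col l) \<alpha> w) = dg (\<lambda>m. if col m = col l then \<one> else \<zero>) \<otimes>\<^bsub>M\<^esub> dg (\<lambda>l. monom_prod A n X (place_perm (s l) \<alpha>)) \<otimes>\<^bsub>M\<^esub> Fm w"
    unfolding Y.B_def using w by (simp add: rep_hom(4) rep_fw rep_xm rep_Ec[OF col_Col[OF l]])
  also have "\<dots> = mm (act (pinv w)) (\<lambda>m. (if col m = col l then \<one> else \<zero>) \<otimes> monom_prod A n X (place_perm (s m) \<alpha>) \<otimes> S (wt w m))"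
    unfolding Fm_def using wt_young[OF w] by (subst dg_mult, simp, simp, subst mm_mult) auto
  also have "\<dots> = mm (act (pinv w)) (\<lambda>m. if m = l then monom_prod A n X (place_perm (s m) \<alpha>) \<otimes> S (wt w m) else \<zero>)"
    using l wt_young[OF w] col_inj by (intro mm_cong) (auto simp: inj_on_eq_iff)
  also have "\<dots> = mat_unit L A l (act (pinv w) l) (monom_prod A n X (place_perm (s l) \<alpha>) \<otimes> S (wt w l))"
    using mat_unit_mm[OF l refl, of "act (pinv w)" "\<lambda>m. monom_prod A n X (place_perm (s m) \<alpha>) \<otimes> S (wt w m)"] by simp
  finally show ?thesis .
qed

end

section \<open>Characters of the torus\<close>

lemma finite_compositions: "finite (compositions r n)"
proof -
  have "compositions r n \<subseteq> {\<mu>. \<forall>a. (a \<in> {1..r} \<longrightarrow> \<mu> a \<in> {0..n}) \<and> (a \<notin> {1..r} \<longrightarrow> \<mu> a = 0)}"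
  proof
    fix \<mu> assume \<mu>: "\<mu> \<in> compositions r n"
    have "\<mu> a \<le> n" if "a \<in> {1..r}" for a
      using \<mu> member_le_sum[of a "{1..r}" \<mu>] that by (auto simp: compositions_def)
    then show "\<mu> \<in> {\<mu>. \<forall>a. (a \<in> {1..r} \<longrightarrow> \<mu> a \<in> {0..n}) \<and> (a \<notin> {1..r} \<longrightarrow> \<mu> a = 0)}"
      using \<mu> by (auto simp: compositions_def)
  qed
  moreover have "finite {\<mu>. \<forall>a. (a \<in> {1..r} \<longrightarrow> \<mu> a \<in> {0..n}) \<and> (a \<notin> {1..r} \<longrightarrow> \<mu> a = (0::nat))}"
    by (rule finite_set_of_finite_funs) auto
  ultimately show ?thesis by (rule finite_subset)
qed

definition colour_count :: "nat \<Rightarrow> nat \<Rightarrow> (nat \<Rightarrow> nat) \<Rightarrow> nat \<Rightarrow> nat" where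
  "colour_count r n c a = (if a \<in> {1..r} then card {j \<in> {1..n}. c j = a} else 0)"

lemma colour_count_comp:
  assumes "c \<in> colourings r n" shows "colour_count r n c \<in> compositions r n"
proof -
  have "(\<Sum>a=1..r. colour_count r n c a) = (\<Sum>a=1..r. \<Sum>j\<in>{j \<in> {1..n}. c j = a}. 1)"
    by (intro sum.cong) (simp_all add: colour_count_def)
  also have "\<dots> = (\<Sum>j\<in>{1..n}. 1)"
    by (rule sum.group) (use assms in \<open>auto simp: colourings_def\<close>)
  finally show ?thesis by (simp add: compositions_def colour_count_def)
qed

lemma colourings_of_iff:
  assumes "\<mu> \<in> compositions r n"
  shows "c \<in> colourings_of r n \<mu> \<longleftrightarrow> c \<in> colourings r n \<and> colour_count r n c = \<mu>"
  using assms by (auto simp: colourings_of_def colour_count_def compositions_def fun_eq_iff)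

text \<open>The inhomogeneous relation reads \<open>k + 1 = k + 1\<close>, and the remaining ones
  hold by commutativity of the field.\<close>

lemma hecke_data_ground:
  assumes "\<mu> \<in> compositions r n"
  shows "hecke_data r n \<mu> (ground_alg :: ('k::field, 'k) module) of_nat (\<lambda>_. 1)"
proof -
  interpret composition r n \<mu> by unfold_locales fact
  interpret kalg "ground_alg :: ('k, 'k) module" by (rule kalg_ground)
  show ?thesis by unfold_locales (simp_all add: ground_alg_def)
qed

locale yh_setup = root_data r \<zeta> for r and \<zeta> :: "nat \<Rightarrow> 'k::field" +
  fixes n :: nat
begin

abbreviation "YA \<equiv> (yh r n :: ('k, 'k yh) module)"
abbreviation "tt \<equiv> (yh_t r n :: nat \<Rightarrow> 'k yh)"

sublocale Y: yokonuma YA r n \<zeta> "yh_t r n" "yh_f r n" "yh_x r n"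
  using r1 rinv zroots by (rule yokonuma_yh)

abbreviation "TA \<equiv> (torus_alg r n :: ('k, 'k yh) module)"

lemma torus_simps [simp]:
  "carrier TA = gen_subalg YA (tt ` {1..n})" "y \<otimes>\<^bsub>TA\<^esub> z = y \<otimes>\<^bsub>YA\<^esub> z" "y \<oplus>\<^bsub>TA\<^esub> z = y \<oplus>\<^bsub>YA\<^esub> z"
  "\<one>\<^bsub>TA\<^esub> = \<one>\<^bsub>YA\<^esub>" "c \<odot>\<^bsub>TA\<^esub> y = c \<odot>\<^bsub>YA\<^esub> y"
  by (simp_all add: torus_alg_def)

lemma ground_simps [simp]:
  "carrier ground_alg = UNIV" "y \<otimes>\<^bsub>ground_alg\<^esub> z = y * z" "y \<oplus>\<^bsub>ground_alg\<^esub> z = y + z"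
  "\<one>\<^bsub>ground_alg\<^esub> = 1" "\<zero>\<^bsub>ground_alg\<^esub> = 0" "c \<odot>\<^bsub>ground_alg\<^esub> y = c * y"
  by (simp_all add: ground_alg_def)

lemma torus_sub: "y \<in> gen_subalg YA (tt ` {1..n}) \<Longrightarrow> y \<in> carrier YA"
proof -
  assume y: "y \<in> gen_subalg YA (tt ` {1..n})"
  have "tt ` {1..n} \<subseteq> carrier YA" by (rule image_subsetI) (rule Y.t_closed)
  from gen_subalg_subset[OF Y.kalg_Y this] y show ?thesis by (rule subsetD)
qed

lemma char_ext:
  assumes "\<chi> \<in> Irr r n" "\<chi>' \<in> Irr r n" "\<And>j. j \<in> {1..n} \<Longrightarrow> \<chi> (tt j) = \<chi>' (tt j)"
  shows "\<chi> = \<chi>'"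
proof
  fix y
  note h = alg_homD[OF assms(1)[unfolded Irr_def]] and h' = alg_homD[OF assms(2)[unfolded Irr_def]]
  show "\<chi> y = \<chi>' y"
  proof (cases "y \<in> gen_subalg YA (tt ` {1..n})")
    case True
    then show ?thesis
    proof induction
      case (gen_add y z)
      then show ?case using h(2)[of y z] h'(2)[of y z] by simp
    next
      case (gen_mult y z)
      then show ?case using h(4)[of y z] h'(4)[of y z] by simp
    next
      case (gen_smult y c)
      then show ?case using h(3)[of y c] h'(3)[of y c] by simp
    qed (use assms(3) h(5) h'(5) in auto)
  qed (use h(6) h'(6) in simp)
qed

lemma char_root:
  assumes \<chi>: "\<chi> \<in> Irr r n" and j: "j \<in> {1..n}"
  shows "\<chi> (tt j) ^ r = 1"
proof -
  note h = alg_homD[OF \<chi>[unfolded Irr_def]]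
  have tj: "tt j \<in> gen_subalg YA (tt ` {1..n})" using j by (auto intro: gen_subalg.gen_incl)
  \<comment> \<open>The laws of \<open>\<chi>\<close> are known on the torus only, so membership of
    the powers is proved together with their values.\<close>
  have "tt j [^]\<^bsub>YA\<^esub> k \<in> gen_subalg YA (tt ` {1..n}) \<and> \<chi> (tt j [^]\<^bsub>YA\<^esub> k) = \<chi> (tt j) ^ k" for k :: nat
  proof (induction k)
    case (Suc k)
    then show ?case using h(4)[of "tt j [^]\<^bsub>YA\<^esub> k" "tt j"] tj by (auto intro: gen_subalg.gen_mult simp: mult.commute)
  qed (use h(5) in \<open>auto intro: gen_subalg.gen_one\<close>)
  then show ?thesis using Y.t_pow[OF j] h(5) by (metis torus_simps(4) ground_simps(4))
qed

text \<open>Identifies characters with colourings: it turns out to be a bijection, through which all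
  questions about characters become combinatorial.\<close>

definition colour :: "('k yh \<Rightarrow> 'k) \<Rightarrow> nat \<Rightarrow> nat" where
  "colour \<chi> j = (if j \<in> {1..n} then THE a. a \<in> {1..r} \<and> \<zeta> a = \<chi> (tt j) else 0)"

lemma colour_props:
  assumes \<chi>: "\<chi> \<in> Irr r n" and j: "j \<in> {1..n}"
  shows "colour \<chi> j \<in> {1..r}" "\<zeta> (colour \<chi> j) = \<chi> (tt j)"
proof -
  have "\<chi> (tt j) \<in> \<zeta> ` {1..r}" using char_root[OF assms] zroots by (auto simp: bij_betw_def)
  then obtain a where a: "a \<in> {1..r}" "\<zeta> a = \<chi> (tt j)" by auto
  have "(THE a. a \<in> {1..r} \<and> \<zeta> a = \<chi> (tt j)) = a"
    by (rule the_equality) (use a Y.zeta_inj in metis)+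
  then show "colour \<chi> j \<in> {1..r}" "\<zeta> (colour \<chi> j) = \<chi> (tt j)" using a j by (auto simp: colour_def)
qed

lemma colour_Col: "\<chi> \<in> Irr r n \<Longrightarrow> colour \<chi> \<in> colourings r n"
proof -
  assume \<chi>: "\<chi> \<in> Irr r n"
  have "colour \<chi> j = 0" if "j \<notin> {1..n}" for j unfolding colour_def if_not_P[OF that] ..
  then show ?thesis using colour_props(1)[OF \<chi>] unfolding colourings_def by blast
qed

lemma colour_inj: "inj_on colour (Irr r n)"
proof (rule inj_onI)
  fix \<chi> \<chi>' assume "\<chi> \<in> Irr r n" "\<chi>' \<in> Irr r n" "colour \<chi> = colour \<chi>'"
  then show "\<chi> = \<chi>'" using colour_props(2) by (intro char_ext) metis+
qed

lemma colour_unique: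
  assumes "\<chi> \<in> Irr r n" "c \<in> colourings r n" "\<And>j. j \<in> {1..n} \<Longrightarrow> \<chi> (tt j) = \<zeta> (c j)"
  shows "colour \<chi> = c"
proof (rule colourings_ext[OF colour_Col[OF assms(1)] assms(2)])
  fix j assume j: "j \<in> {1..n}"
  have "c j \<in> {1..r}" using assms(2) j by (auto simp: colourings_def)
  then show "colour \<chi> j = c j" using colour_props[OF assms(1) j] assms(3)[OF j] Y.zeta_inj by metis
qed

text \<open>
  A character is read off a diagonal entry of the representation on matrices over the ground field in
  which every simple reflection of the Young subgroup acts by \<open>1\<close> and \<open>x\<^sub>k\<close> by \<open>k\<close>.
\<close>

lemma char_exists:
  assumes c: "c \<in> colourings r n"
  shows "\<exists>\<chi>\<in>Irr r n. \<forall>j\<in>{1..n}. \<chi> (tt j) = \<zeta> (c j)"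
proof -
  let ?\<mu> = "colour_count r n c" and ?g = "ground_alg :: ('k, 'k) module"
  have \<mu>: "?\<mu> \<in> compositions r n" by (rule colour_count_comp[OF c])
  let ?L = "colourings_of r n ?\<mu>"
  have cL: "c \<in> ?L" using c colourings_of_iff[OF \<mu>] by simp
  interpret R: matrix_rep r n ?\<mu> ?g of_nat "\<lambda>_. 1" ?L \<zeta> "\<lambda>w c. c \<circ> pinv w" "\<lambda>c. c"
  proof (intro matrix_rep.intro matrix_rep_axioms.intro hecke_data_ground[OF \<mu>] root_data_axioms)
    have "finite ?L" by (rule finite_subset[OF _ finite_colourings[of r n]]) (auto simp: colourings_of_def)
    then show "matrices ?g ?L" by (intro matrices.intro kalg_ground matrices_axioms.intro)
  qed (use colourings_of_perm in auto)
  \<comment> \<open>Reading off one diagonal entry is multiplicative on diagonal matrices, hence the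
    induction showing that the torus acts diagonally.\<close>
  have d: "\<exists>g. R.rep y = R.dg g" if "y \<in> gen_subalg YA (tt ` {1..n})" for y
    using that
  proof induction
    case gen_one
    show ?case using R.rep_hom(5) R.dg_one by metis
  next
    case (gen_incl y)
    then obtain i where "i \<in> {1..n}" "y = tt i" by blast
    then have "R.rep y = R.Tm i" using R.rep_props(2) by blast
    then show ?case unfolding R.Tm_def by blast
  next
    case (gen_add y z)
    then obtain g h where gh: "R.rep y = R.dg g" "R.rep z = R.dg h" by blast
    have "R.rep (y \<oplus>\<^bsub>YA\<^esub> z) = R.dg (\<lambda>i. g i + h i)"
      using R.rep_hom(2)[OF gen_add(1,2)[THEN torus_sub]] gh R.dg_add[of g h] by simp
    then show ?case by blast
  next
    case (gen_mult y z)
    then obtain g h where gh: "R.rep y = R.dg g" "R.rep z = R.dg h" by blast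
    have "R.rep (y \<otimes>\<^bsub>YA\<^esub> z) = R.dg (\<lambda>i. g i * h i)"
      using R.rep_hom(4)[OF gen_mult(1,2)[THEN torus_sub]] gh R.dg_mult[of g h] by simp
    then show ?case by blast
  next
    case (gen_smult y c)
    then obtain g where gh: "R.rep y = R.dg g" by blast
    then have "R.rep (c \<odot>\<^bsub>YA\<^esub> y) = R.dg (\<lambda>i. c * g i)"
      using R.rep_hom(3)[OF torus_sub[OF gen_smult(1)], of c] R.dg_smult[of c g] by simp
    then show ?case by blast
  qed
  define \<chi> where "\<chi> = (\<lambda>y\<in>gen_subalg YA (tt ` {1..n}). R.rep y (c, c))"
  have en: "(N \<oplus>\<^bsub>R.M\<^esub> N') (c, c) = N (c, c) + N' (c, c)" "(a \<odot>\<^bsub>R.M\<^esub> N) (c, c) = a * N (c, c)" for N N' a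
    using cL by (simp_all add: mat_alg_simps)
  have em: "R.rep (y \<otimes>\<^bsub>YA\<^esub> z) (c, c) = R.rep y (c, c) * R.rep z (c, c)"
    if yz: "y \<in> gen_subalg YA (tt ` {1..n})" "z \<in> gen_subalg YA (tt ` {1..n})" for y z
  proof -
    obtain g h where gh: "R.rep y = R.dg g" "R.rep z = R.dg h" using d[OF yz(1)] d[OF yz(2)] by blast
    have "R.rep (y \<otimes>\<^bsub>YA\<^esub> z) = R.dg (\<lambda>i. g i * h i)"
      using R.rep_hom(4)[OF yz[THEN torus_sub]] gh R.dg_mult[of g h] by simp
    then show ?thesis using gh cL by (simp add: R.mm_entry)
  qed
  have "\<chi> \<in> Irr r n"
    unfolding Irr_def
  proof (rule alg_homI)
    show "\<chi> \<one>\<^bsub>TA\<^esub> = \<one>\<^bsub>?g\<^esub>"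
      using R.rep_hom(5) cL by (simp add: \<chi>_def gen_subalg.gen_one mat_alg_simps)
    show "\<chi> (y \<otimes>\<^bsub>TA\<^esub> z) = \<chi> y \<otimes>\<^bsub>?g\<^esub> \<chi> z" if "y \<in> carrier TA" "z \<in> carrier TA" for y z
      using that em[of y z] by (simp add: \<chi>_def gen_subalg.gen_mult)
  qed (auto simp: \<chi>_def en R.rep_hom torus_sub gen_subalg.intros)
  moreover have "\<chi> (tt j) = \<zeta> (c j)" if j: "j \<in> {1..n}" for j
    using j cL R.rep_props(2)[OF j] by (auto simp: \<chi>_def R.Tm_def R.mm_entry gen_subalg.gen_incl)
  ultimately show ?thesis by blast
qed

lemma colour_surj: "c \<in> colourings r n \<Longrightarrow> \<exists>\<chi>\<in>Irr r n. colour \<chi> = c"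
  using char_exists colour_unique by metis

text \<open>A definite description has to be resolved: \<open>colour_surj\<close> supplies a
  character with the permuted values, \<open>char_ext\<close> its uniqueness.\<close>

lemma perm_char_props:
  assumes w: "w permutes {1..n}" and \<chi>: "\<chi> \<in> Irr r n"
  shows "perm_char r n w \<chi> \<in> Irr r n" "colour (perm_char r n w \<chi>) = colour \<chi> \<circ> pinv w"
proof -
  have c: "colour \<chi> \<circ> pinv w \<in> colourings r n" by (rule colourings_perm[OF w colour_Col[OF \<chi>]])
  obtain \<chi>' where \<chi>': "\<chi>' \<in> Irr r n" "colour \<chi>' = colour \<chi> \<circ> pinv w" using colour_surj[OF c] by blast
  have v: "\<chi>' (tt i) = \<chi> (tt (pinv w i))" if i: "i \<in> {1..n}" for i
    using colour_props(2)[OF \<chi>'(1) i] colour_props(2)[OF \<chi> pinv_simps(6)[OF w i]] \<chi>'(2) by simp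
  have "perm_char r n w \<chi> = \<chi>'"
    unfolding perm_char_def
    by (rule the_equality) (use \<chi>' v char_ext in auto)
  then show "perm_char r n w \<chi> \<in> Irr r n" "colour (perm_char r n w \<chi>) = colour \<chi> \<circ> pinv w" using \<chi>' by auto
qed

lemma Comp_eq: "\<chi> \<in> Irr r n \<Longrightarrow> Comp r n \<zeta> \<chi> = colour_count r n (colour \<chi>)"
proof
  fix a assume \<chi>: "\<chi> \<in> Irr r n"
  have "{j \<in> {1..n}. \<chi> (tt j) = \<zeta> a} = {j \<in> {1..n}. colour \<chi> j = a}" if "a \<in> {1..r}"
    using colour_props[OF \<chi>] Y.zeta_inj[OF _ that] by (metis (lifting))
  then show "Comp r n \<zeta> \<chi> a = colour_count r n (colour \<chi>) a" by (simp add: Comp_def colour_count_def)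
qed

lemma chars_iff:
  assumes "\<mu> \<in> compositions r n"
  shows "\<chi> \<in> chars r n \<zeta> \<mu> \<longleftrightarrow> \<chi> \<in> Irr r n \<and> colour \<chi> \<in> colourings_of r n \<mu>"
  using colour_Col by (auto simp: chars_def Comp_eq colourings_of_iff[OF assms])

lemma E_chi_eq: "\<chi> \<in> Irr r n \<Longrightarrow> E_chi r n \<chi> = Y.Ec (colour \<chi>)"
  unfolding E_chi_def Y.Ec_def Y.P_def
  by (intro arg_cong[of _ _ "list_prod YA"] map_cong refl) (auto simp: colour_props(2))

lemma yh_monom_eq: "yh_monom r n \<alpha> = Y.xm \<alpha>"
  by (simp add: yh_monom_def monom_prod_def)

lemma yh_perm_eq: "yh_perm r n w = Y.fw w"
  by (simp add: yh_perm_def)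

end

section \<open>The isomorphism\<close>

lemma place_perm_pinv: "w permutes {1..n} \<Longrightarrow> place_perm (pinv w) (place_perm w \<alpha>) = \<alpha>"
  by (simp add: place_perm_def fun_eq_iff permutes_inv_inv permutes_inverses)

locale yh_comp = yh_setup r \<zeta> n + composition r n \<mu>
  for r and \<zeta> :: "nat \<Rightarrow> 'k::field" and n \<mu>
begin

abbreviation "L \<equiv> (chars r n \<zeta> \<mu> :: ('k yh \<Rightarrow> 'k) set)"
abbreviation "C \<equiv> colourings_of r n \<mu>"
abbreviation "HA \<equiv> (hecke_comp r \<mu> :: ('k, 'k hecke_tensor) module)"
abbreviation "E \<equiv> (E_mu r n \<zeta> \<mu> :: 'k yh)"
abbreviation "YM \<equiv> (yh_mu r n \<zeta> \<mu> :: ('k, 'k yh) module)"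
abbreviation "MM \<equiv> (mat_mu r n \<zeta> \<mu> :: ('k, 'k hecke_mat) module)"

section \<open>Characters of one composition and their coset representatives\<close>

lemma L_iff: "\<chi> \<in> L \<longleftrightarrow> \<chi> \<in> Irr r n \<and> colour \<chi> \<in> C"
  by (rule chars_iff[OF comp])

lemma C_sub: "C \<subseteq> colourings r n"
  by (auto simp: colourings_of_def)

lemma colour_L: "colour ` L = C"
proof
  show "C \<subseteq> colour ` L"
  proof
    fix c assume c: "c \<in> C"
    then obtain \<chi> where "\<chi> \<in> Irr r n" "colour \<chi> = c" using colour_surj C_sub by blast
    then show "c \<in> colour ` L" using c by (auto simp: L_iff)
  qed
qed (auto simp: L_iff)

lemma colour_inj_L: "inj_on colour L"
  using colour_inj by (rule inj_on_subset) (auto simp: L_iff)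

lemma finite_L: "finite L"
  using finite_imageD[OF _ colour_inj_L] finite_subset[OF C_sub finite_colourings] colour_L by metis

lemma matrix_rep_H:
  "matrix_rep r n \<mu> HA (comp_x r \<mu>) (comp_perm r \<mu>) L \<zeta> (perm_char r n) colour"
proof (intro matrix_rep.intro matrix_rep_axioms.intro hecke_data_Hc root_data_axioms
    matrices.intro matrices_axioms.intro kalg_Hc finite_L colour_inj_L)
  fix w \<chi> assume w: "w permutes {1..n}" and \<chi>: "\<chi> \<in> L"
  then have \<chi>I: "\<chi> \<in> Irr r n" "colour \<chi> \<in> C" by (auto simp: L_iff)
  show "colour (perm_char r n w \<chi>) = colour \<chi> \<circ> pinv w" by (rule perm_char_props(2)[OF w \<chi>I(1)])
  then show "perm_char r n w \<chi> \<in> L"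
    using perm_char_props(1)[OF w \<chi>I(1)] colourings_of_perm[OF w \<chi>I(2)] by (simp add: L_iff)
qed (simp add: L_iff)

sublocale R: matrix_rep r n \<mu> HA "comp_x r \<mu>" "comp_perm r \<mu>" L \<zeta> "perm_char r n" colour
  by (rule matrix_rep_H)

lemma MM_eq: "MM = mat_alg L HA"
  by (simp add: mat_mu_def)

lemma c0_Col: "c0 \<in> colourings r n"
  using c0_colouring C_sub by blast

lemma c0_s: "\<chi> \<in> L \<Longrightarrow> c0 \<circ> R.s \<chi> = colour \<chi>"
proof -
  assume \<chi>: "\<chi> \<in> L"
  have p: "pinv (R.s \<chi>) permutes {1..n}" using pinv_simps(3)[OF R.s_permutes[OF \<chi>]] .
  show ?thesis
  proof (rule colourings_ext)
    show "c0 \<circ> R.s \<chi> \<in> colourings r n"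
      using colourings_perm[OF p c0_Col] pinv_simps(4)[OF R.s_permutes[OF \<chi>]] by simp
    show "colour \<chi> \<in> colourings r n" using R.col_Col[OF \<chi>] .
    show "(c0 \<circ> R.s \<chi>) j = colour \<chi> j" if "j \<in> {1..n}" for j
      using c0_std[OF R.col_mem[OF \<chi>] that] by simp
  qed
qed

lemma chi0_props: "chi0 r n \<zeta> \<mu> \<in> (Irr r n :: ('k yh \<Rightarrow> 'k) set)" "colour (chi0 r n \<zeta> \<mu>) = c0"
proof -
  obtain \<chi> where \<chi>: "\<chi> \<in> Irr r n" "colour \<chi> = c0" using colour_surj[OF c0_Col] by blast
  have v: "\<chi> (tt j) = \<zeta> a" if "a \<in> {1..r}" "j \<in> block \<mu> a" for a j
    using colour_props(2)[OF \<chi>(1) block_mem[OF that]] c0_block[OF that] \<chi>(2) by simp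
  have "chi0 r n \<zeta> \<mu> = \<chi>"
    unfolding chi0_def
  proof (rule the_equality)
    fix \<chi>' assume \<chi>': "\<chi>' \<in> Irr r n \<and> (\<forall>a\<in>{1..r}. \<forall>j\<in>block \<mu> a. \<chi>' (tt j) = \<zeta> a)"
    show "\<chi>' = \<chi>"
    proof (rule char_ext)
      fix j assume "j \<in> {1..n}"
      then obtain a where "a \<in> {1..r}" "j \<in> block \<mu> a" using block_exists by blast
      then show "\<chi>' (tt j) = \<chi> (tt j)" using \<chi>' v by simp
    qed (use \<chi>' \<chi> in auto)
  qed (use \<chi> v in blast)
  then show "chi0 r n \<zeta> \<mu> \<in> (Irr r n :: ('k yh \<Rightarrow> 'k) set)" "colour (chi0 r n \<zeta> \<mu>) = c0" using \<chi> by auto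
qed

text \<open>Every permutation taking the standard character to \<open>\<chi>\<close> equals
  \<open>pinv (R.s \<chi>)\<close> times an element of the Young subgroup on the right. A nontrivial
  such factor strictly increases the length, so minimality leaves only the trivial one.\<close>

lemma pi_chi_eq:
  assumes \<chi>: "\<chi> \<in> L" shows "pi_chi r n \<zeta> \<chi> = pinv (R.s \<chi>)"
proof -
  have \<chi>I: "\<chi> \<in> Irr r n" and cC: "colour \<chi> \<in> C" using \<chi> by (auto simp: L_iff)
  have Cm: "Comp r n \<zeta> \<chi> = \<mu>" using \<chi> by (simp add: chars_def)
  note sp = R.s_permutes[OF \<chi>]
  note si = pinv_simps[OF sp]
  have pc: "perm_char r n w (chi0 r n \<zeta> \<mu>) = \<chi> \<longleftrightarrow> c0 \<circ> pinv w = colour \<chi>" if w: "w permutes {1..n}" for w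
    using perm_char_props[OF w chi0_props(1)] chi0_props(2) colour_inj \<chi>I by (metis inj_on_eq_iff)
  show ?thesis
    unfolding pi_chi_def Cm
  proof (rule the_equality, intro conjI ballI)
    show "pinv (R.s \<chi>) permutes {1..n}" by (rule si(3))
    show "perm_char r n (pinv (R.s \<chi>)) (chi0 r n \<zeta> \<mu>) = \<chi>"
      unfolding pc[OF si(3)] si(4) by (rule c0_s[OF \<chi>])
    fix v assume v: "v \<in> young r n \<mu>"
    show "perm_length n (pinv (R.s \<chi>)) \<le> perm_length n (pinv (R.s \<chi>) \<circ> v)"
      using std_length_minimal[OF cC v] by (cases "v = id") auto
  next
    fix w assume w: "w permutes {1..n} \<and> perm_char r n w (chi0 r n \<zeta> \<mu>) = \<chi> \<and>
        (\<forall>v\<in>young r n \<mu>. perm_length n w \<le> perm_length n (w \<circ> v))"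
    then have wp: "w permutes {1..n}" by blast
    have cw: "c0 \<circ> pinv w = colour \<chi>" using w pc[OF wp] by blast
    have v: "R.s \<chi> \<circ> w \<in> young r n \<mu>"
      using cw pinv_simps(2)[OF wp] by (intro std_young[OF cC wp]) (metis comp_apply)
    have wv: "w = pinv (R.s \<chi>) \<circ> (R.s \<chi> \<circ> w)" using si(8) by (metis comp_assoc id_comp)
    have "R.s \<chi> \<circ> w = id"
    proof (rule ccontr)
      assume ne: "R.s \<chi> \<circ> w \<noteq> id"
      have "perm_length n (pinv (R.s \<chi>)) < perm_length n w"
        using std_length_minimal[OF cC v ne] wv by simp
      \<comment> \<open>Minimality of \<open>w\<close> is tested against the Young element that
        carries \<open>w\<close> back to the inverse standardization.\<close>
      moreover have "perm_length n w \<le> perm_length n (w \<circ> pinv (R.s \<chi> \<circ> w))" using w young_inv[OF v] by blast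
      moreover have "w \<circ> pinv (R.s \<chi> \<circ> w) = pinv (R.s \<chi>)"
        unfolding pinv_comp[OF sp wp] using pinv_simps(7)[OF wp] by (simp add: comp_assoc[symmetric])
      ultimately show False by simp
    qed
    then show "w = pinv (R.s \<chi>)" using wv by simp
  qed
qed

section \<open>The central idempotent of a composition and its ideal\<close>

lemma E_eq: "E = Y.EC C"
proof -
  have "E = (\<Oplus>\<^bsub>YA\<^esub>\<chi>\<in>L. Y.Ec (colour \<chi>))"
    unfolding E_mu_def by (rule Y.finsum_cong') (auto simp: L_iff E_chi_eq)
  also have "\<dots> = (\<Oplus>\<^bsub>YA\<^esub>c\<in>colour ` L. Y.Ec c)"
    by (rule Y.finsum_reindex[symmetric]) (use colour_inj_L in auto)
  finally show ?thesis by (simp add: Y.EC_def colour_L)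
qed

lemma E_closed [simp]: "E \<in> carrier YA" by (simp add: E_eq)

lemma E_idem: "E \<otimes>\<^bsub>YA\<^esub> E = E"
  unfolding E_eq using Y.EC_EC[OF C_sub C_sub] by simp

text \<open>Each generator permutes the idempotents \<open>Ec c\<close> among themselves, and
  permuting places preserves the number of places of each colour. So the sum over one composition
  commutes with the generators, hence with everything.\<close>

lemma E_commute: "y \<in> carrier YA \<Longrightarrow> y \<otimes>\<^bsub>YA\<^esub> E = E \<otimes>\<^bsub>YA\<^esub> y"
proof -
  assume y: "y \<in> carrier YA"
  let ?G = "yh_t r n ` {1..n} \<union> yh_f r n ` {1..<n} \<union> yh_x r n ` {1..n}"
  have finC: "finite C" using finite_subset[OF C_sub finite_colourings] .
  have tw: "z \<otimes>\<^bsub>YA\<^esub> E = E \<otimes>\<^bsub>YA\<^esub> z"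
    if z: "z \<in> carrier YA" and w: "w permutes {1..n}" and zE: "\<And>c. c \<in> colourings r n \<Longrightarrow> z \<otimes>\<^bsub>YA\<^esub> Y.Ec c = Y.Ec (c \<circ> w) \<otimes>\<^bsub>YA\<^esub> z" for z w
  proof -
    have inj: "inj_on (\<lambda>c. c \<circ> w) C"
      by (rule inj_onI) (metis comp_assoc comp_id pinv_simps(7)[OF w])
    have im: "(\<lambda>c. c \<circ> w) ` C = C"
    proof
      have cw: "c \<circ> w \<in> C" if "c \<in> C" for c
        using colourings_of_perm[OF pinv_simps(3)[OF w] that] pinv_simps(4)[OF w] by simp
      then show "(\<lambda>c. c \<circ> w) ` C \<subseteq> C" by blast
      show "C \<subseteq> (\<lambda>c. c \<circ> w) ` C"
      proof
        fix c assume c: "c \<in> C"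
        have "c = (c \<circ> pinv w) \<circ> w" using pinv_simps(8)[OF w] by (simp add: comp_assoc)
        then show "c \<in> (\<lambda>c. c \<circ> w) ` C" using colourings_of_perm[OF w c] by (rule image_eqI)
      qed
    qed
    have "z \<otimes>\<^bsub>YA\<^esub> E = (\<Oplus>\<^bsub>YA\<^esub>c\<in>C. z \<otimes>\<^bsub>YA\<^esub> Y.Ec c)"
      unfolding E_eq Y.EC_def using z finC by (intro Y.finsum_rdistr) auto
    also have "\<dots> = (\<Oplus>\<^bsub>YA\<^esub>c\<in>C. Y.Ec (c \<circ> w) \<otimes>\<^bsub>YA\<^esub> z)"
      using z zE C_sub by (intro Y.finsum_cong') auto
    also have "\<dots> = (\<Oplus>\<^bsub>YA\<^esub>c\<in>C. Y.Ec (c \<circ> w)) \<otimes>\<^bsub>YA\<^esub> z"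
      using z finC by (intro Y.finsum_ldistr[symmetric]) auto
    also have "(\<Oplus>\<^bsub>YA\<^esub>c\<in>C. Y.Ec (c \<circ> w)) = (\<Oplus>\<^bsub>YA\<^esub>c\<in>(\<lambda>c. c \<circ> w) ` C. Y.Ec c)"
      by (rule Y.finsum_reindex[OF _ inj, symmetric]) simp
    finally show ?thesis unfolding im E_eq Y.EC_def .
  qed
  have G: "z \<otimes>\<^bsub>YA\<^esub> E = E \<otimes>\<^bsub>YA\<^esub> z" if "z \<in> ?G" for z
    using that
  proof (elim UnE imageE)
    fix i assume i: "z = yh_t r n i" "i \<in> {1..n}"
    show ?thesis using Y.twist_Ec[OF permutes_id, of z] i Y.t_comm
      by (intro tw[OF _ permutes_id]) (auto simp: inv_id)
  next
    fix i assume i: "z = yh_f r n i" "i \<in> {1..<n}"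
    show ?thesis using Y.f_Ec[OF i(2)] i by (intro tw[OF _ simple_refl_permutes[OF i(2)]]) auto
  next
    fix i assume i: "z = yh_x r n i" "i \<in> {1..n}"
    show ?thesis using Y.x_Ec[OF i(2)] i by (intro tw[OF _ permutes_id]) auto
  qed
  have sub: "?G \<subseteq> carrier YA" by auto
  show ?thesis
    by (rule gen_subalg_commute[OF Y.kalg_Y sub E_closed G]; (rule subsetD[OF equalityD1[OF Y.generated] y])?)
qed

text \<open>For a central idempotent the ideal is the corner, whose algebra laws have already been
  established.\<close>

lemma YM_eq: "YM = corner_alg YA E"
proof -
  have "{E \<otimes>\<^bsub>YA\<^esub> y |y. y \<in> carrier YA} = {y \<in> carrier YA. E \<otimes>\<^bsub>YA\<^esub> y = y \<and> y \<otimes>\<^bsub>YA\<^esub> E = y}"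
  proof (intro equalityI subsetI)
    fix z assume "z \<in> {E \<otimes>\<^bsub>YA\<^esub> y |y. y \<in> carrier YA}"
    then obtain y where y: "y \<in> carrier YA" "z = E \<otimes>\<^bsub>YA\<^esub> y" by blast
    have "E \<otimes>\<^bsub>YA\<^esub> z = z" using y E_idem by (simp add: Y.m_assoc[symmetric])
    then show "z \<in> {y \<in> carrier YA. E \<otimes>\<^bsub>YA\<^esub> y = y \<and> y \<otimes>\<^bsub>YA\<^esub> E = y}"
      using y E_commute[of z] by simp
  next
    fix z assume "z \<in> {y \<in> carrier YA. E \<otimes>\<^bsub>YA\<^esub> y = y \<and> y \<otimes>\<^bsub>YA\<^esub> E = y}"
    then have "z \<in> carrier YA" "z = E \<otimes>\<^bsub>YA\<^esub> z" by auto
    then show "z \<in> {E \<otimes>\<^bsub>YA\<^esub> y |y. y \<in> carrier YA}" by blast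
  qed
  then show ?thesis by (simp add: yh_mu_def ideal_alg_def corner_alg_def)
qed

lemma kalg_YM: "kalg YM"
  unfolding YM_eq by (rule kalg_corner[OF Y.kalg_Y E_closed E_idem])

lemma YM_simps [simp]:
  "\<one>\<^bsub>YM\<^esub> = E" "x \<otimes>\<^bsub>YM\<^esub> y = x \<otimes>\<^bsub>YA\<^esub> y" "x \<oplus>\<^bsub>YM\<^esub> y = x \<oplus>\<^bsub>YA\<^esub> y" "c \<odot>\<^bsub>YM\<^esub> y = c \<odot>\<^bsub>YA\<^esub> y" "\<zero>\<^bsub>YM\<^esub> = \<zero>\<^bsub>YA\<^esub>"
  by (simp_all add: YM_eq)

lemma YM_iff: "y \<in> carrier YM \<longleftrightarrow> y \<in> carrier YA \<and> E \<otimes>\<^bsub>YA\<^esub> y = y"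
  using E_commute by (auto simp: YM_eq)

lemma E_mult_YM: "y \<in> carrier YA \<Longrightarrow> E \<otimes>\<^bsub>YA\<^esub> y \<in> carrier YM"
  using E_idem by (simp add: YM_iff Y.m_assoc[symmetric])

lemma B_YM: "c \<in> C \<Longrightarrow> w permutes {1..n} \<Longrightarrow> Y.B c \<alpha> w \<in> carrier YM"
  using Y.EC_B[OF C_sub, of c w \<alpha>] C_sub by (auto simp: YM_iff E_eq)

lemma Bs_YM: "Y.Bs C \<subseteq> carrier YM"
  using B_YM by (auto simp: Y.Bs_def)

lemma YM_span: "y \<in> carrier YM \<Longrightarrow> y \<in> lspan YM (Y.Bs C)"
proof -
  assume y: "y \<in> carrier YM"
  have "z \<in> lspan YM (Y.Bs C)" if "z \<in> lspan YA (Y.Bs C)" for z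
    using that
  proof induction
    case zero
    show ?case using lspan.zero[of YM] by simp
  next
    case (add y z)
    then show ?case using lspan.add[of y YM _ z] by simp
  next
    case (smult y c)
    then show ?case using lspan.smult[of y YM _ c] by simp
  qed (rule lspan.base)
  moreover have "y \<in> lspan YA (Y.Bs C)" using Y.EC_span[OF C_sub, of y] y by (simp add: YM_iff E_eq)
  ultimately show ?thesis by blast
qed

text \<open>Idempotents of colourings outside \<open>C\<close> label no row and act by zero. The sum
  over \<open>C\<close> therefore has the same image as the sum over all colourings, which is the
  unit.\<close>

lemma rep_E: "R.rep E = \<one>\<^bsub>MM\<^esub>"
proof -
  have z: "R.rep (Y.Ec c) = \<zero>\<^bsub>R.M\<^esub>" if "c \<in> colourings r n - C" for c
  proof -
    have "R.rep (Y.Ec c) = R.dg (\<lambda>l. if colour l = c then \<one>\<^bsub>HA\<^esub> else \<zero>\<^bsub>HA\<^esub>)" using that by (intro R.rep_Ec) simp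
    also have "\<dots> = R.dg (\<lambda>l. \<zero>\<^bsub>HA\<^esub>)"
    proof (rule R.mm_cong)
      fix l assume "l \<in> L"
      then have "colour l \<noteq> c" using that by (auto simp: L_iff)
      then show "(if colour l = c then \<one>\<^bsub>HA\<^esub> else \<zero>\<^bsub>HA\<^esub>) = \<zero>\<^bsub>HA\<^esub>" by simp
    qed simp
    also have "\<dots> = \<zero>\<^bsub>R.M\<^esub>" by (simp add: mono_mat_def mat_alg_simps) (auto intro!: restrict_ext)
    finally show ?thesis .
  qed
  have c: "R.rep (Y.Ec c) \<in> carrier R.M" for c using R.rep_hom(1) Y.Ec_closed by blast
  have "R.rep E = (\<Oplus>\<^bsub>R.M\<^esub>c\<in>C. R.rep (Y.Ec c))"
    unfolding E_eq Y.EC_def by (intro linear_maps_finsum[OF Y.kalg_Y R.kalg_M R.rep_hom(7)]) auto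
  also have "\<dots> = (\<Oplus>\<^bsub>R.M\<^esub>c\<in>colourings r n. R.rep (Y.Ec c))"
    by (rule R.M.add.finprod_mono_neutral_cong_left[OF finite_colourings C_sub])
       (use z c in auto)
  also have "\<dots> = R.rep (\<Oplus>\<^bsub>YA\<^esub>c\<in>colourings r n. Y.Ec c)"
    by (intro linear_maps_finsum[OF Y.kalg_Y R.kalg_M R.rep_hom(7), symmetric]) auto
  also have "\<dots> = \<one>\<^bsub>R.M\<^esub>" using R.rep_hom(5) by (simp add: Y.sum_Ec)
  finally show ?thesis by (simp add: MM_eq)
qed

section \<open>The map \<open>Phi\<close> as a restricted matrix representation\<close>

definition PhiM :: "'k yh \<Rightarrow> 'k hecke_mat" where
  "PhiM = restrict R.rep (carrier YM)"

lemma YM_sub: "y \<in> carrier YM \<Longrightarrow> y \<in> carrier YA"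
  by (simp add: YM_iff)

lemma PhiM_hom: "PhiM \<in> alg_hom YM MM"
proof (rule alg_homI)
  interpret YM: kalg YM by (rule kalg_YM)
  show "PhiM \<in> carrier YM \<rightarrow>\<^sub>E carrier MM"
    using R.rep_hom(1) YM_sub by (auto simp: PhiM_def MM_eq)
  show "PhiM (x \<oplus>\<^bsub>YM\<^esub> y) = PhiM x \<oplus>\<^bsub>MM\<^esub> PhiM y" "PhiM (x \<otimes>\<^bsub>YM\<^esub> y) = PhiM x \<otimes>\<^bsub>MM\<^esub> PhiM y"
    if xy: "x \<in> carrier YM" "y \<in> carrier YM" for x y
    using xy YM.a_closed[OF xy] YM.m_closed[OF xy] R.rep_hom(2,4)[OF xy[THEN YM_sub]] by (simp_all add: PhiM_def MM_eq)
  show "PhiM (c \<odot>\<^bsub>YM\<^esub> x) = c \<odot>\<^bsub>MM\<^esub> PhiM x" if x: "x \<in> carrier YM" for x c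
    using x YM.smult_closed[OF x, of c] R.rep_hom(3)[OF YM_sub[OF x], of c] by (simp add: PhiM_def MM_eq)
  show "PhiM \<one>\<^bsub>YM\<^esub> = \<one>\<^bsub>MM\<^esub>" using rep_E YM.one_closed by (simp add: PhiM_def)
qed

text \<open>\<open>E\<close> acts as the unit matrix, so cutting down by it does not change the
  image. This makes each component of \<open>Phi_total\<close> a homomorphism on the whole
  algebra.\<close>

lemma PhiM_E: "y \<in> carrier YA \<Longrightarrow> PhiM (E \<otimes>\<^bsub>YA\<^esub> y) = R.rep y"
proof -
  assume y: "y \<in> carrier YA"
  have "PhiM (E \<otimes>\<^bsub>YA\<^esub> y) = R.rep E \<otimes>\<^bsub>R.M\<^esub> R.rep y" using y E_mult_YM[OF y] by (simp add: PhiM_def R.rep_hom(4))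
  also have "\<dots> = R.rep y" using rep_E R.rep_hom(1)[OF y] by (simp add: MM_eq)
  finally show ?thesis .
qed

lemma E_chi_B: "\<chi> \<in> L \<Longrightarrow> E_chi r n \<chi> \<otimes>\<^bsub>YA\<^esub> yh_monom r n \<alpha> \<otimes>\<^bsub>YA\<^esub> yh_perm r n w = Y.B (colour \<chi>) \<alpha> w"
  by (simp add: Y.B_def L_iff E_chi_eq yh_monom_eq yh_perm_eq)

lemma comp_monom_eq: "comp_monom r n \<mu> \<alpha> = monom_prod HA n (comp_x r \<mu>) \<alpha>"
  by (simp add: comp_monom_def monom_prod_def)

lemma PhiM_B:
  assumes \<chi>: "\<chi> \<in> L" and w: "w permutes {1..n}"
  shows "PhiM (Y.B (colour \<chi>) \<alpha> w) = mat_unit L HA \<chi> (perm_char r n (pinv w) \<chi>)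
     (comp_monom r n \<mu> (place_perm (R.s \<chi>) \<alpha>) \<otimes>\<^bsub>HA\<^esub> comp_perm r \<mu> (R.wt w \<chi>))"
  using R.rep_B[OF assms] B_YM[OF R.col_mem[OF \<chi>] w] by (simp add: PhiM_def comp_monom_eq)

lemma PhiM_is_Phi: "is_Phi r n \<zeta> \<mu> PhiM"
  unfolding is_Phi_def Let_def
proof (intro conjI allI impI)
  show "PhiM \<in> linear_maps YM MM" by (rule alg_homD(7)[OF PhiM_hom])
  fix \<chi> \<alpha> w assume \<chi>: "\<chi> \<in> L" and w: "w permutes {1..n}"
  let ?\<chi>' = "perm_char r n (pinv w) \<chi>"
  have \<chi>': "?\<chi>' \<in> L" by (rule R.act_mem[OF pinv_simps(3)[OF w] \<chi>])
  have p: "pinv (pinv (R.s \<chi>)) = R.s \<chi>" using pinv_simps(4)[OF R.s_permutes[OF \<chi>]] .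
  show "PhiM (E_chi r n \<chi> \<otimes>\<^bsub>YA\<^esub> yh_monom r n \<alpha> \<otimes>\<^bsub>YA\<^esub> yh_perm r n w) =
     mat_unit L HA \<chi> ?\<chi>' (comp_monom r n \<mu> (place_perm (pinv (pi_chi r n \<zeta> \<chi>)) \<alpha>)
       \<otimes>\<^bsub>HA\<^esub> comp_perm r \<mu> (pinv (pi_chi r n \<zeta> \<chi>) \<circ> w \<circ> pi_chi r n \<zeta> ?\<chi>'))"
    unfolding E_chi_B[OF \<chi>] PhiM_B[OF \<chi> w] pi_chi_eq[OF \<chi>] pi_chi_eq[OF \<chi>'] p R.wt_def ..
qed

text \<open>The monomials span the domain, and off the carrier both maps are
  \<open>undefined\<close>.\<close>

lemma is_Phi_unique:
  assumes "is_Phi r n \<zeta> \<mu> h" "is_Phi r n \<zeta> \<mu> k" shows "h = k"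
proof
  fix y
  have l: "h \<in> linear_maps YM MM" "k \<in> linear_maps YM MM" using assms by (simp_all add: is_Phi_def)
  show "h y = k y"
  proof (cases "y \<in> carrier YM")
    case True
    have "h z = k z" if zB: "z \<in> Y.Bs C" for z
    proof -
      obtain c \<alpha> w where z: "z = Y.B c \<alpha> w" "c \<in> C" "w permutes {1..n}" using zB unfolding Y.Bs_def by blast
      then obtain \<chi> where \<chi>: "\<chi> \<in> L" "c = colour \<chi>" using colour_L by blast
      show ?thesis using assms \<chi> z(3) unfolding is_Phi_def Let_def z(1) \<chi>(2) E_chi_B[OF \<chi>(1), symmetric] by simp
    qed
    then show ?thesis
      using lspan_linear_eq[OF kalg_YM _ Bs_YM l _ YM_span[OF True]] R.kalg_M MM_eq by simp
  qed (use linear_mapsD(4)[OF l(1)] linear_mapsD(4)[OF l(2)] in simp)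
qed

lemma Phi_eq: "Phi r n \<zeta> \<mu> = PhiM"
  unfolding Phi_def using PhiM_is_Phi is_Phi_unique by (blast intro: the_equality)

section \<open>The corner at the standard character and the map \<open>Psi\<close>\<close>

abbreviation "E0 \<equiv> Y.Ec c0"

lemma fw_young: "w \<in> young r n \<mu> \<Longrightarrow> Y.fw w \<otimes>\<^bsub>YA\<^esub> E0 = E0 \<otimes>\<^bsub>YA\<^esub> Y.fw w"
proof -
  assume w: "w \<in> young r n \<mu>"
  note wp = young_permutes[OF w]
  have "c0 \<circ> pinv w = c0"
    by (rule colourings_ext[OF colourings_perm[OF wp c0_Col] c0_Col]) (use young_inv[OF w] in \<open>simp add: young_iff\<close>)
  then show ?thesis using Y.fw_Ec[OF wp c0_Col] by simp
qed

abbreviation "CA \<equiv> corner_alg YA E0"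

lemma E0_idem: "E0 \<otimes>\<^bsub>YA\<^esub> E0 = E0"
  using Y.Ec_Ec[OF c0_Col c0_Col] by simp

lemma corner_closed:
  "y \<in> carrier YA \<Longrightarrow> y \<otimes>\<^bsub>YA\<^esub> E0 = E0 \<otimes>\<^bsub>YA\<^esub> y \<Longrightarrow> y \<otimes>\<^bsub>YA\<^esub> E0 \<in> carrier CA"
  using E0_idem by (simp add: Y.m_assoc) (simp add: Y.m_assoc[symmetric])

lemma corner_mult:
  "y \<in> carrier YA \<Longrightarrow> z \<in> carrier YA \<Longrightarrow> z \<otimes>\<^bsub>YA\<^esub> E0 = E0 \<otimes>\<^bsub>YA\<^esub> z \<Longrightarrow>
     (y \<otimes>\<^bsub>YA\<^esub> E0) \<otimes>\<^bsub>YA\<^esub> (z \<otimes>\<^bsub>YA\<^esub> E0) = y \<otimes>\<^bsub>YA\<^esub> z \<otimes>\<^bsub>YA\<^esub> E0"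
proof -
  assume a: "y \<in> carrier YA" "z \<in> carrier YA" "z \<otimes>\<^bsub>YA\<^esub> E0 = E0 \<otimes>\<^bsub>YA\<^esub> z"
  have "(y \<otimes>\<^bsub>YA\<^esub> E0) \<otimes>\<^bsub>YA\<^esub> (z \<otimes>\<^bsub>YA\<^esub> E0) = y \<otimes>\<^bsub>YA\<^esub> (E0 \<otimes>\<^bsub>YA\<^esub> z) \<otimes>\<^bsub>YA\<^esub> E0"
    using a(1,2) by (simp add: Y.m_assoc)
  also have "\<dots> = y \<otimes>\<^bsub>YA\<^esub> z \<otimes>\<^bsub>YA\<^esub> (E0 \<otimes>\<^bsub>YA\<^esub> E0)"
    unfolding a(3)[symmetric] using a(1,2) by (simp add: Y.m_assoc)
  finally show ?thesis unfolding E0_idem .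
qed

lemma kalg_CA: "kalg CA"
  by (rule kalg_corner[OF Y.kalg_Y Y.Ec_closed E0_idem])

lemma hecke_data_corner:
  "hecke_data r n \<mu> CA (\<lambda>k. yh_x r n k \<otimes>\<^bsub>YA\<^esub> E0) (\<lambda>w. Y.fw w \<otimes>\<^bsub>YA\<^esub> E0)"
proof (intro hecke_data.intro hecke_data_axioms.intro composition_axioms kalg_CA; (unfold corner_alg_simps(2-6))?)
  note xE = Y.x_Ec[OF _ c0_Col]
  show "yh_x r n k \<otimes>\<^bsub>YA\<^esub> E0 \<in> carrier CA" if "k \<in> {1..n}" for k
    by (rule corner_closed[OF Y.x_closed[OF that] xE[OF that]])
  show "Y.fw w \<otimes>\<^bsub>YA\<^esub> E0 \<in> carrier CA" if "w \<in> young r n \<mu>" for w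
    using young_permutes[OF that] fw_young[OF that] by (intro corner_closed) simp_all
  show "Y.fw id \<otimes>\<^bsub>YA\<^esub> E0 = E0" unfolding Y.F.perm_elem_id by simp
  show "Y.fw (w \<circ> v) \<otimes>\<^bsub>YA\<^esub> E0 = (Y.fw w \<otimes>\<^bsub>YA\<^esub> E0) \<otimes>\<^bsub>YA\<^esub> (Y.fw v \<otimes>\<^bsub>YA\<^esub> E0)"
    if wv: "w \<in> young r n \<mu>" "v \<in> young r n \<mu>" for w v
    using Y.F.perm_elem_mult[OF wv[THEN young_permutes]] young_permutes wv
    by (subst corner_mult) (simp_all add: fw_young)
  show "yh_x r n k \<otimes>\<^bsub>YA\<^esub> E0 \<otimes>\<^bsub>YA\<^esub> (yh_x r n l \<otimes>\<^bsub>YA\<^esub> E0) = yh_x r n l \<otimes>\<^bsub>YA\<^esub> E0 \<otimes>\<^bsub>YA\<^esub> (yh_x r n k \<otimes>\<^bsub>YA\<^esub> E0)"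
    if kl: "k \<in> {1..n}" "l \<in> {1..n}" for k l
    using corner_mult[OF Y.x_closed[OF kl(1)] Y.x_closed[OF kl(2)] xE[OF kl(2)]]
      corner_mult[OF Y.x_closed[OF kl(2)] Y.x_closed[OF kl(1)] xE[OF kl(1)]] Y.x_comm[OF kl] by simp
  fix a k assume k: "a \<in> {1..r}" "k \<in> block \<mu> a" "Suc k \<in> block \<mu> a"
  have kn: "k \<in> {1..n}" "Suc k \<in> {1..n}" using block_mem[OF k(1,2)] block_mem[OF k(1,3)] .
  then have k1: "k \<in> {1..<n}" by simp
  have fk: "Y.fw (simple_refl k) = yh_f r n k" by (rule Y.F.perm_elem_simple[OF k1])
  note fc = Y.f_closed[OF k1]
  have fE: "yh_f r n k \<otimes>\<^bsub>YA\<^esub> E0 = E0 \<otimes>\<^bsub>YA\<^esub> yh_f r n k" using fw_young[OF young_simple[OF k]] fk by simp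
  have eE: "Y.e k \<otimes>\<^bsub>YA\<^esub> E0 = E0"
    using Y.e_eigen[OF k1 c0_Col Y.eigen_Ec[OF c0_Col]] c0_block[OF k(1,2)] c0_block[OF k(1,3)] by simp
  show "Y.fw (simple_refl k) \<otimes>\<^bsub>YA\<^esub> E0 \<otimes>\<^bsub>YA\<^esub> (yh_x r n (Suc k) \<otimes>\<^bsub>YA\<^esub> E0) =
      yh_x r n k \<otimes>\<^bsub>YA\<^esub> E0 \<otimes>\<^bsub>YA\<^esub> (Y.fw (simple_refl k) \<otimes>\<^bsub>YA\<^esub> E0) \<oplus>\<^bsub>YA\<^esub> E0"
    unfolding fk corner_mult[OF fc Y.x_closed[OF kn(2)] xE[OF kn(2)]] corner_mult[OF Y.x_closed[OF kn(1)] fc fE] Y.f_x_e[OF k1]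
    using eE fc kn k1 by (simp add: Y.l_distr)
  show "Y.fw (simple_refl k) \<otimes>\<^bsub>YA\<^esub> E0 \<otimes>\<^bsub>YA\<^esub> (yh_x r n j \<otimes>\<^bsub>YA\<^esub> E0) =
      yh_x r n j \<otimes>\<^bsub>YA\<^esub> E0 \<otimes>\<^bsub>YA\<^esub> (Y.fw (simple_refl k) \<otimes>\<^bsub>YA\<^esub> E0)"
    if j: "j \<in> {1..n}" "j \<noteq> k" "j \<noteq> Suc k" for j
    unfolding fk corner_mult[OF fc Y.x_closed[OF j(1)] xE[OF j(1)]] corner_mult[OF Y.x_closed[OF j(1)] fc fE]
      Y.f_x_far[OF k1 j] ..
qed

definition psi :: "'k hecke_tensor \<Rightarrow> 'k yh" where
  "psi = (SOME h. h \<in> alg_hom HA CA \<and> (\<forall>k\<in>{1..n}. h (comp_x r \<mu> k) = yh_x r n k \<otimes>\<^bsub>YA\<^esub> E0) \<and>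
      (\<forall>w\<in>young r n \<mu>. h (comp_perm r \<mu> w) = Y.fw w \<otimes>\<^bsub>YA\<^esub> E0))"

lemma psi_props:
  "psi \<in> alg_hom HA CA" "k \<in> {1..n} \<Longrightarrow> psi (comp_x r \<mu> k) = yh_x r n k \<otimes>\<^bsub>YA\<^esub> E0"
  "w \<in> young r n \<mu> \<Longrightarrow> psi (comp_perm r \<mu> w) = Y.fw w \<otimes>\<^bsub>YA\<^esub> E0"
proof -
  have ex: "\<exists>h. h \<in> alg_hom HA CA \<and> (\<forall>k\<in>{1..n}. h (comp_x r \<mu> k) = yh_x r n k \<otimes>\<^bsub>YA\<^esub> E0) \<and>
      (\<forall>w\<in>young r n \<mu>. h (comp_perm r \<mu> w) = Y.fw w \<otimes>\<^bsub>YA\<^esub> E0)"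
    using hecke_data.Hc_hom_exists[OF hecke_data_corner] by blast
  have "psi \<in> alg_hom HA CA \<and> (\<forall>k\<in>{1..n}. psi (comp_x r \<mu> k) = yh_x r n k \<otimes>\<^bsub>YA\<^esub> E0) \<and>
      (\<forall>w\<in>young r n \<mu>. psi (comp_perm r \<mu> w) = Y.fw w \<otimes>\<^bsub>YA\<^esub> E0)"
    unfolding psi_def by (rule someI_ex[OF ex])
  then show "psi \<in> alg_hom HA CA" "k \<in> {1..n} \<Longrightarrow> psi (comp_x r \<mu> k) = yh_x r n k \<otimes>\<^bsub>YA\<^esub> E0"
    "w \<in> young r n \<mu> \<Longrightarrow> psi (comp_perm r \<mu> w) = Y.fw w \<otimes>\<^bsub>YA\<^esub> E0" by blast+
qed

lemma psi_closed: "y \<in> carrier HA \<Longrightarrow> psi y \<in> carrier YA"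
  using alg_homD(1)[OF psi_props(1)] by simp

text \<open>The copies of \<open>E0\<close> brought in by the factors merge into one, because
  \<open>E0\<close> is an idempotent commuting with the \<open>x\<close>. The empty product
  contributes one as well, \<open>E0\<close> being the unit of the corner.\<close>

lemma psi_monom: "psi (monom_prod HA n (comp_x r \<mu>) \<alpha>) = Y.xm \<alpha> \<otimes>\<^bsub>YA\<^esub> E0"
proof -
  note h = alg_homD[OF psi_props(1)]
  have xE: "yh_x r n i [^]\<^bsub>YA\<^esub> m \<otimes>\<^bsub>YA\<^esub> E0 = E0 \<otimes>\<^bsub>YA\<^esub> yh_x r n i [^]\<^bsub>YA\<^esub> m" if "i \<in> {1..n}" for i and m :: nat
    using Y.group_commutes_pow[OF Y.x_Ec[OF that c0_Col]] that by simp
  have pw: "psi (comp_x r \<mu> i [^]\<^bsub>HA\<^esub> m) = yh_x r n i [^]\<^bsub>YA\<^esub> m \<otimes>\<^bsub>YA\<^esub> E0" if i: "i \<in> {1..n}" for i and m :: nat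
  proof (induction m)
    case 0
    show ?case using h(5) by simp
  next
    case (Suc m)
    have "psi (comp_x r \<mu> i [^]\<^bsub>HA\<^esub> Suc m) = psi (comp_x r \<mu> i [^]\<^bsub>HA\<^esub> m) \<otimes>\<^bsub>YA\<^esub> psi (comp_x r \<mu> i)"
      using h(4)[of "comp_x r \<mu> i [^]\<^bsub>HA\<^esub> m" "comp_x r \<mu> i"] R.X_closed[OF i] by simp
    also have "\<dots> = yh_x r n i [^]\<^bsub>YA\<^esub> Suc m \<otimes>\<^bsub>YA\<^esub> E0"
      unfolding Suc psi_props(2)[OF i] using i by (subst corner_mult) (simp_all add: Y.x_Ec[OF _ c0_Col])
    finally show ?case .
  qed
  have l: "psi (list_prod HA (map (\<lambda>i. comp_x r \<mu> i [^]\<^bsub>HA\<^esub> \<alpha> i) is)) = list_prod YA (map (\<lambda>i. yh_x r n i [^]\<^bsub>YA\<^esub> \<alpha> i) is) \<otimes>\<^bsub>YA\<^esub> E0"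
    if "set is \<subseteq> {1..n}" for "is"
    using that
  proof (induction "is")
    case Nil
    show ?case using h(5) by simp
  next
    case (Cons i "is")
    have i: "i \<in> {1..n}" "set is \<subseteq> {1..n}" using Cons.prems by auto
    have lc: "list_prod HA (map (\<lambda>i. comp_x r \<mu> i [^]\<^bsub>HA\<^esub> \<alpha> i) is) \<in> carrier HA"
      using i(2) by (intro R.list_prod_closed) auto
    have ly: "list_prod YA (map (\<lambda>i. yh_x r n i [^]\<^bsub>YA\<^esub> \<alpha> i) is) \<in> carrier YA"
      using i(2) by (intro Y.list_prod_closed) auto
    have lE: "list_prod YA (map (\<lambda>i. yh_x r n i [^]\<^bsub>YA\<^esub> \<alpha> i) is) \<otimes>\<^bsub>YA\<^esub> E0 = E0 \<otimes>\<^bsub>YA\<^esub> list_prod YA (map (\<lambda>i. yh_x r n i [^]\<^bsub>YA\<^esub> \<alpha> i) is)"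
      using i(2) xE by (intro Y.list_prod_commute[symmetric]) (auto simp: subset_iff)
    have "psi (list_prod HA (map (\<lambda>i. comp_x r \<mu> i [^]\<^bsub>HA\<^esub> \<alpha> i) (i # is))) =
        psi (comp_x r \<mu> i [^]\<^bsub>HA\<^esub> \<alpha> i) \<otimes>\<^bsub>YA\<^esub> psi (list_prod HA (map (\<lambda>i. comp_x r \<mu> i [^]\<^bsub>HA\<^esub> \<alpha> i) is))"
      using h(4)[of "comp_x r \<mu> i [^]\<^bsub>HA\<^esub> \<alpha> i" "list_prod HA (map (\<lambda>i. comp_x r \<mu> i [^]\<^bsub>HA\<^esub> \<alpha> i) is)"] R.X_closed[OF i(1)] lc by simp
    also have "\<dots> = list_prod YA (map (\<lambda>i. yh_x r n i [^]\<^bsub>YA\<^esub> \<alpha> i) (i # is)) \<otimes>\<^bsub>YA\<^esub> E0"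
      unfolding pw[OF i(1)] Cons.IH[OF i(2)] using i(1) ly lE by (subst corner_mult) simp_all
    finally show ?case .
  qed
  have "set [1..<n+1] \<subseteq> {1..n}" by auto
  from l[OF this] show ?thesis unfolding monom_prod_def .
qed

text \<open>Translates the corner by coset representatives on both sides, from the standard
  character to row \<open>\<chi>\<close> and column \<open>\<chi>'\<close>. Being defined on all of
  the Hecke algebra it is visibly linear, and its values on monomials come out as those prescribed
  for \<open>Psi\<close>.\<close>

definition G :: "('k yh \<Rightarrow> 'k) \<Rightarrow> ('k yh \<Rightarrow> 'k) \<Rightarrow> 'k hecke_tensor \<Rightarrow> 'k yh" where
  "G \<chi> \<chi>' y = Y.Ec (colour \<chi>) \<otimes>\<^bsub>YA\<^esub> (Y.fw (pinv (R.s \<chi>)) \<otimes>\<^bsub>YA\<^esub> (psi y \<otimes>\<^bsub>YA\<^esub> Y.fw (R.s \<chi>')))"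

lemma p_permutes: "\<chi> \<in> L \<Longrightarrow> pinv (R.s \<chi>) permutes {1..n}"
  using pinv_simps(3)[OF R.s_permutes] .

lemma G_closed: "\<chi> \<in> L \<Longrightarrow> \<chi>' \<in> L \<Longrightarrow> y \<in> carrier HA \<Longrightarrow> G \<chi> \<chi>' y \<in> carrier YA"
  unfolding G_def using psi_closed p_permutes R.s_permutes by simp

lemma G_add: "\<chi> \<in> L \<Longrightarrow> \<chi>' \<in> L \<Longrightarrow> y \<in> carrier HA \<Longrightarrow> z \<in> carrier HA \<Longrightarrow>
    G \<chi> \<chi>' (y \<oplus>\<^bsub>HA\<^esub> z) = G \<chi> \<chi>' y \<oplus>\<^bsub>YA\<^esub> G \<chi> \<chi>' z"
  unfolding G_def using alg_homD(2)[OF psi_props(1), of y z] psi_closed p_permutes R.s_permutes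
  by (simp add: Y.l_distr Y.r_distr)

lemma G_smult: "\<chi> \<in> L \<Longrightarrow> \<chi>' \<in> L \<Longrightarrow> y \<in> carrier HA \<Longrightarrow>
    G \<chi> \<chi>' (c \<odot>\<^bsub>HA\<^esub> y) = c \<odot>\<^bsub>YA\<^esub> G \<chi> \<chi>' y"
  unfolding G_def using alg_homD(3)[OF psi_props(1), of y c] psi_closed p_permutes R.s_permutes
  by (simp add: Y.smult_mult_l Y.smult_mult_r)

lemma G_zero: "\<chi> \<in> L \<Longrightarrow> \<chi>' \<in> L \<Longrightarrow> G \<chi> \<chi>' \<zero>\<^bsub>HA\<^esub> = \<zero>\<^bsub>YA\<^esub>"
  unfolding G_def using linear_maps_zero[OF R.kalg_A kalg_CA alg_homD(7)[OF psi_props(1)]] p_permutes R.s_permutes by simp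

text \<open>Inverts \<open>std_mono\<close>. It is the hypothesis under which
  \<open>fw_xm_Ec\<close> moves a coset representative past the \<open>x\<close> without correction
  terms.\<close>

lemma pinv_std_mono:
  assumes \<chi>: "\<chi> \<in> L" and ij: "i \<in> {1..n}" "j \<in> {1..n}" "i < j" "c0 i = c0 j"
  shows "pinv (R.s \<chi>) i < pinv (R.s \<chi>) j"
proof (rule ccontr)
  let ?p = "pinv (R.s \<chi>)"
  note si = pinv_simps[OF R.s_permutes[OF \<chi>]]
  assume "\<not> ?p i < ?p j"
  moreover have "?p i \<noteq> ?p j" using ij(3) si(1) by (metis less_irrefl)
  ultimately have lt: "?p j < ?p i" by simp
  have pn: "?p j \<in> {1..n}" "?p i \<in> {1..n}" using si(6) ij by blast+
  have "colour \<chi> (?p j) = colour \<chi> (?p i)"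
    using c0_std[OF R.col_mem[OF \<chi>] pn(1)] c0_std[OF R.col_mem[OF \<chi>] pn(2)] si(1) ij(4) by simp
  then have "R.s \<chi> (?p j) < R.s \<chi> (?p i)" using std_mono[OF R.col_mem[OF \<chi>] pn lt] by blast
  then show False using ij(3) si(1) by simp
qed

text \<open>The representative is increasing on every block, so it passes the monomial by permuting
  exponents only, and it turns \<open>E0\<close> into the idempotent of \<open>\<chi>\<close>. The
  three remaining \<open>f\<close> factors multiply to a single one.\<close>

lemma G_monom:
  assumes \<chi>: "\<chi> \<in> L" "\<chi>' \<in> L" and w: "w \<in> young r n \<mu>"
  shows "G \<chi> \<chi>' (comp_monom r n \<mu> \<alpha> \<otimes>\<^bsub>HA\<^esub> comp_perm r \<mu> w) =
     Y.B (colour \<chi>) (place_perm (pinv (R.s \<chi>)) \<alpha>) (pinv (R.s \<chi>) \<circ> w \<circ> R.s \<chi>')"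
proof -
  let ?p = "pinv (R.s \<chi>)" and ?E = "Y.Ec (colour \<chi>)"
  note pp = p_permutes[OF \<chi>(1)] and sp = R.s_permutes[OF \<chi>(2)] and wp = young_permutes[OF w]
  have c: "?E \<in> carrier YA" "Y.fw ?p \<in> carrier YA" "Y.fw w \<in> carrier YA" "Y.fw (R.s \<chi>') \<in> carrier YA" "Y.xm \<alpha> \<in> carrier YA"
    "E0 \<in> carrier YA" "Y.xm (place_perm ?p \<alpha>) \<in> carrier YA"
    using pp sp wp by simp_all
  have cl: "colour \<chi> \<in> colourings r n" by (rule R.col_Col[OF \<chi>(1)])
  have "psi (comp_monom r n \<mu> \<alpha> \<otimes>\<^bsub>HA\<^esub> comp_perm r \<mu> w) = (Y.xm \<alpha> \<otimes>\<^bsub>YA\<^esub> E0) \<otimes>\<^bsub>YA\<^esub> (Y.fw w \<otimes>\<^bsub>YA\<^esub> E0)"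
    using alg_homD(4)[OF psi_props(1), of "monom_prod HA n (comp_x r \<mu>) \<alpha>" "comp_perm r \<mu> w"] w
    by (simp add: comp_monom_eq psi_monom psi_props(3))
  also have "\<dots> = Y.xm \<alpha> \<otimes>\<^bsub>YA\<^esub> Y.fw w \<otimes>\<^bsub>YA\<^esub> E0" using c fw_young[OF w] by (intro corner_mult)
  also have "\<dots> = E0 \<otimes>\<^bsub>YA\<^esub> Y.xm \<alpha> \<otimes>\<^bsub>YA\<^esub> Y.fw w"
  proof -
    have "Y.xm \<alpha> \<otimes>\<^bsub>YA\<^esub> Y.fw w \<otimes>\<^bsub>YA\<^esub> E0 = Y.xm \<alpha> \<otimes>\<^bsub>YA\<^esub> (E0 \<otimes>\<^bsub>YA\<^esub> Y.fw w)"
      using c fw_young[OF w] by (simp add: Y.m_assoc)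
    then show ?thesis using c Y.xm_Ec[OF c0_Col, of \<alpha>] by (simp add: Y.m_assoc[symmetric])
  qed
  finally have ps: "psi (comp_monom r n \<mu> \<alpha> \<otimes>\<^bsub>HA\<^esub> comp_perm r \<mu> w) = E0 \<otimes>\<^bsub>YA\<^esub> Y.xm \<alpha> \<otimes>\<^bsub>YA\<^esub> Y.fw w" .
  have fx: "Y.fw ?p \<otimes>\<^bsub>YA\<^esub> E0 \<otimes>\<^bsub>YA\<^esub> Y.xm \<alpha> = Y.xm (place_perm ?p \<alpha>) \<otimes>\<^bsub>YA\<^esub> (Y.fw ?p \<otimes>\<^bsub>YA\<^esub> E0)"
    using pinv_std_mono[OF \<chi>(1)] by (intro Y.fw_xm_Ec[OF pp c0_Col])
  have fE: "Y.fw ?p \<otimes>\<^bsub>YA\<^esub> E0 = ?E \<otimes>\<^bsub>YA\<^esub> Y.fw ?p"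
    using Y.fw_Ec[OF pp c0_Col] c0_s[OF \<chi>(1)] pinv_simps(4)[OF R.s_permutes[OF \<chi>(1)]] by simp
  have EE: "?E \<otimes>\<^bsub>YA\<^esub> ?E = ?E" using Y.Ec_Ec[OF cl cl] by simp
  have "Y.fw ?p \<otimes>\<^bsub>YA\<^esub> (E0 \<otimes>\<^bsub>YA\<^esub> Y.xm \<alpha> \<otimes>\<^bsub>YA\<^esub> Y.fw w \<otimes>\<^bsub>YA\<^esub> Y.fw (R.s \<chi>')) =
      Y.fw ?p \<otimes>\<^bsub>YA\<^esub> E0 \<otimes>\<^bsub>YA\<^esub> Y.xm \<alpha> \<otimes>\<^bsub>YA\<^esub> (Y.fw w \<otimes>\<^bsub>YA\<^esub> Y.fw (R.s \<chi>'))"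
    using c by (simp add: Y.m_assoc)
  also have "\<dots> = Y.xm (place_perm ?p \<alpha>) \<otimes>\<^bsub>YA\<^esub> ?E \<otimes>\<^bsub>YA\<^esub> (Y.fw ?p \<otimes>\<^bsub>YA\<^esub> (Y.fw w \<otimes>\<^bsub>YA\<^esub> Y.fw (R.s \<chi>')))"
    unfolding fx unfolding fE using c by (simp add: Y.m_assoc)
  also have "Y.fw ?p \<otimes>\<^bsub>YA\<^esub> (Y.fw w \<otimes>\<^bsub>YA\<^esub> Y.fw (R.s \<chi>')) = Y.fw (?p \<circ> w \<circ> R.s \<chi>')"
    unfolding comp_assoc Y.F.perm_elem_mult[OF pp permutes_compose[OF sp wp]] Y.F.perm_elem_mult[OF wp sp] ..
  also have "Y.xm (place_perm ?p \<alpha>) \<otimes>\<^bsub>YA\<^esub> ?E = ?E \<otimes>\<^bsub>YA\<^esub> Y.xm (place_perm ?p \<alpha>)"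
    using Y.xm_Ec[OF cl] by simp
  finally have "Y.fw ?p \<otimes>\<^bsub>YA\<^esub> (E0 \<otimes>\<^bsub>YA\<^esub> Y.xm \<alpha> \<otimes>\<^bsub>YA\<^esub> Y.fw w \<otimes>\<^bsub>YA\<^esub> Y.fw (R.s \<chi>')) =
      Y.B (colour \<chi>) (place_perm ?p \<alpha>) (?p \<circ> w \<circ> R.s \<chi>')" unfolding Y.B_def .
  moreover have "?p \<circ> w \<circ> R.s \<chi>' permutes {1..n}" using pp wp sp by (intro permutes_compose)
  then have "?E \<otimes>\<^bsub>YA\<^esub> Y.B (colour \<chi>) (place_perm ?p \<alpha>) (?p \<circ> w \<circ> R.s \<chi>') = Y.B (colour \<chi>) (place_perm ?p \<alpha>) (?p \<circ> w \<circ> R.s \<chi>')"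
    unfolding Y.B_def using c EE by (simp add: Y.m_assoc[symmetric])
  ultimately show ?thesis unfolding G_def ps by simp
qed

definition PsiM :: "'k hecke_mat \<Rightarrow> 'k yh" where
  "PsiM = (\<lambda>N\<in>carrier MM. \<Oplus>\<^bsub>YA\<^esub>q\<in>L \<times> L. G (fst q) (snd q) (N q))"

lemma MM_entry: "N \<in> carrier MM \<Longrightarrow> q \<in> L \<times> L \<Longrightarrow> N q \<in> carrier HA"
  by (auto simp: MM_eq mat_alg_simps)

lemma G_term: "N \<in> carrier MM \<Longrightarrow> q \<in> L \<times> L \<Longrightarrow> G (fst q) (snd q) (N q) \<in> carrier YA"
  using MM_entry by (intro G_closed) auto

lemma E_G: "\<chi> \<in> L \<Longrightarrow> \<chi>' \<in> L \<Longrightarrow> y \<in> carrier HA \<Longrightarrow> E \<otimes>\<^bsub>YA\<^esub> G \<chi> \<chi>' y = G \<chi> \<chi>' y"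
proof -
  assume a: "\<chi> \<in> L" "\<chi>' \<in> L" "y \<in> carrier HA"
  have "E \<otimes>\<^bsub>YA\<^esub> Y.Ec (colour \<chi>) = Y.Ec (colour \<chi>)"
    unfolding E_eq using Y.EC_Ec[OF C_sub R.col_Col[OF a(1)]] R.col_mem[OF a(1)] by simp
  then show ?thesis unfolding G_def using a psi_closed p_permutes R.s_permutes by (simp add: Y.m_assoc[symmetric])
qed

lemma PsiM_linear: "PsiM \<in> linear_maps MM YM"
  unfolding linear_maps_def
proof (intro CollectI conjI ballI allI)
  interpret MM: kalg MM unfolding MM_eq by (rule R.kalg_M)
  have fin: "finite (L \<times> L)" using finite_L by simp
  show "PsiM \<in> carrier MM \<rightarrow>\<^sub>E carrier YM"
  proof (rule PiE_I)
    fix N assume N: "N \<in> carrier MM"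
    have "E \<otimes>\<^bsub>YA\<^esub> PsiM N = (\<Oplus>\<^bsub>YA\<^esub>q\<in>L \<times> L. E \<otimes>\<^bsub>YA\<^esub> G (fst q) (snd q) (N q))"
      using N unfolding PsiM_def restrict_apply'[OF N] by (intro Y.finsum_rdistr fin E_closed) (use G_term[OF N] in blast)
    also have "\<dots> = PsiM N"
      using N G_term[OF N] MM_entry[OF N] E_G by (simp add: PsiM_def) (rule Y.finsum_cong'; auto)
    finally show "PsiM N \<in> carrier YM"
      using N G_term[OF N] by (auto simp: YM_iff PsiM_def intro!: Y.finsum_closed)
  qed (simp add: PsiM_def)
  fix N assume N: "N \<in> carrier MM"
  {
    fix N' assume N': "N' \<in> carrier MM"
    have "PsiM (N \<oplus>\<^bsub>MM\<^esub> N') = (\<Oplus>\<^bsub>YA\<^esub>q\<in>L \<times> L. G (fst q) (snd q) (N q) \<oplus>\<^bsub>YA\<^esub> G (fst q) (snd q) (N' q))"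
      using MM.a_closed[OF N N'] unfolding PsiM_def
      by (simp, intro Y.finsum_cong') (use N N' MM_entry G_term in \<open>auto simp: MM_eq mat_alg_simps G_add\<close>)
    also have "\<dots> = PsiM N \<oplus>\<^bsub>YA\<^esub> PsiM N'"
      using N N' G_term by (subst Y.finsum_addf) (auto simp: PsiM_def)
    finally show "PsiM (N \<oplus>\<^bsub>MM\<^esub> N') = PsiM N \<oplus>\<^bsub>YM\<^esub> PsiM N'" by simp
  next
    fix c
    have "PsiM (c \<odot>\<^bsub>MM\<^esub> N) = (\<Oplus>\<^bsub>YA\<^esub>q\<in>L \<times> L. c \<odot>\<^bsub>YA\<^esub> G (fst q) (snd q) (N q))"
      using MM.smult_closed[OF N, of c] unfolding PsiM_def
      by (simp, intro Y.finsum_cong') (use N MM_entry G_term in \<open>auto simp: MM_eq mat_alg_simps G_smult\<close>)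
    also have "\<dots> = c \<odot>\<^bsub>YA\<^esub> PsiM N"
      using N G_term by (subst Y.finsum_smult[symmetric]) (auto simp: PsiM_def)
    finally show "PsiM (c \<odot>\<^bsub>MM\<^esub> N) = c \<odot>\<^bsub>YM\<^esub> PsiM N" by simp
  }
qed

lemma PsiM_unit:
  assumes \<chi>: "\<chi> \<in> L" "\<chi>' \<in> L" and y: "y \<in> carrier HA"
  shows "PsiM (mat_unit L HA \<chi> \<chi>' y) = G \<chi> \<chi>' y"
proof -
  have c: "mat_unit L HA \<chi> \<chi>' y \<in> carrier MM" unfolding MM_eq by (rule R.mat_unit_closed[OF y])
  have "PsiM (mat_unit L HA \<chi> \<chi>' y) = (\<Oplus>\<^bsub>YA\<^esub>q\<in>L \<times> L. if q = (\<chi>, \<chi>') then G \<chi> \<chi>' y else \<zero>\<^bsub>YA\<^esub>)"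
    unfolding PsiM_def restrict_apply if_P[OF c]
    by (rule Y.finsum_cong') (use \<chi> G_closed[OF \<chi> y] G_zero in \<open>auto simp: mat_unit_def\<close>)
  also have "\<dots> = G \<chi> \<chi>' y" using \<chi> G_closed[OF \<chi> y] finite_L by (intro Y.finsum_single) auto
  finally show ?thesis .
qed

lemma monom_perm_closed: "w \<in> young r n \<mu> \<Longrightarrow> comp_monom r n \<mu> \<alpha> \<otimes>\<^bsub>HA\<^esub> comp_perm r \<mu> w \<in> carrier HA"
  by (simp add: comp_monom_eq)

lemma PsiM_monom:
  assumes \<chi>: "\<chi> \<in> L" "\<chi>' \<in> L" and w: "w \<in> young r n \<mu>"
  shows "PsiM (mat_unit L HA \<chi> \<chi>' (comp_monom r n \<mu> \<alpha> \<otimes>\<^bsub>HA\<^esub> comp_perm r \<mu> w)) =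
     Y.B (colour \<chi>) (place_perm (pinv (R.s \<chi>)) \<alpha>) (pinv (R.s \<chi>) \<circ> w \<circ> R.s \<chi>')"
  unfolding PsiM_unit[OF \<chi> monom_perm_closed[OF w]] by (rule G_monom[OF \<chi> w])

lemma PsiM_is_Psi: "is_Psi r n \<zeta> \<mu> PsiM"
  unfolding is_Psi_def Let_def
proof (intro conjI allI impI PsiM_linear)
  fix \<chi> \<chi>' \<alpha> w assume \<chi>: "\<chi> \<in> L" "\<chi>' \<in> L" and w: "w \<in> young r n \<mu>"
  show "PsiM (mat_unit L HA \<chi> \<chi>' (comp_monom r n \<mu> \<alpha> \<otimes>\<^bsub>HA\<^esub> comp_perm r \<mu> w)) =
     E_chi r n \<chi> \<otimes>\<^bsub>YA\<^esub> yh_monom r n (place_perm (pi_chi r n \<zeta> \<chi>) \<alpha>) \<otimes>\<^bsub>YA\<^esub> yh_perm r n (pi_chi r n \<zeta> \<chi> \<circ> w \<circ> pinv (pi_chi r n \<zeta> \<chi>'))"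
    unfolding PsiM_monom[OF \<chi> w] E_chi_B[OF \<chi>(1)] pi_chi_eq[OF \<chi>(1)] pi_chi_eq[OF \<chi>(2)]
      pinv_simps(4)[OF R.s_permutes[OF \<chi>(2)]] ..
qed

definition MU :: "'k hecke_mat set" where
  "MU = {mat_unit L HA \<chi> \<chi>' (comp_monom r n \<mu> \<alpha> \<otimes>\<^bsub>HA\<^esub> comp_perm r \<mu> w) | \<chi> \<chi>' \<alpha> w.
     \<chi> \<in> L \<and> \<chi>' \<in> L \<and> w \<in> young r n \<mu>}"

lemma MU_closed: "MU \<subseteq> carrier MM"
  unfolding MU_def MM_eq using monom_perm_closed by (auto intro!: R.mat_unit_closed)

lemma kalg_MM: "kalg MM"
  unfolding MM_eq by (rule R.kalg_M)

lemma MM_span: "N \<in> carrier MM \<Longrightarrow> N \<in> lspan MM MU"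
proof -
  assume N: "N \<in> carrier MM"
  have "N = (\<Oplus>\<^bsub>MM\<^esub>q\<in>L \<times> L. mat_unit L HA (fst q) (snd q) (N q))"
    using R.mat_decomp N unfolding MM_eq .
  also have "\<dots> \<in> lspan MM MU"
  proof (rule lspan_finsum[OF kalg_MM MU_closed])
    fix q assume q: "q \<in> L \<times> L"
    have "N q \<in> lspan HA R.Ms" using MM_entry[OF N q] unfolding R.span[OF Hc_generated] .
    then show "mat_unit L HA (fst q) (snd q) (N q) \<in> lspan MM MU"
      unfolding MM_eq
    proof (rule R.mat_unit_in_lspan)
      fix g assume "g \<in> R.Ms"
      then obtain \<alpha> w where g: "g = comp_monom r n \<mu> \<alpha> \<otimes>\<^bsub>HA\<^esub> comp_perm r \<mu> w" "w \<in> young r n \<mu>"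
        unfolding R.Ms_def comp_monom_eq by blast
      have "fst q \<in> L" "snd q \<in> L" using q by auto
      then show "mat_unit L HA (fst q) (snd q) g \<in> MU" unfolding MU_def g(1) using g(2) by blast
    qed
  qed
  finally show ?thesis .
qed

lemma is_Psi_unique:
  assumes "is_Psi r n \<zeta> \<mu> h" "is_Psi r n \<zeta> \<mu> k" shows "h = k"
proof
  fix N
  have l: "h \<in> linear_maps MM YM" "k \<in> linear_maps MM YM" using assms by (simp_all add: is_Psi_def)
  show "h N = k N"
  proof (cases "N \<in> carrier MM")
    case True
    have "h z = k z" if "z \<in> MU" for z
      using that assms unfolding MU_def is_Psi_def Let_def by auto
    then show ?thesis by (rule lspan_linear_eq[OF kalg_MM kalg_YM MU_closed l _ MM_span[OF True]])
  qed (use linear_mapsD(4)[OF l(1)] linear_mapsD(4)[OF l(2)] in simp)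
qed

lemma Psi_eq: "Psi r n \<zeta> \<mu> = PsiM"
  unfolding Psi_def using PsiM_is_Psi is_Psi_unique by (blast intro: the_equality)

section \<open>The two composites\<close>

lemma linear_comp_id:
  assumes "kalg A" "kalg B" "h \<in> linear_maps A B" "g \<in> linear_maps B A" "S \<subseteq> carrier A"
    "\<And>y. y \<in> S \<Longrightarrow> g (h y) = y" "y \<in> lspan A S"
  shows "g (h y) = y"
  using assms(7)
proof induction
  case zero
  show ?case using linear_maps_zero[OF assms(1,2,3)] linear_maps_zero[OF assms(2,1,4)] by simp
next
  case (add y z)
  then show ?case using lspan_carrier[OF assms(1,5)] linear_mapsD[OF assms(3)] linear_mapsD[OF assms(4)] by simp
next
  case (smult y c)
  then show ?case using lspan_carrier[OF assms(1,5)] linear_mapsD[OF assms(3)] linear_mapsD[OF assms(4)] by simp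
qed (rule assms(6))

text \<open>On a monomial the coset representatives introduced by \<open>PhiM\<close> cancel against
  those of \<open>PsiM\<close>, in the permutation as well as in the exponents.\<close>

lemma PsiM_PhiM: "y \<in> carrier YM \<Longrightarrow> PsiM (PhiM y) = y"
proof (rule linear_comp_id[OF kalg_YM kalg_MM alg_homD(7)[OF PhiM_hom] PsiM_linear Bs_YM _ YM_span])
  fix z assume "z \<in> Y.Bs C"
  then obtain c \<alpha> w where z: "z = Y.B c \<alpha> w" "c \<in> C" and w: "w permutes {1..n}" by (auto simp: Y.Bs_def)
  then obtain \<chi> where \<chi>: "\<chi> \<in> L" "c = colour \<chi>" using colour_L by blast
  let ?\<chi>' = "perm_char r n (pinv w) \<chi>"
  have \<chi>': "?\<chi>' \<in> L" by (rule R.act_mem[OF pinv_simps(3)[OF w] \<chi>(1)])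
  note s = pinv_simps[OF R.s_permutes[OF \<chi>(1)]] and s' = pinv_simps[OF R.s_permutes[OF \<chi>']]
  have "pinv (R.s \<chi>) \<circ> R.wt w \<chi> \<circ> R.s ?\<chi>' = (pinv (R.s \<chi>) \<circ> R.s \<chi>) \<circ> w \<circ> (pinv (R.s ?\<chi>') \<circ> R.s ?\<chi>')"
    by (simp only: R.wt_def comp_assoc)
  also have "\<dots> = w" unfolding s(8) s'(8) by simp
  finally have e: "pinv (R.s \<chi>) \<circ> R.wt w \<chi> \<circ> R.s ?\<chi>' = w" .
  show "PsiM (PhiM z) = z"
    unfolding z(1) \<chi>(2) PhiM_B[OF \<chi>(1) w] PsiM_monom[OF \<chi>(1) \<chi>' R.wt_young[OF w \<chi>(1)]] e
      place_perm_pinv[OF R.s_permutes[OF \<chi>(1)]] ..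
qed

text \<open>The delicate point is the column. A Young element fixes \<open>c0\<close>, so composing
  the colouring of \<open>\<chi>\<close> with \<open>?v\<close> gives that of
  \<open>\<chi>'\<close>, and the matrix unit lands in column \<open>\<chi>'\<close>; after this the
  representatives cancel.\<close>

lemma PhiM_PsiM: "N \<in> carrier MM \<Longrightarrow> PhiM (PsiM N) = N"
proof (rule linear_comp_id[OF kalg_MM kalg_YM PsiM_linear alg_homD(7)[OF PhiM_hom] MU_closed _ MM_span])
  fix z assume "z \<in> MU"
  then obtain \<chi> \<chi>' \<alpha> w where z: "z = mat_unit L HA \<chi> \<chi>' (comp_monom r n \<mu> \<alpha> \<otimes>\<^bsub>HA\<^esub> comp_perm r \<mu> w)"
    and \<chi>: "\<chi> \<in> L" "\<chi>' \<in> L" and w: "w \<in> young r n \<mu>" unfolding MU_def by blast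
  note wp = young_permutes[OF w] and sp = R.s_permutes[OF \<chi>(1)] and sp' = R.s_permutes[OF \<chi>(2)]
  note s = pinv_simps[OF sp] and s' = pinv_simps[OF sp']
  let ?v = "pinv (R.s \<chi>) \<circ> w \<circ> R.s \<chi>'"
  have v: "?v permutes {1..n}" using s(3) wp sp' by (intro permutes_compose)
  have cw: "c0 \<circ> w = c0"
  proof (rule colourings_ext[OF _ c0_Col])
    show "c0 \<circ> w \<in> colourings r n"
      using colourings_perm[OF pinv_simps(3)[OF wp] c0_Col] pinv_simps(4)[OF wp] by simp
    show "(c0 \<circ> w) j = c0 j" if "j \<in> {1..n}" for j using w that by (simp add: young_iff)
  qed
  have "(c0 \<circ> R.s \<chi>) \<circ> ?v = c0 \<circ> (R.s \<chi> \<circ> pinv (R.s \<chi>)) \<circ> w \<circ> R.s \<chi>'"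
    by (simp only: comp_assoc)
  also have "\<dots> = colour \<chi>'" unfolding s(7) comp_id cw by (rule c0_s[OF \<chi>(2)])
  finally have cv: "colour \<chi> \<circ> ?v = colour \<chi>'" unfolding c0_s[OF \<chi>(1)] .
  have av: "perm_char r n (pinv ?v) \<chi> = \<chi>'"
  proof -
    have "colour (perm_char r n (pinv ?v) \<chi>) = colour \<chi>'"
      using R.col_act[OF pinv_simps(3)[OF v] \<chi>(1)] pinv_simps(4)[OF v] cv by simp
    then show ?thesis using colour_inj_L R.act_mem[OF pinv_simps(3)[OF v] \<chi>(1)] \<chi>(2) by (simp add: inj_on_eq_iff)
  qed
  have "R.wt ?v \<chi> = (R.s \<chi> \<circ> pinv (R.s \<chi>)) \<circ> w \<circ> (R.s \<chi>' \<circ> pinv (R.s \<chi>'))"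
    unfolding R.wt_def av by (simp only: comp_assoc)
  also have "\<dots> = w" unfolding s(7) s'(7) by simp
  finally have e: "R.wt ?v \<chi> = w" .
  have pl: "place_perm (R.s \<chi>) (place_perm (pinv (R.s \<chi>)) \<alpha>) = \<alpha>"
    using place_perm_pinv[OF s(3), of \<alpha>] s(4) by simp
  show "PhiM (PsiM z) = z"
    unfolding z PsiM_monom[OF \<chi> w] PhiM_B[OF \<chi>(1) v] av e pl ..
qed

lemma PhiM_iso: "PhiM \<in> alg_iso YM MM"
proof -
  have "bij_betw PhiM (carrier YM) (carrier MM)"
    by (rule bij_betw_byWitness[where f' = PsiM])
       (use PsiM_PhiM PhiM_PsiM alg_homD(1)[OF PhiM_hom] linear_mapsD(1)[OF PsiM_linear] in auto)
  then show ?thesis using PhiM_hom by (simp add: alg_iso_def alg_hom_def ring_iso_def)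
qed

theorem component_iso:
  "(\<exists>!h. is_Phi r n \<zeta> \<mu> h) \<and> (\<exists>!g. is_Psi r n \<zeta> \<mu> g) \<and>
   Phi r n \<zeta> \<mu> \<in> alg_iso YM MM \<and> inverse_maps YM MM (Phi r n \<zeta> \<mu>) (Psi r n \<zeta> \<mu>)"
  unfolding Phi_eq Psi_eq inverse_maps_def
  using PhiM_is_Phi is_Phi_unique PsiM_is_Psi is_Psi_unique PhiM_iso PsiM_PhiM PhiM_PsiM by blast

end

section \<open>The direct sum over all compositions\<close>

context yh_setup
begin

lemma yh_comp: "\<mu> \<in> compositions r n \<Longrightarrow> yh_comp r \<zeta> n \<mu>"
  by (intro yh_comp.intro composition.intro yh_setup_axioms)

abbreviation "Cs \<equiv> compositions r n"
abbreviation "Em \<equiv> (E_mu r n \<zeta> :: _ \<Rightarrow> 'k yh)"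
abbreviation "MT \<equiv> (mat_total r n \<zeta> :: ('k, (nat \<Rightarrow> nat) \<Rightarrow> 'k hecke_mat) module)"

lemma Em_orth:
  assumes "\<mu> \<in> Cs" "\<nu> \<in> Cs" "\<mu> \<noteq> \<nu>" shows "Em \<mu> \<otimes>\<^bsub>YA\<^esub> Em \<nu> = \<zero>\<^bsub>YA\<^esub>"
proof -
  have "colourings_of r n \<mu> \<inter> colourings_of r n \<nu> = {}"
    using assms by (auto simp: colourings_of_iff)
  then show ?thesis
    unfolding yh_comp.E_eq[OF yh_comp[OF assms(1)]] yh_comp.E_eq[OF yh_comp[OF assms(2)]]
    using Y.EC_EC[of "colourings_of r n \<mu>" "colourings_of r n \<nu>"]
    by (simp add: colourings_of_def Y.EC_def)
qed

lemma Em_closed: "\<mu> \<in> Cs \<Longrightarrow> Em \<mu> \<in> carrier YA"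
  by (rule yh_comp.E_closed[OF yh_comp])

text \<open>Every colouring belongs to exactly one composition, so on each \<open>Ec c\<close> one
  of the central idempotents acts as the identity and the others by zero.\<close>

lemma Em_sum: "(\<Oplus>\<^bsub>YA\<^esub>\<mu>\<in>Cs. Em \<mu>) = \<one>\<^bsub>YA\<^esub>"
proof (rule Y.eq_by_Ec)
  show "(\<Oplus>\<^bsub>YA\<^esub>\<mu>\<in>Cs. Em \<mu>) \<in> carrier YA" using Em_closed by (intro Y.finsum_closed) auto
  fix c assume c: "c \<in> colourings r n"
  let ?\<mu> = "colour_count r n c"
  have "(\<Oplus>\<^bsub>YA\<^esub>\<mu>\<in>Cs. Em \<mu>) \<otimes>\<^bsub>YA\<^esub> Y.Ec c = (\<Oplus>\<^bsub>YA\<^esub>\<mu>\<in>Cs. Em \<mu> \<otimes>\<^bsub>YA\<^esub> Y.Ec c)"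
    using Em_closed by (intro Y.finsum_ldistr finite_compositions) auto
  also have "\<dots> = (\<Oplus>\<^bsub>YA\<^esub>\<mu>\<in>Cs. if \<mu> = ?\<mu> then Y.Ec c else \<zero>\<^bsub>YA\<^esub>)"
  proof (rule Y.finsum_cong')
    fix \<mu> assume \<mu>: "\<mu> \<in> Cs"
    interpret Q: yh_comp r \<zeta> n \<mu> by (rule yh_comp[OF \<mu>])
    show "Em \<mu> \<otimes>\<^bsub>YA\<^esub> Y.Ec c = (if \<mu> = ?\<mu> then Y.Ec c else \<zero>\<^bsub>YA\<^esub>)"
      unfolding Q.E_eq Y.EC_Ec[OF Q.C_sub c] using c colourings_of_iff[OF \<mu>, of c] by auto
  qed auto
  also have "\<dots> = Y.Ec c" using colour_count_comp[OF c] by (intro Y.finsum_single finite_compositions) auto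
  finally show "(\<Oplus>\<^bsub>YA\<^esub>\<mu>\<in>Cs. Em \<mu>) \<otimes>\<^bsub>YA\<^esub> Y.Ec c = \<one>\<^bsub>YA\<^esub> \<otimes>\<^bsub>YA\<^esub> Y.Ec c" by simp
qed simp

lemma MT_simps:
  "carrier MT = (\<Pi>\<^sub>E \<mu>\<in>Cs. carrier (mat_mu r n \<zeta> \<mu>))"
  "u \<otimes>\<^bsub>MT\<^esub> v = (\<lambda>\<mu>\<in>Cs. u \<mu> \<otimes>\<^bsub>mat_mu r n \<zeta> \<mu>\<^esub> v \<mu>)"
  "\<one>\<^bsub>MT\<^esub> = (\<lambda>\<mu>\<in>Cs. \<one>\<^bsub>mat_mu r n \<zeta> \<mu>\<^esub>)"
  "u \<oplus>\<^bsub>MT\<^esub> v = (\<lambda>\<mu>\<in>Cs. u \<mu> \<oplus>\<^bsub>mat_mu r n \<zeta> \<mu>\<^esub> v \<mu>)"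
  "c \<odot>\<^bsub>MT\<^esub> u = (\<lambda>\<mu>\<in>Cs. c \<odot>\<^bsub>mat_mu r n \<zeta> \<mu>\<^esub> u \<mu>)"
  by (simp_all add: mat_total_def direct_sum_alg_def)

definition \<rho> :: "(nat \<Rightarrow> nat) \<Rightarrow> 'k yh \<Rightarrow> 'k hecke_mat" where
  "\<rho> \<mu> y = Phi r n \<zeta> \<mu> (Em \<mu> \<otimes>\<^bsub>YA\<^esub> y)"

lemma \<rho>_hom:
  assumes \<mu>: "\<mu> \<in> Cs" shows "restrict (\<rho> \<mu>) (carrier YA) \<in> alg_hom YA (mat_mu r n \<zeta> \<mu>)"
proof -
  interpret Q: yh_comp r \<zeta> n \<mu> by (rule yh_comp[OF \<mu>])
  have "restrict (\<rho> \<mu>) (carrier YA) = Q.R.rep"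
  proof
    fix y
    show "restrict (\<rho> \<mu>) (carrier YA) y = Q.R.rep y"
      using Q.PhiM_E[of y] Q.R.rep_hom(6)[of y] by (simp add: \<rho>_def Q.Phi_eq)
  qed
  then show ?thesis using Q.R.rep_props(1) Q.MM_eq by simp
qed

lemma \<rho>_simps:
  assumes "\<mu> \<in> Cs"
  shows "y \<in> carrier YA \<Longrightarrow> \<rho> \<mu> y \<in> carrier (mat_mu r n \<zeta> \<mu>)"
    and "y \<in> carrier YA \<Longrightarrow> z \<in> carrier YA \<Longrightarrow> \<rho> \<mu> (y \<oplus>\<^bsub>YA\<^esub> z) = \<rho> \<mu> y \<oplus>\<^bsub>mat_mu r n \<zeta> \<mu>\<^esub> \<rho> \<mu> z"
    and "y \<in> carrier YA \<Longrightarrow> z \<in> carrier YA \<Longrightarrow> \<rho> \<mu> (y \<otimes>\<^bsub>YA\<^esub> z) = \<rho> \<mu> y \<otimes>\<^bsub>mat_mu r n \<zeta> \<mu>\<^esub> \<rho> \<mu> z"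
    and "y \<in> carrier YA \<Longrightarrow> \<rho> \<mu> (c \<odot>\<^bsub>YA\<^esub> y) = c \<odot>\<^bsub>mat_mu r n \<zeta> \<mu>\<^esub> \<rho> \<mu> y"
    and "\<rho> \<mu> \<one>\<^bsub>YA\<^esub> = \<one>\<^bsub>mat_mu r n \<zeta> \<mu>\<^esub>"
  using alg_homD(1)[OF \<rho>_hom[OF assms], of y] alg_homD(3)[OF \<rho>_hom[OF assms], of y c]
    alg_homD(5)[OF \<rho>_hom[OF assms]] alg_homD(2,4)[OF \<rho>_hom[OF assms], of y z] by simp_all

lemma Phi_total_apply: "y \<in> carrier YA \<Longrightarrow> Phi_total r n \<zeta> y = (\<lambda>\<mu>\<in>Cs. \<rho> \<mu> y)"
  by (simp add: Phi_total_def \<rho>_def)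

lemma Phi_total_hom: "Phi_total r n \<zeta> \<in> alg_hom YA MT"
proof (rule alg_homI)
  show "Phi_total r n \<zeta> \<in> carrier YA \<rightarrow>\<^sub>E carrier MT"
  proof (rule PiE_I)
    show "Phi_total r n \<zeta> y \<in> carrier MT" if "y \<in> carrier YA" for y
      unfolding Phi_total_apply[OF that] MT_simps using \<rho>_simps(1) that by auto
  qed (simp add: Phi_total_def)
  fix y z c assume y: "y \<in> carrier YA"
  show "Phi_total r n \<zeta> (c \<odot>\<^bsub>YA\<^esub> y) = c \<odot>\<^bsub>MT\<^esub> Phi_total r n \<zeta> y"
    using y by (auto simp: Phi_total_apply MT_simps \<rho>_simps fun_eq_iff restrict_def)
  assume z: "z \<in> carrier YA"
  show "Phi_total r n \<zeta> (y \<oplus>\<^bsub>YA\<^esub> z) = Phi_total r n \<zeta> y \<oplus>\<^bsub>MT\<^esub> Phi_total r n \<zeta> z"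
    using y z by (auto simp: Phi_total_apply MT_simps \<rho>_simps fun_eq_iff restrict_def)
  show "Phi_total r n \<zeta> (y \<otimes>\<^bsub>YA\<^esub> z) = Phi_total r n \<zeta> y \<otimes>\<^bsub>MT\<^esub> Phi_total r n \<zeta> z"
    using y z by (auto simp: Phi_total_apply MT_simps \<rho>_simps fun_eq_iff restrict_def)
next
  show "Phi_total r n \<zeta> \<one>\<^bsub>YA\<^esub> = \<one>\<^bsub>MT\<^esub>"
    by (auto simp: Phi_total_apply MT_simps \<rho>_simps fun_eq_iff restrict_def)
qed

lemma Psi_YM:
  assumes "\<mu> \<in> Cs" "N \<in> carrier (mat_mu r n \<zeta> \<mu>)"
  shows "Psi r n \<zeta> \<mu> N \<in> carrier (yh_mu r n \<zeta> \<mu>)" "Psi r n \<zeta> \<mu> N \<in> carrier YA"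
    "Em \<mu> \<otimes>\<^bsub>YA\<^esub> Psi r n \<zeta> \<mu> N = Psi r n \<zeta> \<mu> N" "Phi r n \<zeta> \<mu> (Psi r n \<zeta> \<mu> N) = N"
proof -
  interpret Q: yh_comp r \<zeta> n \<mu> by (rule yh_comp[OF assms(1)])
  show m: "Psi r n \<zeta> \<mu> N \<in> carrier (yh_mu r n \<zeta> \<mu>)"
    unfolding Q.Psi_eq using linear_mapsD(1)[OF Q.PsiM_linear assms(2)] .
  then show "Psi r n \<zeta> \<mu> N \<in> carrier YA" "Em \<mu> \<otimes>\<^bsub>YA\<^esub> Psi r n \<zeta> \<mu> N = Psi r n \<zeta> \<mu> N"
    by (simp_all add: Q.YM_iff)
  show "Phi r n \<zeta> \<mu> (Psi r n \<zeta> \<mu> N) = N" unfolding Q.Psi_eq Q.Phi_eq by (rule Q.PhiM_PsiM[OF assms(2)])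
qed

lemma Psi_total_apply: "N \<in> carrier MT \<Longrightarrow> Psi_total r n \<zeta> N = (\<Oplus>\<^bsub>YA\<^esub>\<mu>\<in>Cs. Psi r n \<zeta> \<mu> (N \<mu>))"
  by (simp add: Psi_total_def)

lemma MT_comp: "N \<in> carrier MT \<Longrightarrow> \<mu> \<in> Cs \<Longrightarrow> N \<mu> \<in> carrier (mat_mu r n \<zeta> \<mu>)"
  by (auto simp: MT_simps)

lemma Psi_total_closed: "N \<in> carrier MT \<Longrightarrow> Psi_total r n \<zeta> N \<in> carrier YA"
  unfolding Psi_total_apply using Psi_YM(2) MT_comp by (intro Y.finsum_closed) auto

lemma Psi_Phi_total: "y \<in> carrier YA \<Longrightarrow> Psi_total r n \<zeta> (Phi_total r n \<zeta> y) = y"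
proof -
  assume y: "y \<in> carrier YA"
  have "Psi_total r n \<zeta> (Phi_total r n \<zeta> y) = (\<Oplus>\<^bsub>YA\<^esub>\<mu>\<in>Cs. Psi r n \<zeta> \<mu> (Phi_total r n \<zeta> y \<mu>))"
    by (rule Psi_total_apply[OF alg_homD(1)[OF Phi_total_hom y]])
  also have "\<dots> = (\<Oplus>\<^bsub>YA\<^esub>\<mu>\<in>Cs. Em \<mu> \<otimes>\<^bsub>YA\<^esub> y)"
  proof (rule Y.finsum_cong')
    fix \<mu> assume \<mu>: "\<mu> \<in> Cs"
    interpret Q: yh_comp r \<zeta> n \<mu> by (rule yh_comp[OF \<mu>])
    show "Psi r n \<zeta> \<mu> (Phi_total r n \<zeta> y \<mu>) = Em \<mu> \<otimes>\<^bsub>YA\<^esub> y"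
      using Q.PsiM_PhiM[OF Q.E_mult_YM[OF y]] \<mu> by (simp add: Phi_total_apply[OF y] \<rho>_def Q.Phi_eq Q.Psi_eq)
  qed (use y Em_closed in auto)
  also have "\<dots> = (\<Oplus>\<^bsub>YA\<^esub>\<mu>\<in>Cs. Em \<mu>) \<otimes>\<^bsub>YA\<^esub> y"
    using y Em_closed by (intro Y.finsum_ldistr[symmetric] finite_compositions) auto
  also have "\<dots> = y" using y by (simp add: Em_sum)
  finally show ?thesis .
qed

text \<open>Orthogonality of the central idempotents isolates one summand of
  \<open>Psi_total\<close>, on which the component result applies.\<close>

lemma Phi_Psi_total: "N \<in> carrier MT \<Longrightarrow> Phi_total r n \<zeta> (Psi_total r n \<zeta> N) = N"
proof -
  assume N: "N \<in> carrier MT"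
  have "(\<lambda>\<mu>\<in>Cs. \<rho> \<mu> (Psi_total r n \<zeta> N)) = N"
  proof (rule PiE_ext[of _ Cs "\<lambda>\<mu>. carrier (mat_mu r n \<zeta> \<mu>)"])
    show "(\<lambda>\<mu>\<in>Cs. \<rho> \<mu> (Psi_total r n \<zeta> N)) \<in> (\<Pi>\<^sub>E \<mu>\<in>Cs. carrier (mat_mu r n \<zeta> \<mu>))"
      using \<rho>_simps(1) Psi_total_closed[OF N] by auto
    show "N \<in> (\<Pi>\<^sub>E \<mu>\<in>Cs. carrier (mat_mu r n \<zeta> \<mu>))" using N by (simp add: MT_simps)
    fix \<mu> assume \<mu>: "\<mu> \<in> Cs"
    note P = Psi_YM[OF _ MT_comp[OF N]]
    have "Em \<mu> \<otimes>\<^bsub>YA\<^esub> Psi_total r n \<zeta> N = (\<Oplus>\<^bsub>YA\<^esub>\<nu>\<in>Cs. Em \<mu> \<otimes>\<^bsub>YA\<^esub> Psi r n \<zeta> \<nu> (N \<nu>))"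
      unfolding Psi_total_apply[OF N] using P(2) Em_closed[OF \<mu>] by (intro Y.finsum_rdistr finite_compositions) auto
    also have "\<dots> = (\<Oplus>\<^bsub>YA\<^esub>\<nu>\<in>Cs. if \<nu> = \<mu> then Psi r n \<zeta> \<mu> (N \<mu>) else \<zero>\<^bsub>YA\<^esub>)"
    proof (rule Y.finsum_cong')
      fix \<nu> assume \<nu>: "\<nu> \<in> Cs"
      show "Em \<mu> \<otimes>\<^bsub>YA\<^esub> Psi r n \<zeta> \<nu> (N \<nu>) = (if \<nu> = \<mu> then Psi r n \<zeta> \<mu> (N \<mu>) else \<zero>\<^bsub>YA\<^esub>)"
      proof (cases "\<nu> = \<mu>")
        case False
        have "Em \<mu> \<otimes>\<^bsub>YA\<^esub> Psi r n \<zeta> \<nu> (N \<nu>) = Em \<mu> \<otimes>\<^bsub>YA\<^esub> (Em \<nu> \<otimes>\<^bsub>YA\<^esub> Psi r n \<zeta> \<nu> (N \<nu>))" using P(3)[OF \<nu> \<nu>] by simp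
        also have "\<dots> = (Em \<mu> \<otimes>\<^bsub>YA\<^esub> Em \<nu>) \<otimes>\<^bsub>YA\<^esub> Psi r n \<zeta> \<nu> (N \<nu>)"
          using Em_closed[OF \<mu>] Em_closed[OF \<nu>] P(2)[OF \<nu> \<nu>] by (simp add: Y.m_assoc)
        also have "\<dots> = \<zero>\<^bsub>YA\<^esub>" using Em_orth[OF \<mu> \<nu>] False P(2)[OF \<nu> \<nu>] by simp
        finally show ?thesis using False by simp
      qed (use P(3)[OF \<mu> \<mu>] in simp)
    qed (use P(2)[OF \<mu> \<mu>] in auto)
    also have "\<dots> = Psi r n \<zeta> \<mu> (N \<mu>)" using \<mu> P(2)[OF \<mu> \<mu>] by (intro Y.finsum_single finite_compositions)
    finally show "(\<lambda>\<mu>\<in>Cs. \<rho> \<mu> (Psi_total r n \<zeta> N)) \<mu> = N \<mu>" using \<mu> P(4)[OF \<mu> \<mu>] by (simp add: \<rho>_def)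
  qed
  then show ?thesis by (simp add: Phi_total_apply[OF Psi_total_closed[OF N]])
qed

theorem total_iso:
  "Phi_total r n \<zeta> \<in> alg_iso YA MT \<and> inverse_maps YA MT (Phi_total r n \<zeta>) (Psi_total r n \<zeta>)"
proof -
  have "bij_betw (Phi_total r n \<zeta>) (carrier YA) (carrier MT)"
    by (rule bij_betw_byWitness[where f' = "Psi_total r n \<zeta>"])
       (use Psi_Phi_total Phi_Psi_total alg_homD(1)[OF Phi_total_hom] Psi_total_closed in auto)
  then show ?thesis
    using Phi_total_hom Psi_Phi_total Phi_Psi_total by (simp add: alg_iso_def alg_hom_def ring_iso_def inverse_maps_def)
qed

end

theorem theorem3p1:
  fixes n r :: nat and \<zeta> :: "nat \<Rightarrow> 'k::alg_closed_field"
  assumes "n \<ge> 1" and "r \<ge> 1"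
    and "\<not> CHAR('k) dvd r"
    and "bij_betw \<zeta> {1..r} {z. z ^ r = 1}"
  shows "(\<forall>\<mu>\<in>compositions r n.
            (\<exists>!h. is_Phi r n \<zeta> \<mu> h) \<and>
            (\<exists>!g. is_Psi r n \<zeta> \<mu> g) \<and>
            Phi r n \<zeta> \<mu> \<in> alg_iso (yh_mu r n \<zeta> \<mu>) (mat_mu r n \<zeta> \<mu>) \<and>
            inverse_maps (yh_mu r n \<zeta> \<mu>) (mat_mu r n \<zeta> \<mu>) (Phi r n \<zeta> \<mu>) (Psi r n \<zeta> \<mu>)) \<and>
         Phi_total r n \<zeta> \<in> alg_iso (yh r n) (mat_total r n \<zeta>) \<and>
         inverse_maps (yh r n) (mat_total r n \<zeta>) (Phi_total r n \<zeta>) (Psi_total r n \<zeta>)"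
proof -
  have "root_data r \<zeta>"
    by (rule root_data.intro) (use assms in \<open>simp_all add: of_nat_eq_0_iff_char_dvd\<close>)
  then interpret yh_setup r \<zeta> n by (rule yh_setup.intro)
  show ?thesis using yh_comp.component_iso[OF yh_comp] total_iso by blast
qed

end
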